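(* Let $n\ge1$. The map $\mathrm{Ch}=\bar\Gamma_v\circ\bar\iota_v\colon v\mathcal{PB}_n\to v\mathcal{ROU}_n$, from the virtual pure braid group on $n$ strands to reduced virtual OU tangle diagrams on $n$ strands, is injective but not surjective; hence $\bar\iota_v\colon v\mathcal{PB}_n\to v\mathcal{AC}_n$ is also injective but not surjective.
   Context: Virtual tangle diagrams: a virtual tangle diagram on $n$ strands is the combinatorial data of a tangle diagram with planarity dropped (a Gauss diagram): $n$ oriented intervals (strands) labelled $1,\dots,n$, together with a finite set of crossings, each crossing having a sign $\pm1$, an "over" point and an "under" point on the strands, all these points being distinct; only the order of the points along each strand matters. "Virtual crossings" are not part of the data. The product $D_1D_2$ is obtained by joining, for each label $a$, the end of strand $a$ of $D_1$ to the beginning of strand $a$ of $D_2$. The usual (oriented) Reidemeister moves R1, R2, R3 are applied to such diagrams: R1 adds/removes a crossing (of any sign) whose over and under points are adjacent on a strand; R2 adds/removes two crossings of opposite signs whose over points are adjacent on a strand and whose under points are adjacent on a strand; R3 is the usual R3 move read on Gauss diagrams. OU: a diagram is OU (Over-then-Under) if on every strand all over points come before all under points. Acyclic: a cascade path in $D$ is a directed path that travels along strands following their orientation, except that at a crossing it may (but need not) drop from the over point to the under point (never the other way) and continue from there. $D$ is acyclic if it has no closed cascade path. OU diagrams are acyclic. Glide move: write $X_s[a,b]$ for a crossing of sign $s$ with over point at position $a$ and under point at position $b$, positions on strands being numbered by consecutive integers in the order of traversal. If $X_{s_1}[i_1,j_1]$ and $X_{s_2}[i_2,j_2]$ are distinct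 crossings such that $i_2$ immediately follows $j_1$ on the same strand, the glide move replaces them by $X_{s_2}[j_1,j_2],\ X_{s_1}[i_1,i_2],\ X_{s_1s_2}[i_1-\tfrac{s_1}{3},j_2+\tfrac{s_2}{3}],\ X_{-s_1s_2}[i_1+\tfrac{s_1}{3},j_2-\tfrac{s_2}{3}]$ (where $\pm\frac13$ means "immediately after/before"). Every acyclic virtual tangle diagram $D$ can be brought by finitely many glide moves to a unique OU diagram $\Gamma_v(D)$. Reduced: a diagram is reduced if its crossing number cannot be reduced using only R1 and R2 moves. $v\mathcal{ROU}_n$ is the set of reduced virtual OU tangle diagrams on $n$ strands. $v\mathcal{AC}_n$ is the monoid of acyclic virtual tangle diagrams on $n$ strands modulo Reidemeister moves preserving acyclicity. $\bar\Gamma_v\colon v\mathcal{AC}_n\to v\mathcal{ROU}_n$ sends the class of $D$ to the unique reduced OU diagram obtained from $\Gamma_v(D)$ by R1 and R2 moves; it is well-defined (and is a bijection, with inverse induced by inclusion). Virtual pure braids: $$v\mathcal{PB}_n=\left\langle \sigma_{ij}\ (1\le i\ne j\le n)\ :\ \sigma_{ij}\sigma_{ik}\sigma_{jk}=\sigma_{jk}\sigma_{ik}\sigma_{ij},\ \ \sigma_{ij}\sigma_{kl}=\sigma_{kl}\sigma_{ij}\right\rangle$$ with $i,j,k,l$ arbitrary distinct indices. $\bar\iota_v$ is the monoid homomorphism sending $\sigma_{ij}^{\pm1}$ to the class of the virtual tangle diagram on $n$ strands with exactly one crossing, of sign $\pm1$, in which strand $i$ passes over strand $j$ (products of such diagrams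 are acyclic). *)

theory Defs
  imports "HOL-Algebra.Group"
begin

section \<open>Virtual tangle diagrams\<close>

text \<open>
  Crossings are named by natural numbers. A strand is the list, in order of traversal, of the over
  and under points on it; strands are labelled \<open>1, \<dots>, n\<close>. The names of the crossings (and the
  values of \<open>csign\<close> off the crossings) carry no information, so diagrams in the sense of Gauss
  diagrams are the classes of \<open>TD n\<close> under \<open>iso_rel n\<close>.
\<close>

datatype 'c endpt = Over 'c | Under 'c

record vdiag =
  strand :: "nat \<Rightarrow> nat endpt list"
  csign :: "nat \<Rightarrow> int"

definition crossings :: "vdiag \<Rightarrow> nat set" where
  "crossings D = {c. \<exists>a. Over c \<in> set (strand D a)}"

definition crossing_number :: "vdiag \<Rightarrow> nat" where
  "crossing_number D = card (crossings D)"

definition TD :: "nat \<Rightarrow> vdiag set" where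
  "TD n = {D.
     (\<forall>a. a \<notin> {1..n} \<longrightarrow> strand D a = []) \<and>
     (\<forall>a. distinct (strand D a)) \<and>
     (\<forall>a b. a \<noteq> b \<longrightarrow> set (strand D a) \<inter> set (strand D b) = {}) \<and>
     (\<forall>c. (\<exists>a. Over c \<in> set (strand D a)) \<longleftrightarrow> (\<exists>a. Under c \<in> set (strand D a))) \<and>
     (\<forall>c\<in>crossings D. csign D c \<in> {1, -1})}"

definition diag_iso :: "vdiag \<Rightarrow> vdiag \<Rightarrow> bool" where
  "diag_iso D D' \<longleftrightarrow> (\<exists>f. inj_on f (crossings D) \<and>
     (\<forall>a. strand D' a = map (map_endpt f) (strand D a)) \<and>
     (\<forall>c\<in>crossings D. csign D' (f c) = csign D c))"

definition iso_rel :: "nat \<Rightarrow> vdiag rel" where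
  "iso_rel n = {(D, D'). D \<in> TD n \<and> D' \<in> TD n \<and> diag_iso D D'}"

definition follows :: "vdiag \<Rightarrow> nat endpt \<Rightarrow> nat endpt \<Rightarrow> bool" where
  "follows D p q \<longleftrightarrow> (\<exists>a xs ys. strand D a = xs @ [p, q] @ ys)"

definition adjacent :: "vdiag \<Rightarrow> nat endpt \<Rightarrow> nat endpt \<Rightarrow> bool" where
  "adjacent D p q \<longleftrightarrow> follows D p q \<or> follows D q p"

text \<open>The product; the crossings of the two factors are renamed to be disjoint.\<close>

definition diag_prod :: "vdiag \<Rightarrow> vdiag \<Rightarrow> vdiag" where
  "diag_prod D1 D2 = \<lparr>
     strand = (\<lambda>a. map (map_endpt (\<lambda>c. 2 * c)) (strand D1 a) @
                   map (map_endpt (\<lambda>c. 2 * c + 1)) (strand D2 a)),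
     csign = (\<lambda>c. if even c then csign D1 (c div 2) else csign D2 (c div 2)) \<rparr>"

definition diag_one :: vdiag where
  "diag_one = \<lparr> strand = (\<lambda>_. []), csign = (\<lambda>_. 1) \<rparr>"

section \<open>Reidemeister moves\<close>

text \<open>
  R1 and R2 are given in the direction that removes crossings; the relations in which they are
  used below are symmetric.
\<close>

definition del_crossings :: "nat set \<Rightarrow> vdiag \<Rightarrow> vdiag" where
  "del_crossings C D = D\<lparr> strand :=
     (\<lambda>a. filter (\<lambda>p. p \<notin> Over ` C \<union> Under ` C) (strand D a)) \<rparr>"

definition R1 :: "vdiag \<Rightarrow> vdiag \<Rightarrow> bool" where
  "R1 D D' \<longleftrightarrow> (\<exists>c. adjacent D (Over c) (Under c) \<and> D' = del_crossings {c} D)"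

definition R2 :: "vdiag \<Rightarrow> vdiag \<Rightarrow> bool" where
  "R2 D D' \<longleftrightarrow> (\<exists>c d. c \<noteq> d \<and> csign D c = - csign D d \<and>
     adjacent D (Over c) (Over d) \<and> adjacent D (Under c) (Under d) \<and>
     D' = del_crossings {c, d} D)"

text \<open>
  R3 involves a top, a middle and a bottom strand segment (possibly of the same strand), with
  crossings \<open>x\<close> (top over middle), \<open>y\<close> (top over bottom) and \<open>z\<close> (middle over bottom). The move
  exchanges the two adjacent points on each of the three segments. Not all combinations of signs and
  orders come from a planar triangle. If the segments are straight lines with directions \<open>t, m, b\<close>,
  then the signs of \<open>x, y, z\<close> are those of the determinants \<open>[t,m], [t,b], [m,b]\<close>, and if \<open>w\<close> is the
  vector from \<open>x\<close> to a point of the bottom line and \<open>\<delta>\<close> the sign of \<open>[w,b]\<close>, then \<open>y\<close> comes after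
  \<open>x\<close> on the top line iff \<open>\<delta> [t,b] > 0\<close>, \<open>z\<close> comes after \<open>x\<close> on the middle line iff
  \<open>\<delta> [m,b] > 0\<close>, and \<open>z\<close> comes after \<open>y\<close> on the bottom line iff \<open>\<delta> [t,m] [t,b] [m,b] > 0\<close>.
  Conversely all 16 choices of three signs and \<open>\<delta>\<close> occur; these are the two sides of each of the 8
  oriented R3 moves.
\<close>

definition order_sign :: "vdiag \<Rightarrow> nat endpt \<Rightarrow> nat endpt \<Rightarrow> int" where
  "order_sign D p q = (if follows D p q then 1 else -1)"

definition swap_points :: "nat endpt \<Rightarrow> nat endpt \<Rightarrow> nat endpt \<Rightarrow> nat endpt" where
  "swap_points p q r = (if r = p then q else if r = q then p else r)"

definition R3 :: "vdiag \<Rightarrow> vdiag \<Rightarrow> bool" where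
  "R3 D D' \<longleftrightarrow> (\<exists>x y z. x \<noteq> y \<and> x \<noteq> z \<and> y \<noteq> z \<and>
     adjacent D (Over x) (Over y) \<and>
     adjacent D (Under x) (Over z) \<and>
     adjacent D (Under y) (Under z) \<and>
     (\<exists>\<delta>\<in>{1, -1}.
        order_sign D (Over x) (Over y) = \<delta> * csign D y \<and>
        order_sign D (Under x) (Over z) = \<delta> * csign D z \<and>
        order_sign D (Under y) (Under z) = \<delta> * csign D x * csign D y * csign D z) \<and>
     D' = D\<lparr> strand := (\<lambda>a. map
       (swap_points (Over x) (Over y) \<circ> swap_points (Under x) (Over z) \<circ>
        swap_points (Under y) (Under z)) (strand D a)) \<rparr>)"

text \<open>Equality of diagrams up to R1 and R2 moves.\<close>

definition R12_rel :: "nat \<Rightarrow> vdiag rel" where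
  "R12_rel n = {(D, D'). D \<in> TD n \<and> D' \<in> TD n \<and>
     equivclp (\<lambda>E E'. E \<in> TD n \<and> E' \<in> TD n \<and>
       (diag_iso E E' \<or> R1 E E' \<or> R2 E E')) D D'}"

section \<open>OU, reduced and acyclic diagrams\<close>

definition OU :: "vdiag \<Rightarrow> bool" where
  "OU D \<longleftrightarrow> (\<forall>a. \<exists>cs ds. strand D a = map Over cs @ map Under ds)"

definition reduced :: "nat \<Rightarrow> vdiag \<Rightarrow> bool" where
  "reduced n D \<longleftrightarrow> \<not> (\<exists>D'. (D, D') \<in> R12_rel n \<and> crossing_number D' < crossing_number D)"

definition vROU :: "nat \<Rightarrow> vdiag set set" where
  "vROU n = {D \<in> TD n. OU D \<and> reduced n D} // iso_rel n"

text \<open>The elementary steps of cascade paths, between points of the diagram.\<close>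

definition cascade_step :: "vdiag \<Rightarrow> nat endpt rel" where
  "cascade_step D = {(p, q). follows D p q} \<union> {(Over c, Under c) |c. c \<in> crossings D}"

definition AC :: "nat \<Rightarrow> vdiag set" where
  "AC n = {D \<in> TD n. acyclic (cascade_step D)}"

definition vAC_rel :: "nat \<Rightarrow> vdiag rel" where
  "vAC_rel n = {(D, D'). D \<in> AC n \<and> D' \<in> AC n \<and>
     equivclp (\<lambda>E E'. E \<in> AC n \<and> E' \<in> AC n \<and>
       (diag_iso E E' \<or> R1 E E' \<or> R2 E E' \<or> R3 E E')) D D'}"

definition vAC :: "nat \<Rightarrow> vdiag set monoid" where
  "vAC n = \<lparr>
     carrier = AC n // vAC_rel n,
     mult = (\<lambda>A B. \<Union>D\<in>A. \<Union>E\<in>B. vAC_rel n `` {diag_prod D E}),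
     one = vAC_rel n `` {diag_one} \<rparr>"

section \<open>Glide moves\<close>

text \<open>
  Here \<open>c1 = X_s1[i1, j1]\<close>, \<open>c2 = X_s2[i2, j2]\<close> with \<open>i2\<close> immediately after \<open>j1\<close>, and \<open>x\<close>, \<open>y\<close> name
  the new crossings \<open>X_{s1 s2}[i1 - s1/3, j2 + s2/3]\<close> and \<open>X_{-s1 s2}[i1 + s1/3, j2 - s2/3]\<close>; the name
  \<open>c1\<close> is kept for \<open>X_s1[i1, i2]\<close>, and \<open>c2\<close> for \<open>X_s2[j1, j2]\<close>. The substitution lists the points that
  replace each old point.
\<close>

definition glide_subst ::
  "vdiag \<Rightarrow> nat \<Rightarrow> nat \<Rightarrow> nat \<Rightarrow> nat \<Rightarrow> nat endpt \<Rightarrow> nat endpt list" where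
  "glide_subst D c1 c2 x y p =
     (if p = Over c1 then
        (if csign D c1 = 1 then [Over x, Over c1, Over y] else [Over y, Over c1, Over x])
      else if p = Under c1 then [Over c2]
      else if p = Over c2 then [Under c1]
      else if p = Under c2 then
        (if csign D c2 = 1 then [Under y, Under c2, Under x] else [Under x, Under c2, Under y])
      else [p])"

definition glide :: "vdiag \<Rightarrow> vdiag \<Rightarrow> bool" where
  "glide D D' \<longleftrightarrow> (\<exists>c1 c2 x y. c1 \<noteq> c2 \<and> follows D (Under c1) (Over c2) \<and>
     x \<noteq> y \<and> x \<notin> crossings D \<and> y \<notin> crossings D \<and>
     D' = \<lparr> strand = (\<lambda>a. concat (map (glide_subst D c1 c2 x y) (strand D a))),
            csign = (csign D)(x := csign D c1 * csign D c2, y := - csign D c1 * csign D c2) \<rparr>)"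

definition Gamma_v :: "nat \<Rightarrow> vdiag \<Rightarrow> vdiag set" where
  "Gamma_v n D = (THE A. \<exists>E\<in>TD n. OU E \<and> glide\<^sup>*\<^sup>* D E \<and> A = iso_rel n `` {E})"

definition reduced_form :: "nat \<Rightarrow> vdiag set \<Rightarrow> vdiag set" where
  "reduced_form n A = (THE B. B \<in> vROU n \<and> (\<exists>D\<in>A. \<exists>E\<in>B. (D, E) \<in> R12_rel n))"

text \<open>
  As usual for functions on quotients (and for the products above), the union ranges over
  representatives, on all of which the value is the same.
\<close>

definition Gamma_bar_v :: "nat \<Rightarrow> vdiag set \<Rightarrow> vdiag set" where
  "Gamma_bar_v n A = (\<Union>D\<in>A. reduced_form n (Gamma_v n D))"

section \<open>Virtual pure braid groups\<close>

text \<open>Words in generators \<open>S\<close>; the letter \<open>(g, s)\<close> with \<open>s = 1\<close> or \<open>s = -1\<close> stands for \<open>g\<^sup>s\<close>.\<close>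

definition words :: "'g set \<Rightarrow> ('g \<times> int) list set" where
  "words S = lists (S \<times> {1, -1})"

inductive pres_eq :: "'g set \<Rightarrow> ('g \<times> int) list rel \<Rightarrow> ('g \<times> int) list \<Rightarrow> ('g \<times> int) list \<Rightarrow> bool"
  for S R where
  refl: "w \<in> words S \<Longrightarrow> pres_eq S R w w"
| sym: "pres_eq S R u v \<Longrightarrow> pres_eq S R v u"
| trans: "pres_eq S R u v \<Longrightarrow> pres_eq S R v w \<Longrightarrow> pres_eq S R u w"
| congr: "pres_eq S R u v \<Longrightarrow> x \<in> words S \<Longrightarrow> y \<in> words S \<Longrightarrow> pres_eq S R (x @ u @ y) (x @ v @ y)"
| cancel: "g \<in> S \<Longrightarrow> s \<in> {1, -1} \<Longrightarrow> pres_eq S R [(g, s), (g, -s)] []"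
| relator: "(u, v) \<in> R \<Longrightarrow> pres_eq S R u v"

definition pres_rel :: "'g set \<Rightarrow> ('g \<times> int) list rel \<Rightarrow> ('g \<times> int) list rel" where
  "pres_rel S R = {(u, v). pres_eq S R u v}"

definition presented_group :: "'g set \<Rightarrow> ('g \<times> int) list rel \<Rightarrow> ('g \<times> int) list set monoid" where
  "presented_group S R = \<lparr>
     carrier = words S // pres_rel S R,
     mult = (\<lambda>A B. \<Union>u\<in>A. \<Union>v\<in>B. pres_rel S R `` {u @ v}),
     one = pres_rel S R `` {[]} \<rparr>"

definition vPB_gens :: "nat \<Rightarrow> (nat \<times> nat) set" where
  "vPB_gens n = {(i, j). i \<in> {1..n} \<and> j \<in> {1..n} \<and> i \<noteq> j}"

definition vPB_rels :: "nat \<Rightarrow> ((nat \<times> nat) \<times> int) list rel" where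
  "vPB_rels n =
     {([((i, j), 1), ((i, k), 1), ((j, k), 1)], [((j, k), 1), ((i, k), 1), ((i, j), 1)]) |i j k.
        {i, j, k} \<subseteq> {1..n} \<and> distinct [i, j, k]} \<union>
     {([((i, j), 1), ((k, l), 1)], [((k, l), 1), ((i, j), 1)]) |i j k l.
        {i, j, k, l} \<subseteq> {1..n} \<and> distinct [i, j, k, l]}"

definition vPB :: "nat \<Rightarrow> ((nat \<times> nat) \<times> int) list set monoid" where
  "vPB n = presented_group (vPB_gens n) (vPB_rels n)"

definition sigma_diag :: "(nat \<times> nat) \<times> int \<Rightarrow> vdiag" where
  "sigma_diag = (\<lambda>((i, j), s). \<lparr>
     strand = (\<lambda>a. if a = i then [Over 0] else if a = j then [Under 0] else []),
     csign = (\<lambda>_. s) \<rparr>)"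

definition word_diag :: "((nat \<times> nat) \<times> int) list \<Rightarrow> vdiag" where
  "word_diag w = foldr (\<lambda>l D. diag_prod (sigma_diag l) D) w diag_one"

definition iota_bar_v :: "nat \<Rightarrow> ((nat \<times> nat) \<times> int) list set \<Rightarrow> vdiag set" where
  "iota_bar_v n A = (\<Union>w\<in>A. vAC_rel n `` {word_diag w})"

definition Ch :: "nat \<Rightarrow> ((nat \<times> nat) \<times> int) list set \<Rightarrow> vdiag set" where
  "Ch n = Gamma_bar_v n \<circ> iota_bar_v n"

end

theory Submission
  imports Defs
begin

text \<open>
  Glide moves together with R1 and R2 moves form a terminating rewriting system on acyclic diagrams,
  confluent up to isomorphism, and the two sides of an R3 move have a common reduct; so the reduced
  OU diagrams are normal forms for acyclic diagrams modulo Reidemeister moves.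

  For injectivity, a braid word \<open>w\<close> is sent to the crossing number \<open>\<xi>(w)\<close> of its reduced OU diagram.
  Multiplying an OU diagram by a generator \<open>\<sigma>\<^sub>i\<^sub>j\<close> from the left and pushing the new crossing through
  the overs of strand \<open>j\<close> by R3 moves changes the diagram, once enough R2 pairs have been inserted, by
  a single crossing. Removing these R2 pairs again shows that \<open>\<xi>\<close> either increases or decreases
  strictly under such a multiplication, and that it decreases only if the reduced diagram of \<open>w\<close>
  has a crossing that can be pulled out. If two different crossings can be pulled out, then the two
  results are connected by diagrams with fewer crossings, along a commutation or a braid relation of
  the group. By Newman's lemma every word descends to the empty word, which is therefore the only
  one with \<open>\<xi> = 0\<close> up to the relations. On the other hand no crossing can be pulled out of a
  reduced OU diagram all of whose crossings lie on one strand, so such a diagram is not in the image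
  of the braid group unless it is trivial.
\<close>

text \<open>A glide adds two crossings, so the crossing number cannot show termination. What
  decreases is the number of chains of crossings met by cascade paths, each crossing carrying one of
  three marks; the marks leave room to encode the chains through the two new crossings injectively.
  On the braid side the obstacle is that a new first factor destroys the OU form: its under point on
  strand \<open>j\<close> stands before the overs there. It passes an over \<open>q\<close> of
  \<open>j\<close> by an R3 move, which needs an over \<open>p\<close> of strand \<open>i\<close>
  parallel to \<open>q\<close> in the sense of \<open>par\<close>; this is why R2 pairs have to be
  inserted. The move merely exchanges the unders of \<open>p\<close> and \<open>q\<close>, so the OU
  form is back once all overs of \<open>j\<close> are passed. The exchange turns parallels for the
  sign \<open>s\<close> into parallels for \<open>-s\<close>; therefore \<open>link\<close> can
  change its direction when R2 moves are made. The crossing number of the reduced diagram is not a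
  word length: the product of the positive generators for 1 over 2 and 2 over 1 has three crossings.
  Only a strict comparison of neighbouring words is available, and confluence of descents replaces a
  normal form for words.\<close>

definition seg :: "vdiag \<Rightarrow> nat endpt list \<Rightarrow> bool" where
  "seg D ps \<longleftrightarrow> (\<exists>a xs ys. strand D a = xs @ ps @ ys)"

definition points :: "vdiag \<Rightarrow> nat endpt set" where
  "points D = (\<Union>a. set (strand D a))"

fun cname :: "'c endpt \<Rightarrow> 'c" where
  "cname (Over c) = c" | "cname (Under c) = c"

lemma follows_seg: "follows D p q \<longleftrightarrow> seg D [p, q]"
  by (simp add: follows_def seg_def)

lemma adjacent_seg: "adjacent D p q \<longleftrightarrow> seg D [p, q] \<or> seg D [q, p]"
  by (simp add: adjacent_def follows_seg)

lemma seg_points: "seg D ps \<Longrightarrow> set ps \<subseteq> points D"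
  unfolding seg_def points_def by (metis UN_upper UNIV_I Un_upper1 Un_upper2 order_trans set_append)

lemma crossings_points: "c \<in> crossings D \<longleftrightarrow> Over c \<in> points D"
  by (auto simp: crossings_def points_def)

lemma seg_sub: "seg D (xs @ ps @ ys) \<Longrightarrow> seg D ps"
  unfolding seg_def by (metis append.assoc)

lemma seg_Cons2: "seg D (p # q # r) \<Longrightarrow> seg D [p, q]"
  using seg_sub[of D "[]" "[p,q]" r] by simp

lemma seg_tl: "seg D (p # r) \<Longrightarrow> seg D r"
  using seg_sub[of D "[p]" r "[]"] by simp

lemma seg_point: "p \<in> points D \<Longrightarrow> seg D [p]"
  unfolding points_def seg_def by (auto dest!: split_list)

lemma TD_iff: "D \<in> TD n \<longleftrightarrow>
     (\<forall>a. a \<notin> {1..n} \<longrightarrow> strand D a = []) \<and>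
     (\<forall>a. distinct (strand D a)) \<and>
     (\<forall>a b. a \<noteq> b \<longrightarrow> set (strand D a) \<inter> set (strand D b) = {}) \<and>
     (\<forall>c. Over c \<in> points D \<longleftrightarrow> Under c \<in> points D) \<and>
     (\<forall>c. Over c \<in> points D \<longrightarrow> csign D c = 1 \<or> csign D c = -1)"
  unfolding TD_def by (auto simp: crossings_def points_def)

lemma TD_points: "D \<in> TD n \<Longrightarrow> Over c \<in> points D \<longleftrightarrow> Under c \<in> points D"
  by (auto simp: TD_iff)

lemma TD_cname: "D \<in> TD n \<Longrightarrow> p \<in> points D \<Longrightarrow> cname p \<in> crossings D"
  by (cases p) (auto simp: crossings_points TD_iff)

lemma points_iff: "D \<in> TD n \<Longrightarrow> p \<in> points D \<longleftrightarrow> cname p \<in> crossings D"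
  by (cases p) (auto simp: crossings_points TD_iff)

lemma TD_strand_unique:
  "D \<in> TD n \<Longrightarrow> p \<in> set (strand D a) \<Longrightarrow> p \<in> set (strand D b) \<Longrightarrow> a = b"
  by (fastforce simp: TD_iff)

lemma TD_sign: "D \<in> TD n \<Longrightarrow> c \<in> crossings D \<Longrightarrow> csign D c = 1 \<or> csign D c = -1"
  by (auto simp: TD_iff crossings_points)

lemma finite_points: "D \<in> TD n \<Longrightarrow> finite (points D)"
proof -
  assume D: "D \<in> TD n"
  have "strand D a = []" if "a \<notin> {1..n}" for a using D that by (simp add: TD_def)
  then have "points D \<subseteq> (\<Union>a\<in>{1..n}. set (strand D a))"
    unfolding points_def by fastforce
  then show ?thesis by (rule finite_subset) simp
qed

lemma finite_crossings: "D \<in> TD n \<Longrightarrow> finite (crossings D)"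
proof -
  assume D: "D \<in> TD n"
  have "crossings D \<subseteq> cname ` points D"
    by (metis cname.simps(1) crossings_points image_eqI subsetI)
  then show ?thesis using finite_points[OF D] finite_subset by blast
qed

lemma seg_distinct: "D \<in> TD n \<Longrightarrow> seg D ps \<Longrightarrow> distinct ps"
  unfolding seg_def TD_iff by (metis distinct_append)

lemma adjacent_append:
  assumes d: "distinct (xs @ [p, q] @ ys)" and e: "xs @ [p, q] @ ys = zs @ [q, r] @ ws"
  shows "zs = xs @ [p] \<and> ys = r # ws"
proof -
  have "xs @ [p] @ (q # ys) = zs @ (q # r # ws)" using e by simp
  moreover have "q \<notin> set (xs @ [p])" "q \<notin> set ys" using d by auto
  ultimately show ?thesis
    using append_Cons_eq_iff[of q "xs @ [p]" ys zs "r # ws"] by simp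
qed

lemma seg_join: "D \<in> TD n \<Longrightarrow> seg D [p, q] \<Longrightarrow> seg D [q, r] \<Longrightarrow> seg D [p, q, r]"
proof -
  assume D: "D \<in> TD n" and "seg D [p, q]" "seg D [q, r]"
  then obtain a xs ys b zs ws where
    1: "strand D a = xs @ [p, q] @ ys" and 2: "strand D b = zs @ [q, r] @ ws"
    unfolding seg_def by blast
  have "a = b" using TD_strand_unique[OF D, of q a b] 1 2 by simp
  moreover have "distinct (strand D a)" using D by (simp add: TD_iff)
  ultimately have "ys = r # ws" using adjacent_append[of xs p q ys zs r ws] 1 2 by metis
  then show ?thesis using 1 unfolding seg_def by (metis append_Cons append_Nil)
qed

lemma seg_antisym: "D \<in> TD n \<Longrightarrow> seg D [p, q] \<Longrightarrow> \<not> seg D [q, p]"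
  using seg_join seg_distinct by fastforce

lemma seg_right_unique: "D \<in> TD n \<Longrightarrow> seg D [p, q] \<Longrightarrow> seg D [p, r] \<Longrightarrow> q = r"
proof -
  assume D: "D \<in> TD n" and "seg D [p, q]" "seg D [p, r]"
  then obtain a xs ys b zs ws where
    1: "strand D a = xs @ p # q # ys" and 2: "strand D b = zs @ p # r # ws"
    unfolding seg_def by auto
  have "a = b" using TD_strand_unique[OF D, of p a b] 1 2 by simp
  moreover have d: "distinct (strand D a)" using D by (simp add: TD_iff)
  moreover have "p \<notin> set xs" "p \<notin> set (q # ys)" using d 1 by auto
  ultimately show ?thesis using 1 2
    by (metis append_Cons_eq_iff list.inject)
qed

lemma seg_left_unique: "D \<in> TD n \<Longrightarrow> seg D [q, p] \<Longrightarrow> seg D [r, p] \<Longrightarrow> q = r"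
proof -
  assume D: "D \<in> TD n" and "seg D [q, p]" "seg D [r, p]"
  then obtain a xs ys b zs ws where
    1: "strand D a = (xs @ [q]) @ p # ys" and 2: "strand D b = (zs @ [r]) @ p # ws"
    unfolding seg_def by auto
  have "a = b" using TD_strand_unique[OF D, of p a b] 1 2 by simp
  moreover have d: "distinct (strand D a)" using D by (simp add: TD_iff)
  moreover have "p \<notin> set (xs @ [q])" "p \<notin> set ys" using d 1 by auto
  ultimately have "xs @ [q] = zs @ [r]" using 1 2
    by (metis append_Cons_eq_iff)
  then show ?thesis by simp
qed

section \<open>Moves as substitutions of points by lists of points\<close>

lemma points_subst:
  "(\<And>a. strand D' a = concat (map t (strand D a))) \<Longrightarrow> points D' = (\<Union>p\<in>points D. set (t p))"
  by (auto simp: points_def)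

lemma seg_subst:
  "(\<And>a. strand D' a = concat (map t (strand D a))) \<Longrightarrow> seg D ps \<Longrightarrow> seg D' (concat (map t ps))"
  unfolding seg_def by (metis concat_append map_append)

lemma distinct_concat_map:
  assumes "distinct xs" "\<And>p. p \<in> set xs \<Longrightarrow> distinct (t p)"
    "\<And>p q. p \<in> set xs \<Longrightarrow> q \<in> set xs \<Longrightarrow> p \<noteq> q \<Longrightarrow> set (t p) \<inter> set (t q) = {}"
  shows "distinct (concat (map t xs))"
  using assms
proof (induction xs)
  case (Cons x xs)
  have "set (t x) \<inter> set (concat (map t xs)) = {}"
  proof -
    have "set (t x) \<inter> set (t y) = {}" if "y \<in> set xs" for y
      using Cons.prems(1,3)[of ] that by (metis distinct.simps(2) list.set_intros)
    then show ?thesis by auto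
  qed
  then show ?case using Cons by simp
qed simp

text \<open>Deletions, renamings, glides and R3 moves all replace each point by a list of points, so
  the diagram axioms are checked once here. What remains for each move is that distinct points have
  disjoint images and that over and under points of the result match.\<close>

lemma TD_subst:
  assumes D: "D \<in> TD n" and s: "\<And>a. strand D' a = concat (map t (strand D a))"
    and d: "\<And>p. p \<in> points D \<Longrightarrow> distinct (t p)"
    and dd: "\<And>p q. p \<in> points D \<Longrightarrow> q \<in> points D \<Longrightarrow> p \<noteq> q \<Longrightarrow> set (t p) \<inter> set (t q) = {}"
    and OU: "\<And>c. Over c \<in> points D' \<longleftrightarrow> Under c \<in> points D'"
    and sg: "\<And>c. c \<in> crossings D' \<Longrightarrow> csign D' c = 1 \<or> csign D' c = -1"
  shows "D' \<in> TD n"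
  unfolding TD_iff
proof (intro conjI allI impI)
  have pt: "p \<in> set (strand D a) \<Longrightarrow> p \<in> points D" for p a by (auto simp: points_def)
  fix a show "distinct (strand D' a)"
    unfolding s using D pt d dd by (intro distinct_concat_map) (auto simp: TD_iff)
next
  have pt: "p \<in> set (strand D a) \<Longrightarrow> p \<in> points D" for p a by (auto simp: points_def)
  fix a b :: nat assume ab: "a \<noteq> b"
  have "set (t p) \<inter> set (t q) = {}" if "p \<in> set (strand D a)" "q \<in> set (strand D b)" for p q
    using that dd[OF pt pt] TD_strand_unique[OF D] ab by metis
  then show "set (strand D' a) \<inter> set (strand D' b) = {}" unfolding s by fastforce
next
  fix a assume "a \<notin> {1..n}" then show "strand D' a = []" unfolding s using D by (auto simp: TD_iff)
qed (use OU sg in \<open>auto simp: crossings_points\<close>)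

text \<open>A block of consecutive points occurs once and as a whole, so only its concatenated image
  matters: the two substitutions may distribute this image differently over the points of the block.
  This is the device for comparing the results of two sequences of moves.\<close>

lemma subst_seg_eq:
  assumes D: "D \<in> TD n" and sg: "seg D ps"
    and out: "\<And>p. p \<in> points D \<Longrightarrow> p \<notin> set ps \<Longrightarrow> f p = g p"
    and ins: "concat (map f ps) = concat (map g ps)"
  shows "concat (map f (strand D b)) = concat (map g (strand D b))"
proof -
  obtain a xs ys where a: "strand D a = xs @ ps @ ys" using sg unfolding seg_def by blast
  have da: "distinct (strand D a)" using D by (simp add: TD_iff)
  have pt: "p \<in> set (strand D c) \<Longrightarrow> p \<in> points D" for p c by (auto simp: points_def)
  show ?thesis
  proof (cases "b = a")
    case True
    have "map f xs = map g xs" "map f ys = map g ys"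
      using da a pt[of _ a] out by (auto intro!: out simp: a)
    then have "concat (map f xs) = concat (map g xs)" "concat (map f ys) = concat (map g ys)"
      by metis+
    then show ?thesis using ins True a by simp
  next
    case False
    have "map f (strand D b) = map g (strand D b)"
      using TD_strand_unique[OF D, of _ a b] False out pt[of _ b] a by (intro map_cong) auto
    then show ?thesis by metis
  qed
qed

lemma concat_concat_map: "concat (map g (concat (map f xs))) = concat (map (\<lambda>p. concat (map g (f p))) xs)"
  by (induction xs) auto

lemma filter_concat_map: "filter P (concat (map f xs)) = concat (map (\<lambda>p. filter P (f p)) xs)"
  by (induction xs) auto

lemma filter_as_concat: "filter P xs = concat (map (\<lambda>p. if P p then [p] else []) xs)"
  by (induction xs) auto

lemma map_as_concat: "map f xs = concat (map (\<lambda>p. [f p]) xs)"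
  by (induction xs) auto

section \<open>Deleting crossings\<close>

lemma strand_del: "strand (del_crossings C D) a = filter (\<lambda>p. cname p \<notin> C) (strand D a)"
proof -
  have "p \<notin> Over ` C \<union> Under ` C \<longleftrightarrow> cname p \<notin> C" for p :: "nat endpt" by (cases p) auto
  then show ?thesis by (simp add: del_crossings_def)
qed

lemma csign_del [simp]: "csign (del_crossings C D) = csign D"
  by (simp add: del_crossings_def)

lemma del_del: "del_crossings A (del_crossings B D) = del_crossings (B \<union> A) D"
  by (rule vdiag.equality) (auto simp: strand_del fun_eq_iff conj_commute intro!: filter_cong)

lemma del_empty [simp]: "del_crossings {} D = D"
  by (rule vdiag.equality) (auto simp: strand_del fun_eq_iff)

lemma strand_del_subst:
  "strand (del_crossings C D) a = concat (map (\<lambda>p. if cname p \<in> C then [] else [p]) (strand D a))"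
  unfolding strand_del filter_as_concat by (intro arg_cong[of _ _ concat] map_cong) auto

lemma points_del: "points (del_crossings C D) = {p \<in> points D. cname p \<notin> C}"
  by (auto simp: points_def strand_del)

lemma crossings_del: "crossings (del_crossings C D) = crossings D - C"
  by (auto simp: crossings_points points_del)

lemma del_TD: "D \<in> TD n \<Longrightarrow> del_crossings C D \<in> TD n"
  by (rule TD_subst[OF _ strand_del_subst], assumption)
    (auto simp: points_del crossings_del dest: TD_sign TD_points)

lemma seg_del: "seg D ps \<Longrightarrow> seg (del_crossings C D) (filter (\<lambda>p. cname p \<notin> C) ps)"
  unfolding seg_def strand_del by (metis filter_append)

section \<open>Isomorphisms\<close>

lemma diag_iso_refl: "diag_iso D D"
  unfolding diag_iso_def by (intro exI[of _ id]) (auto simp: endpt.map_id0 endpt.map_id)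

lemma cname_map [simp]: "cname (map_endpt f p) = f (cname p)"
  by (cases p) auto

text \<open>The renaming is kept explicit because it has to be extended to fresh crossings by glides
  and restricted to the surviving crossings by deletions.\<close>

definition iso_by :: "(nat \<Rightarrow> nat) \<Rightarrow> vdiag \<Rightarrow> vdiag \<Rightarrow> bool" where
  "iso_by f D D' \<longleftrightarrow> inj_on f (crossings D) \<and>
     (\<forall>a. strand D' a = map (map_endpt f) (strand D a)) \<and>
     (\<forall>c\<in>crossings D. csign D' (f c) = csign D c)"

lemma diag_iso_iff: "diag_iso D D' \<longleftrightarrow> (\<exists>f. iso_by f D D')"
  by (simp add: diag_iso_def iso_by_def)

lemma iso_by_points: "iso_by f D D' \<Longrightarrow> points D' = map_endpt f ` points D"
  by (auto simp: iso_by_def points_def)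

lemma iso_by_crossings: 
  assumes f: "iso_by f D D'" shows "crossings D' = f ` crossings D"
proof (rule equalityI; rule subsetI)
  fix c assume "c \<in> crossings D'"
  then obtain p where p: "p \<in> points D" "map_endpt f p = Over c"
    by (force simp: crossings_points iso_by_points[OF f])
  then obtain d where "p = Over d" "f d = c" by (cases p) auto
  then show "c \<in> f ` crossings D" using p by (auto simp: crossings_points)
next
  fix c assume "c \<in> f ` crossings D"
  then show "c \<in> crossings D'" by (force simp: crossings_points iso_by_points[OF f])
qed

lemma iso_by_seg: "iso_by f D D' \<Longrightarrow> seg D ps \<Longrightarrow> seg D' (map (map_endpt f) ps)"
  unfolding iso_by_def seg_def by (metis map_append)

lemma iso_by_inv:
  assumes "iso_by f D D'" "D \<in> TD n"
  shows "iso_by (inv_into (crossings D) f) D' D"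
proof -
  let ?g = "inv_into (crossings D) f"
  have inj: "inj_on f (crossings D)" using assms by (simp add: iso_by_def)
  have gf: "c \<in> crossings D \<Longrightarrow> ?g (f c) = c" for c using inj by simp
  have "map_endpt ?g (map_endpt f p) = p" if "p \<in> points D" for p
    using TD_cname[OF assms(2) that] gf by (cases p) auto
  then have "map (map_endpt ?g) (map (map_endpt f) (strand D a)) = strand D a" for a
    unfolding map_map by (intro map_idI) (auto simp: points_def)
  then show ?thesis using assms(1) inj gf
    by (auto simp: iso_by_def iso_by_crossings[OF assms(1)] intro: inj_on_inv_into)
qed

lemma diag_iso_sym: "D \<in> TD n \<Longrightarrow> diag_iso D D' \<Longrightarrow> diag_iso D' D"
  using iso_by_inv diag_iso_iff by blast

lemma diag_iso_trans: "diag_iso D D' \<Longrightarrow> diag_iso D' D'' \<Longrightarrow> diag_iso D D''"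
proof -
  assume "diag_iso D D'" "diag_iso D' D''"
  then obtain f g where f: "iso_by f D D'" and g: "iso_by g D' D''" by (auto simp: diag_iso_iff)
  have "inj_on (g \<circ> f) (crossings D)"
    using f g iso_by_crossings[OF f] unfolding iso_by_def by (metis comp_inj_on)
  then have "iso_by (g \<circ> f) D D''"
    using f g iso_by_crossings[OF f] unfolding iso_by_def
    by (auto simp: endpt.map_comp comp_def)
  then show ?thesis by (auto simp: diag_iso_iff)
qed

lemma iso_TD: "D \<in> TD n \<Longrightarrow> diag_iso D D' \<Longrightarrow> D' \<in> TD n"
proof -
  assume D: "D \<in> TD n" and "diag_iso D D'"
  then obtain f where f: "iso_by f D D'" by (auto simp: diag_iso_iff)
  have inj: "inj_on f (crossings D)" using f by (simp add: iso_by_def)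
  have pinj: "map_endpt f p \<noteq> map_endpt f q" if "p \<in> points D" "q \<in> points D" "p \<noteq> q" for p q
    using that TD_cname[OF D that(1)] TD_cname[OF D that(2)] inj
    by (cases p; cases q) (auto dest: inj_onD)
  have st: "strand D' a = concat (map (\<lambda>p. [map_endpt f p]) (strand D a))" for a
    using f unfolding iso_by_def by (metis map_as_concat)
  show ?thesis
  proof (rule TD_subst[OF D st])
    have "Over c \<in> points D' \<longleftrightarrow> c \<in> f ` crossings D" for c
      by (simp add: iso_by_crossings[OF f, symmetric] crossings_points)
    moreover have "Under c \<in> points D' \<longleftrightarrow> c \<in> f ` crossings D" for c
    proof
      assume "Under c \<in> points D'"
      then obtain p where "p \<in> points D" "map_endpt f p = Under c" unfolding iso_by_points[OF f] by auto
      then show "c \<in> f ` crossings D" by (metis TD_cname[OF D] cname.simps(2) cname_map imageI)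
    next
      assume "c \<in> f ` crossings D"
      then obtain d where "Under d \<in> points D" "c = f d" by (auto simp: crossings_points TD_points[OF D])
      then show "Under c \<in> points D'" unfolding iso_by_points[OF f] by force
    qed
    ultimately show "Over c \<in> points D' \<longleftrightarrow> Under c \<in> points D'" for c by simp
    show "csign D' c = 1 \<or> csign D' c = -1" if "c \<in> crossings D'" for c
      using that f unfolding iso_by_crossings[OF f] by (auto simp: iso_by_def dest: TD_sign[OF D])
  next
    show "set [map_endpt f p] \<inter> set [map_endpt f q] = {}" if "p \<in> points D" "q \<in> points D" "p \<noteq> q" for p q
      using pinj[OF that] by simp
  qed simp
qed

lemma iso_rel_iff: "(D, E) \<in> iso_rel n \<longleftrightarrow> D \<in> TD n \<and> diag_iso D E"
  by (auto simp: iso_rel_def intro: iso_TD)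

lemma iso_rel_equiv: "equiv (TD n) (iso_rel n)"
proof (rule equivI)
  show "sym (iso_rel n)" by (rule symI) (metis iso_rel_iff diag_iso_sym iso_TD)
  show "trans (iso_rel n)" by (rule transI) (metis iso_rel_iff diag_iso_trans)
qed (auto simp: iso_rel_def refl_on_def diag_iso_refl)

lemma iso_crossing_number: "diag_iso D E \<Longrightarrow> crossing_number D = crossing_number E"
  unfolding diag_iso_iff crossing_number_def
  by (metis iso_by_crossings iso_by_def card_image)

section \<open>Acyclicity and ranks\<close>

text \<open>A height that increases along cascade paths, used as a certificate of acyclicity: unlike
  acyclicity of a relation it is carried through a move by a formula. All pairs on a strand are
  compared, not only neighbours, since deletions create new neighbours.\<close>

definition ranked :: "vdiag \<Rightarrow> (nat endpt \<Rightarrow> nat) \<Rightarrow> bool" where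
  "ranked D h \<longleftrightarrow> (\<forall>a. sorted_wrt (\<lambda>p q. h p < h q) (strand D a)) \<and>
     (\<forall>c\<in>crossings D. h (Over c) < h (Under c))"

lemma sorted_wrt_adjacentI:
  fixes h :: "'a \<Rightarrow> nat"
  assumes "\<And>xs p q ys. l = xs @ [p, q] @ ys \<Longrightarrow> h p < h q"
  shows "sorted_wrt (\<lambda>p q. h p < h q) l"
  using assms
proof (induction l)
  case (Cons a l)
  have "sorted_wrt (\<lambda>p q. h p < h q) l"
  proof (rule Cons.IH)
    fix xs p q ys assume "l = xs @ [p, q] @ ys"
    then show "h p < h q" using Cons.prems[of "a # xs" p q ys] by simp
  qed
  then show ?case
  proof (cases l)
    case (Cons b m)
    have "h a < h b" using Cons.prems[of "[]" a b m] Cons by simp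
    then show ?thesis using \<open>sorted_wrt _ l\<close> Cons by fastforce
  qed simp
qed simp

lemma ranked_seg: "ranked D h \<Longrightarrow> seg D [p, q] \<Longrightarrow> h p < h q"
proof -
  assume h: "ranked D h" and "seg D [p, q]"
  then obtain a xs ys where "strand D a = xs @ [p, q] @ ys" by (auto simp: seg_def)
  moreover have "sorted_wrt (\<lambda>p q. h p < h q) (strand D a)" using h by (simp add: ranked_def)
  ultimately show "h p < h q" by (simp add: sorted_wrt_append)
qed

lemma cascade_step_points:
  assumes "D \<in> TD n" shows "cascade_step D \<subseteq> points D \<times> points D"
proof -
  have "p \<in> points D \<and> q \<in> points D" if "follows D p q" for p q
    using that seg_points[of D "[p, q]"] by (auto simp: follows_seg)
  then show ?thesis using TD_points[OF assms] by (auto simp: cascade_step_def crossings_points)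
qed

lemma AC_iff: "D \<in> AC n \<longleftrightarrow> D \<in> TD n \<and> (\<exists>h. ranked D h)"
proof (intro iffI conjI)
  assume "D \<in> AC n"
  then have D: "D \<in> TD n" and ac: "acyclic (cascade_step D)" by (auto simp: AC_def)
  show "D \<in> TD n" by fact
  let ?r = "cascade_step D"
  \<comment> \<open>The number of points from which \<open>p\<close> can be reached; by acyclicity
    \<open>p\<close> is not one of them, so the count increases strictly along steps.\<close>
  define h where "h p = card {q. (q, p) \<in> ?r\<^sup>+}" for p
  have "?r\<^sup>+ \<subseteq> points D \<times> points D"
    using cascade_step_points[OF D] by (rule trancl_subset_Sigma)
  then have fin: "finite {q. (q, p) \<in> ?r\<^sup>+}" for p
    by (intro finite_subset[OF _ finite_points[OF D]]) auto
  have less: "h p < h q" if "(p, q) \<in> ?r" for p q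
    unfolding h_def
  proof (rule psubset_card_mono[OF fin])
    have "p \<in> {x. (x, q) \<in> ?r\<^sup>+}" "p \<notin> {x. (x, p) \<in> ?r\<^sup>+}"
      using that ac by (auto simp: acyclic_def)
    moreover have "{x. (x, p) \<in> ?r\<^sup>+} \<subseteq> {x. (x, q) \<in> ?r\<^sup>+}"
      using that by (auto intro: trancl_into_trancl)
    ultimately show "{x. (x, p) \<in> ?r\<^sup>+} \<subset> {x. (x, q) \<in> ?r\<^sup>+}" by blast
  qed
  have "sorted_wrt (\<lambda>p q. h p < h q) (strand D a)" for a
  proof (rule sorted_wrt_adjacentI)
    fix xs p q ys assume "strand D a = xs @ [p, q] @ ys"
    then have "(p, q) \<in> ?r" by (auto simp: cascade_step_def follows_def)
    then show "h p < h q" by (rule less)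
  qed
  moreover have "h (Over c) < h (Under c)" if "c \<in> crossings D" for c
    by (rule less) (use that in \<open>auto simp: cascade_step_def\<close>)
  ultimately have "ranked D h" by (simp add: ranked_def)
  then show "\<exists>h. ranked D h" by blast
next
  assume "D \<in> TD n \<and> (\<exists>h. ranked D h)"
  then obtain h where D: "D \<in> TD n" and h: "ranked D h" by blast
  have "cascade_step D \<subseteq> measure h"
    using ranked_seg[OF h] h by (auto simp: cascade_step_def follows_seg ranked_def)
  then have "acyclic (cascade_step D)"
    using acyclic_subset wf_acyclic wf_measure by blast
  then show "D \<in> AC n" using D by (simp add: AC_def)
qed

lemma AC_TD: "D \<in> AC n \<Longrightarrow> D \<in> TD n"
  by (simp add: AC_def)

lemma ranked_del: "ranked D h \<Longrightarrow> ranked (del_crossings C D) h"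
  by (auto simp: ranked_def strand_del crossings_del sorted_wrt_filter)

lemma del_AC: "D \<in> AC n \<Longrightarrow> del_crossings C D \<in> AC n"
  using ranked_del del_TD unfolding AC_iff by blast

lemma iso_AC: "D \<in> AC n \<Longrightarrow> diag_iso D D' \<Longrightarrow> D' \<in> AC n"
proof -
  assume D: "D \<in> AC n" and i: "diag_iso D D'"
  then have i': "diag_iso D' D" using diag_iso_sym AC_TD by blast
  then obtain f where f: "iso_by f D' D" by (auto simp: diag_iso_iff)
  obtain h where h: "ranked D h" using D by (auto simp: AC_iff)
  have "ranked D' (h \<circ> map_endpt f)"
    using f h unfolding iso_by_def ranked_def
    by (force simp: sorted_wrt_map iso_by_crossings[OF f])
  then show ?thesis using D i iso_TD by (auto simp: AC_iff)
qed

section \<open>Glide moves\<close>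

text \<open>The glide with all names fixed, so that sequences of glides can be compared by equality
  and not only up to isomorphism.\<close>

definition gl :: "nat \<Rightarrow> nat \<Rightarrow> nat \<Rightarrow> nat \<Rightarrow> vdiag \<Rightarrow> vdiag" where
  "gl c1 c2 x y D = \<lparr> strand = (\<lambda>a. concat (map (glide_subst D c1 c2 x y) (strand D a))),
     csign = (csign D)(x := csign D c1 * csign D c2, y := - csign D c1 * csign D c2) \<rparr>"

definition gl_ok :: "vdiag \<Rightarrow> nat \<Rightarrow> nat \<Rightarrow> nat \<Rightarrow> nat \<Rightarrow> bool" where
  "gl_ok D c1 c2 x y \<longleftrightarrow> c1 \<noteq> c2 \<and> seg D [Under c1, Over c2] \<and>
     x \<noteq> y \<and> x \<notin> crossings D \<and> y \<notin> crossings D"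

lemma glide_iff: "glide D D' \<longleftrightarrow> (\<exists>c1 c2 x y. gl_ok D c1 c2 x y \<and> D' = gl c1 c2 x y D)"
  by (simp add: glide_def gl_def gl_ok_def follows_seg)

lemma point_cases:
  obtains "p = Over c1" | "p = Under c1" | "p = Over c2" | "p = Under c2" | "cname p \<noteq> c1" "cname p \<noteq> c2"
  by (cases p) auto

lemma glide_subst_simps:
  assumes "c1 \<noteq> c2"
  shows "glide_subst D c1 c2 x y (Over c1) =
      (if csign D c1 = 1 then [Over x, Over c1, Over y] else [Over y, Over c1, Over x])"
    "glide_subst D c1 c2 x y (Under c1) = [Over c2]"
    "glide_subst D c1 c2 x y (Over c2) = [Under c1]"
    "glide_subst D c1 c2 x y (Under c2) =
      (if csign D c2 = 1 then [Under y, Under c2, Under x] else [Under x, Under c2, Under y])"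
    "cname p \<noteq> c1 \<Longrightarrow> cname p \<noteq> c2 \<Longrightarrow> glide_subst D c1 c2 x y p = [p]"
  using assms by (auto simp: glide_subst_def)

lemma strand_gl: "strand (gl c1 c2 x y D) a = concat (map (glide_subst D c1 c2 x y) (strand D a))"
  by (simp add: gl_def)

lemma csign_gl:
  "csign (gl c1 c2 x y D) = (csign D)(x := csign D c1 * csign D c2, y := - csign D c1 * csign D c2)"
  by (simp add: gl_def)

lemma gl_ok_crossings:
  assumes D: "D \<in> TD n" and ok: "gl_ok D c1 c2 x y"
  shows "c1 \<in> crossings D" "c2 \<in> crossings D" "c1 \<noteq> c2" "x \<noteq> y"
    "x \<noteq> c1" "x \<noteq> c2" "y \<noteq> c1" "y \<noteq> c2" "x \<notin> crossings D" "y \<notin> crossings D"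
proof -
  have "Under c1 \<in> points D" "Over c2 \<in> points D"
    using ok seg_points by (fastforce simp: gl_ok_def)+
  then show "c1 \<in> crossings D" "c2 \<in> crossings D" using TD_points[OF D] by (auto simp: crossings_points)
  then show "c1 \<noteq> c2" "x \<noteq> y" "x \<noteq> c1" "x \<noteq> c2" "y \<noteq> c1" "y \<noteq> c2" 
    "x \<notin> crossings D" "y \<notin> crossings D" using ok by (auto simp: gl_ok_def)
qed

lemma points_gl:
  assumes D: "D \<in> TD n" and ok: "gl_ok D c1 c2 x y"
  shows "p \<in> points (gl c1 c2 x y D) \<longleftrightarrow> cname p \<in> crossings D \<union> {x, y}"
proof -
  note c = gl_ok_crossings[OF D ok]
  have *: "p \<in> points D" if "cname p \<in> crossings D" for p using that points_iff[OF D] by simp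
  show ?thesis
  proof
    assume "p \<in> points (gl c1 c2 x y D)"
    then obtain q where "q \<in> points D" "p \<in> set (glide_subst D c1 c2 x y q)"
      unfolding points_subst[OF strand_gl] by blast
    with TD_cname[OF D \<open>q \<in> points D\<close>] show "cname p \<in> crossings D \<union> {x, y}"
      using c by (cases q rule: point_cases[where ?c1.0 = c1 and ?c2.0 = c2]) (auto simp: glide_subst_simps split: if_splits)
  next
    assume p: "cname p \<in> crossings D \<union> {x, y}"
    consider "p \<in> {Over x, Over y, Over c1}" | "p \<in> {Under x, Under y, Under c2}" | "p = Over c2" | "p = Under c1"
      | "cname p \<in> crossings D" "cname p \<noteq> c1" "cname p \<noteq> c2"
      using p by (cases p) auto
    then have "\<exists>q. cname q \<in> crossings D \<and> p \<in> set (glide_subst D c1 c2 x y q)"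
    proof cases
      case 1 then show ?thesis using c by (intro exI[of _ "Over c1"]) (auto simp: glide_subst_simps)
    next
      case 2 then show ?thesis using c by (intro exI[of _ "Under c2"]) (auto simp: glide_subst_simps)
    next
      case 3 then show ?thesis using c by (intro exI[of _ "Under c1"]) (auto simp: glide_subst_simps)
    next
      case 4 then show ?thesis using c by (intro exI[of _ "Over c2"]) (auto simp: glide_subst_simps)
    next
      case 5 then show ?thesis using c by (intro exI[of _ p]) (auto simp: glide_subst_simps)
    qed
    then obtain q where "q \<in> points D" "p \<in> set (glide_subst D c1 c2 x y q)" using * by blast
    then show "p \<in> points (gl c1 c2 x y D)"
      unfolding points_subst[OF strand_gl] by blast
  qed
qed

lemma crossings_gl:
  assumes D: "D \<in> TD n" and ok: "gl_ok D c1 c2 x y"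
  shows "crossings (gl c1 c2 x y D) = crossings D \<union> {x, y}"
  using points_gl[OF assms] by (auto simp: crossings_points)

text \<open>Left inverse of the substitution: the old point at whose place a new point stands. It is
  not the identity on the kept names, because \<open>Over c2\<close> now stands where
  \<open>Under c1\<close> was, and \<open>Under c1\<close> where \<open>Over c2\<close> was.\<close>

definition glide_orig :: "nat \<Rightarrow> nat \<Rightarrow> nat \<Rightarrow> nat \<Rightarrow> nat endpt \<Rightarrow> nat endpt" where
  "glide_orig c1 c2 x y p = (if p \<in> {Over x, Over y} then Over c1
     else if p \<in> {Under x, Under y} then Under c2
     else if p = Over c2 then Under c1 else if p = Under c1 then Over c2 else p)"

lemma glide_orig:
  assumes "c1 \<noteq> c2" "x \<noteq> y" "x \<noteq> c1" "x \<noteq> c2" "y \<noteq> c1" "y \<noteq> c2"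
    and "cname p \<notin> {x, y}" "w \<in> set (glide_subst D c1 c2 x y p)"
  shows "glide_orig c1 c2 x y w = p"
  proof (cases p rule: point_cases[where ?c1.0 = c1 and ?c2.0 = c2])
  case 1 then show ?thesis using assms by (auto simp: glide_subst_simps glide_orig_def split: if_splits)
next
  case 4 then show ?thesis using assms by (auto simp: glide_subst_simps glide_orig_def split: if_splits)
next
  case 5 then show ?thesis using assms by (auto simp: glide_subst_simps glide_orig_def)
qed (use assms in \<open>simp_all add: glide_subst_simps glide_orig_def\<close>)

lemma glide_subst_disjoint:
  assumes "c1 \<noteq> c2" "x \<noteq> y" "x \<noteq> c1" "x \<noteq> c2" "y \<noteq> c1" "y \<noteq> c2"
    and "cname p \<notin> {x, y}" "cname q \<notin> {x, y}" "p \<noteq> q"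
  shows "set (glide_subst D c1 c2 x y p) \<inter> set (glide_subst D c1 c2 x y q) = {}"
  using glide_orig[OF assms(1-6), of p] glide_orig[OF assms(1-6), of q] assms(7-) by blast

lemma gl_TD:
  assumes D: "D \<in> TD n" and ok: "gl_ok D c1 c2 x y"
  shows "gl c1 c2 x y D \<in> TD n"
proof (rule TD_subst[OF D strand_gl])
  note c = gl_ok_crossings[OF D ok]
  fix p assume p: "p \<in> points D"
  then have px: "cname p \<noteq> x" "cname p \<noteq> y" using TD_cname[OF D] c by auto
  show "distinct (glide_subst D c1 c2 x y p)"
    using c by (cases p rule: point_cases[where ?c1.0 = c1 and ?c2.0 = c2]) (auto simp: glide_subst_simps)
  fix q assume q: "q \<in> points D" "p \<noteq> q"
  then have qx: "cname q \<noteq> x" "cname q \<noteq> y" using TD_cname[OF D] c by auto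
  then show "set (glide_subst D c1 c2 x y p) \<inter> set (glide_subst D c1 c2 x y q) = {}"
    using glide_subst_disjoint px q(2) c by simp
next
  show "Over c \<in> points (gl c1 c2 x y D) \<longleftrightarrow> Under c \<in> points (gl c1 c2 x y D)" for c
    by (simp add: points_gl[OF D ok])
  show "csign (gl c1 c2 x y D) c = 1 \<or> csign (gl c1 c2 x y D) c = - 1" 
    if "c \<in> crossings (gl c1 c2 x y D)" for c
    using that TD_sign[OF D gl_ok_crossings(1)[OF D ok]] TD_sign[OF D gl_ok_crossings(2)[OF D ok]]
    unfolding crossings_gl[OF D ok] by (auto simp: csign_gl dest: TD_sign[OF D])
qed

lemma seg_gl: "seg D ps \<Longrightarrow> seg (gl c1 c2 x y D) (concat (map (glide_subst D c1 c2 x y) ps))"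
  by (rule seg_subst[OF strand_gl])

text \<open>Tripling the heights makes room for the offsets by one third: every old height offers
  three slots, the middle one for the point that keeps the place, the outer ones for
  \<open>x\<close> and \<open>y\<close> in the order given by the sign.\<close>

definition gl_rank :: "vdiag \<Rightarrow> nat \<Rightarrow> nat \<Rightarrow> nat \<Rightarrow> nat \<Rightarrow> (nat endpt \<Rightarrow> nat) \<Rightarrow> nat endpt \<Rightarrow> nat" where
  "gl_rank D c1 c2 x y h w =
    (if w = Over x then 3 * h (Over c1) + (if csign D c1 = 1 then 0 else 2)
     else if w = Over y then 3 * h (Over c1) + (if csign D c1 = 1 then 2 else 0)
     else if w = Under x then 3 * h (Under c2) + (if csign D c2 = 1 then 2 else 0)
     else if w = Under y then 3 * h (Under c2) + (if csign D c2 = 1 then 0 else 2)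
     else if w = Over c2 then 3 * h (Under c1) + 1
     else if w = Under c1 then 3 * h (Over c2) + 1
     else 3 * h w + 1)"

lemma gl_rank_bounds:
  assumes D: "D \<in> TD n" and ok: "gl_ok D c1 c2 x y" and p: "p \<in> points D"
    and w: "w \<in> set (glide_subst D c1 c2 x y p)"
  shows "3 * h p \<le> gl_rank D c1 c2 x y h w \<and> gl_rank D c1 c2 x y h w \<le> 3 * h p + 2"
proof -
  note c = gl_ok_crossings[OF D ok]
  have p: "cname p \<noteq> x" "cname p \<noteq> y" using TD_cname[OF D p] c by auto
  have "\<forall>w\<in>set (glide_subst D c1 c2 x y p).
      3 * h p \<le> gl_rank D c1 c2 x y h w \<and> gl_rank D c1 c2 x y h w \<le> 3 * h p + 2"
  proof (cases p rule: point_cases[where ?c1.0 = c1 and ?c2.0 = c2])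
    case 5
    then show ?thesis using c(3) p
      by (cases p) (simp_all add: glide_subst_simps gl_rank_def)
  qed (use c(3-8) in \<open>simp_all add: glide_subst_simps gl_rank_def\<close>)
  then show ?thesis using w by blast
qed

lemma sorted_wrt_concat_map:
  assumes "sorted_wrt P xs" "\<And>p. p \<in> set xs \<Longrightarrow> sorted_wrt Q (t p)"
    "\<And>p q u v. p \<in> set xs \<Longrightarrow> q \<in> set xs \<Longrightarrow> P p q \<Longrightarrow> u \<in> set (t p) \<Longrightarrow> v \<in> set (t q) \<Longrightarrow> Q u v"
  shows "sorted_wrt Q (concat (map t xs))"
  using assms
proof (induction xs)
  case (Cons a xs)
  have "sorted_wrt Q (concat (map t xs))"
    using Cons.prems by (intro Cons.IH) (auto intro: Cons.prems(3))
  moreover have "Q u v" if u: "u \<in> set (t a)" and v: "v \<in> set (concat (map t xs))" for u v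
  proof -
    obtain q where q: "q \<in> set xs" "v \<in> set (t q)" using v by auto
    then have "P a q" using Cons.prems(1) by simp
    then show ?thesis using Cons.prems(3)[of a q u v] q u by simp
  qed
  ultimately show ?case using Cons.prems(2) by (auto simp: sorted_wrt_append)
qed simp

text \<open>All crossings touched by a glide become short cuts of the old cascade
  \<open>Over c1\<close>, \<open>Under c1\<close>, \<open>Over c2\<close>, \<open>Under c2\<close>
  with increasing heights: \<open>x\<close> and \<open>y\<close> join its first to its last place,
  \<open>c1\<close> the first to the third, \<open>c2\<close> the second to the fourth.\<close>

lemma ranked_gl:
  assumes D: "D \<in> TD n" and ok: "gl_ok D c1 c2 x y" and h: "ranked D h"
  shows "ranked (gl c1 c2 x y D) (gl_rank D c1 c2 x y h)" (is "ranked _ ?h")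
proof -
  note c = gl_ok_crossings[OF D ok]
  have h0: "h (Over c) < h (Under c)" if "c \<in> crossings D" for c 
    using h that by (simp add: ranked_def)
  have h1: "h (Under c1) < h (Over c2)" "h (Over c1) < h (Under c1)" "h (Over c2) < h (Under c2)"
    using ranked_seg[OF h] ok h0 c by (auto simp: gl_ok_def)
  have lt: "?h (Over c) < ?h (Under c)" if "c \<in> crossings D \<union> {x, y}" for c
  proof -
    consider "c = x" | "c = y" | "c = c1" | "c = c2" | "c \<in> crossings D" "c \<notin> {x, y, c1, c2}"
      using \<open>c \<in> crossings D \<union> {x, y}\<close> by auto
    then show ?thesis using h0[of c] h1 c by cases (auto simp: gl_rank_def)
  qed
  have "sorted_wrt (\<lambda>p q. ?h p < ?h q) (strand (gl c1 c2 x y D) a)" for a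
    unfolding strand_gl
  proof (rule sorted_wrt_concat_map)
    show "sorted_wrt (\<lambda>p q. h p < h q) (strand D a)" using h by (simp add: ranked_def)
  next
    fix p assume "p \<in> set (strand D a)"
    show "sorted_wrt (\<lambda>p q. ?h p < ?h q) (glide_subst D c1 c2 x y p)"
      using c by (cases p rule: point_cases[where ?c1.0 = c1 and ?c2.0 = c2]) (simp_all add: glide_subst_simps gl_rank_def)
  next
    fix p q u v assume pq: "p \<in> set (strand D a)" "q \<in> set (strand D a)" "h p < h q"
      and u: "u \<in> set (glide_subst D c1 c2 x y p)" and v: "v \<in> set (glide_subst D c1 c2 x y q)"
    have "p \<in> points D" "q \<in> points D" using pq by (auto simp: points_def)
    then show "?h u < ?h v" using gl_rank_bounds[OF D ok _ u, of h] gl_rank_bounds[OF D ok _ v, of h] pq(3)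
      by linarith
  qed
  then show ?thesis using lt by (simp add: ranked_def crossings_gl[OF D ok])
qed

lemma glide_AC: "D \<in> AC n \<Longrightarrow> glide D D' \<Longrightarrow> D' \<in> AC n"
  using ranked_gl gl_TD by (fastforce simp: AC_iff glide_iff)

section \<open>Steps are compatible with isomorphism\<close>

lemma glide_subst_map:
  assumes c: "c1 \<noteq> c2" "x \<noteq> c1" "x \<noteq> c2" "y \<noteq> c1" "y \<noteq> c2"  "f c1 \<noteq> f c2"
    and s: "csign E (f c1) = csign D c1" "csign E (f c2) = csign D c2"
    and p: "cname p \<noteq> x" "cname p \<noteq> y" "f (cname p) = f c1 \<longleftrightarrow> cname p = c1" "f (cname p) = f c2 \<longleftrightarrow> cname p = c2" and xy: "x \<noteq> y"
  shows "glide_subst E (f c1) (f c2) x' y' (map_endpt f p) = map (map_endpt (f(x := x', y := y'))) (glide_subst D c1 c2 x y p)"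
proof -
  have xy': "y \<noteq> x" "c1 \<noteq> x" "c2 \<noteq> x" "c1 \<noteq> y" "c2 \<noteq> y" "c2 \<noteq> c1" using c xy by auto
  show ?thesis
  proof (cases p)
    case (Over d)
    show ?thesis using p c xy xy' s unfolding Over 
     by (cases "d = c1"; cases "d = c2") (simp_all add: glide_subst_def)
  next
    case (Under d)
    show ?thesis using p c xy xy' s unfolding Under 
     by (cases "d = c1"; cases "d = c2") (simp_all add: glide_subst_def)
  qed
qed

text \<open>The new crossings may get any fresh names on the other side; with the identity as
  \<open>f\<close> this also shows that the names chosen in a glide do not matter.\<close>

lemma glide_iso_by:
  assumes D: "D \<in> TD n" and f: "iso_by f D E" and ok: "gl_ok D c1 c2 x y"
    and xy: "x' \<noteq> y'" "x' \<notin> crossings E" "y' \<notin> crossings E"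
  shows "gl_ok E (f c1) (f c2) x' y'"
    "iso_by (f(x := x', y := y')) (gl c1 c2 x y D) (gl (f c1) (f c2) x' y' E)"
proof -
  note c = gl_ok_crossings[OF D ok]
  have inj: "inj_on f (crossings D)" using f by (simp add: iso_by_def)
  have sE: "csign E (f c) = csign D c" if "c \<in> crossings D" for c using f that by (simp add: iso_by_def)
  have ne: "f c1 \<noteq> f c2" using inj c by (auto dest: inj_onD)
  have cE: "crossings E = f ` crossings D" by (rule iso_by_crossings[OF f])
  have xyE: "f c \<noteq> x'" "f c \<noteq> y'" if "c \<in> crossings D" for c using that xy cE by auto
  show "gl_ok E (f c1) (f c2) x' y'"
    using ok xy ne iso_by_seg[OF f, of "[Under c1, Over c2]"] by (simp add: gl_ok_def)
  let ?f = "f(x := x', y := y')"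
  show "iso_by ?f (gl c1 c2 x y D) (gl (f c1) (f c2) x' y' E)"
    unfolding iso_by_def crossings_gl[OF D ok]
  proof (intro conjI allI ballI)
    have f_eq: "?f d = f d" if "d \<in> crossings D" for d using that c by auto
    then have "inj_on ?f (crossings D)" using inj by (metis inj_on_cong)
    moreover have "?f ` crossings D = f ` crossings D" using f_eq by (auto simp del: fun_upd_apply)
    moreover have "crossings D \<union> {x, y} = insert x (insert y (crossings D))" by auto
    ultimately show "inj_on ?f (crossings D \<union> {x, y})"
      using c xy xyE by auto
  next
    fix a
    have "glide_subst E (f c1) (f c2) x' y' (map_endpt f p) = map (map_endpt ?f) (glide_subst D c1 c2 x y p)"
      if "p \<in> set (strand D a)" for p
    proof -
      have p: "cname p \<in> crossings D" using TD_cname[OF D, of p] that by (auto simp: points_def)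
      have "f (cname p) = f c1 \<longleftrightarrow> cname p = c1" "f (cname p) = f c2 \<longleftrightarrow> cname p = c2"
        using inj p c by (auto dest: inj_onD)
      moreover have "cname p \<noteq> x" "cname p \<noteq> y" using p c by auto
      moreover have "csign E (f c1) = csign D c1" "csign E (f c2) = csign D c2" using sE c by auto
      ultimately show ?thesis using c ne by (intro glide_subst_map) auto
    qed
    then show "strand (gl (f c1) (f c2) x' y' E) a = map (map_endpt ?f) (strand (gl c1 c2 x y D) a)"
      using f by (auto simp: strand_gl iso_by_def map_concat comp_def intro!: arg_cong[of _ _ concat])
  next
    fix d assume "d \<in> crossings D \<union> {x, y}"
    then consider "d = x" | "d = y" | "d \<in> crossings D" "d \<noteq> x" "d \<noteq> y" using c by auto
    then show "csign (gl (f c1) (f c2) x' y' E) (?f d) = csign (gl c1 c2 x y D) d"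
      by cases (use c xy xyE sE in \<open>simp_all add: csign_gl\<close>)
  qed
qed

lemma fresh2: "D \<in> TD n \<Longrightarrow> \<exists>x y. x \<noteq> y \<and> x \<notin> crossings D \<union> A \<and> y \<notin> crossings D \<union> A" if "finite A"
proof -
  assume D: "D \<in> TD n"
  have fin: "finite (crossings D \<union> A)" using finite_crossings[OF D] that by simp
  obtain x where x: "x \<notin> crossings D \<union> A" using ex_new_if_finite[OF infinite_UNIV_nat fin] by blast
  obtain y where y: "y \<notin> insert x (crossings D \<union> A)"
    using ex_new_if_finite[OF infinite_UNIV_nat finite.insertI[OF fin]] by blast
  show ?thesis using x y by blast
qed

lemma glide_iso:
  assumes D: "D \<in> TD n" and i: "diag_iso D E" and g: "glide D D'"
  shows "\<exists>E'. glide E E' \<and> diag_iso D' E'"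
proof -
  obtain f where f: "iso_by f D E" using i by (auto simp: diag_iso_iff)
  obtain c1 c2 x y where ok: "gl_ok D c1 c2 x y" and D': "D' = gl c1 c2 x y D"
    using g by (auto simp: glide_iff)
  have E: "E \<in> TD n" using iso_TD D i by blast
  obtain x' y' where "x' \<noteq> y'" "x' \<notin> crossings E" "y' \<notin> crossings E" using fresh2[OF _ E, of "{}"] by auto
  from glide_iso_by[OF D f ok this] show ?thesis unfolding D' glide_iff diag_iso_iff by blast
qed

lemma gl_rename:
  assumes D: "D \<in> TD n" and ok: "gl_ok D c1 c2 x y" and ok': "gl_ok D c1 c2 x' y'"
  shows "diag_iso (gl c1 c2 x y D) (gl c1 c2 x' y' D)"
proof -
  have "iso_by id D D" by (auto simp: iso_by_def endpt.map_id0)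
  from glide_iso_by(2)[OF D this ok, of x' y'] ok' show ?thesis
    by (auto simp: diag_iso_iff gl_ok_def)
qed

text \<open>The sets of crossings that an R1 or R2 move may remove. Keeping the set apart from the
  resulting diagram lets two removals be compared through unions of sets.\<close>

definition rdel :: "vdiag \<Rightarrow> nat set \<Rightarrow> bool" where
  "rdel D C \<longleftrightarrow> (\<exists>c. C = {c} \<and> adjacent D (Over c) (Under c)) \<or>
     (\<exists>c d. C = {c, d} \<and> c \<noteq> d \<and> csign D c = - csign D d \<and>
       adjacent D (Over c) (Over d) \<and> adjacent D (Under c) (Under d))"

definition red1 :: "vdiag \<Rightarrow> vdiag \<Rightarrow> bool" where
  "red1 D D' \<longleftrightarrow> (\<exists>C. rdel D C \<and> D' = del_crossings C D)"

lemma red1_iff: "red1 D D' \<longleftrightarrow> R1 D D' \<or> R2 D D'"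
  by (auto simp: red1_def rdel_def R1_def R2_def)

lemma adjacent_points: "adjacent D p q \<Longrightarrow> p \<in> points D \<and> q \<in> points D"
  using seg_points by (fastforce simp: adjacent_seg)

lemma rdel_crossings: "D \<in> TD n \<Longrightarrow> rdel D C \<Longrightarrow> C \<subseteq> crossings D \<and> C \<noteq> {}"
  unfolding rdel_def crossings_points by (auto simp: crossings_points dest: adjacent_points)

lemma red1_TD: "D \<in> TD n \<Longrightarrow> red1 D D' \<Longrightarrow> D' \<in> TD n"
  by (auto simp: red1_def del_TD)

lemma red1_AC: "D \<in> AC n \<Longrightarrow> red1 D D' \<Longrightarrow> D' \<in> AC n"
  by (auto simp: red1_def del_AC)

lemma iso_by_adjacent: "iso_by f D E \<Longrightarrow> adjacent D p q \<Longrightarrow> adjacent E (map_endpt f p) (map_endpt f q)"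
  using iso_by_seg[of f D E "[p, q]"] iso_by_seg[of f D E "[q, p]"] by (auto simp: adjacent_seg)

lemma iso_by_rdel:
  assumes D: "D \<in> TD n" and f: "iso_by f D E" and C: "rdel D C"
  shows "rdel E (f ` C)"
proof -
  have sE: "csign E (f c) = csign D c" if "c \<in> crossings D" for c using f that by (simp add: iso_by_def)
  have inj: "inj_on f (crossings D)" using f by (simp add: iso_by_def)
  from C show ?thesis unfolding rdel_def
  proof (elim disjE exE conjE)
    fix c assume "C = {c}" "adjacent D (Over c) (Under c)"
    then show "(\<exists>c. f ` C = {c} \<and> adjacent E (Over c) (Under c)) \<or>
     (\<exists>c d. f ` C = {c, d} \<and> c \<noteq> d \<and> csign E c = - csign E d \<and>
       adjacent E (Over c) (Over d) \<and> adjacent E (Under c) (Under d))"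
      using iso_by_adjacent[OF f, of "Over c" "Under c"] by simp
  next
    fix c d assume *: "C = {c, d}" "c \<noteq> d" "csign D c = - csign D d"
      "adjacent D (Over c) (Over d)" "adjacent D (Under c) (Under d)"
    then have "c \<in> crossings D" "d \<in> crossings D" by (auto simp: crossings_points dest: adjacent_points)
    then have "f c \<noteq> f d \<and> csign E (f c) = - csign E (f d)" using * sE inj by (auto dest: inj_onD)
    then show "(\<exists>c. f ` C = {c} \<and> adjacent E (Over c) (Under c)) \<or>
     (\<exists>c d. f ` C = {c, d} \<and> c \<noteq> d \<and> csign E c = - csign E d \<and>
       adjacent E (Over c) (Over d) \<and> adjacent E (Under c) (Under d))"
      using * iso_by_adjacent[OF f, of "Over c" "Over d"] iso_by_adjacent[OF f, of "Under c" "Under d"]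
      by (intro disjI2 exI[of _ "f c"] exI[of _ "f d"]) simp
  qed
qed

lemma iso_by_del:
  assumes D: "D \<in> TD n" and f: "iso_by f D E" and C: "C \<subseteq> crossings D"
  shows "iso_by f (del_crossings C D) (del_crossings (f ` C) E)"
proof -
  have inj: "inj_on f (crossings D)" using f by (simp add: iso_by_def)
  have *: "f (cname p) \<in> f ` C \<longleftrightarrow> cname p \<in> C" if "p \<in> points D" for p
    using inj_on_image_mem_iff[OF inj TD_cname[OF D that] C] .
  have "strand (del_crossings (f ` C) E) a = map (map_endpt f) (strand (del_crossings C D) a)" for a
    using f * by (auto simp: strand_del iso_by_def filter_map comp_def points_def intro!: filter_cong arg_cong[of _ _ "map (map_endpt f)"])
  then show ?thesis using f by (auto simp: iso_by_def crossings_del intro: inj_on_subset)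
qed

lemma red1_iso:
  assumes D: "D \<in> TD n" and i: "diag_iso D E" and r: "red1 D D'"
  shows "\<exists>E'. red1 E E' \<and> diag_iso D' E'"
proof -
  obtain f where f: "iso_by f D E" using i by (auto simp: diag_iso_iff)
  obtain C where C: "rdel D C" "D' = del_crossings C D" using r by (auto simp: red1_def)
  show ?thesis
    using iso_by_rdel[OF D f C(1)] iso_by_del[OF D f] rdel_crossings[OF D C(1)] C(2)
    unfolding red1_def diag_iso_iff by blast
qed

section \<open>Termination\<close>

text \<open>A cascade path that has dropped at \<open>c\<close> can travel on to the over point of
  \<open>d\<close> without a further drop.\<close>

definition prec :: "vdiag \<Rightarrow> nat \<Rightarrow> nat \<Rightarrow> bool" where
  "prec D c d \<longleftrightarrow> (\<exists>a xs ys zs. strand D a = xs @ Under c # ys @ Over d # zs)"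

text \<open>Sequences of crossings at which a cascade path can drop one after the other. Three marks
  are what the comparison after a glide needs: one mark of \<open>c1\<close> encodes
  \<open>x\<close>, one encodes \<open>y\<close>, and the last one makes the inequality
  strict.\<close>

definition marked_chains :: "vdiag \<Rightarrow> (nat \<times> nat) list set" where
  "marked_chains D = {l. successively (\<lambda>p q. prec D (fst p) (fst q)) l \<and> set l \<subseteq> crossings D \<times> {..<3}}"

definition weight :: "vdiag \<Rightarrow> nat" where
  "weight D = card (marked_chains D)"

lemma ranked_strand_less:
  assumes "ranked D h" "strand D a = xs @ p # ys @ q # zs" shows "h p < h q"
proof -
  have "sorted_wrt (\<lambda>p q. h p < h q) (strand D a)" using assms(1) by (simp add: ranked_def)
  then show ?thesis by (simp add: assms(2) sorted_wrt_append)
qed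

lemma prec_ranked:
  assumes h: "ranked D h"
  shows "prec D c d \<longleftrightarrow>
    (\<exists>a. Under c \<in> set (strand D a) \<and> Over d \<in> set (strand D a) \<and> h (Under c) < h (Over d))"
proof
  assume "prec D c d"
  then obtain a xs ys zs where a: "strand D a = xs @ Under c # ys @ Over d # zs" by (auto simp: prec_def)
  then have "h (Under c) < h (Over d)" using ranked_strand_less[OF h a] by simp
  then show "\<exists>a. Under c \<in> set (strand D a) \<and> Over d \<in> set (strand D a) \<and> h (Under c) < h (Over d)"
    using a by (intro exI[of _ a]) simp
next
  assume "\<exists>a. Under c \<in> set (strand D a) \<and> Over d \<in> set (strand D a) \<and> h (Under c) < h (Over d)"
  then obtain a where a: "Under c \<in> set (strand D a)" "Over d \<in> set (strand D a)"
    and less: "h (Under c) < h (Over d)" by blast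
  obtain xs ys where x: "strand D a = xs @ Under c # ys" using split_list[OF a(1)] by blast
  have s: "sorted_wrt (\<lambda>p q. h p < h q) (xs @ Under c # ys)" using h x by (metis ranked_def)
  have "Over d \<notin> set xs" using s less by (fastforce simp: sorted_wrt_append)
  then have "Over d \<in> set ys" using a(2) x by auto
  then obtain us vs where "ys = us @ Over d # vs" using split_list by metis
  then show "prec D c d" using x unfolding prec_def by blast
qed

lemma prec_less:
  assumes h: "ranked D h" and "prec D c d" "c \<in> crossings D"
  shows "h (Over c) < h (Over d)"
proof -
  have "h (Over c) < h (Under c)" using h assms(3) by (simp add: ranked_def)
  also have "\<dots> < h (Over d)" using assms prec_ranked[OF h] by blast
  finally show ?thesis .
qed

text \<open>Along a chain the heights of the over points increase strictly, so in an acyclic diagram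
  no chain has a repetition.\<close>

lemma finite_marked_chains:
  assumes D: "D \<in> AC n" shows "finite (marked_chains D)"
proof (rule finite_subset)
  obtain h where h: "ranked D h" using D by (auto simp: AC_iff)
  show "marked_chains D \<subseteq> {l. set l \<subseteq> crossings D \<times> {..<3} \<and> distinct l}"
  proof (intro subsetI, clarsimp simp: marked_chains_def)
    fix l :: "(nat \<times> nat) list" assume s: "successively (\<lambda>p q. prec D (fst p) (fst q)) l" and l: "set l \<subseteq> crossings D \<times> {..<3}"
    let ?P = "\<lambda>p q. h (Over (fst p)) < h (Over (fst q))"
    have "successively ?P l"
      by (rule successively_mono[OF s]) (use l prec_less[OF h] in auto)
    moreover have "transp ?P" by (auto simp: transp_def)
    ultimately have "sorted_wrt ?P l" using successively_conv_sorted_wrt by blast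
    then show "distinct l" by (induction l) auto
  qed
  show "finite {l. set l \<subseteq> crossings D \<times> {..<3::nat} \<and> distinct l}"
    using finite_crossings[OF AC_TD[OF D]] by (intro finite_subset_distinct) auto
qed

lemma weight_del:
  assumes D: "D \<in> AC n" and C: "C \<subseteq> crossings D" "C \<noteq> {}"
  shows "weight (del_crossings C D) < weight D"
  unfolding weight_def
proof (rule psubset_card_mono[OF finite_marked_chains[OF D]])
  obtain h where h: "ranked D h" using D by (auto simp: AC_iff)
  have p: "prec D c d" if "prec (del_crossings C D) c d" for c d
    using that unfolding prec_ranked[OF h] prec_ranked[OF ranked_del[OF h]]
    by (auto simp: strand_del)
  have "marked_chains (del_crossings C D) \<subseteq> marked_chains D"
    unfolding marked_chains_def crossings_del using p by (auto intro: successively_mono)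
  moreover obtain c where "c \<in> C" using C by auto
  \<comment> \<open>A one-element chain at a deleted crossing is lost, which makes the inclusion
    strict.\<close>
  then have "[(c, 0)] \<in> marked_chains D - marked_chains (del_crossings C D)"
    using C by (auto simp: marked_chains_def crossings_del)
  ultimately show "marked_chains (del_crossings C D) \<subset> marked_chains D" by blast
qed

lemma weight_red1: "D \<in> AC n \<Longrightarrow> red1 D D' \<Longrightarrow> weight D' < weight D"
proof -
  assume D: "D \<in> AC n" and "red1 D D'"
  then obtain C where C: "rdel D C" "D' = del_crossings C D" by (auto simp: red1_def)
  then show "weight D' < weight D" using weight_del[OF D] rdel_crossings[OF AC_TD[OF D] C(1)] by simp
qed

text \<open>
  A cascade of crossings through \<open>x\<close> or \<open>y\<close> after the glide move is turned into one through \<open>c1, c2\<close>;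
  of the three marks of \<open>c1\<close>, two are used to distinguish \<open>x\<close> from \<open>y\<close>.
\<close>

definition unglide :: "nat \<Rightarrow> nat \<Rightarrow> nat \<Rightarrow> nat \<Rightarrow> nat \<times> nat \<Rightarrow> (nat \<times> nat) list" where
  "unglide c1 c2 x y p = (if fst p = x then [(c1, 1), (c2, snd p)]
     else if fst p = y then [(c1, 2), (c2, snd p)] else [p])"

fun reglide :: "nat \<Rightarrow> nat \<Rightarrow> nat \<Rightarrow> nat \<Rightarrow> (nat \<times> nat) list \<Rightarrow> (nat \<times> nat) list" where
  "reglide c1 c2 x y (p # q # r) = (if fst p = c1 \<and> fst q = c2
     then (if snd p = 1 then x else y, snd q) # reglide c1 c2 x y r
     else p # reglide c1 c2 x y (q # r))"
| "reglide c1 c2 x y l = l"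

text \<open>Decoding is unambiguous: a \<open>c1\<close> directly before a \<open>c2\<close> in the
  code stems from \<open>x\<close> or \<open>y\<close>, since in the chain itself \<open>c1\<close>
  is never followed by \<open>c2\<close>. After a glide this hypothesis holds because the over point
  now called \<open>c2\<close> stands before the under point of \<open>c1\<close>.\<close>

lemma reglide_unglide:
  assumes "c1 \<noteq> c2" "x \<noteq> y" and "successively (\<lambda>p q. \<not> (fst p = c1 \<and> fst q = c2)) l"
  shows "reglide c1 c2 x y (concat (map (unglide c1 c2 x y) l)) = l"
  using assms(3)
proof (induction l)
  case (Cons p l)
  then have IH: "reglide c1 c2 x y (concat (map (unglide c1 c2 x y) l)) = l"
    by (auto simp: successively_Cons)
  show ?case
  proof (cases "fst p = x \<or> fst p = y")
    case True
    then show ?thesis using IH assms by (auto simp: unglide_def[of _ _ _ _ p] prod_eq_iff)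
  next
    case False
    show ?thesis
    proof (cases l)
      case Nil
      then show ?thesis using False by (simp add: unglide_def)
    next
      case (Cons q r)
      have nn: "\<not> (fst p = c1 \<and> fst q = c2)" using Cons.prems Cons by simp
      \<comment> \<open>The code of \<open>q\<close> starts with the crossing of \<open>q\<close>
        itself or with \<open>c1\<close>, so it cannot supply a \<open>c2\<close> that would be
        merged with a preceding \<open>c1\<close>.\<close>
      have u: "unglide c1 c2 x y q \<noteq> []" "fst (hd (unglide c1 c2 x y q)) \<in> {c1, fst q}"
        by (auto simp: unglide_def)
      define q' where "q' = hd (unglide c1 c2 x y q)"
      define r' where "r' = tl (unglide c1 c2 x y q) @ concat (map (unglide c1 c2 x y) r)"
      have q': "concat (map (unglide c1 c2 x y) l) = q' # r'" "fst q' = c1 \<or> fst q' = fst q"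
        using Cons u by (auto simp: q'_def r'_def)
      then have "\<not> (fst p = c1 \<and> fst q' = c2)" using nn assms by auto
      then show ?thesis using False IH q' by (auto simp: unglide_def[of _ _ _ _ p])
    qed
  qed
qed simp

text \<open>The under points of \<open>x\<close> and \<open>y\<close> stand next to that of
  \<open>c2\<close>, their over points next to that of \<open>c1\<close>; replacing them accordingly
  gives an old precedence. The other points that have moved are the under point of
  \<open>c1\<close>, which went to a later place, and the over point of \<open>c2\<close>, which
  went to an earlier one, so there precedences can only be lost.\<close>

lemma prec_gl:
  assumes D: "D \<in> TD n" and h: "ranked D h" and ok: "gl_ok D c1 c2 x y"
    and p: "prec (gl c1 c2 x y D) c d"
  shows "prec D (if c = x \<or> c = y then c2 else c) (if d = x \<or> d = y then c1 else d)"
    "\<not> (c = c1 \<and> d = c2)"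
proof -
  note c = gl_ok_crossings[OF D ok]
  let ?h = "gl_rank D c1 c2 x y h" and ?o = "glide_orig c1 c2 x y"
  obtain a where a: "Under c \<in> set (strand (gl c1 c2 x y D) a)" "Over d \<in> set (strand (gl c1 c2 x y D) a)"
    "?h (Under c) < ?h (Over d)"
    using p unfolding prec_ranked[OF ranked_gl[OF D ok h]] by blast
  have orig: "?o w \<in> set (strand D a) \<and> 3 * h (?o w) \<le> ?h w \<and> ?h w \<le> 3 * h (?o w) + 2"
    if w: "w \<in> set (strand (gl c1 c2 x y D) a)" for w
  proof -
    obtain q where q: "q \<in> set (strand D a)" "w \<in> set (glide_subst D c1 c2 x y q)"
      using w unfolding strand_gl by auto
    have qD: "q \<in> points D" using q by (auto simp: points_def)
    then have "?o w = q" using TD_cname[OF D qD] c q(2) by (intro glide_orig) auto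
    then show ?thesis using q gl_rank_bounds[OF D ok qD q(2)] by simp
  qed
  have ne: "?o (Under c) \<noteq> ?o (Over d)"
    using c by (auto simp: glide_orig_def)
  have le: "h (?o (Under c)) \<le> h (?o (Over d))" using orig[OF a(1)] orig[OF a(2)] a(3) by linarith
  have "sorted_wrt (<) (map h (strand D a))" using h by (simp add: ranked_def sorted_wrt_map)
  then have "inj_on h (set (strand D a))" by (simp add: strict_sorted_iff distinct_map)
  then have inj: "u = v" if "u \<in> set (strand D a)" "v \<in> set (strand D a)" "h u = h v" for u v
    using that by (auto dest: inj_onD)
  have lt: "h (?o (Under c)) < h (?o (Over d))"
    using le inj[of "?o (Under c)" "?o (Over d)"] orig[OF a(1)] orig[OF a(2)] ne by fastforce
  have sg: "seg D [Under c1, Over c2]" using ok by (simp add: gl_ok_def)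
  have lt12: "h (Under c1) < h (Over c2)" by (rule ranked_seg[OF h sg])
  obtain b xs ys where b: "strand D b = xs @ [Under c1, Over c2] @ ys" using sg by (auto simp: seg_def)
  have st12: "Under c1 \<in> set (strand D e) \<longleftrightarrow> Over c2 \<in> set (strand D e)" for e
    using b TD_strand_unique[OF D, of "Under c1" e b] TD_strand_unique[OF D, of "Over c2" e b] by auto
  show "\<not> (c = c1 \<and> d = c2)"
  proof
    assume "c = c1 \<and> d = c2"
    then have "h (Over c2) < h (Under c1)" using lt c by (simp add: glide_orig_def)
    then show False using lt12 by simp
  qed
  show "prec D (if c = x \<or> c = y then c2 else c) (if d = x \<or> d = y then c1 else d)"
    unfolding prec_ranked[OF h]
  proof (intro exI[of _ a] conjI)
    let ?c = "if c = x \<or> c = y then c2 else c" and ?d = "if d = x \<or> d = y then c1 else d"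
    have oc: "?o (Under c) = (if c = c1 then Over c2 else Under ?c)" using c by (simp add: glide_orig_def)
    have od: "?o (Over d) = (if d = c2 then Under c1 else Over ?d)" using c by (simp add: glide_orig_def)
    have U: "Under ?c \<in> set (strand D a) \<and> h (Under ?c) \<le> h (?o (Under c))"
      using orig[OF a(1)] oc st12[of a] lt12 c by (cases "c = c1") auto
    have O: "Over ?d \<in> set (strand D a) \<and> h (?o (Over d)) \<le> h (Over ?d)"
      using orig[OF a(2)] od st12[of a] lt12 c by (cases "d = c2") auto
    show "Under ?c \<in> set (strand D a)" "Over ?d \<in> set (strand D a)" "h (Under ?c) < h (Over ?d)"
      using U O lt by auto
  qed
qed

lemma weight_gl:
  assumes D: "D \<in> AC n" and ok: "gl_ok D c1 c2 x y"
  shows "weight (gl c1 c2 x y D) < weight D"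
proof -
  have T: "D \<in> TD n" by (rule AC_TD[OF D])
  note c = gl_ok_crossings[OF T ok]
  obtain h where h: "ranked D h" using D by (auto simp: AC_iff)
  let ?D = "gl c1 c2 x y D" and ?u = "\<lambda>l. concat (map (unglide c1 c2 x y) l)"
  have "prec D c1 c2" using ok unfolding gl_ok_def prec_def seg_def by (metis append_Cons append_Nil)
  then have u1: "successively (\<lambda>p q. prec D (fst p) (fst q)) (unglide c1 c2 x y p)" for p
    by (simp add: unglide_def)
  have mem: "?u l \<in> marked_chains D" if "l \<in> marked_chains ?D" for l
    using that
  proof (induction l)
    case (Cons p l)
    then have "l \<in> marked_chains ?D" by (auto simp: marked_chains_def successively_Cons)
    then have IH: "?u l \<in> marked_chains D" by (rule Cons.IH)
    have pc: "fst p \<in> crossings D \<union> {x, y}" "snd p < 3"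
      using Cons.prems by (auto simp: marked_chains_def crossings_gl[OF T ok])
    have "set (unglide c1 c2 x y p) \<subseteq> crossings D \<times> {..<3}"
      using pc c by (cases p) (auto simp: unglide_def)
    moreover have "successively (\<lambda>p q. prec D (fst p) (fst q)) (?u (p # l))"
    proof (cases l)
      case Nil
      then show ?thesis using u1 by simp
    next
      case (Cons q r)
      then have "prec ?D (fst p) (fst q)" using Cons.prems by (simp add: marked_chains_def)
      from prec_gl(1)[OF T h ok this]
      have "prec D (fst (last (unglide c1 c2 x y p))) (fst (hd (unglide c1 c2 x y q)))"
        by (auto simp: unglide_def split: if_splits)
      moreover have "unglide c1 c2 x y q \<noteq> []" "unglide c1 c2 x y p \<noteq> []" by (auto simp: unglide_def)
      ultimately show ?thesis using IH u1[of p] Cons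
        by (auto simp: successively_append_iff marked_chains_def hd_append)
    qed
    ultimately show ?case using IH by (auto simp: marked_chains_def)
  qed (simp add: marked_chains_def)
  have dec: "reglide c1 c2 x y (?u l) = l" if "l \<in> marked_chains ?D" for l
  proof (rule reglide_unglide)
    have "successively (\<lambda>p q. prec ?D (fst p) (fst q)) l" using that by (simp add: marked_chains_def)
    then show "successively (\<lambda>p q. \<not> (fst p = c1 \<and> fst q = c2)) l"
      by (rule successively_mono) (use prec_gl(2)[OF T h ok] in blast)
  qed (use c in auto)
  have inj: "inj_on ?u (marked_chains ?D)"
    by (rule inj_on_inverseI[of _ "reglide c1 c2 x y"]) (rule dec)
  \<comment> \<open>With mark 0 on \<open>c1\<close> this chain of the old diagram is not the code
    of any new chain.\<close>
  let ?z = "[(c1, 0), (c2, 0)]"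
  have z: "?z \<in> marked_chains D" using \<open>prec D c1 c2\<close> c by (simp add: marked_chains_def)
  have "?z \<notin> ?u ` marked_chains ?D"
  proof
    assume "?z \<in> ?u ` marked_chains ?D"
    then obtain l where l: "?z = ?u l" "l \<in> marked_chains ?D" by (rule imageE)
    then have "l = reglide c1 c2 x y ?z" using dec[OF l(2)] by simp
    then have "l = [(y, 0)]" by simp
    then have "?u l = unglide c1 c2 x y (y, 0)" by simp
    then show False using l(1) c by (simp add: unglide_def)
  qed
  moreover have "?u ` marked_chains ?D \<subseteq> marked_chains D" using mem by (rule image_subsetI)
  ultimately have "?u ` marked_chains ?D \<subset> marked_chains D" using z by (metis psubsetI)
  then have "card (?u ` marked_chains ?D) < card (marked_chains D)"
    by (rule psubset_card_mono[OF finite_marked_chains[OF D]])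
  then show ?thesis by (simp add: weight_def card_image[OF inj])
qed

lemma weight_glide: "D \<in> AC n \<Longrightarrow> glide D D' \<Longrightarrow> weight D' < weight D"
  using weight_gl by (auto simp: glide_iff)

section \<open>Newman's lemma modulo isomorphism\<close>

text \<open>Rewriting that terminates by the measure \<open>m\<close> and commutes with isomorphism.
  There are three instances: glides alone for \<open>Gamma_v\<close>, R1 and R2 removals alone for
  reduced forms, and the union of both for the classes of \<open>vAC\<close>.\<close>

locale iso_rewriting =
  fixes n :: nat and S :: "vdiag set" and R :: "vdiag \<Rightarrow> vdiag \<Rightarrow> bool" and m :: "vdiag \<Rightarrow> nat"
  assumes S_TD: "D \<in> S \<Longrightarrow> D \<in> TD n"
    and S_iso: "D \<in> S \<Longrightarrow> diag_iso D E \<Longrightarrow> E \<in> S"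
    and S_step: "D \<in> S \<Longrightarrow> R D D' \<Longrightarrow> D' \<in> S"
    and dec: "D \<in> S \<Longrightarrow> R D D' \<Longrightarrow> m D' < m D"
    and compat: "D \<in> S \<Longrightarrow> diag_iso D E \<Longrightarrow> R D D' \<Longrightarrow> \<exists>E'. R E E' \<and> diag_iso D' E'"
begin

lemma S_steps: "R\<^sup>*\<^sup>* D D' \<Longrightarrow> D \<in> S \<Longrightarrow> D' \<in> S"
  by (induction rule: rtranclp_induct) (auto intro: S_step)

lemma dec_steps: "R\<^sup>*\<^sup>* D D' \<Longrightarrow> D \<in> S \<Longrightarrow> m D' \<le> m D"
proof (induction rule: rtranclp_induct)
  case (step D1 D2)
  then show ?case using dec[OF S_steps[OF step.hyps(1)] step.hyps(2)] by simp
qed simp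

lemma compat_steps:
  "R\<^sup>*\<^sup>* D D' \<Longrightarrow> D \<in> S \<Longrightarrow> diag_iso D E \<Longrightarrow> \<exists>E'. R\<^sup>*\<^sup>* E E' \<and> diag_iso D' E'"
proof (induction rule: rtranclp_induct)
  case (step D1 D2)
  then obtain E1 where "R\<^sup>*\<^sup>* E E1" "diag_iso D1 E1" by blast
  then show ?case using compat[of D1 E1 D2] S_steps[OF step.hyps(1)] step
    by (meson rtranclp.rtrancl_into_rtrancl)
qed blast

lemma normal_form_exists: "D \<in> S \<Longrightarrow> \<exists>E. R\<^sup>*\<^sup>* D E \<and> \<not> (\<exists>X. R E X)"
proof (induction "m D" arbitrary: D rule: less_induct)
  case less
  show ?case
  proof (cases "\<exists>X. R D X")
    case True
    then obtain X where X: "R D X" by blast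
    then show ?thesis using less.hyps[OF dec[OF less.prems X] S_step[OF less.prems X]]
      by (meson converse_rtranclp_into_rtranclp)
  qed blast
qed

lemma iso_sym: "D \<in> S \<Longrightarrow> diag_iso D E \<Longrightarrow> diag_iso E D"
  using diag_iso_sym S_TD by blast

lemma normal_iso: "D \<in> S \<Longrightarrow> diag_iso D E \<Longrightarrow> \<not> (\<exists>X. R D X) \<Longrightarrow> \<not> (\<exists>X. R E X)"
  using compat[of E D] iso_sym S_iso by blast

text \<open>Newman's lemma by induction on \<open>m\<close>. The two reductions start from
  isomorphic diagrams because local joins exist only up to isomorphism. The first step of the second
  reduction is transported to \<open>D\<close>; then the induction hypothesis is used at
  \<open>D1\<close>, at the isomorphic reducts \<open>X\<close> and \<open>Y\<close>, and at
  \<open>D2\<close>.\<close>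

lemma unique_normal_form:
  assumes lc: "\<And>D A B. D \<in> S \<Longrightarrow> R D A \<Longrightarrow> R D B \<Longrightarrow>
      \<exists>A' B'. R\<^sup>*\<^sup>* A A' \<and> R\<^sup>*\<^sup>* B B' \<and> diag_iso A' B'"
  shows "D \<in> S \<Longrightarrow> diag_iso D E \<Longrightarrow> R\<^sup>*\<^sup>* D A \<Longrightarrow> R\<^sup>*\<^sup>* E B \<Longrightarrow>
    \<not> (\<exists>X. R A X) \<Longrightarrow> \<not> (\<exists>X. R B X) \<Longrightarrow> diag_iso A B"
proof (induction "m D" arbitrary: D E A B rule: less_induct)
  case less
  have ES: "E \<in> S" using S_iso less.prems by blast
  show ?case
  proof (cases "\<exists>X. R D X")
    case False
    then have "A = D" using less.prems(3) by (metis converse_rtranclpE)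
    moreover have "\<not> (\<exists>X. R E X)" using normal_iso[OF less.prems(1,2) False] .
    then have "B = E" using less.prems(4) by (metis converse_rtranclpE)
    ultimately show ?thesis using less.prems by simp
  next
    case True
    then have "A \<noteq> D" using less.prems by blast
    then obtain D1 where D1: "R D D1" "R\<^sup>*\<^sup>* D1 A" using less.prems(3) by (metis converse_rtranclpE)
    have "\<exists>X. R E X" using True compat less.prems by blast
    then have "B \<noteq> E" using less.prems by blast
    then obtain E1 where E1: "R E E1" "R\<^sup>*\<^sup>* E1 B" using less.prems(4) by (metis converse_rtranclpE)
    obtain D2 where D2: "R D D2" "diag_iso E1 D2"
      using compat[OF ES iso_sym[OF less.prems(1,2)] E1(1)] by blast
    note S1 = S_step[OF less.prems(1) D1(1)] and S2 = S_step[OF less.prems(1) D2(1)]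
    note m1 = dec[OF less.prems(1) D1(1)] and m2 = dec[OF less.prems(1) D2(1)]
    obtain X Y where XY: "R\<^sup>*\<^sup>* D1 X" "R\<^sup>*\<^sup>* D2 Y" "diag_iso X Y"
      using lc[OF less.prems(1) D1(1) D2(1)] by blast
    obtain NX where NX: "R\<^sup>*\<^sup>* X NX" "\<not> (\<exists>Z. R NX Z)" using normal_form_exists S_steps XY S1 by blast
    obtain NY where NY: "R\<^sup>*\<^sup>* Y NY" "\<not> (\<exists>Z. R NY Z)" using normal_form_exists S_steps XY S2 by blast
    have "diag_iso A NX"
      using less.hyps[OF m1 S1 diag_iso_refl D1(2)] rtranclp_trans[OF XY(1) NX(1)] NX(2) less.prems(5) by blast
    moreover have "m X < m D" using dec_steps[OF XY(1) S1] m1 by simp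
    then have "diag_iso NX NY"
      using less.hyps[OF _ S_steps[OF XY(1) S1] XY(3) NX(1) NY(1) NX(2) NY(2)] by blast
    moreover have "diag_iso NY B"
    proof (rule less.hyps[OF m2 S2 _ _ E1(2) NY(2) less.prems(6)])
      show "diag_iso D2 E1" using diag_iso_sym D2(2) S_TD S_step[OF ES E1(1)] by blast
      show "R\<^sup>*\<^sup>* D2 NY" using XY(2) NY(1) by simp
    qed
    ultimately show ?thesis by (meson diag_iso_trans)
  qed
qed

end

section \<open>Critical pairs\<close>

text \<open>Induction over the list of blocks: as they are disjoint, \<open>f\<close> can be changed
  into \<open>g\<close> on one block at a time.\<close>

lemma subst_segs_eq:
  assumes D: "D \<in> TD n" 
    and sg: "\<And>ps. ps \<in> set L \<Longrightarrow> seg D ps \<and> concat (map f ps) = concat (map g ps)"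
    and dis: "sorted_wrt (\<lambda>ps qs. set ps \<inter> set qs = {}) L"
    and out: "\<And>p. p \<in> points D \<Longrightarrow> \<forall>ps\<in>set L. p \<notin> set ps \<Longrightarrow> f p = g p"
  shows "concat (map f (strand D b)) = concat (map g (strand D b))"
  using sg dis out
proof (induction L arbitrary: f)
  case Nil
  have "map f (strand D b) = map g (strand D b)" by (rule map_cong) (auto simp: points_def intro!: Nil.prems(3))
  then show ?case by metis
next
  case (Cons ps L)
  let ?f = "\<lambda>p. if p \<in> set ps then g p else f p"
  have 1: "concat (map f (strand D b)) = concat (map ?f (strand D b))"
  proof (rule subst_seg_eq[OF D])
    show "seg D ps" using Cons.prems(1) by simp
    have "map ?f ps = map g ps" by simp
    then have "concat (map ?f ps) = concat (map g ps)" by metis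
    then show "concat (map f ps) = concat (map ?f ps)" using Cons.prems(1)[of ps] by simp
  qed simp
  also have "\<dots> = concat (map g (strand D b))"
  proof (rule Cons.IH)
    fix qs assume q: "qs \<in> set L"
    have "map ?f qs = map f qs" using Cons.prems(2) q by auto
    then have "concat (map ?f qs) = concat (map f qs)" by metis
    then show "seg D qs \<and> concat (map ?f qs) = concat (map g qs)"
      using Cons.prems(1)[of qs] q by simp
  qed (use Cons.prems in auto)
  finally show ?case .
qed

lemma seg_join_gen:
  assumes D: "D \<in> TD n" and "seg D (ps @ [q])" "seg D (q # rs)"
  shows "seg D (ps @ q # rs)"
proof -
  obtain a xs ys b zs ws where
    1: "strand D a = (xs @ ps) @ q # ys" and 2: "strand D b = zs @ q # rs @ ws"
    using assms(2,3) unfolding seg_def by auto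
  have "a = b" using TD_strand_unique[OF D, of q a b] 1 2 by simp
  moreover have d: "distinct (strand D a)" using D by (simp add: TD_iff)
  moreover have "q \<notin> set (xs @ ps)" "q \<notin> set ys" using d 1 by auto
  ultimately have "ys = rs @ ws" using 1 2 append_Cons_eq_iff by metis
  then have "strand D a = xs @ (ps @ q # rs) @ ws" using 1 by simp
  then show ?thesis unfolding seg_def by blast
qed

lemma adjacent_sym: "adjacent D p q \<longleftrightarrow> adjacent D q p"
  by (auto simp: adjacent_def)

lemma adj_adj:
  assumes D: "D \<in> TD n" and "adjacent D p q" "adjacent D q r" "p \<noteq> r"
  shows "seg D [p, q, r] \<or> seg D [r, q, p]"
  using assms seg_join[OF D] seg_left_unique[OF D] seg_right_unique[OF D]
  unfolding adjacent_seg by metis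

section \<open>Local confluence of R1 and R2 removals\<close>

lemma adjacent_del:
  "adjacent D p q \<Longrightarrow> cname p \<notin> C \<Longrightarrow> cname q \<notin> C \<Longrightarrow> adjacent (del_crossings C D) p q"
  using seg_del[of D "[p, q]" C] seg_del[of D "[q, p]" C] by (auto simp: adjacent_seg)

lemma rdel_del: "rdel D C \<Longrightarrow> C \<inter> X = {} \<Longrightarrow> rdel (del_crossings X D) C"
proof -
  assume "rdel D C" and X: "C \<inter> X = {}"
  from this(1) consider c where "C = {c}" "adjacent D (Over c) (Under c)"
    | c d where "C = {c, d}" "c \<noteq> d" "csign D c = - csign D d"
       "adjacent D (Over c) (Over d)" "adjacent D (Under c) (Under d)"
    unfolding rdel_def by blast
  then show ?thesis
  proof cases
    case 1
    then have "adjacent (del_crossings X D) (Over c) (Under c)" using X by (intro adjacent_del) auto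
    then show ?thesis using 1 unfolding rdel_def by blast
  next
    case 2
    then have "adjacent (del_crossings X D) (Over c) (Over d)" "adjacent (del_crossings X D) (Under c) (Under d)"
      using X by (auto intro!: adjacent_del)
    then show ?thesis using 2 unfolding rdel_def csign_del by blast
  qed
qed

lemma red1I: "rdel D C \<Longrightarrow> red1 D (del_crossings C D)"
  by (auto simp: red1_def)

text \<open>The four points are consecutive, with those of \<open>c\<close> in the middle; once
  \<open>c\<close> is gone, the two points of \<open>e\<close> are neighbours.\<close>

lemma critical_R1_R2:
  assumes D: "D \<in> TD n" and c: "adjacent D (Over c) (Under c)"
    and e: "c \<noteq> e" "adjacent D (Over c) (Over e)" "adjacent D (Under c) (Under e)"
  shows "rdel (del_crossings {c} D) {e}"
proof -
  have 1: "seg D [Over e, Over c, Under c] \<or> seg D [Under c, Over c, Over e]"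
    using adj_adj[OF D, of "Over e" "Over c" "Under c"] c e adjacent_sym by auto
  have 2: "seg D [Over c, Under c, Under e] \<or> seg D [Under e, Under c, Over c]"
    using adj_adj[OF D, of "Over c" "Under c" "Under e"] c e by auto
  have 3: "\<not> (seg D [Over c, Under c] \<and> seg D [Under c, Over c])" using seg_antisym[OF D] by blast
  have "seg D [Over e, Over c, Under c, Under e] \<or> seg D [Under e, Under c, Over c, Over e]"
  proof (cases "seg D [Over c, Under c]")
    case True
    then have "seg D [Over e, Over c, Under c]" "seg D [Over c, Under c, Under e]"
      using 1 2 3 seg_Cons2 seg_tl by blast+
    then show ?thesis using seg_join_gen[OF D, of "[Over e, Over c]" "Under c" "[Under e]"] seg_tl by auto
  next
    case False
    then have "seg D [Under e, Under c, Over c]" "seg D [Under c, Over c, Over e]"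
      using 1 2 seg_Cons2 seg_tl by blast+
    then show ?thesis using seg_join_gen[OF D, of "[Under e, Under c]" "Over c" "[Over e]"] seg_tl by auto
  qed
  then have "adjacent (del_crossings {c} D) (Over e) (Under e)"
    using seg_del[of D _ "{c}"] e(1) unfolding adjacent_seg by fastforce
  then show ?thesis by (auto simp: rdel_def)
qed

text \<open>Removing \<open>c, d\<close> leaves \<open>e\<close> and removing \<open>d, e\<close>
  leaves \<open>c\<close>; both survivors have the same sign and stand at the same place, so the
  results differ by a name only.\<close>

lemma critical_R2_R2:
  assumes D: "D \<in> TD n" and ne: "c \<noteq> d" "d \<noteq> e" "c \<noteq> e" and s: "csign D c = csign D e"
    and cd: "adjacent D (Over c) (Over d)" "adjacent D (Under c) (Under d)"
    and de: "adjacent D (Over d) (Over e)" "adjacent D (Under d) (Under e)"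
  shows "diag_iso (del_crossings {c, d} D) (del_crossings {d, e} D)"
proof -
  define f where "f = id(e := c)"
  define t1 where "t1 p = (if cname p \<in> {c, d} then [] else [map_endpt f p])" for p
  define t2 where "t2 p = (if cname p \<in> {d, e} then [] else [p])" for p
  obtain os where os: "os \<in> {[Over c, Over d, Over e], [Over e, Over d, Over c]}" "seg D os"
    using adj_adj[OF D cd(1) de(1)] ne by blast
  obtain us where us: "us \<in> {[Under c, Under d, Under e], [Under e, Under d, Under c]}" "seg D us"
    using adj_adj[OF D cd(2) de(2)] ne by blast
  have cr: "c \<in> crossings D" "e \<in> crossings D"
    using cd de adjacent_points[of D] by (auto simp: crossings_points)
  have "concat (map t1 (strand D b)) = concat (map t2 (strand D b))" for b
  proof (rule subst_segs_eq[OF D, of "[os, us]"])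
    show "seg D ps \<and> concat (map t1 ps) = concat (map t2 ps)" if "ps \<in> set [os, us]" for ps
      using that os us ne by (auto simp: t1_def t2_def f_def)
    show "sorted_wrt (\<lambda>ps qs. set ps \<inter> set qs = {}) [os, us]" using os us by auto
  next
    fix p assume "p \<in> points D" "\<forall>ps\<in>set [os, us]. p \<notin> set ps"
    then have "cname p \<notin> {c, d, e}" using os(1) us(1) by (cases p) auto
    then show "t1 p = t2 p" by (cases p) (auto simp: t1_def t2_def f_def)
  qed
  moreover have "map (map_endpt f) (strand (del_crossings {c, d} D) b) = concat (map t1 (strand D b))" for b
    unfolding strand_del_subst map_concat by (auto simp: t1_def intro!: arg_cong[of _ _ concat])
  moreover have "strand (del_crossings {d, e} D) b = concat (map t2 (strand D b))" for b
    unfolding strand_del_subst by (auto simp: t2_def intro!: arg_cong[of _ _ concat])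
  ultimately have "iso_by f (del_crossings {c, d} D) (del_crossings {d, e} D)"
    using s ne unfolding iso_by_def crossings_del by (auto simp: f_def inj_on_def)
  then show ?thesis by (auto simp: diag_iso_iff)
qed

lemma red1_confluent:
  assumes D: "D \<in> TD n" and A: "red1 D A" and B: "red1 D B"
  shows "\<exists>A' B'. red1\<^sup>*\<^sup>* A A' \<and> red1\<^sup>*\<^sup>* B B' \<and> diag_iso A' B'"
proof -
  obtain X Y where X: "rdel D X" "A = del_crossings X D" and Y: "rdel D Y" "B = del_crossings Y D"
    using A B by (auto simp: red1_def)
  have disj: ?thesis if "X \<inter> Y = {}"
  proof -
    have "red1 A (del_crossings (X \<union> Y) D)" "red1 B (del_crossings (X \<union> Y) D)"
      using rdel_del[OF Y(1), of X] rdel_del[OF X(1), of Y] that red1I X(2) Y(2)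
      by (metis del_del inf_commute sup_commute)+
    then show ?thesis using diag_iso_refl by blast
  qed
  have mixed: "\<exists>A' B'. red1\<^sup>*\<^sup>* (del_crossings {c} D) A' \<and> red1\<^sup>*\<^sup>* (del_crossings {c, e} D) B' \<and> diag_iso A' B'"
    if "adjacent D (Over c) (Under c)" "c \<noteq> e" "adjacent D (Over c) (Over e)" "adjacent D (Under c) (Under e)" for c e
  proof -
    have "red1 (del_crossings {c} D) (del_crossings {c, e} D)"
      using red1I[OF critical_R1_R2[OF D that]] by (simp add: del_del insert_commute)
    then show ?thesis using diag_iso_refl by blast
  qed
  consider (11) c d where "X = {c}" "Y = {d}" 
    | (12) c d e where "X = {c}" "adjacent D (Over c) (Under c)" "Y = {d, e}" "d \<noteq> e"
        "adjacent D (Over d) (Over e)" "adjacent D (Under d) (Under e)"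
    | (21) c d e where "Y = {c}" "adjacent D (Over c) (Under c)" "X = {d, e}" "d \<noteq> e"
        "adjacent D (Over d) (Over e)" "adjacent D (Under d) (Under e)"
    | (22) c d e g where "X = {c, d}" "Y = {e, g}" "c \<noteq> d" "e \<noteq> g"
        "csign D c = - csign D d" "csign D e = - csign D g"
        "adjacent D (Over c) (Over d)" "adjacent D (Under c) (Under d)"
        "adjacent D (Over e) (Over g)" "adjacent D (Under e) (Under g)"
    using X(1) Y(1) unfolding rdel_def by metis
  then show ?thesis
  proof cases
    case 11
    then show ?thesis using disj X Y diag_iso_refl by (cases "c = d") auto
  next
    case 12
    then consider "c \<notin> {d, e}" | "c = d" | "c = e" by auto
    then show ?thesis
    proof cases
      case 1 then show ?thesis using disj 12 by auto
    next
      case 2 then show ?thesis using mixed[of c e] 12 X(2) Y(2) by simp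
    next
      case 3 then show ?thesis using mixed[of c d] 12 X(2) Y(2) adjacent_sym by (simp add: insert_commute)
    qed
  next
    case 21
    have flip: ?thesis if ex: "\<exists>B' A'. red1\<^sup>*\<^sup>* B B' \<and> red1\<^sup>*\<^sup>* A A' \<and> diag_iso B' A'"
    proof -
      obtain B' A' where *: "red1\<^sup>*\<^sup>* B B'" "red1\<^sup>*\<^sup>* A A'" "diag_iso B' A'" using ex by blast
      have "B \<in> TD n" using Y(2) del_TD[OF D] by simp
      with *(1) have "B' \<in> TD n" by (induction rule: rtranclp_induct) (auto intro: red1_TD)
      then show ?thesis using * diag_iso_sym by blast
    qed
    from 21 consider "c \<notin> {d, e}" | "c = d" | "c = e" by auto
    then show ?thesis
    proof cases
      case 1 then show ?thesis using disj 21 by auto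
    next
      case 2 then show ?thesis using flip mixed[of c e] 21 X(2) Y(2) by simp
    next
      case 3 then show ?thesis using flip mixed[of c d] 21 X(2) Y(2) adjacent_sym by (simp add: insert_commute)
    qed
  next
    case 22
    have tri: "\<exists>A' B'. red1\<^sup>*\<^sup>* (del_crossings {c, d} D) A' \<and> red1\<^sup>*\<^sup>* (del_crossings {d, e} D) B' \<and> diag_iso A' B'"
      if "c \<noteq> d" "d \<noteq> e" "csign D c = - csign D d" "csign D d = - csign D e"
        "adjacent D (Over c) (Over d)" "adjacent D (Under c) (Under d)"
        "adjacent D (Over d) (Over e)" "adjacent D (Under d) (Under e)" for c d e
    proof (cases "c = e")
      case True
      then show ?thesis using diag_iso_refl by (auto simp: insert_commute)
    next
      case False
      then have "diag_iso (del_crossings {c, d} D) (del_crossings {d, e} D)"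
        using that by (intro critical_R2_R2[OF D]) auto
      then show ?thesis by blast
    qed
    note sym = adjacent_sym[THEN iffD1]
    consider "X \<inter> Y = {}" | "d = e" | "d = g" | "c = e" | "c = g" using 22 by auto
    then show ?thesis
    proof cases
      case 1 then show ?thesis using disj by simp
    next
      case 2 then show ?thesis using tri[of c d g] 22 X(2) Y(2) by simp
    next
      case 3 then show ?thesis using tri[of c d e] 22 X(2) Y(2) sym by (simp add: insert_commute)
    next
      case 4 then show ?thesis using tri[of d c g] 22 X(2) Y(2) sym by (simp add: insert_commute)
    next
      case 5 then show ?thesis using tri[of d c e] 22 X(2) Y(2) sym by (simp add: insert_commute)
    qed
  qed
qed

section \<open>Local confluence of glide moves\<close>

lemma gl_gl_eq:
  assumes "\<And>p. p \<in> points D \<Longrightarrow> concat (map t (glide_subst D c1 c2 x y p)) = t' p"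
  shows "concat (map t (strand (gl c1 c2 x y D) a)) = concat (map t' (strand D a))"
  unfolding strand_gl concat_concat_map using assms
  by (intro arg_cong[of _ _ concat] map_cong) (auto simp: points_def)

lemma gl_commute:
  assumes D: "D \<in> TD n" and c: "gl_ok D c1 c2 x y" and d: "gl_ok D d1 d2 u v"
    and cd: "{c1, c2} \<inter> {d1, d2} = {}" and xu: "{x, y} \<inter> {u, v} = {}"
  shows "gl_ok (gl c1 c2 x y D) d1 d2 u v"
    "gl d1 d2 u v (gl c1 c2 x y D) = gl c1 c2 x y (gl d1 d2 u v D)"
proof -
  note c' = gl_ok_crossings[OF D c] and d' = gl_ok_crossings[OF D d]
  have ne: "distinct [c1, c2, d1, d2, x, y, u, v]" "distinct [v, u, y, x, d2, d1, c2, c1]"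
    using c' d' cd xu by auto
  have "seg D [Under d1, Over d2]" using d by (simp add: gl_ok_def)
  from seg_gl[OF this, of c1 c2 x y] have "seg (gl c1 c2 x y D) [Under d1, Over d2]"
    using ne by (simp add: glide_subst_def)
  then show "gl_ok (gl c1 c2 x y D) d1 d2 u v"
    using ne d d' xu by (simp add: gl_ok_def crossings_gl[OF D c])
  show "gl d1 d2 u v (gl c1 c2 x y D) = gl c1 c2 x y (gl d1 d2 u v D)"
  proof (rule vdiag.equality)
    show "csign (gl d1 d2 u v (gl c1 c2 x y D)) = csign (gl c1 c2 x y (gl d1 d2 u v D))"
      using ne by (auto simp: csign_gl fun_eq_iff)
    show "strand (gl d1 d2 u v (gl c1 c2 x y D)) = strand (gl c1 c2 x y (gl d1 d2 u v D))"
    proof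
      fix a
      show "strand (gl d1 d2 u v (gl c1 c2 x y D)) a = strand (gl c1 c2 x y (gl d1 d2 u v D)) a"
        unfolding strand_gl[of d1 _ _ _ "gl _ _ _ _ _"] strand_gl[of c1 _ _ _ "gl _ _ _ _ _"]
          strand_gl[of d1 _ _ _ D]
      proof (subst gl_gl_eq)
        fix p assume p: "p \<in> points D"
        have pxy: "cname p \<notin> {x, y, u, v}" using TD_cname[OF D p] c' d' by auto
        consider "p = Over c1" | "p = Under c1" | "p = Over c2" | "p = Under c2" 
          | "p = Over d1" | "p = Under d1" | "p = Over d2" | "p = Under d2"
          | "cname p \<notin> {c1, c2, d1, d2}" by (cases p) auto
        then show "concat (map (glide_subst (gl c1 c2 x y D) d1 d2 u v) (glide_subst D c1 c2 x y p)) =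
          concat (map (glide_subst (gl d1 d2 u v D) c1 c2 x y) (glide_subst D d1 d2 u v p))"
        proof cases
          case 9
          then show ?thesis using pxy by (cases p) (simp_all add: glide_subst_def)
        qed (use ne in \<open>simp_all add: glide_subst_def csign_gl\<close>)
      qed (simp add: concat_concat_map)
    qed
  qed simp
qed

text \<open>\<open>glide_subst\<close> with the signs as Booleans and without the diagram:
  compositions of several glides can then be evaluated by rewriting, independently of the
  intermediate diagrams.\<close>

definition gs :: "bool \<Rightarrow> bool \<Rightarrow> nat \<Rightarrow> nat \<Rightarrow> nat \<Rightarrow> nat \<Rightarrow> nat endpt \<Rightarrow> nat endpt list" where
  "gs s1 s2 c1 c2 x y p =
     (if p = Over c1 then (if s1 then [Over x, Over c1, Over y] else [Over y, Over c1, Over x])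
      else if p = Under c1 then [Over c2]
      else if p = Over c2 then [Under c1]
      else if p = Under c2 then (if s2 then [Under y, Under c2, Under x] else [Under x, Under c2, Under y])
      else [p])"

lemma glide_subst_gs: "glide_subst D c1 c2 x y = gs (csign D c1 = 1) (csign D c2 = 1) c1 c2 x y"
  by (simp add: fun_eq_iff glide_subst_def gs_def)

lemma gs_simps:
  "gs s1 s2 c1 c2 x y (Over d) =
    (if d = c1 then (if s1 then [Over x, Over c1, Over y] else [Over y, Over c1, Over x])
     else if d = c2 then [Under c1] else [Over d])"
  "gs s1 s2 c1 c2 x y (Under d) =
    (if d = c1 then [Over c2]
     else if d = c2 then (if s2 then [Under y, Under c2, Under x] else [Under x, Under c2, Under y])
     else [Under d])"
  by (auto simp: gs_def)

lemma gs_other: "cname p \<noteq> c1 \<Longrightarrow> cname p \<noteq> c2 \<Longrightarrow> gs s1 s2 c1 c2 x y p = [p]"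
  by (auto simp: gs_def)

lemmas gs_eval = gs_simps if_True if_False simp_thms not_True_eq_False not_False_eq_True
  list.map concat.simps append.simps

text \<open>The essential overlap of two glides: \<open>c2\<close> is the second crossing of one and
  the first of the other. Gliding \<open>c1, c2\<close> first splits off \<open>x, y\<close>, and
  then \<open>x\<close>, \<open>c2\<close>, \<open>y\<close> all pass \<open>c3\<close>; gliding
  \<open>c2, c3\<close> first splits off \<open>u, v\<close>, and then \<open>c1\<close> passes
  \<open>u\<close>, \<open>c2\<close>, \<open>v\<close>. The crossings of the second generation are
  indexed by one of \<open>x, y\<close> and one of \<open>u, v\<close>: \<open>a\<close>,
  \<open>b\<close>, \<open>e\<close>, \<open>f\<close> belong to \<open>x u\<close>,
  \<open>x v\<close>, \<open>y u\<close>, \<open>y v\<close>. This dictates the names in the later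
  glides and makes both results equal.\<close>

lemma glide_chain_pos:
  fixes c1 c2 c3 x y u v a b e f :: nat and s1 s3 :: bool
  assumes ne: "distinct [c1, c2, c3, x, y, u, v, a, b, e, f]" "distinct [f, e, b, a, v, u, y, x, c3, c2, c1]"
  defines "F \<equiv> \<lambda>p. concat (map (gs (\<not> s1) s3 y c3 e f) (concat (map (gs True s3 c2 c3 u v) (concat (map (gs s1 s3 x c3 a b) (gs s1 True c1 c2 x y p))))))"
    and "G \<equiv> \<lambda>p. concat (map (gs s1 (\<not> s3) c1 v b f) (concat (map (gs s1 True c1 c2 x y) (concat (map (gs s1 s3 c1 u a e) (gs True s3 c2 c3 u v p))))))"
  shows "p \<in> {Over c1, Under c3} \<Longrightarrow> F p = G p"
    "concat (map F [Under c1, Over c2]) = concat (map G [Under c1, Over c2])"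
    "concat (map F [Under c2, Over c3]) = concat (map G [Under c2, Over c3])"
    "cname p \<notin> {c1, c2, c3, x, y, u, v, a, b, e, f} \<Longrightarrow> F p = G p"
proof -
  note nes = ne[unfolded distinct.simps list.set insert_iff empty_iff de_Morgan_disj simp_thms]
  show "F p = G p" if "p \<in> {Over c1, Under c3}"
  proof -
    from that consider "p = Over c1" | "p = Under c3" by blast
    then show ?thesis unfolding F_def G_def
      by cases (cases s1; cases s3; hypsubst, simp only: gs_eval nes)+
  qed
  show "concat (map F [Under c1, Over c2]) = concat (map G [Under c1, Over c2])"
    "concat (map F [Under c2, Over c3]) = concat (map G [Under c2, Over c3])"
    unfolding F_def G_def by (cases s1; cases s3; simp only: gs_eval nes)+
  show "F p = G p" if "cname p \<notin> {c1, c2, c3, x, y, u, v, a, b, e, f}"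
    using that unfolding F_def G_def by (simp add: gs_other)
qed

text \<open>For negative \<open>c2\<close> the new points around its over and under points come in
  the opposite order, so \<open>y\<close> passes \<open>c3\<close> before \<open>x\<close>, and
  \<open>c1\<close> passes \<open>v\<close> before \<open>u\<close>.\<close>

lemma glide_chain_neg:
  fixes c1 c2 c3 x y u v a b e f :: nat and s1 s3 :: bool
  assumes ne: "distinct [c1, c2, c3, x, y, u, v, a, b, e, f]" "distinct [f, e, b, a, v, u, y, x, c3, c2, c1]"
  defines "F \<equiv> \<lambda>p. concat (map (gs (\<not> s1) s3 x c3 a b) (concat (map (gs False s3 c2 c3 u v) (concat (map (gs s1 s3 y c3 e f) (gs s1 False c1 c2 x y p))))))"
    and "G \<equiv> \<lambda>p. concat (map (gs s1 (\<not> s3) c1 u a e) (concat (map (gs s1 False c1 c2 x y) (concat (map (gs s1 s3 c1 v b f) (gs False s3 c2 c3 u v p))))))"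
  shows "p \<in> {Over c1, Under c3} \<Longrightarrow> F p = G p"
    "concat (map F [Under c1, Over c2]) = concat (map G [Under c1, Over c2])"
    "concat (map F [Under c2, Over c3]) = concat (map G [Under c2, Over c3])"
    "cname p \<notin> {c1, c2, c3, x, y, u, v, a, b, e, f} \<Longrightarrow> F p = G p"
proof -
  note nes = ne[unfolded distinct.simps list.set insert_iff empty_iff de_Morgan_disj simp_thms]
  show "F p = G p" if "p \<in> {Over c1, Under c3}"
  proof -
    from that consider "p = Over c1" | "p = Under c3" by blast
    then show ?thesis unfolding F_def G_def
      by cases (cases s1; cases s3; hypsubst, simp only: gs_eval nes)+
  qed
  show "concat (map F [Under c1, Over c2]) = concat (map G [Under c1, Over c2])"
    "concat (map F [Under c2, Over c3]) = concat (map G [Under c2, Over c3])"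
    unfolding F_def G_def by (cases s1; cases s3; simp only: gs_eval nes)+
  show "F p = G p" if "cname p \<notin> {c1, c2, c3, x, y, u, v, a, b, e, f}"
    using that unfolding F_def G_def by (simp add: gs_other)
qed

text \<open>All fresh names are prescribed so that both sequences of four glides end in literally
  the same diagram. The sign of \<open>c2\<close> decides the order of the later glides.\<close>

lemma gl_chain:
  assumes D: "D \<in> TD n" and 12: "gl_ok D c1 c2 x y" and 23: "gl_ok D c2 c3 u v" and 13: "c1 \<noteq> c3"
    and fresh: "{a, b, e, f} \<inter> crossings D = {}" and dis: "distinct [x, y, u, v, a, b, e, f]"
  shows "\<exists>E. glide\<^sup>*\<^sup>* (gl c1 c2 x y D) E \<and> glide\<^sup>*\<^sup>* (gl c2 c3 u v D) E"
proof -
  note c12 = gl_ok_crossings[OF D 12] and c23 = gl_ok_crossings[OF D 23]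
  have ne: "distinct [c1, c2, c3, x, y, u, v, a, b, e, f]" "distinct [f, e, b, a, v, u, y, x, c3, c2, c1]"
    using c12 c23 13 fresh dis by auto
  note nes = ne[unfolded distinct.simps list.set insert_iff empty_iff de_Morgan_disj simp_thms]
  have nD: "x \<notin> crossings D" "y \<notin> crossings D" "u \<notin> crossings D" "v \<notin> crossings D"
     "a \<notin> crossings D" "b \<notin> crossings D" "e \<notin> crossings D" "f \<notin> crossings D"
    using c12 c23 fresh by auto
  have s: "csign D c1 = 1 \<or> csign D c1 = -1" "csign D c2 = 1 \<or> csign D c2 = -1" "csign D c3 = 1 \<or> csign D c3 = -1"
    using TD_sign[OF D] c12 c23 by auto
  have sg: "seg D [Under c1, Over c2]" "seg D [Under c2, Over c3]" using 12 23 by (auto simp: gl_ok_def)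
  define A1 where "A1 = gl c1 c2 x y D"
  define B1 where "B1 = gl c2 c3 u v D"
  have A1: "A1 \<in> TD n" "crossings A1 = crossings D \<union> {x, y}" 
    using gl_TD[OF D 12] crossings_gl[OF D 12] by (auto simp: A1_def)
  have B1: "B1 \<in> TD n" "crossings B1 = crossings D \<union> {u, v}" 
    using gl_TD[OF D 23] crossings_gl[OF D 23] by (auto simp: B1_def)
  show ?thesis
  proof (cases "csign D c2 = 1")
    case True
    have sA1: "seg A1 [Under y, Under c2, Under x, Over c3]"
      using seg_gl[OF sg(2), of c1 c2 x y] ne True by (simp add: A1_def glide_subst_def)
    have okA1: "gl_ok A1 x c3 a b"
      using ne nD A1 seg_sub[of A1 "[Under y, Under c2]" "[Under x, Over c3]" "[]"] sA1
      by (simp add: gl_ok_def)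
    define A2 where "A2 = gl x c3 a b A1"
    have A2: "A2 \<in> TD n" "crossings A2 = crossings A1 \<union> {a, b}" 
      using gl_TD[OF A1(1) okA1] crossings_gl[OF A1(1) okA1] by (auto simp: A2_def)
    have sA2: "seg A2 [Under y, Under c2, Over c3, Under x]"
      using seg_gl[OF sA1, of x c3 a b] ne by (simp add: A2_def glide_subst_def)
    have okA2: "gl_ok A2 c2 c3 u v"
      using ne nD A1 A2 seg_sub[of A2 "[Under y]" "[Under c2, Over c3]" "[Under x]"] sA2
      by (simp add: gl_ok_def)
    define A3 where "A3 = gl c2 c3 u v A2"
    have A3: "A3 \<in> TD n" "crossings A3 = crossings A2 \<union> {u, v}" 
      using gl_TD[OF A2(1) okA2] crossings_gl[OF A2(1) okA2] by (auto simp: A3_def)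
    have sA3: "seg A3 [Under y, Over c3, Under c2, Under x]"
      using seg_gl[OF sA2, of c2 c3 u v] ne by (simp add: A3_def glide_subst_def)
    have okA3: "gl_ok A3 y c3 e f"
      using ne nD A1 A2 A3 seg_sub[of A3 "[]" "[Under y, Over c3]" "[Under c2, Under x]"] sA3
      by (simp add: gl_ok_def)
    define A4 where "A4 = gl y c3 e f A3"
    have sB1: "seg B1 [Under c1, Over u, Over c2, Over v]"
      using seg_gl[OF sg(1), of c2 c3 u v] ne True by (simp add: B1_def glide_subst_def)
    have okB1: "gl_ok B1 c1 u a e"
      using ne nD B1 seg_sub[of B1 "[]" "[Under c1, Over u]" "[Over c2, Over v]"] sB1
      by (simp add: gl_ok_def)
    define B2 where "B2 = gl c1 u a e B1"
    have B2: "B2 \<in> TD n" "crossings B2 = crossings B1 \<union> {a, e}" 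
      using gl_TD[OF B1(1) okB1] crossings_gl[OF B1(1) okB1] by (auto simp: B2_def)
    have sB2: "seg B2 [Over u, Under c1, Over c2, Over v]"
      using seg_gl[OF sB1, of c1 u a e] ne by (simp add: B2_def glide_subst_def)
    have okB2: "gl_ok B2 c1 c2 x y"
      using ne nD B1 B2 seg_sub[of B2 "[Over u]" "[Under c1, Over c2]" "[Over v]"] sB2
      by (simp add: gl_ok_def)
    define B3 where "B3 = gl c1 c2 x y B2"
    have B3: "B3 \<in> TD n" "crossings B3 = crossings B2 \<union> {x, y}" 
      using gl_TD[OF B2(1) okB2] crossings_gl[OF B2(1) okB2] by (auto simp: B3_def)
    have sB3: "seg B3 [Over u, Over c2, Under c1, Over v]"
      using seg_gl[OF sB2, of c1 c2 x y] ne by (simp add: B3_def glide_subst_def)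
    have okB3: "gl_ok B3 c1 v b f"
      using ne nD B1 B2 B3 seg_sub[of B3 "[Over u, Over c2]" "[Under c1, Over v]" "[]"] sB3
      by (simp add: gl_ok_def)
    define B4 where "B4 = gl c1 v b f B3"
    note defs = A1_def A2_def A3_def A4_def B1_def B2_def B3_def B4_def
    have csA: "csign A1 = (csign D)(x := csign D c1 * csign D c2, y := - csign D c1 * csign D c2)"
      "csign A2 = (csign A1)(a := csign A1 x * csign A1 c3, b := - csign A1 x * csign A1 c3)"
      "csign A3 = (csign A2)(u := csign A2 c2 * csign A2 c3, v := - csign A2 c2 * csign A2 c3)"
      "csign A4 = (csign A3)(e := csign A3 y * csign A3 c3, f := - csign A3 y * csign A3 c3)"
      by (simp_all add: defs csign_gl)
    have csB: "csign B1 = (csign D)(u := csign D c2 * csign D c3, v := - csign D c2 * csign D c3)"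
      "csign B2 = (csign B1)(a := csign B1 c1 * csign B1 u, e := - csign B1 c1 * csign B1 u)"
      "csign B3 = (csign B2)(x := csign B2 c1 * csign B2 c2, y := - csign B2 c1 * csign B2 c2)"
      "csign B4 = (csign B3)(b := csign B3 c1 * csign B3 v, f := - csign B3 c1 * csign B3 v)"
      by (simp_all add: defs csign_gl)
    have sgA: "csign A1 x = csign D c1 * csign D c2 * 1" "csign A1 c3 = csign D c3"
      "csign A2 c2 = csign D c2" "csign A2 c3 = csign D c3"
      "csign A3 y = csign D c1 * csign D c2 * (-1)" "csign A3 c3 = csign D c3"
      "csign B1 c1 = csign D c1" "csign B1 u = csign D c2 * csign D c3 * 1"
      "csign B2 c1 = csign D c1" "csign B2 c2 = csign D c2"
      "csign B3 c1 = csign D c1" "csign B3 v = csign D c2 * csign D c3 * (-1)"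
      using ne by (simp_all add: csA csB)
    have "A4 = B4"
    proof (rule vdiag.equality)
      show "csign A4 = csign B4"
        using ne by (auto simp: csA csB fun_eq_iff algebra_simps)
      show "strand A4 = strand B4"
      proof
        fix i
        have stA1: "strand A1 i = concat (map (gs (csign D c1 = 1) (csign D c2 = 1) c1 c2 x y) (strand D i))"
          by (subst A1_def) (simp only: strand_gl glide_subst_gs)
        have stA2: "strand A2 i = concat (map (gs (csign A1 x = 1) (csign A1 c3 = 1) x c3 a b) (strand A1 i))"
          by (subst A2_def) (simp only: strand_gl glide_subst_gs)
        have stA3: "strand A3 i = concat (map (gs (csign A2 c2 = 1) (csign A2 c3 = 1) c2 c3 u v) (strand A2 i))"
          by (subst A3_def) (simp only: strand_gl glide_subst_gs)
        have stA4: "strand A4 i = concat (map (gs (csign A3 y = 1) (csign A3 c3 = 1) y c3 e f) (strand A3 i))"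
          by (subst A4_def) (simp only: strand_gl glide_subst_gs)
        note stA = stA1 stA2 stA3 stA4
        have stB1: "strand B1 i = concat (map (gs (csign D c2 = 1) (csign D c3 = 1) c2 c3 u v) (strand D i))"
          by (subst B1_def) (simp only: strand_gl glide_subst_gs)
        have stB2: "strand B2 i = concat (map (gs (csign B1 c1 = 1) (csign B1 u = 1) c1 u a e) (strand B1 i))"
          by (subst B2_def) (simp only: strand_gl glide_subst_gs)
        have stB3: "strand B3 i = concat (map (gs (csign B2 c1 = 1) (csign B2 c2 = 1) c1 c2 x y) (strand B2 i))"
          by (subst B3_def) (simp only: strand_gl glide_subst_gs)
        have stB4: "strand B4 i = concat (map (gs (csign B3 c1 = 1) (csign B3 v = 1) c1 v b f) (strand B3 i))"
          by (subst B4_def) (simp only: strand_gl glide_subst_gs)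
        note stB = stB1 stB2 stB3 stB4
        have sgn: "(csign D c2 = 1) = True"
          "(csign A1 x = 1) = (csign D c1 = 1)" "(csign A1 c3 = 1) = (csign D c3 = 1)"
          "(csign A2 c2 = 1) = True" "(csign A2 c3 = 1) = (csign D c3 = 1)"
          "(csign A3 y = 1) = (\<not> csign D c1 = 1)" "(csign A3 c3 = 1) = (csign D c3 = 1)"
          "(csign B1 c1 = 1) = (csign D c1 = 1)" "(csign B1 u = 1) = (csign D c3 = 1)"
          "(csign B2 c1 = 1) = (csign D c1 = 1)" "(csign B2 c2 = 1) = True"
          "(csign B3 c1 = 1) = (csign D c1 = 1)" "(csign B3 v = 1) = (\<not> csign D c3 = 1)"
          using s True by (auto simp: sgA)
        let ?F = "\<lambda>p. concat (map (gs (\<not> (csign D c1 = 1)) (csign D c3 = 1) y c3 e f) (concat (map (gs True (csign D c3 = 1) c2 c3 u v) (concat (map (gs (csign D c1 = 1) (csign D c3 = 1) x c3 a b) (gs (csign D c1 = 1) True c1 c2 x y p))))))"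
        let ?G = "\<lambda>p. concat (map (gs (csign D c1 = 1) (\<not> (csign D c3 = 1)) c1 v b f) (concat (map (gs (csign D c1 = 1) True c1 c2 x y) (concat (map (gs (csign D c1 = 1) (csign D c3 = 1) c1 u a e) (gs True (csign D c3 = 1) c2 c3 u v p))))))"
        note ch = glide_chain_pos[OF ne, where ?s1.0 = "csign D c1 = 1" and ?s3.0 = "csign D c3 = 1"]
        have "strand A4 i = concat (map ?F (strand D i))"
          by (simp only: stA sgn concat_concat_map)
        moreover have "concat (map ?F (strand D i)) = concat (map ?G (strand D i))"
        proof (rule subst_segs_eq[OF D, of "[[Under c1, Over c2], [Under c2, Over c3]]"])
          fix ps assume "ps \<in> set [[Under c1, Over c2], [Under c2, Over c3]]"
          then show "seg D ps \<and> concat (map ?F ps) = concat (map ?G ps)"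
            using sg ch(2,3) by auto
        next
          fix p assume p: "p \<in> points D" "\<forall>ps\<in>set [[Under c1, Over c2], [Under c2, Over c3]]. p \<notin> set ps"
          have "cname p \<notin> {x, y, u, v, a, b, e, f}" using TD_cname[OF D p(1)] nD by auto
          moreover have "p \<notin> {Under c1, Over c2, Under c2, Over c3}" using p(2) by auto
          ultimately have "p \<in> {Over c1, Under c3} \<or> cname p \<notin> {c1, c2, c3, x, y, u, v, a, b, e, f}"
            by (cases p) auto
          then show "?F p = ?G p" using ch(1,4) by blast
        qed (use ne in auto)
        moreover have "strand B4 i = concat (map ?G (strand D i))"
          by (simp only: stB sgn concat_concat_map)
        ultimately show "strand A4 i = strand B4 i" by simp
      qed
    qed simp
    moreover have "glide\<^sup>*\<^sup>* A1 A4" "glide\<^sup>*\<^sup>* B1 B4"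
      using okA1 okA2 okA3 okB1 okB2 okB3 unfolding A4_def A3_def A2_def B4_def B3_def B2_def
      by (meson converse_rtranclp_into_rtranclp glide_iff rtranclp.rtrancl_refl)+
    ultimately show ?thesis unfolding A1_def B1_def by metis
  next
    case False
    have sA1: "seg A1 [Under x, Under c2, Under y, Over c3]"
      using seg_gl[OF sg(2), of c1 c2 x y] ne False by (simp add: A1_def glide_subst_def)
    have okA1: "gl_ok A1 y c3 e f"
      using ne nD A1 seg_sub[of A1 "[Under x, Under c2]" "[Under y, Over c3]" "[]"] sA1
      by (simp add: gl_ok_def)
    define A2 where "A2 = gl y c3 e f A1"
    have A2: "A2 \<in> TD n" "crossings A2 = crossings A1 \<union> {e, f}" 
      using gl_TD[OF A1(1) okA1] crossings_gl[OF A1(1) okA1] by (auto simp: A2_def)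
    have sA2: "seg A2 [Under x, Under c2, Over c3, Under y]"
      using seg_gl[OF sA1, of y c3 e f] ne by (simp add: A2_def glide_subst_def)
    have okA2: "gl_ok A2 c2 c3 u v"
      using ne nD A1 A2 seg_sub[of A2 "[Under x]" "[Under c2, Over c3]" "[Under y]"] sA2
      by (simp add: gl_ok_def)
    define A3 where "A3 = gl c2 c3 u v A2"
    have A3: "A3 \<in> TD n" "crossings A3 = crossings A2 \<union> {u, v}" 
      using gl_TD[OF A2(1) okA2] crossings_gl[OF A2(1) okA2] by (auto simp: A3_def)
    have sA3: "seg A3 [Under x, Over c3, Under c2, Under y]"
      using seg_gl[OF sA2, of c2 c3 u v] ne by (simp add: A3_def glide_subst_def)
    have okA3: "gl_ok A3 x c3 a b"
      using ne nD A1 A2 A3 seg_sub[of A3 "[]" "[Under x, Over c3]" "[Under c2, Under y]"] sA3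
      by (simp add: gl_ok_def)
    define A4 where "A4 = gl x c3 a b A3"
    have sB1: "seg B1 [Under c1, Over v, Over c2, Over u]"
      using seg_gl[OF sg(1), of c2 c3 u v] ne False by (simp add: B1_def glide_subst_def)
    have okB1: "gl_ok B1 c1 v b f"
      using ne nD B1 seg_sub[of B1 "[]" "[Under c1, Over v]" "[Over c2, Over u]"] sB1
      by (simp add: gl_ok_def)
    define B2 where "B2 = gl c1 v b f B1"
    have B2: "B2 \<in> TD n" "crossings B2 = crossings B1 \<union> {b, f}" 
      using gl_TD[OF B1(1) okB1] crossings_gl[OF B1(1) okB1] by (auto simp: B2_def)
    have sB2: "seg B2 [Over v, Under c1, Over c2, Over u]"
      using seg_gl[OF sB1, of c1 v b f] ne by (simp add: B2_def glide_subst_def)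
    have okB2: "gl_ok B2 c1 c2 x y"
      using ne nD B1 B2 seg_sub[of B2 "[Over v]" "[Under c1, Over c2]" "[Over u]"] sB2
      by (simp add: gl_ok_def)
    define B3 where "B3 = gl c1 c2 x y B2"
    have B3: "B3 \<in> TD n" "crossings B3 = crossings B2 \<union> {x, y}" 
      using gl_TD[OF B2(1) okB2] crossings_gl[OF B2(1) okB2] by (auto simp: B3_def)
    have sB3: "seg B3 [Over v, Over c2, Under c1, Over u]"
      using seg_gl[OF sB2, of c1 c2 x y] ne by (simp add: B3_def glide_subst_def)
    have okB3: "gl_ok B3 c1 u a e"
      using ne nD B1 B2 B3 seg_sub[of B3 "[Over v, Over c2]" "[Under c1, Over u]" "[]"] sB3
      by (simp add: gl_ok_def)
    define B4 where "B4 = gl c1 u a e B3"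
    note defs = A1_def A2_def A3_def A4_def B1_def B2_def B3_def B4_def
    have csA: "csign A1 = (csign D)(x := csign D c1 * csign D c2, y := - csign D c1 * csign D c2)"
      "csign A2 = (csign A1)(e := csign A1 y * csign A1 c3, f := - csign A1 y * csign A1 c3)"
      "csign A3 = (csign A2)(u := csign A2 c2 * csign A2 c3, v := - csign A2 c2 * csign A2 c3)"
      "csign A4 = (csign A3)(a := csign A3 x * csign A3 c3, b := - csign A3 x * csign A3 c3)"
      by (simp_all add: defs csign_gl)
    have csB: "csign B1 = (csign D)(u := csign D c2 * csign D c3, v := - csign D c2 * csign D c3)"
      "csign B2 = (csign B1)(b := csign B1 c1 * csign B1 v, f := - csign B1 c1 * csign B1 v)"
      "csign B3 = (csign B2)(x := csign B2 c1 * csign B2 c2, y := - csign B2 c1 * csign B2 c2)"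
      "csign B4 = (csign B3)(a := csign B3 c1 * csign B3 u, e := - csign B3 c1 * csign B3 u)"
      by (simp_all add: defs csign_gl)
    have sgA: "csign A1 y = csign D c1 * csign D c2 * (-1)" "csign A1 c3 = csign D c3"
      "csign A2 c2 = csign D c2" "csign A2 c3 = csign D c3"
      "csign A3 x = csign D c1 * csign D c2 * 1" "csign A3 c3 = csign D c3"
      "csign B1 c1 = csign D c1" "csign B1 v = csign D c2 * csign D c3 * (-1)"
      "csign B2 c1 = csign D c1" "csign B2 c2 = csign D c2"
      "csign B3 c1 = csign D c1" "csign B3 u = csign D c2 * csign D c3 * 1"
      using ne by (simp_all add: csA csB)
    have "A4 = B4"
    proof (rule vdiag.equality)
      show "csign A4 = csign B4"
        using ne by (auto simp: csA csB fun_eq_iff algebra_simps)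
      show "strand A4 = strand B4"
      proof
        fix i
        have stA1: "strand A1 i = concat (map (gs (csign D c1 = 1) (csign D c2 = 1) c1 c2 x y) (strand D i))"
          by (subst A1_def) (simp only: strand_gl glide_subst_gs)
        have stA2: "strand A2 i = concat (map (gs (csign A1 y = 1) (csign A1 c3 = 1) y c3 e f) (strand A1 i))"
          by (subst A2_def) (simp only: strand_gl glide_subst_gs)
        have stA3: "strand A3 i = concat (map (gs (csign A2 c2 = 1) (csign A2 c3 = 1) c2 c3 u v) (strand A2 i))"
          by (subst A3_def) (simp only: strand_gl glide_subst_gs)
        have stA4: "strand A4 i = concat (map (gs (csign A3 x = 1) (csign A3 c3 = 1) x c3 a b) (strand A3 i))"
          by (subst A4_def) (simp only: strand_gl glide_subst_gs)
        note stA = stA1 stA2 stA3 stA4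
        have stB1: "strand B1 i = concat (map (gs (csign D c2 = 1) (csign D c3 = 1) c2 c3 u v) (strand D i))"
          by (subst B1_def) (simp only: strand_gl glide_subst_gs)
        have stB2: "strand B2 i = concat (map (gs (csign B1 c1 = 1) (csign B1 v = 1) c1 v b f) (strand B1 i))"
          by (subst B2_def) (simp only: strand_gl glide_subst_gs)
        have stB3: "strand B3 i = concat (map (gs (csign B2 c1 = 1) (csign B2 c2 = 1) c1 c2 x y) (strand B2 i))"
          by (subst B3_def) (simp only: strand_gl glide_subst_gs)
        have stB4: "strand B4 i = concat (map (gs (csign B3 c1 = 1) (csign B3 u = 1) c1 u a e) (strand B3 i))"
          by (subst B4_def) (simp only: strand_gl glide_subst_gs)
        note stB = stB1 stB2 stB3 stB4
        have sgn: "(csign D c2 = 1) = False"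
          "(csign A1 y = 1) = (csign D c1 = 1)" "(csign A1 c3 = 1) = (csign D c3 = 1)"
          "(csign A2 c2 = 1) = False" "(csign A2 c3 = 1) = (csign D c3 = 1)"
          "(csign A3 x = 1) = (\<not> csign D c1 = 1)" "(csign A3 c3 = 1) = (csign D c3 = 1)"
          "(csign B1 c1 = 1) = (csign D c1 = 1)" "(csign B1 v = 1) = (csign D c3 = 1)"
          "(csign B2 c1 = 1) = (csign D c1 = 1)" "(csign B2 c2 = 1) = False"
          "(csign B3 c1 = 1) = (csign D c1 = 1)" "(csign B3 u = 1) = (\<not> csign D c3 = 1)"
          using s False by (auto simp: sgA)
        let ?F = "\<lambda>p. concat (map (gs (\<not> (csign D c1 = 1)) (csign D c3 = 1) x c3 a b) (concat (map (gs False (csign D c3 = 1) c2 c3 u v) (concat (map (gs (csign D c1 = 1) (csign D c3 = 1) y c3 e f) (gs (csign D c1 = 1) False c1 c2 x y p))))))"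
        let ?G = "\<lambda>p. concat (map (gs (csign D c1 = 1) (\<not> (csign D c3 = 1)) c1 u a e) (concat (map (gs (csign D c1 = 1) False c1 c2 x y) (concat (map (gs (csign D c1 = 1) (csign D c3 = 1) c1 v b f) (gs False (csign D c3 = 1) c2 c3 u v p))))))"
        note ch = glide_chain_neg[OF ne, where ?s1.0 = "csign D c1 = 1" and ?s3.0 = "csign D c3 = 1"]
        have "strand A4 i = concat (map ?F (strand D i))"
          by (simp only: stA sgn concat_concat_map)
        moreover have "concat (map ?F (strand D i)) = concat (map ?G (strand D i))"
        proof (rule subst_segs_eq[OF D, of "[[Under c1, Over c2], [Under c2, Over c3]]"])
          fix ps assume "ps \<in> set [[Under c1, Over c2], [Under c2, Over c3]]"
          then show "seg D ps \<and> concat (map ?F ps) = concat (map ?G ps)"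
            using sg ch(2,3) by auto
        next
          fix p assume p: "p \<in> points D" "\<forall>ps\<in>set [[Under c1, Over c2], [Under c2, Over c3]]. p \<notin> set ps"
          have "cname p \<notin> {x, y, u, v, a, b, e, f}" using TD_cname[OF D p(1)] nD by auto
          moreover have "p \<notin> {Under c1, Over c2, Under c2, Over c3}" using p(2) by auto
          ultimately have "p \<in> {Over c1, Under c3} \<or> cname p \<notin> {c1, c2, c3, x, y, u, v, a, b, e, f}"
            by (cases p) auto
          then show "?F p = ?G p" using ch(1,4) by blast
        qed (use ne in auto)
        moreover have "strand B4 i = concat (map ?G (strand D i))"
          by (simp only: stB sgn concat_concat_map)
        ultimately show "strand A4 i = strand B4 i" by simp
      qed
    qed simp
    moreover have "glide\<^sup>*\<^sup>* A1 A4" "glide\<^sup>*\<^sup>* B1 B4"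
      using okA1 okA2 okA3 okB1 okB2 okB3 unfolding A4_def A3_def A2_def B4_def B3_def B2_def
      by (meson converse_rtranclp_into_rtranclp glide_iff rtranclp.rtrancl_refl)+
    ultimately show ?thesis unfolding A1_def B1_def by metis
  qed
qed

interpretation glide: iso_rewriting n "AC n" glide weight for n
  by unfold_locales (auto intro: AC_TD iso_AC glide_AC weight_glide glide_iso dest: AC_TD)

interpretation red: iso_rewriting n "TD n" red1 crossing_number for n
proof
  fix D D' assume D: "D \<in> TD n" and "red1 D D'"
  then obtain C where C: "rdel D C" "D' = del_crossings C D" by (auto simp: red1_def)
  show "crossing_number D' < crossing_number D"
    unfolding crossing_number_def C(2) crossings_del
    using rdel_crossings[OF D C(1)] finite_crossings[OF D] by (intro psubset_card_mono) auto
qed (auto intro: iso_TD red1_TD red1_iso)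

lemma finite_fresh: "finite A \<Longrightarrow> \<exists>B :: nat list. distinct B \<and> length B = k \<and> set B \<inter> A = {}"
proof (induction k)
  case (Suc k)
  then obtain B where B: "distinct B" "length B = k" "set B \<inter> A = {}" by blast
  obtain x where "x \<notin> A \<union> set B" using Suc.prems ex_new_if_finite[OF infinite_UNIV_nat, of "A \<union> set B"] by auto
  then show ?case using B by (intro exI[of _ "x # B"]) auto
qed simp

text \<open>Both glides are first renamed to use names disjoint from each other and from the
  auxiliary \<open>a, b, e, f\<close>; then they are joined at a common diagram, and the join is
  carried back along the renamings.\<close>

lemma glide_confluent:
  assumes D: "D \<in> AC n" and A: "glide D A" and B: "glide D B"
  shows "\<exists>A' B'. glide\<^sup>*\<^sup>* A A' \<and> glide\<^sup>*\<^sup>* B B' \<and> diag_iso A' B'"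
proof -
  have T: "D \<in> TD n" by (rule AC_TD[OF D])
  obtain h where h: "ranked D h" using D by (auto simp: AC_iff)
  obtain c1 c2 x0 y0 where c0: "gl_ok D c1 c2 x0 y0" "A = gl c1 c2 x0 y0 D" using A by (auto simp: glide_iff)
  obtain d1 d2 u0 v0 where d0: "gl_ok D d1 d2 u0 v0" "B = gl d1 d2 u0 v0 D" using B by (auto simp: glide_iff)
  obtain L where L: "distinct L" "length L = 8" "set L \<inter> crossings D = {}"
    using finite_fresh[OF finite_crossings[OF T]] by blast
  then obtain x y u v a b e f where L': "L = [x, y, u, v, a, b, e, f]"
    by (auto simp: numeral_eq_Suc length_Suc_conv)
  have c: "gl_ok D c1 c2 x y" and d: "gl_ok D d1 d2 u v"
    using c0(1) d0(1) L unfolding L' by (auto simp: gl_ok_def)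
  have AC: "gl c1 c2 x y D \<in> AC n" "gl d1 d2 u v D \<in> AC n" "A \<in> AC n" "B \<in> AC n"
    by (rule glide_AC[OF D], use c d A B in \<open>auto simp: glide_iff\<close>)+
  have isoA: "diag_iso (gl c1 c2 x y D) A" and isoB: "diag_iso (gl d1 d2 u v D) B"
    using gl_rename[OF T] c d c0 d0 by auto
  have transfer: ?thesis
    if E: "glide\<^sup>*\<^sup>* (gl c1 c2 x y D) E" "glide\<^sup>*\<^sup>* (gl d1 d2 u v D) E" for E
  proof -
    obtain A' where A': "glide\<^sup>*\<^sup>* A A'" "diag_iso E A'" using glide.compat_steps[OF E(1) AC(1) isoA] by blast
    obtain B' where B': "glide\<^sup>*\<^sup>* B B'" "diag_iso E B'" using glide.compat_steps[OF E(2) AC(2) isoB] by blast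
    have "diag_iso A' E" using diag_iso_sym[OF _ A'(2)] AC_TD[OF glide.S_steps[OF E(1) AC(1)]] by blast
    then show ?thesis using A' B' diag_iso_trans by blast
  qed
  have sg: "seg D [Under c1, Over c2]" "seg D [Under d1, Over d2]" using c d by (auto simp: gl_ok_def)
  note cc = gl_ok_crossings[OF T c] and dd = gl_ok_crossings[OF T d]
  have hc: "h (Over c) < h (Under c)" if "c \<in> crossings D" for c using h that by (auto simp: ranked_def)
  have h12: "h (Under c1) < h (Over c2)" "h (Under d1) < h (Over d2)" using ranked_seg[OF h] sg by auto
  consider "c1 = d1" | "c2 = d2" | "c2 = d1" "c1 \<noteq> d2" | "c1 = d2" "c2 \<noteq> d1" | "c1 = d2" "c2 = d1"
    | "{c1, c2} \<inter> {d1, d2} = {}" by blast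
  then show ?thesis
  proof cases
    case 1
    then have "d2 = c2" using seg_right_unique[OF T] sg by blast
    then have "diag_iso A B" using gl_rename[OF T c0(1)] d0 1 c0 by simp
    then show ?thesis by blast
  next
    case 2
    then have "d1 = c1" using seg_left_unique[OF T] sg by blast
    then have "diag_iso A B" using gl_rename[OF T c0(1)] d0 2 c0 by simp
    then show ?thesis by blast
  next
    case 3
    obtain E where "glide\<^sup>*\<^sup>* (gl c1 c2 x y D) E" "glide\<^sup>*\<^sup>* (gl c2 d2 u v D) E"
      using gl_chain[OF T c, of d2 u v a b e f] d 3 L unfolding L' by auto
    then show ?thesis using transfer 3 by simp
  next
    case 4
    obtain E where "glide\<^sup>*\<^sup>* (gl d1 d2 u v D) E" "glide\<^sup>*\<^sup>* (gl d2 c2 x y D) E"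
      using gl_chain[OF T d, of c2 x y a b e f] c 4 L unfolding L' by auto
    then show ?thesis using transfer 4 by simp
  next
    \<comment> \<open>Two crossings that each glide through the other would close a cascade
      path.\<close>
    case 5
    then show ?thesis using h12 hc[OF cc(1)] hc[OF cc(2)] by simp
  next
    case 6
    have xu: "{x, y} \<inter> {u, v} = {}" using L unfolding L' by auto
    then have ux: "{u, v} \<inter> {x, y} = {}" by blast
    have dc: "{d1, d2} \<inter> {c1, c2} = {}" using 6 by blast
    have "glide (gl c1 c2 x y D) (gl d1 d2 u v (gl c1 c2 x y D))"
      "glide (gl d1 d2 u v D) (gl d1 d2 u v (gl c1 c2 x y D))"
      using gl_commute[OF T c d 6 xu] gl_commute(1)[OF T d c dc ux] unfolding glide_iff by metis+
    then show ?thesis using transfer by blast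
  qed
qed

section \<open>Local confluence of glides with R1 and R2 removals\<close>

definition cstep :: "vdiag \<Rightarrow> vdiag \<Rightarrow> bool" where
  "cstep D D' \<longleftrightarrow> glide D D' \<or> red1 D D'"

interpretation cstep: iso_rewriting n "AC n" cstep weight for n
proof
  fix D E D' assume "D \<in> AC n" "diag_iso D E" "cstep D D'"
  then show "\<exists>E'. cstep E E' \<and> diag_iso D' E'"
    using glide_iso[OF AC_TD] red1_iso[OF AC_TD] unfolding cstep_def by blast
qed (auto simp: cstep_def intro: AC_TD iso_AC glide_AC red1_AC weight_glide weight_red1)

lemma red1_cstep: "red1\<^sup>*\<^sup>* D E \<Longrightarrow> cstep\<^sup>*\<^sup>* D E"
  by (erule mono_rtranclp[rule_format, rotated]) (simp add: cstep_def)

lemma glide_cstep: "glide\<^sup>*\<^sup>* D E \<Longrightarrow> cstep\<^sup>*\<^sup>* D E"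
  by (erule mono_rtranclp[rule_format, rotated]) (simp add: cstep_def)

lemma R2_rdel: "adjacent D (Over c) (Over d) \<Longrightarrow> adjacent D (Under c) (Under d) \<Longrightarrow>
    csign D c = - csign D d \<Longrightarrow> c \<noteq> d \<Longrightarrow> rdel D {c, d}"
  unfolding rdel_def by blast

lemma adjacent_seg_del:
  "seg D ps \<Longrightarrow> filter (\<lambda>p. cname p \<notin> X) ps = xs @ p # q # ys \<Longrightarrow> adjacent (del_crossings X D) p q"
  using seg_del[of D ps X] seg_sub[of "del_crossings X D" xs "[p, q]" ys] by (simp add: adjacent_seg)

text \<open>On the \<open>P\<close> side the pairs are nested with \<open>p, p'\<close> innermost
  and have to be removed from the inside; on the \<open>Q\<close> side each pair is adjacent from
  the start.\<close>

lemma three_R2: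
  assumes dis: "distinct [p, p', c, d, q, q']"
    and s: "csign A p = - csign A p'" "csign A c = - csign A d" "csign A q = - csign A q'"
    and PQ: "(P, Q) \<in> {(Over, Under), (Under, Over)}"
    and P: "seg A [P q, P c, P p, P p', P d, P q'] \<or> seg A [P q', P d, P p', P p, P c, P q]"
    and Q: "adjacent A (Q p) (Q p')" "adjacent A (Q c) (Q d)" "adjacent A (Q q) (Q q')"
  shows "red1\<^sup>*\<^sup>* A (del_crossings {p, p', c, d, q, q'} A)"
proof -
  have R2: "red1 B (del_crossings {c, d} B)" if "adjacent B (P c) (P d)" "adjacent B (Q c) (Q d)"
    "csign B c = - csign B d" "c \<noteq> d" for B c d
    using that PQ by (intro red1I R2_rdel) auto
  have n: "cname (P c) = c" "cname (Q c) = c" for c using PQ by auto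
  have 1: "adjacent A (P p) (P p')"
    using P seg_sub[of A "[P q, P c]" "[P p, P p']"  "[P d, P q']"]
       seg_sub[of A "[P q', P d]" "[P p', P p]"  "[P c, P q]"] by (auto simp: adjacent_seg)
  have 2: "adjacent (del_crossings {p, p'} A) (P c) (P d)"
    using P
  proof
    assume "seg A [P q, P c, P p, P p', P d, P q']"
    then show ?thesis by (rule adjacent_seg_del[of _ _ _ "[P q]" _ _ "[P q']"]) (use dis n in auto)
  next
    assume "seg A [P q', P d, P p', P p, P c, P q]"
    then have "adjacent (del_crossings {p, p'} A) (P d) (P c)"
      by (rule adjacent_seg_del[of _ _ _ "[P q']" _ _ "[P q]"]) (use dis n in auto)
    then show ?thesis by (simp add: adjacent_sym)
  qed
  have 3: "adjacent (del_crossings {p, p', c, d} A) (P q) (P q')"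
    using P
  proof
    assume "seg A [P q, P c, P p, P p', P d, P q']"
    then show ?thesis by (rule adjacent_seg_del[of _ _ _ "[]" _ _ "[]"]) (use dis n in auto)
  next
    assume "seg A [P q', P d, P p', P p, P c, P q]"
    then have "adjacent (del_crossings {p, p', c, d} A) (P q') (P q)"
      by (rule adjacent_seg_del[of _ _ _ "[]" _ _ "[]"]) (use dis n in auto)
    then show ?thesis by (simp add: adjacent_sym)
  qed
  have "red1 A (del_crossings {p, p'} A)" using R2[OF 1 Q(1)] s dis by simp
  moreover have "red1 (del_crossings {p, p'} A) (del_crossings {c, d} (del_crossings {p, p'} A))"
    using R2[OF 2 adjacent_del[OF Q(2)]] s dis n by auto
  moreover have "red1 (del_crossings {p, p', c, d} A) (del_crossings {q, q'} (del_crossings {p, p', c, d} A))"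
    using R2[OF 3 adjacent_del[OF Q(3)]] s dis n by auto
  ultimately show ?thesis unfolding del_del
    by (simp add: insert_commute)
qed

lemma strand_del_gl:
  "strand (del_crossings X (gl c1 c2 x y D)) i = concat (map (\<lambda>p. filter (\<lambda>q. cname q \<notin> X)
     (gs (csign D c1 = 1) (csign D c2 = 1) c1 c2 x y p)) (strand D i))"
  by (simp add: strand_del strand_gl filter_concat_map glide_subst_gs)

lemma seg_gs: "seg D ps \<Longrightarrow>
    seg (gl c1 c2 x y D) (concat (map (gs (csign D c1 = 1) (csign D c2 = 1) c1 c2 x y) ps))"
  using seg_gl[of D ps c1 c2 x y] by (simp add: glide_subst_gs)

text \<open>A glide inserts points only beside points of \<open>c1\<close> and \<open>c2\<close>, so
  neighbours that belong to other crossings stay neighbours.\<close>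

lemma glide_del_disjoint:
  assumes D: "D \<in> TD n" and ok: "gl_ok D c1 c2 x y" and C: "rdel D C" and dis: "C \<inter> {c1, c2} = {}"
  shows "gl_ok (del_crossings C D) c1 c2 x y" "rdel (gl c1 c2 x y D) C"
    "gl c1 c2 x y (del_crossings C D) = del_crossings C (gl c1 c2 x y D)"
proof -
  note c = gl_ok_crossings[OF D ok]
  have CD: "C \<subseteq> crossings D" using rdel_crossings[OF D C] by blast
  then have Cxy: "x \<notin> C" "y \<notin> C" using c by auto
  show "gl_ok (del_crossings C D) c1 c2 x y"
    using ok seg_del[of D "[Under c1, Over c2]" C] dis by (auto simp: gl_ok_def crossings_del)
  have adj: "adjacent (gl c1 c2 x y D) p q" if "adjacent D p q" "cname p \<in> C" "cname q \<in> C" for p q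
  proof -
    have "gs s1 s2 c1 c2 x y p = [p]" "gs s1 s2 c1 c2 x y q = [q]" for s1 s2
      using that dis by (auto intro!: gs_other)
    then show ?thesis
      using that(1) seg_gs[of D "[p, q]" c1 c2 x y] seg_gs[of D "[q, p]" c1 c2 x y] by (auto simp: adjacent_seg)
  qed
  have sgn: "csign (gl c1 c2 x y D) c = csign D c" if "c \<in> C" for c
    using that Cxy by (auto simp: csign_gl)
  from C show "rdel (gl c1 c2 x y D) C" unfolding rdel_def
  proof (elim disjE exE conjE)
    fix d assume "C = {d}" "adjacent D (Over d) (Under d)"
    then have "C = {d} \<and> adjacent (gl c1 c2 x y D) (Over d) (Under d)" by (auto intro!: adj)
    then show "(\<exists>c. C = {c} \<and> adjacent (gl c1 c2 x y D) (Over c) (Under c)) \<or> (\<exists>c d. C = {c, d} \<and>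
      c \<noteq> d \<and> csign (gl c1 c2 x y D) c = - csign (gl c1 c2 x y D) d \<and> adjacent (gl c1 c2 x y D) (Over c) (Over d) \<and>
      adjacent (gl c1 c2 x y D) (Under c) (Under d))" by blast
  next
    fix d e assume *: "C = {d, e}" "d \<noteq> e" "csign D d = - csign D e"
      "adjacent D (Over d) (Over e)" "adjacent D (Under d) (Under e)"
    then have "C = {d, e} \<and> d \<noteq> e \<and> csign (gl c1 c2 x y D) d = - csign (gl c1 c2 x y D) e \<and>
      adjacent (gl c1 c2 x y D) (Over d) (Over e) \<and> adjacent (gl c1 c2 x y D) (Under d) (Under e)"
      using sgn by (auto intro!: adj)
    then show "(\<exists>c. C = {c} \<and> adjacent (gl c1 c2 x y D) (Over c) (Under c)) \<or> (\<exists>c d. C = {c, d} \<and>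
      c \<noteq> d \<and> csign (gl c1 c2 x y D) c = - csign (gl c1 c2 x y D) d \<and> adjacent (gl c1 c2 x y D) (Over c) (Over d) \<and>
      adjacent (gl c1 c2 x y D) (Under c) (Under d))" by blast
  qed
  show "gl c1 c2 x y (del_crossings C D) = del_crossings C (gl c1 c2 x y D)"
  proof (rule vdiag.equality)
    show "strand (gl c1 c2 x y (del_crossings C D)) = strand (del_crossings C (gl c1 c2 x y D))"
    proof
      fix i
      have "concat (map (gs s1 s2 c1 c2 x y) (if cname p \<in> C then [] else [p])) =
          filter (\<lambda>q. cname q \<notin> C) (gs s1 s2 c1 c2 x y p)" for s1 s2 p
        using dis Cxy by (cases p) (auto simp: gs_simps)
      then show "strand (gl c1 c2 x y (del_crossings C D)) i = strand (del_crossings C (gl c1 c2 x y D)) i"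
        unfolding strand_del_gl strand_gl strand_del_subst[of C D] csign_del glide_subst_gs concat_concat_map
        by simp
    qed
  qed (simp_all add: csign_gl gl_def)
qed

lemma AC_no_cycle2:
  assumes D: "D \<in> AC n" and "c \<in> crossings D" shows "\<not> seg D (Under c # ps @ [Over c])"
proof
  obtain h where h: "ranked D h" using D by (auto simp: AC_iff)
  assume "seg D (Under c # ps @ [Over c])"
  then obtain a xs ys where "strand D a = xs @ Under c # ps @ Over c # ys" by (auto simp: seg_def)
  then have "h (Under c) < h (Over c)" by (rule ranked_strand_less[OF h])
  then show False using h assms(2) by (auto simp: ranked_def dest!: bspec)
qed

text \<open>After the glide the new crossing \<open>w\<close> between \<open>Over c\<close> and
  \<open>Over c2\<close> has the sign opposite to \<open>c2\<close> and is parallel to it, so the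
  two cancel by R2. Then \<open>c\<close> is a kink again, and \<open>w'\<close> is left in the
  place of the old \<open>c2\<close>.\<close>

lemma critical_glide_R1_over:
  assumes D: "D \<in> TD n" and ok: "gl_ok D c c2 x y" and s1: "seg D [Over c, Under c]"
  shows "\<exists>A'. red1\<^sup>*\<^sup>* (gl c c2 x y D) A' \<and> diag_iso A' (del_crossings {c} D)"
proof -
  let ?A = "gl c c2 x y D"
  note nd = gl_ok_crossings[OF D ok]
  have ne: "distinct [c, c2, x, y]" "distinct [y, x, c2, c]" using nd by auto
  note nes = ne[unfolded distinct.simps list.set insert_iff empty_iff de_Morgan_disj simp_thms]
  have sgn: "csign D c = 1 \<or> csign D c = -1" "csign D c2 = 1 \<or> csign D c2 = -1" using TD_sign[OF D] nd by auto
  define w where "w = (if csign D c = 1 then y else x)"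
  define w' where "w' = (if csign D c = 1 then x else y)"
  have w: "{w, w'} = {x, y}" "w \<noteq> w'" "w \<noteq> c" "w \<noteq> c2" "w' \<noteq> c" "w' \<noteq> c2" "w' \<notin> crossings D"
    using nd by (auto simp: w_def w'_def)
  have sw: "csign ?A w = - csign D c2" "csign ?A w' = csign D c2" "csign ?A c2 = csign D c2"
    using ne sgn by (auto simp: csign_gl w_def w'_def)
  have "seg D [Under c, Over c2]" using ok by (simp add: gl_ok_def)
  from seg_join[OF D s1 this] have sg: "seg D [Over c, Under c, Over c2]" .
  have O: "seg ?A [Over w', Over c, Over w, Over c2, Under c]"
    using seg_gs[OF sg, of c c2 x y] by (simp add: gs_simps nes w_def w'_def split: if_splits)
  have "seg D [Under c2]" using nd points_iff[OF D] by (intro seg_point) simp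
  from seg_gs[OF this, of c c2 x y]
  have U: "seg ?A [Under w, Under c2, Under w'] \<or> seg ?A [Under w', Under c2, Under w]"
    by (auto simp: gs_simps nes w_def w'_def split: if_splits)
  have 1: "rdel ?A {w, c2}"
  proof (rule R2_rdel)
    show "adjacent ?A (Over w) (Over c2)" using seg_sub[of ?A "[Over w', Over c]" _ "[Under c]"] O by (simp add: adjacent_seg)
    show "adjacent ?A (Under w) (Under c2)"
      using U seg_sub[of ?A "[]" "[Under w, Under c2]" "[Under w']"] seg_sub[of ?A "[Under w']" "[Under c2, Under w]" "[]"]
      by (auto simp: adjacent_seg)
    show "csign ?A w = - csign ?A c2" "w \<noteq> c2" using sw w by auto
  qed
  have 2: "rdel (del_crossings {w, c2} ?A) {c}"
    unfolding rdel_def using adjacent_seg_del[OF O, of "{w, c2}" "[Over w']" "Over c" "Under c" "[]"] w nd by auto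
  have red: "red1\<^sup>*\<^sup>* ?A (del_crossings {w, c2, c} ?A)"
    using red1I[OF 1] red1I[OF 2] unfolding del_del by (simp add: insert_commute)
  define f where "f = id(w' := c2)"
  let ?F = "\<lambda>p. map (map_endpt f) (filter (\<lambda>q. cname q \<notin> {w, c2, c}) (gs (csign D c = 1) (csign D c2 = 1) c c2 x y p))"
  let ?G = "\<lambda>p. if cname p \<in> {c} then [] else [p]"
  have "concat (map ?F (strand D i)) = concat (map ?G (strand D i))" for i
  proof (rule subst_seg_eq[OF D sg])
    show "concat (map ?F [Over c, Under c, Over c2]) = concat (map ?G [Over c, Under c, Over c2])"
      using nes by (auto simp: gs_simps w_def w'_def f_def)
    fix p assume p: "p \<in> points D" "p \<notin> set [Over c, Under c, Over c2]"
    then have pc: "cname p \<notin> {x, y}" using TD_cname[OF D p(1)] nd by auto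
    show "?F p = ?G p"
    proof (cases "p = Under c2")
      case True
      then show ?thesis using nes by (auto simp: gs_simps w_def w'_def f_def)
    next
      case False
      then have "cname p \<notin> {c, c2}" using p by (cases p) auto
      then show ?thesis using pc w by (cases p) (auto simp: gs_simps f_def)
    qed
  qed
  then have "strand (del_crossings {c} D) i = map (map_endpt f) (strand (del_crossings {w, c2, c} ?A) i)" for i
    unfolding strand_del_gl strand_del_subst[of "{c}"] map_concat map_map comp_def by simp
  moreover have "crossings (del_crossings {w, c2, c} ?A) = (crossings D - {c, c2}) \<union> {w'}"
    unfolding crossings_del crossings_gl[OF D ok] using w nd by auto
  ultimately have "iso_by f (del_crossings {w, c2, c} ?A) (del_crossings {c} D)"
    unfolding iso_by_def using w sw nd by (auto simp: f_def inj_on_def csign_gl)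
  then show ?thesis using red by (auto simp: diag_iso_iff)
qed

text \<open>The mirror situation with the kink at the second crossing of the glide: here
  \<open>w\<close> cancels with \<open>c1\<close>, and \<open>w'\<close> is left in the place of the
  old \<open>c1\<close>.\<close>

lemma critical_glide_R1_under:
  assumes D: "D \<in> TD n" and ok: "gl_ok D c1 c x y" and s1: "seg D [Over c, Under c]"
  shows "\<exists>A'. red1\<^sup>*\<^sup>* (gl c1 c x y D) A' \<and> diag_iso A' (del_crossings {c} D)"
proof -
  let ?A = "gl c1 c x y D"
  note nd = gl_ok_crossings[OF D ok]
  have ne: "distinct [c1, c, x, y]" "distinct [y, x, c, c1]" using nd by auto
  note nes = ne[unfolded distinct.simps list.set insert_iff empty_iff de_Morgan_disj simp_thms]
  have sgn: "csign D c = 1 \<or> csign D c = -1" "csign D c1 = 1 \<or> csign D c1 = -1" using TD_sign[OF D] nd by auto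
  define w where "w = (if csign D c = 1 then y else x)"
  define w' where "w' = (if csign D c = 1 then x else y)"
  have w: "{w, w'} = {x, y}" "w \<noteq> w'" "w \<noteq> c" "w \<noteq> c1" "w' \<noteq> c" "w' \<noteq> c1" "w' \<notin> crossings D"
    using nd by (auto simp: w_def w'_def)
  have sw: "csign ?A w = - csign D c1" "csign ?A w' = csign D c1" "csign ?A c1 = csign D c1"
    using ne sgn by (auto simp: csign_gl w_def w'_def)
  have "seg D [Under c1, Over c]" using ok by (simp add: gl_ok_def)
  from seg_join[OF D this s1] have sg: "seg D [Under c1, Over c, Under c]" .
  have U: "seg ?A [Over c, Under c1, Under w, Under c, Under w']"
    using seg_gs[OF sg, of c1 c x y] by (simp add: gs_simps nes w_def w'_def split: if_splits)
  have "seg D [Over c1]" using nd points_iff[OF D] by (intro seg_point) simp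
  from seg_gs[OF this, of c1 c x y]
  have O: "seg ?A [Over w, Over c1, Over w'] \<or> seg ?A [Over w', Over c1, Over w]"
    by (auto simp: gs_simps nes w_def w'_def split: if_splits)
  have 1: "rdel ?A {w, c1}"
  proof (rule R2_rdel)
    show "adjacent ?A (Under w) (Under c1)"
      using seg_sub[of ?A "[Over c]" "[Under c1, Under w]" "[Under c, Under w']"] U by (simp add: adjacent_seg)
    show "adjacent ?A (Over w) (Over c1)"
      using O seg_sub[of ?A "[]" "[Over w, Over c1]" "[Over w']"] seg_sub[of ?A "[Over w']" "[Over c1, Over w]" "[]"]
      by (auto simp: adjacent_seg)
    show "csign ?A w = - csign ?A c1" "w \<noteq> c1" using sw w by auto
  qed
  have 2: "rdel (del_crossings {w, c1} ?A) {c}"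
    unfolding rdel_def using adjacent_seg_del[OF U, of "{w, c1}" "[]" "Over c" "Under c" "[Under w']"] w nd by auto
  have red: "red1\<^sup>*\<^sup>* ?A (del_crossings {w, c1, c} ?A)"
    using red1I[OF 1] red1I[OF 2] unfolding del_del by (simp add: insert_commute)
  define f where "f = id(w' := c1)"
  let ?F = "\<lambda>p. map (map_endpt f) (filter (\<lambda>q. cname q \<notin> {w, c1, c}) (gs (csign D c1 = 1) (csign D c = 1) c1 c x y p))"
  let ?G = "\<lambda>p. if cname p \<in> {c} then [] else [p]"
  have "concat (map ?F (strand D i)) = concat (map ?G (strand D i))" for i
  proof (rule subst_seg_eq[OF D sg])
    show "concat (map ?F [Under c1, Over c, Under c]) = concat (map ?G [Under c1, Over c, Under c])"
      using nes by (auto simp: gs_simps w_def w'_def f_def)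
    fix p assume p: "p \<in> points D" "p \<notin> set [Under c1, Over c, Under c]"
    then have pc: "cname p \<notin> {x, y}" using TD_cname[OF D p(1)] nd by auto
    show "?F p = ?G p"
    proof (cases "p = Over c1")
      case True
      then show ?thesis using nes by (auto simp: gs_simps w_def w'_def f_def)
    next
      case False
      then have "cname p \<notin> {c, c1}" using p by (cases p) auto
      then show ?thesis using pc w by (cases p) (auto simp: gs_simps f_def)
    qed
  qed
  then have "strand (del_crossings {c} D) i = map (map_endpt f) (strand (del_crossings {w, c1, c} ?A) i)" for i
    unfolding strand_del_gl strand_del_subst[of "{c}"] map_concat map_map comp_def by simp
  moreover have "crossings (del_crossings {w, c1, c} ?A) = (crossings D - {c, c1}) \<union> {w'}"
    unfolding crossings_del crossings_gl[OF D ok] using w nd by auto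
  ultimately have "iso_by f (del_crossings {w, c1, c} ?A) (del_crossings {c} D)"
    unfolding iso_by_def using w sw nd by (auto simp: f_def inj_on_def csign_gl)
  then show ?thesis using red by (auto simp: diag_iso_iff)
qed

lemma strand_del_gl_gl:
  "strand (del_crossings X (gl d1 d2 u v (gl c1 c2 x y D))) i = concat (map (\<lambda>p. filter (\<lambda>q. cname q \<notin> X)
     (concat (map (gs (csign (gl c1 c2 x y D) d1 = 1) (csign (gl c1 c2 x y D) d2 = 1) d1 d2 u v)
       (gs (csign D c1 = 1) (csign D c2 = 1) c1 c2 x y p)))) (strand D i))"
  by (simp add: strand_del strand_gl filter_concat_map concat_concat_map glide_subst_gs)

text \<open>\<open>Over d\<close> must follow \<open>Over c\<close>, whose predecessor is
  \<open>Under c1\<close>; so after the first glide \<open>c1\<close> can glide through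
  \<open>d\<close> as well. As \<open>c\<close> and \<open>d\<close> have opposite signs, the new
  crossings of the two glides are parallel with opposite signs, and the pairs \<open>x, x'\<close>,
  \<open>c, d\<close> and \<open>y, y'\<close> cancel.\<close>

lemma critical_glide_R2_over:
  assumes D: "D \<in> AC n" and ok: "gl_ok D c1 c x y" and sgn: "csign D c = - csign D d"
    and O: "adjacent D (Over c) (Over d)" and U: "adjacent D (Under c) (Under d)" and cd: "c \<noteq> d"
  shows "\<exists>A. cstep\<^sup>*\<^sup>* (gl c1 c x y D) A \<and> diag_iso A (del_crossings {c, d} D)"
proof -
  have T: "D \<in> TD n" by (rule AC_TD[OF D])
  note nd = gl_ok_crossings[OF T ok]
  have dD: "d \<in> crossings D" using O adjacent_points by (auto simp: crossings_points)
  have s1: "seg D [Under c1, Over c]" using ok by (simp add: gl_ok_def)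
  have O': "seg D [Over c, Over d]"
    using O seg_left_unique[OF T s1, of "Over d"] unfolding adjacent_seg by auto
  have sg: "seg D [Under c1, Over c, Over d]" by (rule seg_join[OF T s1 O'])
  \<comment> \<open>If \<open>c1\<close> were \<open>d\<close>, its under point would precede its
    over point on one strand.\<close>
  have c1d: "c1 \<noteq> d" using AC_no_cycle2[OF D dD, of "[Over c]"] sg by auto
  let ?A = "gl c1 c x y D"
  have TA: "?A \<in> TD n" by (rule gl_TD[OF T ok])
  obtain x' y' where xy': "x' \<noteq> y'" "x' \<notin> crossings ?A" "y' \<notin> crossings ?A" using fresh2[OF _ TA, of "{}"] by auto
  have ne: "distinct [c1, c, d, x, y, x', y']" "distinct [y', x', y, x, d, c, c1]"
    using nd xy' c1d cd dD unfolding crossings_gl[OF T ok] by auto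
  note nes = ne[unfolded distinct.simps list.set insert_iff empty_iff de_Morgan_disj simp_thms]
  have sA: "seg ?A [Over c, Under c1, Over d]" using seg_gs[OF sg, of c1 c x y] by (simp add: gs_simps nes)
  have okA: "gl_ok ?A c1 d x' y'"
    using seg_sub[of ?A "[Over c]" "[Under c1, Over d]" "[]"] sA xy' nes by (simp add: gl_ok_def)
  let ?B = "gl c1 d x' y' ?A"
  have cA: "csign ?A c1 = csign D c1" "csign ?A d = csign D d" "csign ?A c = csign D c" 
     "csign ?A x = csign D c1 * csign D c" "csign ?A y = - csign D c1 * csign D c"
    using nes by (simp_all add: csign_gl)
  have cB: "csign ?B c = csign D c" "csign ?B d = csign D d" "csign ?B x = csign D c1 * csign D c" 
     "csign ?B y = - csign D c1 * csign D c" "csign ?B x' = csign D c1 * csign D d" "csign ?B y' = - csign D c1 * csign D d"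
    unfolding csign_gl[of c1 d] using nes by (simp_all add: cA)
  have sB: "seg ?B [Over c, Over d, Under c1]" using seg_gs[OF sA, of c1 d x' y'] by (simp add: gs_simps nes)
  have "seg D [Over c1]" using nd points_iff[OF T] by (intro seg_point) simp
  from seg_gs[OF seg_gs[OF this, of c1 c x y], of c1 d x' y']
  have O1: "seg ?B [Over x, Over x', Over c1, Over y', Over y] \<or> seg ?B [Over y, Over y', Over c1, Over x', Over x]"
    by (auto simp: gs_simps nes cA split: if_splits)
  have adjO: "adjacent ?B (Over c) (Over d)" "adjacent ?B (Over x) (Over x')" "adjacent ?B (Over y) (Over y')"
    using seg_Cons2[OF sB] O1 seg_sub[of ?B "[]" "[Over x, Over x']" "[Over c1, Over y', Over y]"]
      seg_sub[of ?B "[Over x, Over x', Over c1]" "[Over y', Over y]" "[]"]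
      seg_sub[of ?B "[]" "[Over y, Over y']" "[Over c1, Over x', Over x]"]
      seg_sub[of ?B "[Over y, Over y', Over c1]" "[Over x', Over x]" "[]"]
    by (auto simp: adjacent_seg)
  have U0: "seg D [Under c, Under d] \<or> seg D [Under d, Under c]" using U by (simp add: adjacent_seg)
  have sc: "csign D c = 1 \<and> csign D d = -1 \<or> csign D c = -1 \<and> csign D d = 1"
    using TD_sign[OF T nd(2)] sgn by auto
  have U1: "(csign D c = 1 \<longrightarrow> seg ?B [Under y, Under c, Under x, Under x', Under d, Under y'] \<or> seg ?B [Under x', Under d, Under y', Under y, Under c, Under x])
    \<and> (csign D c = -1 \<longrightarrow> seg ?B [Under x, Under c, Under y, Under y', Under d, Under x'] \<or> seg ?B [Under y', Under d, Under x', Under x, Under c, Under y])"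
    using U0
  proof
    assume "seg D [Under c, Under d]"
    from seg_gs[OF seg_gs[OF this, of c1 c x y], of c1 d x' y'] sc show ?thesis
      by (auto simp: gs_simps nes cA split: if_splits)
  next
    assume "seg D [Under d, Under c]"
    from seg_gs[OF seg_gs[OF this, of c1 c x y], of c1 d x' y'] sc show ?thesis
      by (auto simp: gs_simps nes cA split: if_splits)
  qed
  have sgs: "csign ?B x = - csign ?B x'" "csign ?B y = - csign ?B y'" "csign ?B c = - csign ?B d"
    using cB sgn by auto
  have dis: "distinct [x, x', c, d, y, y']" "distinct [y, y', c, d, x, x']" using ne by auto
  let ?X = "{c, d, x, x', y, y'}"
  have R: "red1\<^sup>*\<^sup>* ?B (del_crossings ?X ?B)"
  proof -
    from U1 sc consider
      "seg ?B [Under y, Under c, Under x, Under x', Under d, Under y'] \<or> seg ?B [Under y', Under d, Under x', Under x, Under c, Under y]"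
      | "seg ?B [Under x, Under c, Under y, Under y', Under d, Under x'] \<or> seg ?B [Under x', Under d, Under y', Under y, Under c, Under x]"
      by blast
    then show ?thesis
    proof cases
      case 1
      have "red1\<^sup>*\<^sup>* ?B (del_crossings {x, x', c, d, y, y'} ?B)"
        by (rule three_R2[of x x' c d y y' ?B Under Over]) (use dis sgs adjO 1 in auto)
      moreover have "{x, x', c, d, y, y'} = ?X" by auto
      ultimately show ?thesis by simp
    next
      case 2
      have "red1\<^sup>*\<^sup>* ?B (del_crossings {y, y', c, d, x, x'} ?B)"
        by (rule three_R2[of y y' c d x x' ?B Under Over]) (use dis sgs adjO 2 in auto)
      moreover have "{y, y', c, d, x, x'} = ?X" by auto
      ultimately show ?thesis by simp
    qed
  qed
  have "strand (del_crossings ?X ?B) i = strand (del_crossings {c, d} D) i" for i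
    proof -
      let ?F = "\<lambda>p. filter (\<lambda>q. cname q \<notin> ?X) (concat (map (gs (csign ?A c1 = 1) (csign ?A d = 1) c1 d x' y')
       (gs (csign D c1 = 1) (csign D c = 1) c1 c x y p)))"
      let ?G = "\<lambda>p. if cname p \<in> {c, d} then [] else [p]"
      have "concat (map ?F (strand D i)) = concat (map ?G (strand D i))"
      proof (rule subst_seg_eq[OF T sg])
        show "concat (map ?F [Under c1, Over c, Over d]) = concat (map ?G [Under c1, Over c, Over d])"
          by (simp add: gs_simps nes)
        fix p assume p: "p \<in> points D" "p \<notin> set [Under c1, Over c, Over d]"
        then have pc: "cname p \<notin> {x, y, x', y'}" using TD_cname[OF T p(1)] nd xy' crossings_gl[OF T ok] by auto
        consider "p = Over c1" | "p = Under c" | "p = Under d" | "cname p \<notin> {c1, c, d}" using p by (cases p) auto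
        then show "?F p = ?G p"
          by cases (use pc in \<open>auto simp: gs_simps nes gs_other\<close>)
      qed
      then show "strand (del_crossings ?X ?B) i = strand (del_crossings {c, d} D) i"
        unfolding strand_del_gl_gl strand_del_subst[of "{c, d}" D] .
    qed
  moreover have "crossings (del_crossings ?X ?B) = crossings D - {c, d}"
    unfolding crossings_del crossings_gl[OF TA okA] crossings_gl[OF T ok] using nd xy' crossings_gl[OF T ok] by auto
  ultimately have "iso_by id (del_crossings ?X ?B) (del_crossings {c, d} D)"
    unfolding iso_by_def using nd xy' crossings_gl[OF T ok] by (auto simp: csign_gl endpt.map_id0)
  moreover have "cstep\<^sup>*\<^sup>* ?A (del_crossings ?X ?B)"
  proof (rule converse_rtranclp_into_rtranclp)
    show "cstep ?A ?B" using okA unfolding cstep_def glide_iff by blast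
  qed (rule red1_cstep[OF R])
  ultimately show ?thesis unfolding diag_iso_iff by blast
qed

text \<open>Here \<open>Under d\<close> must precede \<open>Under c\<close>, and \<open>d\<close>
  glides through \<open>c2\<close> after \<open>c\<close> has done so; the same three pairs cancel,
  now nested along the over points.\<close>

lemma critical_glide_R2_under:
  assumes D: "D \<in> AC n" and ok: "gl_ok D c c2 x y" and sgn: "csign D c = - csign D d"
    and O: "adjacent D (Over c) (Over d)" and U: "adjacent D (Under c) (Under d)" and cd: "c \<noteq> d"
  shows "\<exists>A. cstep\<^sup>*\<^sup>* (gl c c2 x y D) A \<and> diag_iso A (del_crossings {c, d} D)"
proof -
  have T: "D \<in> TD n" by (rule AC_TD[OF D])
  note nd = gl_ok_crossings[OF T ok]
  have dD: "d \<in> crossings D" using O adjacent_points by (auto simp: crossings_points)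
  have s1: "seg D [Under c, Over c2]" using ok by (simp add: gl_ok_def)
  have U': "seg D [Under d, Under c]"
    using U seg_right_unique[OF T s1, of "Under d"] unfolding adjacent_seg by auto
  have sg: "seg D [Under d, Under c, Over c2]" by (rule seg_join[OF T U' s1])
  have c2d: "c2 \<noteq> d" using AC_no_cycle2[OF D dD, of "[Under c]"] sg by auto
  let ?A = "gl c c2 x y D"
  have TA: "?A \<in> TD n" by (rule gl_TD[OF T ok])
  obtain x' y' where xy': "x' \<noteq> y'" "x' \<notin> crossings ?A" "y' \<notin> crossings ?A" using fresh2[OF _ TA, of "{}"] by auto
  have ne: "distinct [c2, c, d, x, y, x', y']" "distinct [y', x', y, x, d, c, c2]"
    using nd xy' c2d cd dD unfolding crossings_gl[OF T ok] by auto
  note nes = ne[unfolded distinct.simps list.set insert_iff empty_iff de_Morgan_disj simp_thms]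
  have sA: "seg ?A [Under d, Over c2, Under c]" using seg_gs[OF sg, of c c2 x y] by (simp add: gs_simps nes)
  have okA: "gl_ok ?A d c2 x' y'"
    using seg_sub[of ?A "[]" "[Under d, Over c2]" "[Under c]"] sA xy' nes by (simp add: gl_ok_def)
  let ?B = "gl d c2 x' y' ?A"
  have cA: "csign ?A c2 = csign D c2" "csign ?A d = csign D d" "csign ?A c = csign D c" 
     "csign ?A x = csign D c * csign D c2" "csign ?A y = - csign D c * csign D c2"
    using nes by (simp_all add: csign_gl)
  have cB: "csign ?B c = csign D c" "csign ?B d = csign D d" "csign ?B x = csign D c * csign D c2" 
     "csign ?B y = - csign D c * csign D c2" "csign ?B x' = csign D d * csign D c2" "csign ?B y' = - csign D d * csign D c2"
    unfolding csign_gl[of d c2] using nes by (simp_all add: cA)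
  have sB: "seg ?B [Over c2, Under d, Under c]" using seg_gs[OF sA, of d c2 x' y'] by (simp add: gs_simps nes)
  have "seg D [Under c2]" using nd points_iff[OF T] by (intro seg_point) simp
  from seg_gs[OF seg_gs[OF this, of c c2 x y], of d c2 x' y']
  have U1: "seg ?B [Under x, Under x', Under c2, Under y', Under y] \<or> seg ?B [Under y, Under y', Under c2, Under x', Under x]"
    by (auto simp: gs_simps nes cA split: if_splits)
  have adjU: "adjacent ?B (Under c) (Under d)" "adjacent ?B (Under x) (Under x')" "adjacent ?B (Under y) (Under y')"
    using seg_tl[OF sB] U1 seg_sub[of ?B "[]" "[Under x, Under x']" "[Under c2, Under y', Under y]"]
      seg_sub[of ?B "[Under x, Under x', Under c2]" "[Under y', Under y]" "[]"]
      seg_sub[of ?B "[]" "[Under y, Under y']" "[Under c2, Under x', Under x]"]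
      seg_sub[of ?B "[Under y, Under y', Under c2]" "[Under x', Under x]" "[]"]
    by (auto simp: adjacent_seg)
  have O0: "seg D [Over c, Over d] \<or> seg D [Over d, Over c]" using O by (simp add: adjacent_seg)
  have sc: "csign D c = 1 \<and> csign D d = -1 \<or> csign D c = -1 \<and> csign D d = 1"
    using TD_sign[OF T nd(1)] sgn by auto
  have O1: "seg ?B [Over y, Over c, Over x, Over x', Over d, Over y'] \<or> seg ?B [Over y', Over d, Over x', Over x, Over c, Over y]
    \<or> seg ?B [Over x, Over c, Over y, Over y', Over d, Over x'] \<or> seg ?B [Over x', Over d, Over y', Over y, Over c, Over x]"
    using O0
  proof
    assume "seg D [Over c, Over d]"
    from seg_gs[OF seg_gs[OF this, of c c2 x y], of d c2 x' y'] sc show ?thesis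
      by (auto simp: gs_simps nes cA split: if_splits)
  next
    assume "seg D [Over d, Over c]"
    from seg_gs[OF seg_gs[OF this, of c c2 x y], of d c2 x' y'] sc show ?thesis
      by (auto simp: gs_simps nes cA split: if_splits)
  qed
  have sgs: "csign ?B x = - csign ?B x'" "csign ?B y = - csign ?B y'" "csign ?B c = - csign ?B d"
    using cB sgn by auto
  have dis: "distinct [x, x', c, d, y, y']" "distinct [y, y', c, d, x, x']" using ne by auto
  let ?X = "{c, d, x, x', y, y'}"
  have R: "red1\<^sup>*\<^sup>* ?B (del_crossings ?X ?B)"
  proof -
    from O1 consider
      "seg ?B [Over y, Over c, Over x, Over x', Over d, Over y'] \<or> seg ?B [Over y', Over d, Over x', Over x, Over c, Over y]"
      | "seg ?B [Over x, Over c, Over y, Over y', Over d, Over x'] \<or> seg ?B [Over x', Over d, Over y', Over y, Over c, Over x]"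
      by blast
    then show ?thesis
    proof cases
      case 1
      have "red1\<^sup>*\<^sup>* ?B (del_crossings {x, x', c, d, y, y'} ?B)"
        by (rule three_R2[of x x' c d y y' ?B Over Under]) (use dis sgs adjU 1 in auto)
      moreover have "{x, x', c, d, y, y'} = ?X" by auto
      ultimately show ?thesis by simp
    next
      case 2
      have "red1\<^sup>*\<^sup>* ?B (del_crossings {y, y', c, d, x, x'} ?B)"
        by (rule three_R2[of y y' c d x x' ?B Over Under]) (use dis sgs adjU 2 in auto)
      moreover have "{y, y', c, d, x, x'} = ?X" by auto
      ultimately show ?thesis by simp
    qed
  qed
  have "strand (del_crossings ?X ?B) i = strand (del_crossings {c, d} D) i" for i
  proof -
    let ?F = "\<lambda>p. filter (\<lambda>q. cname q \<notin> ?X) (concat (map (gs (csign ?A d = 1) (csign ?A c2 = 1) d c2 x' y')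
       (gs (csign D c = 1) (csign D c2 = 1) c c2 x y p)))"
    let ?G = "\<lambda>p. if cname p \<in> {c, d} then [] else [p]"
    have "concat (map ?F (strand D i)) = concat (map ?G (strand D i))"
    proof (rule subst_seg_eq[OF T sg])
      show "concat (map ?F [Under d, Under c, Over c2]) = concat (map ?G [Under d, Under c, Over c2])"
        by (simp add: gs_simps nes)
      fix p assume p: "p \<in> points D" "p \<notin> set [Under d, Under c, Over c2]"
      then have pc: "cname p \<notin> {x, y, x', y'}" using TD_cname[OF T p(1)] nd xy' crossings_gl[OF T ok] by auto
      consider "p = Under c2" | "p = Over c" | "p = Over d" | "cname p \<notin> {c2, c, d}" using p by (cases p) auto
      then show "?F p = ?G p"
        by cases (use pc in \<open>auto simp: gs_simps nes gs_other\<close>)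
    qed
    then show "strand (del_crossings ?X ?B) i = strand (del_crossings {c, d} D) i"
      unfolding strand_del_gl_gl strand_del_subst[of "{c, d}" D] .
  qed
  moreover have "crossings (del_crossings ?X ?B) = crossings D - {c, d}"
    unfolding crossings_del crossings_gl[OF TA okA] crossings_gl[OF T ok] using nd xy' crossings_gl[OF T ok] by auto
  ultimately have "iso_by id (del_crossings ?X ?B) (del_crossings {c, d} D)"
    unfolding iso_by_def using nd xy' crossings_gl[OF T ok] by (auto simp: csign_gl endpt.map_id0)
  moreover have "cstep\<^sup>*\<^sup>* ?A (del_crossings ?X ?B)"
  proof (rule converse_rtranclp_into_rtranclp)
    show "cstep ?A ?B" using okA unfolding cstep_def glide_iff by blast
  qed (rule red1_cstep[OF R])
  ultimately show ?thesis unfolding diag_iso_iff by blast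
qed

lemma glide_red1_confluent:
  assumes D: "D \<in> AC n" and A: "glide D A" and B: "red1 D B"
  shows "\<exists>A' B'. cstep\<^sup>*\<^sup>* A A' \<and> cstep\<^sup>*\<^sup>* B B' \<and> diag_iso A' B'"
proof -
  have T: "D \<in> TD n" by (rule AC_TD[OF D])
  obtain c1 c2 x y where ok: "gl_ok D c1 c2 x y" and A': "A = gl c1 c2 x y D" using A by (auto simp: glide_iff)
  obtain C where C: "rdel D C" and B': "B = del_crossings C D" using B by (auto simp: red1_def)
  show ?thesis
  proof (cases "C \<inter> {c1, c2} = {}")
    case True
    note g = glide_del_disjoint[OF T ok C True]
    have "cstep A (del_crossings C A)" using g(2) A' red1I by (auto simp: cstep_def)
    moreover have "cstep B (del_crossings C A)" using g(1,3) unfolding A' B' cstep_def glide_iff by metis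
    ultimately show ?thesis using diag_iso_refl by blast
  next
    case False
    have "\<exists>A'. cstep\<^sup>*\<^sup>* A A' \<and> diag_iso A' (del_crossings C D)"
      using C unfolding rdel_def
    proof (elim disjE exE conjE)
      fix c assume c: "C = {c}" "adjacent D (Over c) (Under c)"
      have "c \<in> crossings D" using adjacent_points[OF c(2)] by (simp add: crossings_points)
      \<comment> \<open>Acyclicity fixes the orientation of the kink.\<close>
      then have "seg D [Over c, Under c]" using c(2) AC_no_cycle2[OF D, of c "[]"] by (auto simp: adjacent_seg)
      moreover from c False have "c1 = c \<or> c2 = c" by auto
      ultimately show ?thesis
        using critical_glide_R1_over[OF T] critical_glide_R1_under[OF T] ok red1_cstep unfolding A' c(1) by metis
    next
      fix c d assume c: "C = {c, d}" "c \<noteq> d" "csign D c = - csign D d"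
        "adjacent D (Over c) (Over d)" "adjacent D (Under c) (Under d)"
      have c': "adjacent D (Over d) (Over c)" "adjacent D (Under d) (Under c)" "csign D d = - csign D c"
        using c by (auto simp: adjacent_sym)
      have Cd: "C = {d, c}" using c by auto
      from c False consider "c1 = c" | "c2 = c" | "c1 = d" | "c2 = d" by auto
      then show ?thesis
      proof cases
        case 1 then show ?thesis using critical_glide_R2_under[OF D _ c(3-5) c(2)] ok unfolding A' c(1) by blast
      next
        case 2 then show ?thesis using critical_glide_R2_over[OF D _ c(3-5) c(2)] ok unfolding A' c(1) by blast
      next
        case 3 then show ?thesis using critical_glide_R2_under[OF D _ c'(3,1,2) c(2)[symmetric]] ok unfolding A' Cd by blast
      next
        case 4 then show ?thesis using critical_glide_R2_over[OF D _ c'(3,1,2) c(2)[symmetric]] ok unfolding A' Cd by blast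
      qed
    qed
    then show ?thesis unfolding B' by blast
  qed
qed

lemma cstep_confluent:
  assumes D: "D \<in> AC n" and A: "cstep D A" and B: "cstep D B"
  shows "\<exists>A' B'. cstep\<^sup>*\<^sup>* A A' \<and> cstep\<^sup>*\<^sup>* B B' \<and> diag_iso A' B'"
proof -
  note T = AC_TD[OF D]
  from A B consider "glide D A" "glide D B" | "glide D A" "red1 D B" | "red1 D A" "glide D B" | "red1 D A" "red1 D B"
    by (auto simp: cstep_def)
  then show ?thesis
  proof cases
    case 1
    then show ?thesis using glide_confluent[OF D] glide_cstep by blast
  next
    case 2
    then show ?thesis using glide_red1_confluent[OF D] by blast
  next
    case 3
    then obtain A' B' where *: "cstep\<^sup>*\<^sup>* B B'" "cstep\<^sup>*\<^sup>* A A'" "diag_iso B' A'"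
      using glide_red1_confluent[OF D] by blast
    have "B' \<in> AC n" using cstep.S_steps[OF *(1)] cstep.S_step[OF D B] by blast
    then show ?thesis using * diag_iso_sym[OF AC_TD] by blast
  next
    case 4
    then show ?thesis using red1_confluent[OF T] red1_cstep by blast
  qed
qed

section \<open>Invariance under R3\<close>

definition joinable :: "vdiag \<Rightarrow> vdiag \<Rightarrow> bool" where
  "joinable D D' \<longleftrightarrow> (\<exists>E E'. cstep\<^sup>*\<^sup>* D E \<and> cstep\<^sup>*\<^sup>* D' E' \<and> diag_iso E E')"

definition R3_swap :: "nat \<Rightarrow> nat \<Rightarrow> nat \<Rightarrow> nat endpt \<Rightarrow> nat endpt" where
  "R3_swap x y z = swap_points (Over x) (Over y) \<circ> swap_points (Under x) (Over z) \<circ>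
        swap_points (Under y) (Under z)"

definition R3_diag :: "nat \<Rightarrow> nat \<Rightarrow> nat \<Rightarrow> vdiag \<Rightarrow> vdiag" where
  "R3_diag x y z D = D\<lparr> strand := (\<lambda>a. map (R3_swap x y z) (strand D a)) \<rparr>"

lemma R3_swap_simps:
  assumes "x \<noteq> y" "x \<noteq> z" "y \<noteq> z"
  shows "R3_swap x y z (Over x) = Over y" "R3_swap x y z (Over y) = Over x"
    "R3_swap x y z (Under x) = Over z" "R3_swap x y z (Over z) = Under x"
    "R3_swap x y z (Under y) = Under z" "R3_swap x y z (Under z) = Under y"
    "cname p \<notin> {x, y, z} \<Longrightarrow> R3_swap x y z p = p"
  using assms by (auto simp: R3_swap_def swap_points_def)

lemma R3_swap_swap:
  assumes "x \<noteq> y" "x \<noteq> z" "y \<noteq> z" shows "R3_swap x y z (R3_swap x y z p) = p"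
proof -
  consider "p = Over x" | "p = Over y" | "p = Under x" | "p = Over z" | "p = Under y" | "p = Under z"
    | "cname p \<notin> {x, y, z}" by (cases p) auto
  then show ?thesis by cases (use assms in \<open>simp_all add: R3_swap_simps\<close>)
qed

text \<open>An R3 move is a glide followed by an R2 removal. Gliding \<open>x\<close> through
  \<open>z\<close> exchanges the points on the middle segment and creates two crossings from the top
  to the bottom segment, one on either side. The one of sign opposite to \<open>y\<close> stands
  next to \<open>y\<close> and cancels with it; the other one remains on the far side as the new
  \<open>y\<close>. The hypotheses \<open>O\<close> and \<open>U\<close> are the sign rule of R3 for
  the given order on the middle segment.\<close>

lemma R3_core:
  assumes D: "D \<in> AC n" and xyz: "x \<noteq> y" "x \<noteq> z" "y \<noteq> z"
    and M: "seg D [Under x, Over z]"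
    and O: "if csign D z * csign D y = 1 then seg D [Over x, Over y] else seg D [Over y, Over x]"
    and U: "if csign D x * csign D y = 1 then seg D [Under y, Under z] else seg D [Under z, Under y]"
  shows "\<exists>E. cstep\<^sup>*\<^sup>* D E \<and> diag_iso E (R3_diag x y z D)"
proof -
  have T: "D \<in> TD n" by (rule AC_TD[OF D])
  obtain u v where uv: "u \<noteq> v" "u \<notin> crossings D" "v \<notin> crossings D" using fresh2[OF _ T, of "{}"] by auto
  have ok: "gl_ok D x z u v" using M xyz uv by (simp add: gl_ok_def)
  note nd = gl_ok_crossings[OF T ok]
  have "Over y \<in> points D" using O seg_points[of D "[Over x, Over y]"] seg_points[of D "[Over y, Over x]"]
    by (auto split: if_splits)
  then have yD: "y \<in> crossings D" by (simp add: crossings_points)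
  have ne: "distinct [x, y, z, u, v]" "distinct [v, u, z, y, x]" using nd xyz yD by auto
  note nes = ne[unfolded distinct.simps list.set insert_iff empty_iff de_Morgan_disj simp_thms]
  note sx = TD_sign[OF T nd(1)] and sz = TD_sign[OF T nd(2)] and sy = TD_sign[OF T yD]
  let ?A = "gl x z u v D"
  define w where "w = (if csign D y = csign D x * csign D z then v else u)"
  define w' where "w' = (if csign D y = csign D x * csign D z then u else v)"
  have w: "{w, w'} = {u, v}" "w \<noteq> w'" "w \<notin> {x, y, z}" "w' \<notin> {x, y, z}" "w' \<notin> crossings D"
    using nes uv by (auto simp: w_def w'_def)
  have sw: "csign ?A w = - csign D y" "csign ?A w' = csign D y" "csign ?A y = csign D y"
    using nes sx sy sz by (auto simp: csign_gl w_def w'_def)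
  define os where "os = (if csign D z * csign D y = 1 then [Over x, Over y] else [Over y, Over x])"
  define us where "us = (if csign D x * csign D y = 1 then [Under y, Under z] else [Under z, Under y])"
  have sos: "seg D os" and sus: "seg D us" using O U by (auto simp: os_def us_def split: if_splits)
  have "seg ?A [Over w', Over x, Over w, Over y] \<or> seg ?A [Over y, Over w, Over x, Over w']"
    using seg_gs[OF sos, of x z u v] sx sy sz
    by (elim disjE; simp add: gs_simps nes w_def w'_def os_def)
  then have aO: "adjacent ?A (Over w) (Over y)"
    using seg_sub[of ?A "[Over w', Over x]" "[Over w, Over y]" "[]"] 
      seg_sub[of ?A "[]" "[Over y, Over w]" "[Over x, Over w']"] by (auto simp: adjacent_seg)
  have "seg ?A [Under w', Under z, Under w, Under y] \<or> seg ?A [Under y, Under w, Under z, Under w']"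
    using seg_gs[OF sus, of x z u v] sx sy sz
    by (elim disjE; simp add: gs_simps nes w_def w'_def us_def)
  then have aU: "adjacent ?A (Under w) (Under y)"
    using seg_sub[of ?A "[Under w', Under z]" "[Under w, Under y]" "[]"] 
      seg_sub[of ?A "[]" "[Under y, Under w]" "[Under z, Under w']"] by (auto simp: adjacent_seg)
  have r: "rdel ?A {w, y}" by (rule R2_rdel[OF aO aU]) (use sw w in auto)
  define f where "f = id(w' := y)"
  let ?F = "\<lambda>p. map (map_endpt f) (filter (\<lambda>q. cname q \<notin> {w, y}) (gs (csign D x = 1) (csign D z = 1) x z u v p))"
  let ?G = "\<lambda>p. [R3_swap x y z p]"
  have "concat (map ?F (strand D i)) = concat (map ?G (strand D i))" for i
  proof (rule subst_segs_eq[OF T, of "[os, [Under x, Over z], us]"])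
    have "concat (map ?F os) = concat (map ?G os)"
      using sx sy sz by (elim disjE; simp add: os_def R3_swap_simps gs_simps nes w_def w'_def f_def)
    moreover have "concat (map ?F us) = concat (map ?G us)"
      using sx sy sz by (elim disjE; simp add: us_def R3_swap_simps gs_simps nes w_def w'_def f_def)
    moreover have "concat (map ?F [Under x, Over z]) = concat (map ?G [Under x, Over z])"
      using w by (simp add: R3_swap_simps gs_simps nes f_def)
    ultimately show "seg D ps \<and> concat (map ?F ps) = concat (map ?G ps)" if "ps \<in> set [os, [Under x, Over z], us]" for ps
      using that sos sus M by auto
    show "sorted_wrt (\<lambda>ps qs. set ps \<inter> set qs = {}) [os, [Under x, Over z], us]"
      using xyz by (auto simp: os_def us_def)
  next
    fix p assume p: "p \<in> points D" "\<forall>ps\<in>set [os, [Under x, Over z], us]. p \<notin> set ps"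
    have "p \<notin> {Over x, Over y, Under x, Over z, Under y, Under z}"
      using p(2) unfolding os_def us_def by (auto split: if_splits)
    then have "cname p \<notin> {x, y, z}" by (cases p) auto
    moreover have "cname p \<notin> {u, v}" using TD_cname[OF T p(1)] uv by auto
    ultimately show "?F p = ?G p" using w by (cases p) (auto simp: R3_swap_simps xyz gs_other f_def)
  qed
  then have "strand (R3_diag x y z D) i = map (map_endpt f) (strand (del_crossings {w, y} ?A) i)" for i
    unfolding strand_del_gl map_concat map_map comp_def by (simp add: R3_diag_def)
  moreover have "crossings (del_crossings {w, y} ?A) = (crossings D - {y}) \<union> {w'}"
    unfolding crossings_del crossings_gl[OF T ok] using w uv yD by auto
  ultimately have "iso_by f (del_crossings {w, y} ?A) (R3_diag x y z D)"
    unfolding iso_by_def using w sw nd uv yD by (auto simp: f_def inj_on_def csign_gl R3_diag_def)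
  moreover have "cstep D ?A" using ok by (auto simp: cstep_def glide_iff)
  moreover have "cstep ?A (del_crossings {w, y} ?A)" using red1I[OF r] by (simp add: cstep_def)
  ultimately show ?thesis unfolding diag_iso_iff by (meson converse_rtranclp_into_rtranclp rtranclp.rtrancl_refl)
qed

text \<open>Exactly one side of the move has \<open>Under x\<close> before \<open>Over z\<close>.
  Since the exchange of points is an involution, the glide and the R2 removal can always be started
  from that side.\<close>

lemma R3_joinable:
  assumes D: "D \<in> AC n" and D': "D' \<in> AC n" and R3: "R3 D D'"
  shows "joinable D D'"
proof -
  obtain x y z \<delta> where xyz: "x \<noteq> y" "x \<noteq> z" "y \<noteq> z"
    and adj: "adjacent D (Over x) (Over y)" "adjacent D (Under x) (Over z)" "adjacent D (Under y) (Under z)"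
    and d: "\<delta> \<in> {1, -1}" "order_sign D (Over x) (Over y) = \<delta> * csign D y"
       "order_sign D (Under x) (Over z) = \<delta> * csign D z"
       "order_sign D (Under y) (Under z) = \<delta> * csign D x * csign D y * csign D z"
    and D'_eq: "D' = R3_diag x y z D"
    using R3 unfolding R3_def R3_diag_def R3_swap_def by blast
  have T: "D \<in> TD n" by (rule AC_TD[OF D])
  have T': "D' \<in> TD n" by (rule AC_TD[OF D'])
  have cr: "x \<in> crossings D" "y \<in> crossings D" "z \<in> crossings D"
    using adj adjacent_points by (auto simp: crossings_points)
  note s = TD_sign[OF T cr(1)] TD_sign[OF T cr(2)] TD_sign[OF T cr(3)]
  have oD: "if order_sign D p q = 1 then seg D [p, q] else seg D [q, p]" if "adjacent D p q" for p q
    using that by (auto simp: order_sign_def follows_seg adjacent_seg)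
  have sgD': "seg D' (map (R3_swap x y z) ps)" if "seg D ps" for ps
    using that unfolding seg_def D'_eq R3_diag_def by (auto, metis map_append)
  note oO = oD[OF adj(1)] and oM = oD[OF adj(2)] and oU = oD[OF adj(3)]
  show ?thesis
  proof (cases "seg D [Under x, Over z]")
    case True
    then have "order_sign D (Under x) (Over z) = 1" by (simp add: order_sign_def follows_seg)
    then have "\<delta> = csign D z" using d(1,3) s by auto
    then have o: "order_sign D (Over x) (Over y) = csign D z * csign D y"
      "order_sign D (Under y) (Under z) = csign D x * csign D y" using d s by auto
    have "\<exists>E. cstep\<^sup>*\<^sup>* D E \<and> diag_iso E D'"
      unfolding D'_eq by (rule R3_core[OF D xyz True]) (use oO oU o in auto)
    then show ?thesis unfolding joinable_def by blast
  next
    case False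
    then have "order_sign D (Under x) (Over z) = -1" by (simp add: order_sign_def follows_seg)
    then have "\<delta> = - csign D z" using d(1,3) s by auto
    then have o: "order_sign D (Over x) (Over y) = - (csign D z * csign D y)"
      "order_sign D (Under y) (Under z) = - (csign D x * csign D y)" using d s by auto
    have cs: "csign D' = csign D" by (simp add: D'_eq R3_diag_def)
    have "seg D [Over z, Under x]" using False adj(2) by (simp add: adjacent_seg)
    from sgD'[OF this] have M: "seg D' [Under x, Over z]" by (simp add: R3_swap_simps xyz)
    have O: "if csign D' z * csign D' y = 1 then seg D' [Over x, Over y] else seg D' [Over y, Over x]"
      using oO o(1) s sgD'[of "[Over x, Over y]"] sgD'[of "[Over y, Over x]"] unfolding cs
      by (auto simp: R3_swap_simps xyz split: if_splits)
    have U: "if csign D' x * csign D' y = 1 then seg D' [Under y, Under z] else seg D' [Under z, Under y]"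
      using oU o(2) s sgD'[of "[Under y, Under z]"] sgD'[of "[Under z, Under y]"] unfolding cs
      by (auto simp: R3_swap_simps xyz split: if_splits)
    have "R3_diag x y z D' = D"
      unfolding D'_eq R3_diag_def by (simp add: R3_swap_swap xyz comp_def)
    then obtain E where "cstep\<^sup>*\<^sup>* D' E" "diag_iso E D"
      using R3_core[OF D' xyz M O U] by auto
    moreover have "diag_iso D E" using diag_iso_sym AC_TD cstep.S_steps[OF \<open>cstep\<^sup>*\<^sup>* D' E\<close> D'] \<open>diag_iso E D\<close> by blast
    ultimately show ?thesis unfolding joinable_def by blast
  qed
qed

section \<open>Normal forms\<close>

definition nf :: "vdiag \<Rightarrow> vdiag \<Rightarrow> bool" where
  "nf D E \<longleftrightarrow> cstep\<^sup>*\<^sup>* D E \<and> \<not> (\<exists>X. cstep E X)"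

lemma nf_exists: "D \<in> AC n \<Longrightarrow> \<exists>E. nf D E"
  using cstep.normal_form_exists unfolding nf_def by blast

lemma nf_AC: "D \<in> AC n \<Longrightarrow> nf D E \<Longrightarrow> E \<in> AC n"
  using cstep.S_steps unfolding nf_def by blast

lemma cstep_unique:
  "D \<in> AC n \<Longrightarrow> diag_iso D E \<Longrightarrow> cstep\<^sup>*\<^sup>* D A \<Longrightarrow> cstep\<^sup>*\<^sup>* E B \<Longrightarrow>
    \<not> (\<exists>X. cstep A X) \<Longrightarrow> \<not> (\<exists>X. cstep B X) \<Longrightarrow> diag_iso A B"
  by (rule cstep.unique_normal_form[where n = n, OF cstep_confluent])

lemma glide_unique:
  "D \<in> AC n \<Longrightarrow> diag_iso D E \<Longrightarrow> glide\<^sup>*\<^sup>* D A \<Longrightarrow> glide\<^sup>*\<^sup>* E B \<Longrightarrow>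
    \<not> (\<exists>X. glide A X) \<Longrightarrow> \<not> (\<exists>X. glide B X) \<Longrightarrow> diag_iso A B"
  by (rule glide.unique_normal_form[where n = n, OF glide_confluent])

lemma red_unique:
  "D \<in> TD n \<Longrightarrow> diag_iso D E \<Longrightarrow> red1\<^sup>*\<^sup>* D A \<Longrightarrow> red1\<^sup>*\<^sup>* E B \<Longrightarrow>
    \<not> (\<exists>X. red1 A X) \<Longrightarrow> \<not> (\<exists>X. red1 B X) \<Longrightarrow> diag_iso A B"
  by (rule red.unique_normal_form[where n = n, OF red1_confluent])

lemma nf_iso: "D \<in> AC n \<Longrightarrow> diag_iso D D' \<Longrightarrow> nf D E \<Longrightarrow> nf D' E' \<Longrightarrow> diag_iso E E'"
  using cstep_unique unfolding nf_def by blast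

lemma nf_step: "cstep\<^sup>*\<^sup>* D D' \<Longrightarrow> nf D' E \<Longrightarrow> nf D E"
  unfolding nf_def by auto

lemma nf_joinable:
  assumes D: "D \<in> AC n" and D': "D' \<in> AC n" and j: "joinable D D'" and E: "nf D E" and E': "nf D' E'"
  shows "diag_iso E E'"
proof -
  obtain F F' where F: "cstep\<^sup>*\<^sup>* D F" "cstep\<^sup>*\<^sup>* D' F'" "diag_iso F F'" using j by (auto simp: joinable_def)
  have A: "F \<in> AC n" "F' \<in> AC n" using cstep.S_steps F D D' by blast+
  obtain G G' where G: "nf F G" "nf F' G'" using nf_exists A by blast
  have "diag_iso E G" using nf_iso[OF D diag_iso_refl E nf_step[OF F(1) G(1)]] .
  moreover have "diag_iso G G'" using nf_iso[OF A(1) F(3) G] .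
  moreover have "diag_iso G' E'" using nf_iso[OF D' diag_iso_refl nf_step[OF F(2) G(2)] E'] .
  ultimately show ?thesis by (meson diag_iso_trans)
qed

lemma vAC_rel_induct:
  assumes "(D, D') \<in> vAC_rel n"
    and "\<And>D. D \<in> AC n \<Longrightarrow> P D D"
    and "\<And>D E. D \<in> AC n \<Longrightarrow> E \<in> AC n \<Longrightarrow> P D E \<Longrightarrow> P E D"
    and "\<And>D E F. D \<in> AC n \<Longrightarrow> E \<in> AC n \<Longrightarrow> F \<in> AC n \<Longrightarrow> P D E \<Longrightarrow> P E F \<Longrightarrow> P D F"
    and "\<And>D E. D \<in> AC n \<Longrightarrow> E \<in> AC n \<Longrightarrow> diag_iso D E \<or> R1 D E \<or> R2 D E \<or> R3 D E \<Longrightarrow> P D E"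
  shows "P D D'"
proof -
  have D: "D \<in> AC n" and e: "equivclp (\<lambda>E E'. E \<in> AC n \<and> E' \<in> AC n \<and>
       (diag_iso E E' \<or> R1 E E' \<or> R2 E E' \<or> R3 E E')) D D'" using assms(1) by (auto simp: vAC_rel_def)
  from e have "D' \<in> AC n \<and> P D D'"
  proof (induction rule: equivclp_induct)
    case base
    then show ?case using D assms(2) by simp
  next
    case (step E F)
    then have "E \<in> AC n" "F \<in> AC n" "P E F" using assms(3,5) by blast+
    then show ?case using step.IH assms(4) D by blast
  qed
  then show ?thesis by simp
qed

text \<open>The generating moves of \<open>vAC_rel\<close> are isomorphisms, rewriting steps or R3
  moves, and each of them relates joinable diagrams; so the normal form is an invariant of the
  class.\<close>

lemma vAC_nf:
  assumes "(D, D') \<in> vAC_rel n" "nf D E" "nf D' E'" shows "diag_iso E E'"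
proof -
  have "\<forall>E E'. nf D E \<longrightarrow> nf D' E' \<longrightarrow> diag_iso E E'"
  proof (rule vAC_rel_induct[OF assms(1)])
    fix D :: vdiag assume "D \<in> AC n"
    then show "\<forall>E E'. nf D E \<longrightarrow> nf D E' \<longrightarrow> diag_iso E E'" using nf_iso diag_iso_refl by blast
  next
    fix D E :: vdiag assume "D \<in> AC n" "E \<in> AC n" "\<forall>F F'. nf D F \<longrightarrow> nf E F' \<longrightarrow> diag_iso F F'"
    then show "\<forall>F F'. nf E F \<longrightarrow> nf D F' \<longrightarrow> diag_iso F F'" using nf_AC AC_TD diag_iso_sym by blast
  next
    fix D E F :: vdiag assume *: "E \<in> AC n" "\<forall>X Y. nf D X \<longrightarrow> nf E Y \<longrightarrow> diag_iso X Y"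
      "\<forall>X Y. nf E X \<longrightarrow> nf F Y \<longrightarrow> diag_iso X Y"
    obtain G where "nf E G" using nf_exists[OF *(1)] by blast
    then show "\<forall>X Y. nf D X \<longrightarrow> nf F Y \<longrightarrow> diag_iso X Y" using * diag_iso_trans by blast
  next
    fix D E :: vdiag assume *: "D \<in> AC n" "E \<in> AC n" "diag_iso D E \<or> R1 D E \<or> R2 D E \<or> R3 D E"
    have "joinable D E"
    proof (cases "R3 D E")
      case True
      then show ?thesis using R3_joinable * by blast
    next
      case False
      then have "diag_iso D E \<or> cstep D E" using * by (auto simp: cstep_def red1_iff)
      then show ?thesis using diag_iso_refl unfolding joinable_def by blast
    qed
    then show "\<forall>X Y. nf D X \<longrightarrow> nf E Y \<longrightarrow> diag_iso X Y" using nf_joinable * by blast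
  qed
  then show ?thesis using assms by blast
qed

section \<open>The map to reduced OU diagrams\<close>

lemma OU_no_glide:
  assumes D: "D \<in> TD n" and OU: "OU D" shows "\<not> glide D D'"
proof
  assume "glide D D'"
  then obtain c1 c2 where "seg D [Under c1, Over c2]" by (auto simp: glide_iff gl_ok_def)
  then obtain a xs ys where a: "strand D a = xs @ Under c1 # Over c2 # ys" by (auto simp: seg_def)
  obtain cs ds where "strand D a = map Over cs @ map Under ds" using OU unfolding OU_def by blast
  then have "sorted_wrt (\<lambda>p q. \<not> ((\<exists>c. p = Under c) \<and> (\<exists>c. q = Over c))) (strand D a)"
    by (auto simp: sorted_wrt_append sorted_wrt_map intro!: sorted_wrt_true sorted_wrt_mono_rel[of _ "\<lambda>_ _. True"])
  then show False unfolding a by (auto simp: sorted_wrt_append)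
qed

lemma OU_list:
  assumes "\<And>xs c d ys. l \<noteq> xs @ Under c # Over d # ys"
  shows "\<exists>cs ds. l = map Over cs @ map Under ds"
  using assms
proof (induction l)
  case (Cons p l)
  have "\<exists>cs ds. l = map Over cs @ map Under ds"
    by (rule Cons.IH) (metis Cons.prems append_Cons)
  then obtain cs ds where l: "l = map Over cs @ map Under ds" by blast
  show ?case
  proof (cases p)
    case (Over c)
    then show ?thesis using l by (intro exI[of _ "c # cs"] exI[of _ ds]) simp
  next
    case (Under c)
    have "cs = []"
    proof (cases cs)
      case (Cons d ds')
      then show ?thesis using Cons.prems[of "[]" c d "map Over ds' @ map Under ds"] l Under by simp
    qed simp
    then show ?thesis using l Under by (intro exI[of _ "[]"] exI[of _ "c # ds"]) simp
  qed
qed simp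

lemma no_glide_OU:
  assumes D: "D \<in> AC n" and ng: "\<not> (\<exists>X. glide D X)" shows "OU D"
  unfolding OU_def
proof
  have T: "D \<in> TD n" by (rule AC_TD[OF D])
  fix a show "\<exists>cs ds. strand D a = map Over cs @ map Under ds"
  proof (rule OU_list)
    fix xs c d ys show "strand D a \<noteq> xs @ Under c # Over d # ys"
    proof
      assume a: "strand D a = xs @ Under c # Over d # ys"
      then have sg: "seg D [Under c, Over d]" unfolding seg_def by (metis append_Cons append_Nil)
      then have "Under c \<in> points D" using seg_points by force
      then have "c \<in> crossings D" using TD_points[OF T] by (simp add: crossings_points)
      \<comment> \<open>A crossing cannot glide through itself; acyclicity excludes this
        configuration.\<close>
      then have "c \<noteq> d" using AC_no_cycle2[OF D, of c "[]"] sg by auto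
      moreover obtain x y where "x \<noteq> y" "x \<notin> crossings D" "y \<notin> crossings D" using fresh2[OF _ T, of "{}"] by auto
      ultimately have "gl_ok D c d x y" using sg by (simp add: gl_ok_def)
      then show False using ng by (auto simp: glide_iff)
    qed
  qed
qed

text \<open>Weak monotonicity along strands suffices, since ties are broken by the position on the
  strand; \<open>K\<close> exceeds every strand length, so that a position never outweighs a
  level.\<close>

lemma levels_AC:
  fixes lev :: "nat endpt \<Rightarrow> nat"
  assumes D: "D \<in> TD n" and mono: "\<And>a. sorted_wrt (\<lambda>p q. lev p \<le> lev q) (strand D a)"
    and lt: "\<And>c. c \<in> crossings D \<Longrightarrow> lev (Over c) < lev (Under c)"
  shows "D \<in> AC n"
proof -
  define K where "K = Suc (card (points D))"
  define str where "str p = (SOME a. p \<in> set (strand D a))" for p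
  define pos where "pos p = inv_into {..<length (strand D (str p))} ((!) (strand D (str p))) p" for p
  have dis: "distinct (strand D a)" for a using D by (simp add: TD_iff)
  have str: "str p = a" if "p \<in> set (strand D a)" for p a
    unfolding str_def
  proof (rule some_equality)
    fix b assume "p \<in> set (strand D b)" then show "b = a" using TD_strand_unique[OF D _ that] by blast
  qed (rule that)
  have pos: "pos (strand D a ! i) = i" if "i < length (strand D a)" for a i
    unfolding pos_def using str[of "strand D a ! i" a] that dis[of a]
    by (simp add: inv_into_f_f inj_on_nth)
  have len: "length (strand D a) < K" for a
  proof -
    have "card (set (strand D a)) \<le> card (points D)"
      by (rule card_mono[OF finite_points[OF D]]) (auto simp: points_def)
    then show ?thesis using dis[of a] by (simp add: K_def distinct_card)
  qed
  have posK: "pos p < K" if p: "p \<in> points D" for p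
  proof -
    obtain a where "p \<in> set (strand D a)" using p by (auto simp: points_def)
    then obtain i where "i < length (strand D a)" "strand D a ! i = p" by (auto simp: in_set_conv_nth)
    then show ?thesis using pos len by (metis less_trans)
  qed
  define h where "h p = lev p * K + pos p" for p
  have step: "h p < h q" if "lev p < lev q" "pos p < K" for p q
  proof -
    have "h p < Suc (lev p) * K" using that by (simp add: h_def)
    also have "\<dots> \<le> lev q * K" using that by (intro mult_le_mono1) simp
    finally show ?thesis by (simp add: h_def)
  qed
  have "ranked D h"
    unfolding ranked_def
  proof (intro conjI allI ballI)
    fix a
    show "sorted_wrt (\<lambda>p q. h p < h q) (strand D a)"
      unfolding sorted_wrt_iff_nth_less
    proof (intro allI impI)
      fix i j assume ij: "i < j" "j < length (strand D a)"
      then have "lev (strand D a ! i) \<le> lev (strand D a ! j)"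
        using mono[of a] by (simp add: sorted_wrt_iff_nth_less)
      moreover have "pos (strand D a ! i) = i" "pos (strand D a ! j) = j" using pos ij by auto
      ultimately show "h (strand D a ! i) < h (strand D a ! j)"
        using step[of "strand D a ! i" "strand D a ! j"] len[of a] ij
        by (cases "lev (strand D a ! i) = lev (strand D a ! j)") (auto simp: h_def)
    qed
  next
    fix c assume c: "c \<in> crossings D"
    then show "h (Over c) < h (Under c)"
      by (intro step lt posK) (simp_all add: crossings_points)
  qed
  then show ?thesis using D by (auto simp: AC_iff)
qed

lemma OU_AC: 
  assumes D: "D \<in> TD n" and OU: "OU D" shows "D \<in> AC n"
proof (rule levels_AC[OF D])
  let ?lev = "\<lambda>p. case p of Over c \<Rightarrow> 0 | Under c \<Rightarrow> Suc 0"
  fix a 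
  obtain cs ds where "strand D a = map Over cs @ map Under ds" using OU unfolding OU_def by blast
  then show "sorted_wrt (\<lambda>p q. ?lev p \<le> ?lev q) (strand D a)"
    by (auto simp: sorted_wrt_append sorted_wrt_map)
qed auto

lemma OU_del: "OU D \<Longrightarrow> OU (del_crossings C D)"
  unfolding OU_def
proof
  fix a assume "\<forall>a. \<exists>cs ds. strand D a = map Over cs @ map Under ds"
  then obtain cs ds where "strand D a = map Over cs @ map Under ds" by blast
  then have "strand (del_crossings C D) a =
      map Over (filter (\<lambda>c. c \<notin> C) cs) @ map Under (filter (\<lambda>c. c \<notin> C) ds)"
    by (simp add: strand_del filter_map comp_def)
  then show "\<exists>cs ds. strand (del_crossings C D) a = map Over cs @ map Under ds" by blast
qed

text \<open>Church-Rosser property up to isomorphism: normal forms of neighbours along the zigzag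
  are isomorphic.\<close>

lemma R12_rel_join:
  assumes "(D, D') \<in> R12_rel n"
  shows "D \<in> TD n \<and> D' \<in> TD n \<and> (\<exists>E E'. red1\<^sup>*\<^sup>* D E \<and> red1\<^sup>*\<^sup>* D' E' \<and> diag_iso E E')"
proof -
  have D: "D \<in> TD n" and D': "D' \<in> TD n" and e: "equivclp (\<lambda>E E'. E \<in> TD n \<and> E' \<in> TD n \<and>
       (diag_iso E E' \<or> R1 E E' \<or> R2 E E')) D D'" using assms by (auto simp: R12_rel_def)
  let ?n = "\<lambda>D E. red1\<^sup>*\<^sup>* D E \<and> \<not> (\<exists>X. red1 E X)"
  note un = red_unique
  from e have "D' \<in> TD n \<and> (\<exists>E E'. ?n D E \<and> ?n D' E' \<and> diag_iso E E')"
  proof (induction rule: equivclp_induct)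
    case base
    then show ?case using D red.normal_form_exists[OF D] diag_iso_refl by blast
  next
    case (step X Y)
    then have X: "X \<in> TD n" and Y: "Y \<in> TD n" and XY: "diag_iso X Y \<or> red1 X Y \<or> diag_iso Y X \<or> red1 Y X"
      by (auto simp: red1_iff)
    obtain E E' where E: "?n D E" "?n X E'" "diag_iso E E'" using step.IH by blast
    obtain F where F: "?n Y F" using red.normal_form_exists[OF Y] by blast
    have FT: "F \<in> TD n" using red.S_steps[OF _ Y] F by blast
    have "diag_iso E' F"
      using XY
    proof (elim disjE)
      assume "diag_iso X Y" then show ?thesis using un[OF X _, of Y] E F by blast
    next
      assume "red1 X Y"
      then have "red1\<^sup>*\<^sup>* X F" using F by (meson converse_rtranclp_into_rtranclp)
      then show ?thesis using un[OF X diag_iso_refl] E F by blast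
    next
      assume "diag_iso Y X" then show ?thesis using un[OF Y _, of X] E F diag_iso_sym[OF FT] by blast
    next
      assume "red1 Y X"
      then have "red1\<^sup>*\<^sup>* Y E'" using E by (meson converse_rtranclp_into_rtranclp)
      then show ?thesis using un[OF Y diag_iso_refl] E F by blast
    qed
    then show ?case using E F Y diag_iso_trans by blast
  qed
  then show ?thesis using D by blast
qed

lemma iso_R12: "D \<in> TD n \<Longrightarrow> diag_iso D E \<Longrightarrow> (D, E) \<in> R12_rel n"
  unfolding R12_rel_def using iso_TD by (auto intro!: r_into_equivclp)

lemma R12_trans: "(D, E) \<in> R12_rel n \<Longrightarrow> (E, F) \<in> R12_rel n \<Longrightarrow> (D, F) \<in> R12_rel n"
  unfolding R12_rel_def by (auto intro: equivclp_trans)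

lemma R12_sym: "(D, E) \<in> R12_rel n \<Longrightarrow> (E, D) \<in> R12_rel n"
  unfolding R12_rel_def by (auto intro: equivclp_sym)

lemma red1_R12:
  assumes "red1\<^sup>*\<^sup>* D E" and D: "D \<in> TD n" shows "(D, E) \<in> R12_rel n"
  using assms(1)
proof (induction rule: rtranclp_induct)
  case base
  then show ?case using iso_R12[OF D] diag_iso_refl by blast
next
  case (step E F)
  have E: "E \<in> TD n" using R12_rel_join step.IH by blast
  have F: "F \<in> TD n" using red1_TD[OF E step.hyps(2)] .
  have "(E, F) \<in> R12_rel n" using step.hyps(2) E F unfolding R12_rel_def
    by (auto simp: red1_iff intro!: r_into_equivclp)
  then show ?case using R12_trans step.IH by blast
qed

lemma irreducible_no_steps: "\<not> (\<exists>X. R D X) \<Longrightarrow> R\<^sup>*\<^sup>* D E \<Longrightarrow> E = D"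
  by (metis converse_rtranclpE)

text \<open>An irreducible diagram is the normal form of every diagram in its R1-R2 class, and
  removals lower the crossing number; so being locally irreducible means being globally
  minimal.\<close>

lemma reduced_iff:
  assumes D: "D \<in> TD n" shows "reduced n D \<longleftrightarrow> \<not> (\<exists>X. red1 D X)"
proof
  assume r: "reduced n D"
  show "\<not> (\<exists>X. red1 D X)"
  proof
    assume "\<exists>X. red1 D X"
    then obtain X where X: "red1 D X" by blast
    then show False using r red1_R12[OF _ D, of X] red.dec[OF D X] by (auto simp: reduced_def)
  qed
next
  assume i: "\<not> (\<exists>X. red1 D X)"
  show "reduced n D"
    unfolding reduced_def
  proof (intro notI, elim exE conjE)
    fix D' assume r: "(D, D') \<in> R12_rel n" and less: "crossing_number D' < crossing_number D"
    obtain E E' where E: "red1\<^sup>*\<^sup>* D E" "red1\<^sup>*\<^sup>* D' E'" "diag_iso E E'" "D' \<in> TD n" using R12_rel_join[OF r] by blast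
    have "E = D" using irreducible_no_steps[OF i E(1)] .
    then show False using less red.dec_steps[OF E(2,4)] iso_crossing_number[OF E(3)] by simp
  qed
qed

lemma nf_reduced_OU:
  assumes D: "D \<in> AC n" and E: "nf D E" shows "E \<in> TD n" "OU E" "reduced n E"
proof -
  have E': "E \<in> AC n" using nf_AC D E by blast
  show T: "E \<in> TD n" by (rule AC_TD[OF E'])
  show "OU E" using no_glide_OU[OF E'] E by (auto simp: nf_def cstep_def)
  show "reduced n E" unfolding reduced_iff[OF T] using E by (auto simp: nf_def cstep_def)
qed

lemma OU_reduced_nf: "D \<in> TD n \<Longrightarrow> OU D \<Longrightarrow> reduced n D \<Longrightarrow> nf D D"
  using OU_no_glide reduced_iff by (auto simp: nf_def cstep_def)

lemma Gamma_v_eq: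
  assumes D: "D \<in> AC n" and E: "glide\<^sup>*\<^sup>* D E" "OU E"
  shows "Gamma_v n D = iso_rel n `` {E}"
  unfolding Gamma_v_def
proof (rule the_equality)
  have ET: "E \<in> TD n" using glide.S_steps[OF E(1) D] AC_TD by blast
  then show "\<exists>F\<in>TD n. OU F \<and> glide\<^sup>*\<^sup>* D F \<and> iso_rel n `` {E} = iso_rel n `` {F}" using E by blast
  fix A assume "\<exists>F\<in>TD n. OU F \<and> glide\<^sup>*\<^sup>* D F \<and> A = iso_rel n `` {F}"
  then obtain F where F: "F \<in> TD n" "OU F" "glide\<^sup>*\<^sup>* D F" "A = iso_rel n `` {F}" by blast
  have "diag_iso E F"
    using glide_unique[OF D diag_iso_refl E(1) F(3)]
      OU_no_glide[OF ET E(2)] OU_no_glide[OF F(1,2)] by blast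
  then show "A = iso_rel n `` {E}" using F(4) ET equiv_class_eq[OF iso_rel_equiv] iso_rel_iff by metis
qed

lemma reduced_form_eq:
  assumes D: "D \<in> TD n" and OU: "OU D" and E: "red1\<^sup>*\<^sup>* D E" "\<not> (\<exists>X. red1 E X)"
  shows "reduced_form n (iso_rel n `` {D}) = iso_rel n `` {E}"
  unfolding reduced_form_def
proof (rule the_equality)
  have ET: "E \<in> TD n" using red.S_steps E D by blast
  have "OU E" using E(1) OU by (induction rule: rtranclp_induct) (auto simp: red1_def OU_del)
  moreover have "reduced n E" using reduced_iff[OF ET] E by blast
  ultimately have "iso_rel n `` {E} \<in> vROU n" unfolding vROU_def using ET by (intro quotientI) simp
  moreover have "D \<in> iso_rel n `` {D}" "E \<in> iso_rel n `` {E}" using D ET by (auto simp: iso_rel_iff diag_iso_refl)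
  ultimately show "iso_rel n `` {E} \<in> vROU n \<and> (\<exists>D\<in>iso_rel n `` {D}. \<exists>Ea\<in>iso_rel n `` {E}. (D, Ea) \<in> R12_rel n)"
    using red1_R12[OF E(1) D] by blast
  fix B assume "B \<in> vROU n \<and> (\<exists>D\<in>iso_rel n `` {D}. \<exists>E\<in>B. (D, E) \<in> R12_rel n)"
  then obtain D' F where F: "B \<in> vROU n" "(D, D') \<in> iso_rel n" "F \<in> B" "(D', F) \<in> R12_rel n" by blast
  then obtain F0 where F0: "F0 \<in> TD n" "reduced n F0" "B = iso_rel n `` {F0}" unfolding vROU_def by (auto elim: quotientE)
  have "(F0, F) \<in> iso_rel n" using F0 F by blast
  then have BF: "B = iso_rel n `` {F}" and FF0: "diag_iso F0 F" 
    using F0 equiv_class_eq[OF iso_rel_equiv] by (auto simp: iso_rel_iff)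
  have FT: "F \<in> TD n" using iso_TD F0 FF0 by blast
  have Fi: "\<not> (\<exists>X. red1 F X)" using red.normal_iso[OF F0(1) FF0] F0 reduced_iff by blast
  have "(D, D') \<in> R12_rel n" using F(2) iso_R12[OF D] by (simp add: iso_rel_iff)
  then have "(D, F) \<in> R12_rel n" using F(4) R12_trans by blast
  then have "(E, F) \<in> R12_rel n" using R12_trans R12_sym red1_R12[OF E(1) D] by blast
  then obtain E' F' where *: "red1\<^sup>*\<^sup>* E E'" "red1\<^sup>*\<^sup>* F F'" "diag_iso E' F'" using R12_rel_join by blast
  then have "diag_iso E F" using irreducible_no_steps[OF E(2) *(1)] irreducible_no_steps[OF Fi *(2)] by simp
  then show "B = iso_rel n `` {E}" using BF ET equiv_class_eq[OF iso_rel_equiv] iso_rel_iff by metis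
qed

lemma vAC_rel_equiv: "equiv (AC n) (vAC_rel n)"
proof (rule equivI)
  show "refl_on (AC n) (vAC_rel n)" by (auto simp: refl_on_def vAC_rel_def)
  show "sym (vAC_rel n)" by (rule symI) (auto simp: vAC_rel_def intro: equivclp_sym)
  show "trans (vAC_rel n)" by (rule transI) (auto simp: vAC_rel_def intro: equivclp_trans)
qed (auto simp: vAC_rel_def)

text \<open>All glides first and all removals afterwards end in a normal form for both kinds of
  steps, because removals preserve the OU property. Hence the composite in
  \<open>Gamma_bar_v\<close> computes \<open>nf\<close>, and it gives the same value for every
  representative of the class.\<close>

lemma Gamma_bar_v_eq:
  assumes D: "D \<in> AC n" and E: "nf D E"
  shows "Gamma_bar_v n (vAC_rel n `` {D}) = iso_rel n `` {E}"
proof -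
  have ET: "E \<in> TD n" using nf_reduced_OU D E by blast
  have "reduced_form n (Gamma_v n F) = iso_rel n `` {E}" if F: "(D, F) \<in> vAC_rel n" for F
  proof -
    have FA: "F \<in> AC n" using F by (auto simp: vAC_rel_def)
    obtain G where G: "glide\<^sup>*\<^sup>* F G" "\<not> (\<exists>X. glide G X)" using glide.normal_form_exists[OF FA] by blast
    have GA: "G \<in> AC n" using glide.S_steps[OF G(1) FA] .
    have OU: "OU G" using no_glide_OU[OF GA G(2)] .
    obtain H where H: "red1\<^sup>*\<^sup>* G H" "\<not> (\<exists>X. red1 H X)" using red.normal_form_exists[OF AC_TD[OF GA]] by blast
    have HT: "H \<in> TD n" using red.S_steps[OF H(1) AC_TD[OF GA]] .
    have "OU H" using H(1) OU by (induction rule: rtranclp_induct) (auto simp: red1_def OU_del)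
    then have "nf F H"
      unfolding nf_def using OU_no_glide[OF HT] H(2) rtranclp_trans[OF glide_cstep[OF G(1)] red1_cstep[OF H(1)]]
      by (auto simp: cstep_def)
    then have "diag_iso E H" using vAC_nf[OF F E] by blast
    then have "iso_rel n `` {H} = iso_rel n `` {E}" using ET equiv_class_eq[OF iso_rel_equiv] iso_rel_iff by metis
    then show ?thesis using Gamma_v_eq[OF FA G(1) OU] reduced_form_eq[OF AC_TD[OF GA] OU H] by simp
  qed
  moreover have "(D, D) \<in> vAC_rel n" using D vAC_rel_equiv by (auto simp: equiv_def refl_on_def)
  ultimately show ?thesis unfolding Gamma_bar_v_def by auto
qed

section \<open>Products\<close>

abbreviation evn :: "nat \<Rightarrow> nat" where "evn \<equiv> \<lambda>c. 2 * c"
abbreviation odn :: "nat \<Rightarrow> nat" where "odn \<equiv> \<lambda>c. Suc (2 * c)"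

lemma strand_prod:
  "strand (diag_prod D E) a = map (map_endpt evn) (strand D a) @ map (map_endpt odn) (strand E a)"
  by (simp add: diag_prod_def)

lemma csign_prod: "csign (diag_prod D E) (2 * c) = csign D c" "csign (diag_prod D E) (Suc (2 * c)) = csign E c"
  by (simp_all add: diag_prod_def)

lemma points_prod: "points (diag_prod D E) = map_endpt evn ` points D \<union> map_endpt odn ` points E"
  by (auto simp: points_def strand_prod)

lemma map_endpt_eq_iff: "inj f \<Longrightarrow> map_endpt f p = map_endpt f q \<longleftrightarrow> p = q"
  by (cases p; cases q) (auto dest: injD)

lemma inj_evn: "inj evn" and inj_odn: "inj odn"
  by (auto simp: inj_on_def)

lemma Over_mem_map: "Over c \<in> map_endpt f ` A \<longleftrightarrow> (\<exists>d. Over d \<in> A \<and> f d = c)"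
  and Under_mem_map: "Under c \<in> map_endpt f ` A \<longleftrightarrow> (\<exists>d. Under d \<in> A \<and> f d = c)"
proof -
  show "Over c \<in> map_endpt f ` A \<longleftrightarrow> (\<exists>d. Over d \<in> A \<and> f d = c)"
  proof
    assume "Over c \<in> map_endpt f ` A"
    then obtain p where "p \<in> A" "map_endpt f p = Over c" by auto
    then show "\<exists>d. Over d \<in> A \<and> f d = c" by (cases p) auto
  qed force
  show "Under c \<in> map_endpt f ` A \<longleftrightarrow> (\<exists>d. Under d \<in> A \<and> f d = c)"
  proof
    assume "Under c \<in> map_endpt f ` A"
    then obtain p where "p \<in> A" "map_endpt f p = Under c" by auto
    then show "\<exists>d. Under d \<in> A \<and> f d = c" by (cases p) auto
  qed force
qed

lemma crossings_prod: "crossings (diag_prod D E) = evn ` crossings D \<union> odn ` crossings E"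
proof (rule Set.set_eqI)
  fix c show "c \<in> crossings (diag_prod D E) \<longleftrightarrow> c \<in> evn ` crossings D \<union> odn ` crossings E"
    unfolding crossings_points points_prod Un_iff Over_mem_map by (auto simp: crossings_points)
qed

lemma prod_TD:
  assumes D: "D \<in> TD n" and E: "E \<in> TD n" shows "diag_prod D E \<in> TD n"
  unfolding TD_iff
proof (intro conjI allI impI)
  have ne: "map_endpt evn p \<noteq> map_endpt odn q" for p q
    by (cases p; cases q) (auto, presburger+)
  fix a
  have "distinct (strand D a)" "distinct (strand E a)" using D E by (auto simp: TD_iff)
  then show "distinct (strand (diag_prod D E) a)"
    using ne by (auto simp: strand_prod distinct_map inj_on_def map_endpt_eq_iff[OF inj_evn]
        map_endpt_eq_iff[OF inj_odn])
  fix b :: nat assume ab: "a \<noteq> b"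
  show "set (strand (diag_prod D E) a) \<inter> set (strand (diag_prod D E) b) = {}"
    using ne ne[symmetric] TD_strand_unique[OF D, of _ a b] TD_strand_unique[OF E, of _ a b] ab
    by (auto simp: strand_prod map_endpt_eq_iff[OF inj_evn] map_endpt_eq_iff[OF inj_odn])
next
  fix a assume "a \<notin> {1..n}" then show "strand (diag_prod D E) a = []"
    using D E by (auto simp: strand_prod TD_def)
next
  fix c show "(Over c \<in> points (diag_prod D E)) = (Under c \<in> points (diag_prod D E))"
    unfolding points_prod Un_iff Over_mem_map Under_mem_map using TD_points[OF D] TD_points[OF E] by simp
next
  fix c assume "Over c \<in> points (diag_prod D E)"
  then have "c \<in> crossings (diag_prod D E)" by (simp add: crossings_points)
  then show "csign (diag_prod D E) c = 1 \<or> csign (diag_prod D E) c = -1"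
    unfolding crossings_prod by (auto simp: csign_prod dest: TD_sign[OF D] TD_sign[OF E])
qed

lemma prod_AC:
  assumes D: "D \<in> AC n" and E: "E \<in> AC n" shows "diag_prod D E \<in> AC n"
proof -
  obtain h k where h: "ranked D h" and k: "ranked E k" using D E by (auto simp: AC_iff)
  have fin: "finite (h ` points D)" using finite_points[OF AC_TD[OF D]] by simp
  \<comment> \<open>A bound for the heights of the first factor; those of the second factor are
    shifted above it.\<close>
  define M where "M = Suc (Max (insert 0 (h ` points D)))"
  have M: "h p < M" if "p \<in> points D" for p
    using fin that by (auto simp: M_def less_Suc_eq_le intro!: Max_ge)
  define r where "r p = (if even (cname p) then h (map_endpt (\<lambda>c. c div 2) p)
     else M + k (map_endpt (\<lambda>c. c div 2) p))" for p
  have r1: "r (map_endpt evn p) = h p" for p by (cases p) (auto simp: r_def)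
  have r2: "r (map_endpt odn p) = M + k p" for p by (cases p) (auto simp: r_def)
  have r3: "r (Over (2 * c)) = h (Over c)" "r (Under (2 * c)) = h (Under c)"
    "r (Over (Suc (2 * c))) = M + k (Over c)" "r (Under (Suc (2 * c))) = M + k (Under c)" for c
    by (auto simp: r_def)
  have "sorted_wrt (\<lambda>p q. r p < r q) (strand (diag_prod D E) a)" for a
    using h k M unfolding strand_prod sorted_wrt_append sorted_wrt_map r1 r2 ranked_def
    by (auto simp: r1 r2 points_def intro: trans_less_add1)
  moreover have "r (Over c) < r (Under c)" if "c \<in> crossings (diag_prod D E)" for c
    using that h k unfolding crossings_prod ranked_def by (auto simp: r3)
  ultimately have "ranked (diag_prod D E) r" by (simp add: ranked_def)
  then show ?thesis using prod_TD AC_TD D E by (auto simp: AC_iff)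
qed

lemma seg_prod: "seg D ps \<Longrightarrow> seg (diag_prod D E) (map (map_endpt evn) ps)"
  "seg E ps \<Longrightarrow> seg (diag_prod D E) (map (map_endpt odn) ps)"
  unfolding seg_def strand_prod by (metis append.assoc map_append)+

lemma adjacent_prod:
  "adjacent D p q \<Longrightarrow> adjacent (diag_prod D E) (map_endpt evn p) (map_endpt evn q)"
  "adjacent E p q \<Longrightarrow> adjacent (diag_prod D E) (map_endpt odn p) (map_endpt odn q)"
  using seg_prod(1)[of D "[p, q]" E] seg_prod(1)[of D "[q, p]" E]
    seg_prod(2)[of E "[p, q]" D] seg_prod(2)[of E "[q, p]" D] by (auto simp: adjacent_seg)

lemma rdel_prod:
  assumes "rdel D C" shows "rdel (diag_prod D E) (evn ` C)" "rdel (diag_prod E D) (odn ` C)"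
proof -
  from assms consider c where "C = {c}" "adjacent D (Over c) (Under c)"
    | c d where "C = {c, d}" "c \<noteq> d" "csign D c = - csign D d"
       "adjacent D (Over c) (Over d)" "adjacent D (Under c) (Under d)"
    unfolding rdel_def by blast
  then have "rdel (diag_prod D E) (evn ` C) \<and> rdel (diag_prod E D) (odn ` C)"
  proof cases
    case 1
    then show ?thesis using adjacent_prod[of D "Over c" "Under c" E] adjacent_prod[of D "Over c" "Under c" E]
        adjacent_prod(2)[of D "Over c" "Under c" E] unfolding rdel_def by auto
  next
    case 2
    then have "rdel (diag_prod D E) {2 * c, 2 * d}" "rdel (diag_prod E D) {Suc (2 * c), Suc (2 * d)}"
      using adjacent_prod(1)[of D "Over c" "Over d" E] adjacent_prod(2)[of D "Over c" "Over d" E]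
        adjacent_prod(1)[of D "Under c" "Under d" E] adjacent_prod(2)[of D "Under c" "Under d" E]
      by (auto intro!: R2_rdel simp: csign_prod)
    then show ?thesis using 2(1) by simp
  qed
  then show "rdel (diag_prod D E) (evn ` C)" "rdel (diag_prod E D) (odn ` C)" by auto
qed

lemma del_prod:
  "diag_prod (del_crossings C D) E = del_crossings (evn ` C) (diag_prod D E)"
  "diag_prod E (del_crossings C D) = del_crossings (odn ` C) (diag_prod E D)"
proof -
  have 1: "2 * k \<in> evn ` C \<longleftrightarrow> k \<in> C" "Suc (2 * k) \<notin> evn ` C"
    "Suc (2 * k) \<in> odn ` C \<longleftrightarrow> k \<in> C" "2 * k \<notin> odn ` C" for k
    by (auto, presburger+)
  show "diag_prod (del_crossings C D) E = del_crossings (evn ` C) (diag_prod D E)"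
    by (rule vdiag.equality) (auto simp: strand_prod strand_del fun_eq_iff filter_map comp_def 1 diag_prod_def[unfolded fun_eq_iff])
  show "diag_prod E (del_crossings C D) = del_crossings (odn ` C) (diag_prod E D)"
    by (rule vdiag.equality) (auto simp: strand_prod strand_del fun_eq_iff filter_map comp_def 1 diag_prod_def[unfolded fun_eq_iff])
qed

lemma red1_prod:
  "red1 D D' \<Longrightarrow> red1 (diag_prod D E) (diag_prod D' E)" "red1 D D' \<Longrightarrow> red1 (diag_prod E D) (diag_prod E D')"
  unfolding red1_def using rdel_prod del_prod by blast+

lemma order_sign_prod:
  assumes "adjacent D p q" "D \<in> TD n" "E \<in> TD n"
  shows "order_sign (diag_prod D E) (map_endpt evn p) (map_endpt evn q) = order_sign D p q"
    "order_sign (diag_prod E D) (map_endpt odn p) (map_endpt odn q) = order_sign D p q"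
proof -
  have T: "diag_prod D E \<in> TD n" "diag_prod E D \<in> TD n" using assms prod_TD by auto
  show "order_sign (diag_prod D E) (map_endpt evn p) (map_endpt evn q) = order_sign D p q"
    using assms(1) seg_prod(1)[of D "[p, q]" E] seg_prod(1)[of D "[q, p]" E] seg_antisym[OF T(1)]
    by (auto simp: order_sign_def follows_seg adjacent_seg)
  show "order_sign (diag_prod E D) (map_endpt odn p) (map_endpt odn q) = order_sign D p q"
    using assms(1) seg_prod(2)[of D "[p, q]" E] seg_prod(2)[of D "[q, p]" E] seg_antisym[OF T(2)]
    by (auto simp: order_sign_def follows_seg adjacent_seg)
qed

lemma R3_swap_map:
  "inj f \<Longrightarrow> R3_swap (f x) (f y) (f z) (map_endpt f p) = map_endpt f (R3_swap x y z p)"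
  by (cases p) (auto simp: R3_swap_def swap_points_def dest: injD)

lemma R3_iff: "R3 D D' \<longleftrightarrow> (\<exists>x y z. x \<noteq> y \<and> x \<noteq> z \<and> y \<noteq> z \<and>
     adjacent D (Over x) (Over y) \<and> adjacent D (Under x) (Over z) \<and> adjacent D (Under y) (Under z) \<and>
     (\<exists>\<delta>\<in>{1, -1}. order_sign D (Over x) (Over y) = \<delta> * csign D y \<and>
        order_sign D (Under x) (Over z) = \<delta> * csign D z \<and>
        order_sign D (Under y) (Under z) = \<delta> * csign D x * csign D y * csign D z) \<and>
     D' = R3_diag x y z D)"
  unfolding R3_def R3_diag_def R3_swap_def ..

lemma R3_prod:
  assumes R: "R3 D D'" and D: "D \<in> TD n" and E: "E \<in> TD n"
  shows "R3 (diag_prod D E) (diag_prod D' E)" "R3 (diag_prod E D) (diag_prod E D')"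
proof -
  obtain x y z \<delta> where xyz: "x \<noteq> y" "x \<noteq> z" "y \<noteq> z"
    and adj: "adjacent D (Over x) (Over y)" "adjacent D (Under x) (Over z)" "adjacent D (Under y) (Under z)"
    and d: "\<delta> \<in> {1, -1}" "order_sign D (Over x) (Over y) = \<delta> * csign D y"
       "order_sign D (Under x) (Over z) = \<delta> * csign D z"
       "order_sign D (Under y) (Under z) = \<delta> * csign D x * csign D y * csign D z"
    and D'_eq: "D' = R3_diag x y z D"
    using R unfolding R3_iff by blast
  have par: "even (f c) \<noteq> even (g d) \<Longrightarrow> f c \<noteq> g d" for f g :: "nat \<Rightarrow> nat" and c d by metis
  have fix1: "R3_swap (2 * x) (2 * y) (2 * z) (map_endpt odn p) = map_endpt odn p" for p
    by (intro R3_swap_simps(7)) (use xyz in \<open>auto, presburger+\<close>)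
  have fix2: "R3_swap (Suc (2 * x)) (Suc (2 * y)) (Suc (2 * z)) (map_endpt evn p) = map_endpt evn p" for p
    by (intro R3_swap_simps(7)) (use xyz in \<open>auto, presburger+\<close>)
  have e1: "diag_prod D' E = R3_diag (2 * x) (2 * y) (2 * z) (diag_prod D E)"
    unfolding D'_eq by (rule vdiag.equality)
      (auto simp: R3_diag_def diag_prod_def fun_eq_iff fix1 R3_swap_map[OF inj_evn])
  have e2: "diag_prod E D' = R3_diag (Suc (2 * x)) (Suc (2 * y)) (Suc (2 * z)) (diag_prod E D)"
    unfolding D'_eq by (rule vdiag.equality)
      (auto simp: R3_diag_def diag_prod_def fun_eq_iff fix2 R3_swap_map[OF inj_odn])
  show "R3 (diag_prod D E) (diag_prod D' E)"
    unfolding R3_iff using xyz d(1) adjacent_prod(1)[OF adj(1), of E] adjacent_prod(1)[OF adj(2), of E] adjacent_prod(1)[OF adj(3), of E]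
      order_sign_prod(1)[OF adj(1) D E] order_sign_prod(1)[OF adj(2) D E] order_sign_prod(1)[OF adj(3) D E] d(2-) e1
    by (intro exI[of _ "2 * x"] exI[of _ "2 * y"] exI[of _ "2 * z"] conjI bexI[of _ \<delta>]) (simp_all add: csign_prod)
  show "R3 (diag_prod E D) (diag_prod E D')"
    unfolding R3_iff using xyz d(1) adjacent_prod(2)[OF adj(1), of E] adjacent_prod(2)[OF adj(2), of E] adjacent_prod(2)[OF adj(3), of E]
      order_sign_prod(2)[OF adj(1) D E] order_sign_prod(2)[OF adj(2) D E] order_sign_prod(2)[OF adj(3) D E] d(2-) e2
    by (intro exI[of _ "Suc (2 * x)"] exI[of _ "Suc (2 * y)"] exI[of _ "Suc (2 * z)"] conjI bexI[of _ \<delta>]) (simp_all add: csign_prod)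
qed

lemma iso_prod:
  assumes "diag_iso D D'" "diag_iso E E'" shows "diag_iso (diag_prod D E) (diag_prod D' E')"
proof -
  obtain f g where f: "iso_by f D D'" and g: "iso_by g E E'" using assms by (auto simp: diag_iso_iff)
  define k where "k c = (if even c then 2 * f (c div 2) else 2 * g (c div 2) + 1)" for c
  have k: "k (2 * c) = 2 * f c" "k (Suc (2 * c)) = Suc (2 * g c)" for c by (simp_all add: k_def)
  have ke: "map_endpt k (map_endpt evn p) = map_endpt evn (map_endpt f p)"
    "map_endpt k (map_endpt odn p) = map_endpt odn (map_endpt g p)" for p
    by (cases p; simp add: k)+
  have "inj_on k (crossings (diag_prod D E))"
  proof (rule inj_onI)
    fix c d assume cd: "c \<in> crossings (diag_prod D E)" "d \<in> crossings (diag_prod D E)" "k c = k d"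
    have fi: "inj_on f (crossings D)" and gi: "inj_on g (crossings E)" using f g by (auto simp: iso_by_def)
    have "even (k c) \<longleftrightarrow> even c" for c by (simp add: k_def)
    then have "even c \<longleftrightarrow> even d" using cd(3) by metis
    then show "c = d" using cd fi gi unfolding crossings_prod by (auto simp: k dest: inj_onD)
  qed
  then have "iso_by k (diag_prod D E) (diag_prod D' E')"
    using f g unfolding iso_by_def crossings_prod by (auto simp: strand_prod ke k csign_prod)
  then show ?thesis by (auto simp: diag_iso_iff)
qed

lemma prod_assoc: "diag_iso (diag_prod (diag_prod A B) C) (diag_prod A (diag_prod B C))"
proof -
  \<comment> \<open>Crossing \<open>c\<close> of \<open>A\<close>, \<open>B\<close>,
    \<open>C\<close> is called \<open>4c\<close>, \<open>4c + 2\<close>, \<open>2c + 1\<close> in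
    the left product and \<open>2c\<close>, \<open>4c + 1\<close>, \<open>4c + 3\<close> in the
    right one; \<open>k\<close> translates.\<close>
  define k where "k c = (if odd c then 2 * c + 1 else if even (c div 2) then c div 2 else c - 1)" for c :: nat
  have k: "k (2 * (2 * c)) = 2 * c" "k (2 * Suc (2 * c)) = Suc (2 * (2 * c))" "k (Suc (2 * c)) = Suc (2 * (Suc (2 * c)))" for c
    by (simp_all add: k_def)
  have "inj k"
  proof (rule injI)
    fix c d assume "k c = k d"
    then show "c = d" unfolding k_def by (auto split: if_splits elim!: evenE oddE) presburger+
  qed
  have ke: "map_endpt k (map_endpt evn (map_endpt evn p)) = map_endpt evn p"
    "map_endpt k (map_endpt evn (map_endpt odn p)) = map_endpt odn (map_endpt evn p)"
    "map_endpt k (map_endpt odn p) = map_endpt odn (map_endpt odn p)" for p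
    by (cases p; simp add: k k[simplified])+
  have cs: "csign (diag_prod (diag_prod A B) C) (4 * c) = csign A c"
    "csign (diag_prod (diag_prod A B) C) (Suc (Suc (4 * c))) = csign B c"
    "csign (diag_prod A (diag_prod B C)) (Suc (4 * c)) = csign B c"
    "csign (diag_prod A (diag_prod B C)) (Suc (Suc (Suc (4 * c)))) = csign C c" for c
  proof -
    have d: "4 * c div 2 = 2 * c" "Suc (4 * c) div 2 = 2 * c" "Suc (Suc (4 * c)) div 2 = Suc (2 * c)"
      "Suc (Suc (Suc (4 * c))) div 2 = Suc (2 * c)" "Suc (2 * c) div 2 = c" by presburger+
    show "csign (diag_prod (diag_prod A B) C) (4 * c) = csign A c"
      "csign (diag_prod (diag_prod A B) C) (Suc (Suc (4 * c))) = csign B c"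
      "csign (diag_prod A (diag_prod B C)) (Suc (4 * c)) = csign B c"
      "csign (diag_prod A (diag_prod B C)) (Suc (Suc (Suc (4 * c)))) = csign C c"
      by (simp_all add: diag_prod_def d)
  qed
  have "iso_by k (diag_prod (diag_prod A B) C) (diag_prod A (diag_prod B C))"
    unfolding iso_by_def crossings_prod
    using \<open>inj k\<close> by (auto simp: strand_prod ke k k[simplified] csign_prod cs inj_on_def)
  then show ?thesis by (auto simp: diag_iso_iff)
qed

lemma one_prod: "diag_iso (diag_prod diag_one D) D"
proof -
  have "iso_by (\<lambda>c. c div 2) (diag_prod diag_one D) D"
    unfolding iso_by_def crossings_prod
    by (auto simp: strand_prod diag_one_def csign_prod crossings_def inj_on_def comp_def endpt.map_comp endpt.map_ident)
  then show ?thesis by (auto simp: diag_iso_iff)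
qed

lemma prod_one: "diag_iso (diag_prod D diag_one) D"
proof -
  have "iso_by (\<lambda>c. c div 2) (diag_prod D diag_one) D"
    unfolding iso_by_def crossings_prod
    by (auto simp: strand_prod diag_one_def csign_prod crossings_def inj_on_def comp_def endpt.map_comp endpt.map_ident)
  then show ?thesis by (auto simp: diag_iso_iff)
qed

lemma one_TD: "diag_one \<in> TD n"
  by (auto simp: TD_iff diag_one_def points_def)

lemma one_AC: "diag_one \<in> AC n"
  by (rule OU_AC[OF one_TD]) (simp add: OU_def diag_one_def)

lemma vAC_step: "D \<in> AC n \<Longrightarrow> E \<in> AC n \<Longrightarrow> diag_iso D E \<or> red1 D E \<or> R3 D E \<Longrightarrow> (D, E) \<in> vAC_rel n"
  unfolding vAC_rel_def by (auto simp: red1_iff intro!: r_into_equivclp)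

lemma vAC_sym: "(D, E) \<in> vAC_rel n \<Longrightarrow> (E, D) \<in> vAC_rel n"
  using vAC_rel_equiv by (auto simp: equiv_def dest: symD)

lemma vAC_trans: "(D, E) \<in> vAC_rel n \<Longrightarrow> (E, F) \<in> vAC_rel n \<Longrightarrow> (D, F) \<in> vAC_rel n"
  using vAC_rel_equiv unfolding equiv_def by (meson transD)

lemma vAC_refl: "D \<in> AC n \<Longrightarrow> (D, D) \<in> vAC_rel n"
  using vAC_step diag_iso_refl by blast

lemma vAC_iso: "D \<in> AC n \<Longrightarrow> diag_iso D E \<Longrightarrow> (D, E) \<in> vAC_rel n"
  using vAC_step iso_AC by blast

lemma vAC_in: "(D, E) \<in> vAC_rel n \<Longrightarrow> D \<in> AC n \<and> E \<in> AC n"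
  by (auto simp: vAC_rel_def)

text \<open>A move in one factor is a move of the same kind in the product, on either side; the two
  factors are then changed one after the other.\<close>

lemma vAC_prod:
  assumes "(D, D') \<in> vAC_rel n" "(E, E') \<in> vAC_rel n"
  shows "(diag_prod D E, diag_prod D' E') \<in> vAC_rel n"
proof -
  have 1: "(diag_prod D F, diag_prod D' F) \<in> vAC_rel n \<and> (diag_prod F D, diag_prod F D') \<in> vAC_rel n"
    if "(D, D') \<in> vAC_rel n" "F \<in> AC n" for D D' F
    using that(1)
  proof (rule vAC_rel_induct)
    fix D E assume *: "D \<in> AC n" "E \<in> AC n" "diag_iso D E \<or> R1 D E \<or> R2 D E \<or> R3 D E"
    then have *: "D \<in> AC n" "E \<in> AC n" "diag_iso D E \<or> red1 D E \<or> R3 D E" by (auto simp: red1_iff)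
    have ac: "diag_prod D F \<in> AC n" "diag_prod E F \<in> AC n" "diag_prod F D \<in> AC n" "diag_prod F E \<in> AC n"
      using * that(2) prod_AC by auto
    have t: "D \<in> TD n" "F \<in> TD n" using * that(2) AC_TD by auto
    have "diag_iso (diag_prod D F) (diag_prod E F) \<or> red1 (diag_prod D F) (diag_prod E F) \<or> R3 (diag_prod D F) (diag_prod E F)"
      "diag_iso (diag_prod F D) (diag_prod F E) \<or> red1 (diag_prod F D) (diag_prod F E) \<or> R3 (diag_prod F D) (diag_prod F E)"
      using *(3) iso_prod[OF _ diag_iso_refl] iso_prod[OF diag_iso_refl] red1_prod R3_prod[OF _ t]
      by blast+
    then show "(diag_prod D F, diag_prod E F) \<in> vAC_rel n \<and> (diag_prod F D, diag_prod F E) \<in> vAC_rel n"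
      using ac vAC_step by blast
  qed (use that(2) prod_AC vAC_refl in \<open>auto intro: vAC_sym vAC_trans\<close>)
  show ?thesis using 1[OF assms(1)] 1[OF assms(2)] vAC_in[OF assms(1)] vAC_in[OF assms(2)] vAC_trans by meson
qed

section \<open>Words\<close>

lemma word_diag_simps [simp]:
  "word_diag [] = diag_one" "word_diag (l # w) = diag_prod (sigma_diag l) (word_diag w)"
  by (simp_all add: word_diag_def)

lemma sigma_TD:
  assumes "i \<in> {1..n}" "j \<in> {1..n}" "i \<noteq> j" "s \<in> {1, -1}"
  shows "sigma_diag ((i, j), s) \<in> TD n"
  unfolding TD_iff points_def using assms by (auto simp: sigma_diag_def split: if_splits)

lemma sigma_AC:
  assumes "l \<in> vPB_gens n \<times> {1, -1}" shows "sigma_diag l \<in> AC n"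
proof -
  obtain i j s where l: "l = ((i, j), s)" by (cases l) auto
  show ?thesis unfolding l
  proof (rule OU_AC)
    show "sigma_diag ((i, j), s) \<in> TD n" using assms unfolding l vPB_gens_def by (intro sigma_TD) auto
    have "\<exists>cs ds. strand (sigma_diag ((i, j), s)) a = map Over cs @ map Under ds" for a
    proof -
      consider "a = i" | "a \<noteq> i" "a = j" | "a \<noteq> i" "a \<noteq> j" by blast
      then show ?thesis
      proof cases
        case 1 then show ?thesis by (intro exI[of _ "[0]"] exI[of _ "[]"]) (simp add: sigma_diag_def)
      next
        case 2 then show ?thesis by (intro exI[of _ "[]"] exI[of _ "[0]"]) (simp add: sigma_diag_def)
      next
        case 3 then show ?thesis by (intro exI[of _ "[]"]) (simp add: sigma_diag_def)
      qed
    qed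
    then show "OU (sigma_diag ((i, j), s))" by (simp add: OU_def)
  qed
qed

lemma words_simps: "[] \<in> words S" "l # w \<in> words S \<longleftrightarrow> l \<in> S \<times> {1, -1} \<and> w \<in> words S"
  "u @ v \<in> words S \<longleftrightarrow> u \<in> words S \<and> v \<in> words S"
  by (auto simp: words_def)

lemma word_AC: "w \<in> words (vPB_gens n) \<Longrightarrow> word_diag w \<in> AC n"
  by (induction w) (auto simp: words_simps one_AC intro!: prod_AC sigma_AC)

lemma word_append: "u \<in> words (vPB_gens n) \<Longrightarrow> diag_iso (diag_prod (word_diag u) (word_diag v)) (word_diag (u @ v))"
proof (induction u)
  case (Cons l u)
  then show ?case using prod_assoc[of "sigma_diag l" "word_diag u" "word_diag v"] iso_prod[OF diag_iso_refl] diag_iso_trans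
    by (fastforce simp: words_simps)
qed (simp add: one_prod)

lemma sigma_cancel:
  assumes g: "g \<in> vPB_gens n" and s: "s \<in> {1, -1}"
  shows "(diag_prod (sigma_diag (g, s)) (sigma_diag (g, -s)), diag_one) \<in> vAC_rel n"
proof -
  obtain i j where ij: "g = (i, j)" "i \<noteq> j" using g by (auto simp: vPB_gens_def)
  let ?D = "diag_prod (sigma_diag (g, s)) (sigma_diag (g, -s))"
  have D: "?D \<in> AC n" using g s by (intro prod_AC sigma_AC) auto
  have "strand ?D i = [Over 0, Over 1]" "strand ?D j = [Under 0, Under 1]"
    using ij by (simp_all add: strand_prod sigma_diag_def)
  then have "seg ?D [Over 0, Over 1]" "seg ?D [Under 0, Under 1]"
    unfolding seg_def by (metis append_Nil append_Nil2)+
  moreover have "csign ?D 0 = s" "csign ?D 1 = - s" by (simp_all add: diag_prod_def sigma_diag_def ij(1))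
  ultimately have "rdel ?D {0, 1}" by (intro R2_rdel) (simp_all add: adjacent_seg)
  from red1I[OF this] have "(?D, del_crossings {0, 1} ?D) \<in> vAC_rel n"
    using D del_AC vAC_step by blast
  moreover have "diag_iso (del_crossings {0, 1} ?D) diag_one"
  proof -
    have "strand (del_crossings {0, 1} ?D) a = []" for a by (simp add: strand_del strand_prod sigma_diag_def ij)
    then have "iso_by id (del_crossings {0, 1} ?D) diag_one" by (auto simp: iso_by_def diag_one_def crossings_def)
    then show ?thesis by (auto simp: diag_iso_iff)
  qed
  then have "(del_crossings {0, 1} ?D, diag_one) \<in> vAC_rel n" using D del_AC vAC_iso by blast
  ultimately show ?thesis by (rule vAC_trans)
qed

lemma R3_positive:
  assumes "x \<noteq> y" "x \<noteq> z" "y \<noteq> z" "seg D [Over x, Over y]" "seg D [Under x, Over z]" "seg D [Under y, Under z]"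
    and "csign D x = 1" "csign D y = 1" "csign D z = 1"
  shows "R3 D (R3_diag x y z D)"
  unfolding R3_iff using assms
  by (intro exI[of _ x] exI[of _ y] exI[of _ z] conjI bexI[of _ 1])
    (simp_all add: adjacent_seg order_sign_def follows_seg)

lemma relator_R3:
  assumes ijk: "i \<in> {1..n}" "j \<in> {1..n}" "k \<in> {1..n}" "i \<noteq> j" "i \<noteq> k" "j \<noteq> k"
  shows "(word_diag [((i, j), 1), ((i, k), 1), ((j, k), 1)], word_diag [((j, k), 1), ((i, k), 1), ((i, j), 1)]) \<in> vAC_rel n"
    (is "(?D, ?E) \<in> _")
proof -
  have w: "[((i, j), 1), ((i, k), 1), ((j, k), 1)] \<in> words (vPB_gens n)"
    "[((j, k), 1), ((i, k), 1), ((i, j), 1)] \<in> words (vPB_gens n)"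
    using ijk by (auto simp: words_simps vPB_gens_def)
  have D: "?D \<in> AC n" and E: "?E \<in> AC n" using word_AC w by blast+
  have T: "?D \<in> TD n" by (rule AC_TD[OF D])
  \<comment> \<open>The renamings of the iterated product call the three crossings 0, 1 and 3; they
    are \<open>x\<close>, \<open>y\<close>, \<open>z\<close> of the R3 move.\<close>
  have st: "strand ?D a = (if a = i then [Over 0, Over 1] else if a = j then [Under 0, Over 3]
      else if a = k then [Under 1, Under 3] else [])" for a
    using ijk by (simp add: strand_prod sigma_diag_def diag_one_def)
  have stE: "strand ?E a = (if a = i then [Over 1, Over 3] else if a = j then [Over 0, Under 3]
      else if a = k then [Under 0, Under 1] else [])" for a
    using ijk by (simp add: strand_prod sigma_diag_def diag_one_def)
  have cs: "csign ?D c = 1" "csign ?E c = 1" if "c \<in> {0, 1, 3}" for c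
    using that by (auto simp: diag_prod_def sigma_diag_def)
  have "strand ?D i = [] @ [Over 0, Over 1] @ []" "strand ?D j = [] @ [Under 0, Over 3] @ []"
    "strand ?D k = [] @ [Under 1, Under 3] @ []" using ijk by (simp_all only: st if_True if_False) auto
  then have sg: "seg ?D [Over 0, Over 1]" "seg ?D [Under 0, Over 3]" "seg ?D [Under 1, Under 3]"
    unfolding seg_def by blast+
  let ?F = "R3_diag 0 1 3 ?D"
  have "R3 ?D ?F"
    by (rule R3_positive[OF _ _ _ sg]) (use cs(1) in \<open>simp_all del: word_diag_simps\<close>)
  have "diag_iso ?E ?F"
  proof -
    have "strand ?F a = (if a = i then [Over 1, Over 0] else if a = j then [Over 3, Under 0]
      else if a = k then [Under 3, Under 1] else [])" for a
      using st[of a] R3_swap_simps[of 0 1 3] by (simp add: R3_diag_def del: word_diag_simps)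
    moreover have "crossings ?E \<subseteq> {0, 1, 3}"
      unfolding crossings_def stE by (auto split: if_splits)
    moreover have "csign ?F = csign ?D" by (simp add: R3_diag_def)
    ultimately have "iso_by (\<lambda>c. if c = 0 then 3 else if c = 3 then 0 else c) ?E ?F"
      unfolding iso_by_def stE using cs by (auto simp: inj_on_def simp del: word_diag_simps)
    then show ?thesis unfolding diag_iso_iff by blast
  qed
  then have F: "?F \<in> AC n" using iso_AC[OF E] by blast
  have "(?D, ?F) \<in> vAC_rel n" using vAC_step D F \<open>R3 ?D ?F\<close> by blast
  moreover have "(?F, ?E) \<in> vAC_rel n" using vAC_sym[OF vAC_iso[OF E \<open>diag_iso ?E ?F\<close>]] .
  ultimately show ?thesis by (rule vAC_trans)
qed

lemma relator_commute:
  assumes d: "{i, j, k, l} \<subseteq> {1..n}" "distinct [i, j, k, l]"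
  shows "(word_diag [((i, j), 1), ((k, l), 1)], word_diag [((k, l), 1), ((i, j), 1)]) \<in> vAC_rel n"
    (is "(?D, ?E) \<in> _")
proof (rule vAC_iso)
  show "?D \<in> AC n" using d by (intro word_AC) (auto simp: words_simps vPB_gens_def)
  have st: "strand ?D a = (if a = i then [Over 0] else if a = j then [Under 0]
      else if a = k then [Over 1] else if a = l then [Under 1] else [])" for a
    using d by (simp add: strand_prod sigma_diag_def diag_one_def)
  have stE: "strand ?E a = (if a = i then [Over 1] else if a = j then [Under 1]
      else if a = k then [Over 0] else if a = l then [Under 0] else [])" for a
    using d by (simp add: strand_prod sigma_diag_def diag_one_def)
  have cs: "csign ?D c = 1" "csign ?E c = 1" if "c \<in> {0, 1}" for c
    using that by (auto simp: diag_prod_def sigma_diag_def)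
  have "crossings ?D \<subseteq> {0, 1}"
    unfolding crossings_def st by (auto split: if_splits)
  then have "iso_by (\<lambda>c. if c = 0 then 1 else if c = 1 then 0 else c) ?D ?E"
    unfolding iso_by_def st stE using cs by (auto simp: inj_on_def simp del: word_diag_simps)
  then show "diag_iso ?D ?E" unfolding diag_iso_iff by blast
qed

lemma pres_eq_words:
  assumes R: "R \<subseteq> words S \<times> words S"
  shows "pres_eq S R u v \<Longrightarrow> u \<in> words S \<and> v \<in> words S"
  by (induction rule: pres_eq.induct) (use R in \<open>auto simp: words_simps\<close>)

lemma vPB_rels_words: "vPB_rels n \<subseteq> words (vPB_gens n) \<times> words (vPB_gens n)"
  by (auto simp: vPB_rels_def words_simps vPB_gens_def)

lemma word_diag_respects:
  assumes "pres_eq (vPB_gens n) (vPB_rels n) u v" shows "(word_diag u, word_diag v) \<in> vAC_rel n"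
  using assms
proof (induction rule: pres_eq.induct)
  case (refl w) then show ?case using word_AC vAC_refl by blast
next
  case (sym u v) then show ?case using vAC_sym by blast
next
  case (trans u v w) then show ?case using vAC_trans by blast
next
  case (congr u v x y)
  have w: "u \<in> words (vPB_gens n)" "v \<in> words (vPB_gens n)"
    using pres_eq_words[OF vPB_rels_words congr.hyps(1)] by auto
  have *: "(word_diag (x @ z @ y), diag_prod (word_diag x) (diag_prod (word_diag z) (word_diag y))) \<in> vAC_rel n"
    if "z \<in> words (vPB_gens n)" for z
  proof -
    have zy: "(diag_prod (word_diag z) (word_diag y), word_diag (z @ y)) \<in> vAC_rel n"
      by (rule vAC_iso[OF prod_AC word_append]) (use that congr.hyps word_AC in auto)
    have "(diag_prod (word_diag x) (word_diag (z @ y)), word_diag (x @ z @ y)) \<in> vAC_rel n"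
      by (rule vAC_iso[OF prod_AC word_append]) (use that congr.hyps in \<open>auto intro!: word_AC simp: words_simps\<close>)
    with vAC_prod[OF vAC_refl[OF word_AC[OF congr.hyps(2)]] zy]
    have "(diag_prod (word_diag x) (diag_prod (word_diag z) (word_diag y)), word_diag (x @ z @ y)) \<in> vAC_rel n"
      by (rule vAC_trans)
    then show ?thesis by (rule vAC_sym)
  qed
  have "(diag_prod (word_diag x) (diag_prod (word_diag u) (word_diag y)), diag_prod (word_diag x) (diag_prod (word_diag v) (word_diag y))) \<in> vAC_rel n"
    by (intro vAC_prod vAC_refl word_AC congr.hyps congr.IH)
  from vAC_trans[OF vAC_trans[OF *[OF w(1)] this] vAC_sym[OF *[OF w(2)]]] show ?case .
next
  case (cancel g s)
  have "(diag_prod (sigma_diag (g, s)) (diag_prod (sigma_diag (g, -s)) diag_one), 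
      diag_prod (sigma_diag (g, s)) (sigma_diag (g, -s))) \<in> vAC_rel n"
    using cancel by (intro vAC_prod vAC_refl vAC_iso prod_one prod_AC sigma_AC one_AC) auto
  then show ?case using sigma_cancel[of g n s] cancel vAC_trans by auto
next
  case (relator u v)
  from this[unfolded vPB_rels_def] show ?case
  proof (elim UnE CollectE exE conjE)
    fix i j k
    assume "(u, v) = ([((i, j), 1), ((i, k), 1), ((j, k), 1)], [((j, k), 1), ((i, k), 1), ((i, j), 1)])"
      and "{i, j, k} \<subseteq> {1..n}" "distinct [i, j, k]"
    then show ?thesis using relator_R3[of i n j k] by (simp del: word_diag_simps)
  next
    fix i j k l
    assume "(u, v) = ([((i, j), 1), ((k, l), 1)], [((k, l), 1), ((i, j), 1)])"
      and *: "{i, j, k, l} \<subseteq> {1..n}" "distinct [i, j, k, l]"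
    then show ?thesis using relator_commute[OF *] by (simp del: word_diag_simps)
  qed
qed

lemma UN_eq_const: "a \<in> A \<Longrightarrow> (\<And>x. x \<in> A \<Longrightarrow> f x = c) \<Longrightarrow> (\<Union>x\<in>A. f x) = c"
  by auto

lemma UN2_eq_const:
  assumes "a \<in> A" "b \<in> B" "\<And>x y. x \<in> A \<Longrightarrow> y \<in> B \<Longrightarrow> f x y = c"
  shows "(\<Union>x\<in>A. \<Union>y\<in>B. f x y) = c"
  by (rule UN_eq_const[OF assms(1)], rule UN_eq_const[OF assms(2)], rule assms(3))

abbreviation vPB_eq :: "nat \<Rightarrow> ((nat \<times> nat) \<times> int) list \<Rightarrow> ((nat \<times> nat) \<times> int) list \<Rightarrow> bool" where
  "vPB_eq n \<equiv> pres_eq (vPB_gens n) (vPB_rels n)"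

abbreviation vPB_class :: "nat \<Rightarrow> ((nat \<times> nat) \<times> int) list \<Rightarrow> ((nat \<times> nat) \<times> int) list set" where
  "vPB_class n w \<equiv> pres_rel (vPB_gens n) (vPB_rels n) `` {w}"

lemma pres_rel_equiv: "equiv (words (vPB_gens n)) (pres_rel (vPB_gens n) (vPB_rels n))"
proof (rule equivI)
  show "pres_rel (vPB_gens n) (vPB_rels n) \<subseteq> words (vPB_gens n) \<times> words (vPB_gens n)"
    using pres_eq_words[OF vPB_rels_words] by (auto simp: pres_rel_def)
  show "refl_on (words (vPB_gens n)) (pres_rel (vPB_gens n) (vPB_rels n))"
    by (auto simp: refl_on_def pres_rel_def intro: pres_eq.refl)
  show "sym (pres_rel (vPB_gens n) (vPB_rels n))"
    by (rule symI) (auto simp: pres_rel_def intro: pres_eq.sym)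
  show "trans (pres_rel (vPB_gens n) (vPB_rels n))"
    by (rule transI) (auto simp: pres_rel_def intro: pres_eq.trans)
qed

lemma carrier_vPB: "A \<in> carrier (vPB n) \<longleftrightarrow> (\<exists>w\<in>words (vPB_gens n). A = vPB_class n w)"
  unfolding vPB_def presented_group_def partial_object.simps quotient_def by blast

lemma vPB_class_eq: "vPB_eq n u v \<Longrightarrow> vPB_class n u = vPB_class n v"
  by (rule equiv_class_eq[OF pres_rel_equiv]) (simp add: pres_rel_def)

lemma mem_vPB_class: "v \<in> vPB_class n u \<longleftrightarrow> vPB_eq n u v"
  by (simp add: pres_rel_def)

lemma pres_eq_append:
  assumes "vPB_eq n u u'" "vPB_eq n v v'" shows "vPB_eq n (u @ v) (u' @ v')"
proof -
  have w: "u' \<in> words (vPB_gens n)" "v \<in> words (vPB_gens n)"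
    using pres_eq_words[OF vPB_rels_words] assms by blast+
  have "vPB_eq n ([] @ u @ v) ([] @ u' @ v)" by (rule pres_eq.congr[OF assms(1)]) (use w in \<open>auto simp: words_simps\<close>)
  moreover have "vPB_eq n (u' @ v @ []) (u' @ v' @ [])" by (rule pres_eq.congr[OF assms(2)]) (use w in \<open>auto simp: words_simps\<close>)
  ultimately show ?thesis using pres_eq.trans by auto
qed

lemma mult_vPB:
  assumes "u \<in> words (vPB_gens n)" "v \<in> words (vPB_gens n)"
  shows "vPB_class n u \<otimes>\<^bsub>vPB n\<^esub> vPB_class n v = vPB_class n (u @ v)"
  unfolding vPB_def presented_group_def monoid.simps
proof (rule UN2_eq_const)
  show "u \<in> vPB_class n u" "v \<in> vPB_class n v"
    unfolding mem_vPB_class using assms by (auto intro: pres_eq.refl)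
  fix u' v' assume "u' \<in> vPB_class n u" "v' \<in> vPB_class n v"
  then show "vPB_class n (u' @ v') = vPB_class n (u @ v)"
    unfolding mem_vPB_class by (intro vPB_class_eq[symmetric] pres_eq_append)
qed

lemma iota_class:
  assumes "w \<in> words (vPB_gens n)" shows "iota_bar_v n (vPB_class n w) = vAC_rel n `` {word_diag w}"
  unfolding iota_bar_v_def
proof (rule UN_eq_const)
  show "w \<in> vPB_class n w" unfolding mem_vPB_class by (rule pres_eq.refl[OF assms])
  fix v assume "v \<in> vPB_class n w"
  then have "(word_diag w, word_diag v) \<in> vAC_rel n" unfolding mem_vPB_class by (rule word_diag_respects)
  then show "vAC_rel n `` {word_diag v} = vAC_rel n `` {word_diag w}"
    by (rule equiv_class_eq[OF vAC_rel_equiv, symmetric])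
qed

lemma mult_vAC:
  assumes "D \<in> AC n" "E \<in> AC n"
  shows "vAC_rel n `` {D} \<otimes>\<^bsub>vAC n\<^esub> vAC_rel n `` {E} = vAC_rel n `` {diag_prod D E}"
  unfolding vAC_def monoid.simps
proof (rule UN2_eq_const)
  show "D \<in> vAC_rel n `` {D}" "E \<in> vAC_rel n `` {E}" using assms vAC_refl by auto
  fix D' E' assume "D' \<in> vAC_rel n `` {D}" "E' \<in> vAC_rel n `` {E}"
  then have "(diag_prod D E, diag_prod D' E') \<in> vAC_rel n" by (simp add: vAC_prod)
  then show "vAC_rel n `` {diag_prod D' E'} = vAC_rel n `` {diag_prod D E}"
    by (rule equiv_class_eq[OF vAC_rel_equiv, symmetric])
qed

lemma iota_hom: "iota_bar_v n \<in> hom (vPB n) (vAC n)"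
proof (rule homI)
  fix A assume "A \<in> carrier (vPB n)"
  then obtain w where w: "w \<in> words (vPB_gens n)" "A = vPB_class n w" unfolding carrier_vPB by blast
  show "iota_bar_v n A \<in> carrier (vAC n)"
    unfolding w(2) iota_class[OF w(1)] vAC_def partial_object.simps by (intro quotientI word_AC w)
next
  fix A B assume "A \<in> carrier (vPB n)" "B \<in> carrier (vPB n)"
  then obtain u v where uv: "u \<in> words (vPB_gens n)" "v \<in> words (vPB_gens n)" 
    and AB: "A = vPB_class n u" "B = vPB_class n v" unfolding carrier_vPB by blast
  have "(diag_prod (word_diag u) (word_diag v), word_diag (u @ v)) \<in> vAC_rel n"
    using vAC_iso[OF prod_AC word_append] word_AC uv by blast
  then have "vAC_rel n `` {word_diag (u @ v)} = vAC_rel n `` {diag_prod (word_diag u) (word_diag v)}"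
    using equiv_class_eq[OF vAC_rel_equiv] by metis
  then show "iota_bar_v n (A \<otimes>\<^bsub>vPB n\<^esub> B) = iota_bar_v n A \<otimes>\<^bsub>vAC n\<^esub> iota_bar_v n B"
    unfolding AB mult_vPB[OF uv] iota_class[OF uv(1)] iota_class[OF uv(2)]
      mult_vAC[OF word_AC[OF uv(1)] word_AC[OF uv(2)]]
    using uv by (simp add: iota_class words_simps del: word_diag_simps)
qed

section \<open>Division of OU diagrams by generators\<close>

text \<open>Coordinates for OU diagrams: with the over part \<open>W\<close> and the under part
  \<open>V\<close> as lists of names, prefixes, parallels and deletions become plain list
  operations.\<close>

definition ou :: "(nat \<Rightarrow> nat list) \<Rightarrow> (nat \<Rightarrow> nat list) \<Rightarrow> (nat \<Rightarrow> int) \<Rightarrow> vdiag" where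
  "ou W V g = \<lparr> strand = (\<lambda>a. map Over (W a) @ map Under (V a)), csign = g \<rparr>"

lemma strand_ou: "strand (ou W V g) a = map Over (W a) @ map Under (V a)"
  and csign_ou [simp]: "csign (ou W V g) = g"
  by (simp_all add: ou_def)

lemma OU_ou: "OU (ou W V g)"
  by (auto simp: OU_def strand_ou)

lemma OU_obtain:
  assumes "OU D" obtains W V where "D = ou W V (csign D)"
proof -
  from assms have "\<forall>a. \<exists>x. strand D a = map Over (fst x) @ map Under (snd x)" by (auto simp: OU_def)
  then obtain f where f: "\<And>a. strand D a = map Over (fst (f a)) @ map Under (snd (f a))" by metis
  have "D = ou (fst \<circ> f) (snd \<circ> f) (csign D)"
    by (rule vdiag.equality) (auto simp: ou_def fun_eq_iff f)
  then show ?thesis by (rule that)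
qed

lemma points_ou: "Over c \<in> points (ou W V g) \<longleftrightarrow> (\<exists>a. c \<in> set (W a))"
  "Under c \<in> points (ou W V g) \<longleftrightarrow> (\<exists>a. c \<in> set (V a))"
  by (auto simp: points_def strand_ou)

lemma crossings_ou: "crossings (ou W V g) = (\<Union>a. set (W a))"
  by (auto simp: crossings_points points_ou)

lemma ou_TD: "ou W V g \<in> TD n \<longleftrightarrow>
    (\<forall>a. a \<notin> {1..n} \<longrightarrow> W a = [] \<and> V a = []) \<and>
    (\<forall>a. distinct (W a)) \<and> (\<forall>a. distinct (V a)) \<and>
    (\<forall>a b. a \<noteq> b \<longrightarrow> set (W a) \<inter> set (W b) = {}) \<and>
    (\<forall>a b. a \<noteq> b \<longrightarrow> set (V a) \<inter> set (V b) = {}) \<and>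
    (\<forall>c. (\<exists>a. c \<in> set (W a)) \<longleftrightarrow> (\<exists>a. c \<in> set (V a))) \<and>
    (\<forall>c a. c \<in> set (W a) \<longrightarrow> g c = 1 \<or> g c = -1)"
proof -
  have 1: "distinct (map Over xs @ map Under ys) \<longleftrightarrow> distinct xs \<and> distinct ys" for xs ys :: "nat list"
    by (auto simp: distinct_map inj_on_def)
  have 2: "set (map Over xs @ map Under ys) \<inter> set (map Over us @ map Under vs) = {} \<longleftrightarrow>
    set xs \<inter> set us = {} \<and> set ys \<inter> set vs = {}" for xs ys us vs :: "nat list"
    by auto
  show ?thesis unfolding TD_iff strand_ou points_ou 1 2 by (simp add: ou_def) blast
qed

definition nxt :: "(nat \<Rightarrow> nat list) \<Rightarrow> nat \<Rightarrow> nat \<Rightarrow> bool" where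
  "nxt V x y \<longleftrightarrow> (\<exists>a xs ys. V a = xs @ [x, y] @ ys)"

lemma OU_split:
  fixes ws vs :: "nat list"
  assumes "map Over ws @ map Under vs = xs @ ps @ ys"
  shows "\<exists>ws1 ws2 ws3 vs1 vs2 vs3. ws = ws1 @ ws2 @ ws3 \<and> vs = vs1 @ vs2 @ vs3 \<and>
    xs = map Over ws1 @ map Under vs1 \<and> ps = map Over ws2 @ map Under vs2 \<and> ys = map Over ws3 @ map Under vs3"
proof -
  have split2: "\<exists>ws1 ws2 vs1 vs2. ws = ws1 @ ws2 \<and> vs = vs1 @ vs2 \<and>
    xs = map Over ws1 @ map Under vs1 \<and> ys = map Over ws2 @ map Under vs2"
    if "map Over ws @ map Under vs = xs @ ys" for ws vs :: "nat list" and xs ys :: "nat endpt list"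
  proof -
    from that consider us where "xs = map Over ws @ us" "map Under vs = us @ ys"
      | us where "map Over ws = xs @ us" "ys = us @ map Under vs"
      unfolding append_eq_append_conv2 by metis
    then show ?thesis
    proof cases
      case 1
      then show ?thesis unfolding map_eq_append_conv by (metis append_Nil append_Nil2 list.simps(8))
    next
      case 2
      then show ?thesis unfolding map_eq_append_conv by (metis append_Nil append_Nil2 list.simps(8))
    qed
  qed
  obtain ws1 wsr vs1 vsr where 1: "ws = ws1 @ wsr" "vs = vs1 @ vsr" "xs = map Over ws1 @ map Under vs1"
    "ps @ ys = map Over wsr @ map Under vsr" using split2[OF assms] by metis
  obtain ws2 ws3 vs2 vs3 where "wsr = ws2 @ ws3" "vsr = vs2 @ vs3" "ps = map Over ws2 @ map Under vs2"
    "ys = map Over ws3 @ map Under vs3" using split2[OF 1(4)[symmetric]] by metis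
  then show ?thesis using 1 by blast
qed

lemma seg_ou_Under: "seg (ou W V g) [Under x, Under y] \<longleftrightarrow> nxt V x y"
proof
  assume "seg (ou W V g) [Under x, Under y]"
  then obtain a xs ys where "map Over (W a) @ map Under (V a) = xs @ [Under x, Under y] @ ys"
    by (auto simp: seg_def strand_ou)
  from OU_split[OF this] obtain vs1 vs2 vs3 ws2 where
    "V a = vs1 @ vs2 @ vs3" "[Under x, Under y] = map Over ws2 @ map Under vs2" by blast
  moreover from this have "vs2 = [x, y]" by (cases ws2) (auto simp: map_eq_Cons_conv)
  ultimately show "nxt V x y" unfolding nxt_def by blast
next
  assume "nxt V x y"
  then obtain a xs ys where "V a = xs @ [x, y] @ ys" by (auto simp: nxt_def)
  then have "strand (ou W V g) a = (map Over (W a) @ map Under xs) @ [Under x, Under y] @ map Under ys"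
    by (simp add: strand_ou)
  then show "seg (ou W V g) [Under x, Under y]" unfolding seg_def by blast
qed

lemma seg_ou_Over: "seg (ou W V g) [Over x, Over y] \<longleftrightarrow> nxt W x y"
proof
  assume "seg (ou W V g) [Over x, Over y]"
  then obtain a xs ys where "map Over (W a) @ map Under (V a) = xs @ [Over x, Over y] @ ys"
    by (auto simp: seg_def strand_ou)
  from OU_split[OF this] obtain ws1 ws2 ws3 vs2 where
    "W a = ws1 @ ws2 @ ws3" "[Over x, Over y] = map Over ws2 @ map Under vs2" by blast
  moreover from this have "ws2 = [x, y]"
    by (cases vs2 rule: rev_cases) (auto simp: map_eq_Cons_conv Cons_eq_append_conv Cons_eq_map_conv)
  ultimately show "nxt W x y" unfolding nxt_def by blast
next
  assume "nxt W x y"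
  then obtain a xs ys where "W a = xs @ [x, y] @ ys" by (auto simp: nxt_def)
  then have "strand (ou W V g) a = map Over xs @ [Over x, Over y] @ map Over ys @ map Under (V a)"
    by (simp add: strand_ou)
  then show "seg (ou W V g) [Over x, Over y]" unfolding seg_def by blast
qed

lemma seg_ou_Over_Under:
  assumes "seg (ou W V g) [Over x, Under y]"
  shows "\<exists>a xs ys. W a = xs @ [x] \<and> V a = y # ys"
proof -
  from assms obtain a xs ys where "map Over (W a) @ map Under (V a) = xs @ [Over x, Under y] @ ys"
    by (auto simp: seg_def strand_ou)
  from OU_split[OF this] obtain ws1 ws2 ws3 vs1 vs2 vs3 where
    *: "W a = ws1 @ ws2 @ ws3" "V a = vs1 @ vs2 @ vs3" "[Over x, Under y] = map Over ws2 @ map Under vs2"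
    "xs = map Over ws1 @ map Under vs1" "ys = map Over ws3 @ map Under vs3" by blast
  then have "ws2 = [x]" "vs2 = [y]"
    by (cases ws2; auto simp: Cons_eq_append_conv Cons_eq_map_conv map_eq_Cons_conv)+
  moreover have "vs1 = [] \<and> ws3 = []"
    using \<open>map Over (W a) @ map Under (V a) = xs @ [Over x, Under y] @ ys\<close> *(1,2,4,5) calculation
    by (cases ws3; cases vs1; auto simp: append_eq_append_conv2 append_eq_Cons_conv Cons_eq_append_conv map_eq_append_conv)
  ultimately show ?thesis using * by auto
qed

lemma seg_ou_Under_Over: "\<not> seg (ou W V g) [Under x, Over y]"
proof
  assume "seg (ou W V g) [Under x, Over y]"
  then obtain a xs ys where "map Over (W a) @ map Under (V a) = xs @ [Under x, Over y] @ ys"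
    by (auto simp: seg_def strand_ou)
  from OU_split[OF this] obtain ws2 vs2 where "[Under x, Over y] = map Over ws2 @ map Under vs2" by blast
  then show False by (cases ws2) (auto simp: Cons_eq_map_conv)
qed

text \<open>The sign rule under which a crossing \<open>e\<close> of sign \<open>-s\<close>,
  standing right before \<open>Over p\<close> with its over point and right before
  \<open>Over q\<close> with its under point, can pass both by an R3 move with \<open>x = e\<close>,
  \<open>y = p\<close>, \<open>z = q\<close>: the orders on the top and middle segments force equal
  signs of \<open>p\<close> and \<open>q\<close>, and the order of their unders then depends on
  \<open>s * g q\<close>.\<close>

definition par :: "(nat \<Rightarrow> nat list) \<Rightarrow> (nat \<Rightarrow> int) \<Rightarrow> int \<Rightarrow> nat \<Rightarrow> nat \<Rightarrow> bool" where
  "par V g s p q \<longleftrightarrow> g p = g q \<and> (if s * g q = 1 then nxt V q p else nxt V p q)"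

definition tr :: "nat \<Rightarrow> nat \<Rightarrow> nat \<Rightarrow> nat" where
  "tr p q x = (if x = p then q else if x = q then p else x)"

text \<open>The product of the transpositions of corresponding entries: the accumulated effect on
  the unders of the R3 moves that push a crossing through all pairs.\<close>

fun trs :: "nat list \<Rightarrow> nat list \<Rightarrow> nat \<Rightarrow> nat" where
  "trs (p # ps) (q # qs) x = trs ps qs (tr p q x)"
| "trs _ _ x = x"

lemma trs_other: "x \<notin> set ps \<Longrightarrow> x \<notin> set qs \<Longrightarrow> trs ps qs x = x"
  by (induction ps qs x rule: trs.induct) (auto simp: tr_def)

lemma trs_nth:
  "length ps = length qs \<Longrightarrow> distinct (ps @ qs) \<Longrightarrow> m < length ps \<Longrightarrow>
    trs ps qs (ps ! m) = qs ! m \<and> trs ps qs (qs ! m) = ps ! m"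
proof (induction ps qs arbitrary: m rule: list_induct2)
  case (Cons p ps q qs)
  show ?case
  proof (cases m)
    case 0
    then show ?thesis using Cons.prems trs_other by (auto simp: tr_def)
  next
    case (Suc k)
    then have "ps ! k \<in> set ps" "qs ! k \<in> set qs" using Cons by auto
    then show ?thesis using Cons Suc by (auto simp: tr_def)
  qed
qed simp

lemma trs_range:
  assumes "length ps = length qs" "distinct (ps @ qs)"
  shows "trs ps qs x \<in> set ps \<longleftrightarrow> x \<in> set qs" "trs ps qs x \<in> set qs \<longleftrightarrow> x \<in> set ps" "trs ps qs (trs ps qs x) = x"
proof -
  consider (p) m where "m < length ps" "x = ps ! m" | (q) m where "m < length ps" "x = qs ! m" 
    | (o) "x \<notin> set ps" "x \<notin> set qs" using assms(1) by (metis in_set_conv_nth)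
  then have "(trs ps qs x \<in> set ps \<longleftrightarrow> x \<in> set qs) \<and> (trs ps qs x \<in> set qs \<longleftrightarrow> x \<in> set ps) \<and> trs ps qs (trs ps qs x) = x"
  proof cases
    case p
    then show ?thesis using trs_nth[OF assms, of m] assms by auto (metis IntI nth_mem empty_iff)+
  next
    case q
    then show ?thesis using trs_nth[OF assms, of m] assms by auto (metis IntI nth_mem empty_iff)+
  next
    case o
    then show ?thesis using trs_other by auto
  qed
  then show "trs ps qs x \<in> set ps \<longleftrightarrow> x \<in> set qs" "trs ps qs x \<in> set qs \<longleftrightarrow> x \<in> set ps" "trs ps qs (trs ps qs x) = x" by auto
qed

lemma inj_trs: "length ps = length qs \<Longrightarrow> distinct (ps @ qs) \<Longrightarrow> inj (trs ps qs)"
  by (rule inj_on_inverseI[of _ "trs ps qs"]) (rule trs_range(3))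

lemma nxt_map: "nxt V x y \<Longrightarrow> nxt (\<lambda>a. map f (V a)) (f x) (f y)"
proof -
  assume "nxt V x y"
  then obtain a xs ys where "V a = xs @ [x, y] @ ys" unfolding nxt_def by blast
  then have "map f (V a) = map f xs @ [f x, f y] @ map f ys" by simp
  then show ?thesis unfolding nxt_def by blast
qed

text \<open>
  The diagram with overs \<open>W\<close> and unders \<open>V\<close> to which a crossing \<open>e\<close> of strand \<open>i\<close> over strand \<open>j\<close> has
  been added within the overs of these two strands.
\<close>

definition mix :: "nat \<Rightarrow> nat \<Rightarrow> nat \<Rightarrow> nat list \<Rightarrow> nat list \<Rightarrow> nat list \<Rightarrow> nat list \<Rightarrow>
    (nat \<Rightarrow> nat list) \<Rightarrow> (nat \<Rightarrow> nat list) \<Rightarrow> (nat \<Rightarrow> int) \<Rightarrow> vdiag" where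
  "mix i j e A1 A2 B1 B2 W V g = \<lparr> strand = (\<lambda>a.
     (if a = i then map Over A1 @ Over e # map Over A2
      else if a = j then map Over B1 @ Under e # map Over B2 else map Over (W a)) @ map Under (V a)),
     csign = g \<rparr>"

lemma sorted_wrt_const:
  fixes lev :: "'a \<Rightarrow> nat"
  shows "(\<And>x. x \<in> set xs \<Longrightarrow> lev x = k) \<Longrightarrow> sorted_wrt (\<lambda>p q. lev p \<le> lev q) xs"
  by (induction xs) auto

text \<open>\<open>Under e\<close> is the only under point in front of overs. It gets level 1 and
  the overs behind it level 2; all other overs have level 0 and all other unders level 3.\<close>

lemma mix_AC:
  assumes T: "mix i j e A1 A2 B1 B2 W V g \<in> TD n" and ij: "i \<noteq> j"
  shows "mix i j e A1 A2 B1 B2 W V g \<in> AC n"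
proof -
  let ?D = "mix i j e A1 A2 B1 B2 W V g"
  define lev where "lev p = (if p \<in> Over ` set B2 then 2 else if p = Under e then 1
    else case p of Over c \<Rightarrow> 0 | Under c \<Rightarrow> (3::nat))" for p
  have sj: "strand ?D j = map Over B1 @ Under e # map Over B2 @ map Under (V j)" using ij by (simp add: mix_def)
  have si: "strand ?D i = map Over A1 @ Over e # map Over A2 @ map Under (V i)" by (simp add: mix_def)
  have so: "strand ?D a = map Over (W a) @ map Under (V a)" if "a \<noteq> i" "a \<noteq> j" for a using that by (simp add: mix_def)
  have dis: "distinct (strand ?D j)" using T by (simp add: TD_iff)
  have uniq: "a = j" if "x \<in> set (strand ?D a)" "x \<in> set (strand ?D j)" for x a
    using TD_strand_unique[OF T] that by blast
  have l0: "lev (Over c) = 0" if "Over c \<in> set (strand ?D a)" "c \<notin> set B2 \<or> a \<noteq> j" for c a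
    using that uniq[of "Over c" a] sj by (auto simp: lev_def)
  have l3: "lev (Under c) = 3" if "c \<in> set (V a)" for c a
    using that uniq[of "Under e" a] dis sj by (auto simp: lev_def mix_def split: if_splits)
  have l2: "lev (Over c) = 2" if "c \<in> set B2" for c using that by (simp add: lev_def)
  have l1: "lev (Under e) = 1" by (auto simp: lev_def)
  have V: "sorted_wrt (\<lambda>p q. lev p \<le> lev q) (map Under (V a))" for a
    by (rule sorted_wrt_const[of _ _ 3]) (auto intro: l3)
  have O0: "sorted_wrt (\<lambda>p q. lev p \<le> lev q) (map Over ws)" "\<And>x. x \<in> set ws \<Longrightarrow> lev (Over x) = 0"
    if st: "strand ?D a = map Over ws @ map Under (V a)" and a: "a \<noteq> j" for ws a
  proof -
    show l: "lev (Over x) = 0" if "x \<in> set ws" for x using l0[of x a] that st a by simp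
    show "sorted_wrt (\<lambda>p q. lev p \<le> lev q) (map Over ws)"
      by (rule sorted_wrt_const[of _ _ 0]) (use l in auto)
  qed
  show ?thesis
  proof (rule levels_AC[OF T])
    fix a
    consider "a = j" | "a = i" "a \<noteq> j" | "a \<noteq> i" "a \<noteq> j" by blast
    then show "sorted_wrt (\<lambda>p q. lev p \<le> lev q) (strand ?D a)"
    proof cases
      case 1
      have "set B1 \<inter> set B2 = {}" using dis sj by auto
      have B1: "lev p = 0" if p: "p \<in> set (map Over B1)" for p
      proof -
        obtain x where "p = Over x" "x \<in> set B1" using p by auto
        then show ?thesis using \<open>set B1 \<inter> set B2 = {}\<close> l0[of x j] sj by (simp add: disjoint_iff)
      qed
      have B2: "lev p = 2" if "p \<in> set (map Over B2)" for p using that l2 by auto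
      have "sorted_wrt (\<lambda>p q. lev p \<le> lev q) (map Over B1)" "sorted_wrt (\<lambda>p q. lev p \<le> lev q) (map Over B2)"
        using sorted_wrt_const[of "map Over B1" lev 0] sorted_wrt_const[of "map Over B2" lev 2] B1 B2 by blast+
      then show ?thesis
        unfolding 1 sj using V[of j] B1 B2 l1 l3[of _ j] by (auto simp: sorted_wrt_append)
    next
      case 2
      have "strand ?D i = map Over (A1 @ e # A2) @ map Under (V i)" using si by simp
      from O0[OF this ij] V[of i] show ?thesis
        unfolding 2 \<open>strand ?D i = map Over (A1 @ e # A2) @ map Under (V i)\<close> sorted_wrt_append[of _ "map Over _"]
        using l3 by (auto simp del: map_append list.map)
    next
      case 3
      from O0[OF so[OF 3] 3(2)] V[of a] show ?thesis unfolding so[OF 3] sorted_wrt_append using l3 by auto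
    qed
  next
    fix c assume "c \<in> crossings ?D"
    have "Over e \<in> set (strand ?D i)" by (simp add: mix_def)
    then have "e \<notin> set B2" using uniq[of "Over e" i] ij sj by auto
    then show "lev (Over c) < lev (Under c)" by (auto simp: lev_def)
  qed
qed

lemma R3_diag_TD:
  assumes D: "D \<in> TD n" and c: "x \<in> crossings D" "y \<in> crossings D" "z \<in> crossings D"
    and ne: "x \<noteq> y" "x \<noteq> z" "y \<noteq> z"
  shows "R3_diag x y z D \<in> TD n"
proof -
  have ss: "R3_swap x y z (R3_swap x y z p) = p" for p by (rule R3_swap_swap[OF ne])
  have mem: "R3_swap x y z p \<in> points D" if "p \<in> points D" for p
  proof -
    consider "p = Over x" | "p = Over y" | "p = Under x" | "p = Over z" | "p = Under y" | "p = Under z"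
      | "cname p \<notin> {x, y, z}" by (cases p) auto
    then show ?thesis by cases (use that c points_iff[OF D] in \<open>simp_all add: R3_swap_simps[OF ne]\<close>)
  qed
  have pts: "points (R3_diag x y z D) = points D"
  proof -
    have "points (R3_diag x y z D) = R3_swap x y z ` points D" by (auto simp: points_def R3_diag_def)
    also have "\<dots> = points D" using mem ss by (metis image_iff subsetI subset_antisym image_subsetI)
    finally show ?thesis .
  qed
  have st: "strand (R3_diag x y z D) a = concat (map (\<lambda>p. [R3_swap x y z p]) (strand D a))" for a
    by (simp add: R3_diag_def)
  show ?thesis
  proof (rule TD_subst[OF D st])
  show "(Over c \<in> points (R3_diag x y z D)) = (Under c \<in> points (R3_diag x y z D))" for c
    unfolding pts by (rule TD_points[OF D])
  show "csign (R3_diag x y z D) c = 1 \<or> csign (R3_diag x y z D) c = - 1" if "c \<in> crossings (R3_diag x y z D)" for c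
    using that TD_sign[OF D] unfolding crossings_points pts by (simp add: R3_diag_def)
  show "set [R3_swap x y z p] \<inter> set [R3_swap x y z q] = {}" if "p \<noteq> q" for p q
    using that ss by (auto, metis)
qed simp
qed

lemma R3_intro:
  assumes "adjacent D (Over x) (Over y)" "adjacent D (Under x) (Over z)" "adjacent D (Under y) (Under z)"
    "order_sign D (Over x) (Over y) = d * csign D y" "order_sign D (Under x) (Over z) = d * csign D z"
    "order_sign D (Under y) (Under z) = d * csign D x * csign D y * csign D z"
    "d \<in> {1, -1}" "x \<noteq> y" "x \<noteq> z" "y \<noteq> z"
  shows "R3 D (R3_diag x y z D)"
  unfolding R3_iff using assms(1-6,8-10)
  by (rule_tac exI[of _ x], rule_tac exI[of _ y], rule_tac exI[of _ z])
    (intro conjI bexI[OF _ assms(7)]; simp)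

text \<open>This is one R3 move with \<open>x = e\<close>, \<open>y = p\<close>,
  \<open>z = q\<close>. On the strands \<open>i\<close> and \<open>j\<close> the crossing
  \<open>e\<close> advances by one place, and the exchange on the bottom segment is the
  transposition \<open>tr p q\<close> of the unders.\<close>

lemma mix_step:
  assumes T: "mix i j e A1 (p # A2) B1 (q # B2) W V g \<in> TD n" and ij: "i \<noteq> j"
    and par: "par V g s p q" and s: "g e = - s" "s \<in> {1, -1}"
  shows "(mix i j e A1 (p # A2) B1 (q # B2) W V g,
      mix i j e (A1 @ [p]) A2 (B1 @ [q]) B2 W (\<lambda>a. map (tr p q) (V a)) g) \<in> vAC_rel n"
proof -
  let ?D = "mix i j e A1 (p # A2) B1 (q # B2) W V g"
  let ?E = "mix i j e (A1 @ [p]) A2 (B1 @ [q]) B2 W (\<lambda>a. map (tr p q) (V a)) g"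
  have si: "strand ?D i = map Over A1 @ [Over e, Over p] @ (map Over A2 @ map Under (V i))" by (simp add: mix_def)
  have sj: "strand ?D j = map Over B1 @ [Under e, Over q] @ (map Over B2 @ map Under (V j))" using ij by (simp add: mix_def)
  have so: "strand ?D a = map Over (W a) @ map Under (V a)" if "a \<noteq> i" "a \<noteq> j" for a using that by (simp add: mix_def)
  have dis: "distinct (strand ?D a)" for a using T by (simp add: TD_iff)
  have uniq: "a = b" if "x \<in> set (strand ?D a)" "x \<in> set (strand ?D b)" for x a b
    using TD_strand_unique[OF T] that by blast
  have cr: "e \<in> crossings ?D" "p \<in> crossings ?D" "q \<in> crossings ?D"
    unfolding crossings_def using si sj by (metis (mono_tags) in_set_conv_decomp append_Cons append_Nil append_assoc mem_Collect_eq)+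
  have ne: "e \<noteq> p" "e \<noteq> q" "p \<noteq> q"
    using dis[of i] uniq[of "Over q" i j] si sj ij by auto
  have gq: "g q = 1 \<or> g q = -1" and gp: "g p = g q"
    using TD_sign[OF T cr(3)] par by (auto simp: mix_def par_def)
  have sg: "seg ?D [Over e, Over p]" "seg ?D [Under e, Over q]" unfolding seg_def using si sj by blast+
  have "seg ?D [Under x, Under y]" if xy: "nxt V x y" for x y
  proof -
    obtain a xs ys where "V a = xs @ [x, y] @ ys" using xy unfolding nxt_def by blast
    then have "\<exists>zs. strand ?D a = zs @ [Under x, Under y] @ map Under ys"
      by (auto simp: mix_def)
    then show ?thesis unfolding seg_def by blast
  qed
  then have U: "if s * g q = 1 then seg ?D [Under q, Under p] else seg ?D [Under p, Under q]"
    using par by (auto simp: par_def)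
  have R: "R3 ?D (R3_diag e p q ?D)"
  proof -
    have a: "adjacent ?D (Over e) (Over p)" "adjacent ?D (Under e) (Over q)" using sg by (auto simp: adjacent_seg)
    have b: "adjacent ?D (Under p) (Under q)" using U by (auto simp: adjacent_seg split: if_splits)
    have cg: "csign ?D = g" by (simp add: mix_def)
    have c: "order_sign ?D (Over e) (Over p) = g q * csign ?D p" "order_sign ?D (Under e) (Over q) = g q * csign ?D q"
      using sg gq gp by (auto simp: order_sign_def follows_seg cg)
    have d: "order_sign ?D (Under p) (Under q) = g q * csign ?D e * csign ?D p * csign ?D q"
      using U s gq gp seg_antisym[OF T, of "Under q" "Under p"] by (auto simp: order_sign_def follows_seg cg)
    have g: "g q \<in> {1, -1}" using gq by auto
    show ?thesis by (rule R3_intro[OF a b c d g ne])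
  qed
  have "R3_diag e p q ?D = ?E"
  proof (rule vdiag.equality)
    have O: "R3_swap e p q (Over x) = Over x" if "x \<noteq> e" "x \<noteq> p" "x \<noteq> q" for x
      using that R3_swap_simps(7)[OF ne, of "Over x"] by simp
    have Un: "R3_swap e p q (Under x) = Under (tr p q x)" if "x \<noteq> e" for x
      using that R3_swap_simps[OF ne] by (cases "x = p \<or> x = q") (auto simp: tr_def)
    show "strand (R3_diag e p q ?D) = strand ?E"
    proof
      fix a
      have Ve: "e \<notin> set (V a)" using uniq[of "Under e" a j] sj dis[of j] by (auto simp: mix_def split: if_splits)
      then have "R3_swap e p q (Under x) = Under (tr p q x)" if "x \<in> set (V a)" for x
        using Un[of x] that by metis
      then have VU: "map (R3_swap e p q) (map Under (V a)) = map Under (map (tr p q) (V a))" by simp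
      have OO: "map (R3_swap e p q) (map Over xs) = map Over xs" if "e \<notin> set xs" "p \<notin> set xs" "q \<notin> set xs" for xs
      proof -
        have "R3_swap e p q (Over x) = Over x" if "x \<in> set xs" for x
          using O[of x] that \<open>e \<notin> set xs\<close> \<open>p \<notin> set xs\<close> \<open>q \<notin> set xs\<close> by metis
        then show ?thesis by simp
      qed
      consider "a = i" | "a = j" "a \<noteq> i" | "a \<noteq> i" "a \<noteq> j" by blast
      then show "strand (R3_diag e p q ?D) a = strand ?E a"
      proof cases
        case 1
        have A: "e \<notin> set A1" "p \<notin> set A1" "e \<notin> set A2" "p \<notin> set A2" using dis[of i] si by auto
        have q: "q \<notin> set A1" "q \<notin> set A2" using uniq[of "Over q" i j] si sj ij by auto
        have "strand (R3_diag e p q ?D) i = map (R3_swap e p q) (strand ?D i)" by (simp add: R3_diag_def)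
        also have "\<dots> = map Over A1 @ [Over p, Over e] @ (map Over A2 @ map Under (map (tr p q) (V i)))"
          unfolding si map_append list.map R3_swap_simps[OF ne] OO[OF A(1,2) q(1)] OO[OF A(3,4) q(2)]
          using VU 1 by (simp only:)
        finally show ?thesis using 1 by (simp add: mix_def)
      next
        case 2
        have B: "q \<notin> set B1" "q \<notin> set B2" using dis[of j] sj by auto
        have e: "e \<notin> set B1" "e \<notin> set B2" "p \<notin> set B1" "p \<notin> set B2"
          using uniq[of "Over e" i j] uniq[of "Over p" i j] si sj ij by auto
        have "strand (R3_diag e p q ?D) j = map (R3_swap e p q) (strand ?D j)" by (simp add: R3_diag_def)
        also have "\<dots> = map Over B1 @ [Over q, Under e] @ (map Over B2 @ map Under (map (tr p q) (V j)))"
          unfolding sj map_append list.map R3_swap_simps[OF ne] OO[OF e(1,3) B(1)] OO[OF e(2,4) B(2)]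
          using VU 2 by (simp only:)
        finally show ?thesis using 2 ij by (simp add: mix_def)
      next
        case 3
        have w: "e \<notin> set (W a)" "p \<notin> set (W a)" "q \<notin> set (W a)"
          using uniq[of "Over e" i a] uniq[of "Over p" i a] uniq[of "Over q" j a] si sj so[OF 3] 3 by auto
        have "strand (R3_diag e p q ?D) a = map (R3_swap e p q) (strand ?D a)" by (simp add: R3_diag_def)
        also have "\<dots> = map Over (W a) @ map Under (map (tr p q) (V a))"
          unfolding so[OF 3] map_append OO[OF w] using VU by (simp only:)
        finally show ?thesis using 3 by (simp add: mix_def)
      qed
    qed
  qed (simp_all add: R3_diag_def mix_def)
  moreover from this have "?E \<in> TD n" using R3_diag_TD[OF T cr ne] by simp
  then have "?E \<in> AC n" by (rule mix_AC[OF _ ij])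
  ultimately show ?thesis using vAC_step[OF mix_AC[OF T ij]] R by metis
qed

lemma mix_steps:
  assumes "length ps = length qs" "list_all2 (par V g s) ps qs" "distinct (ps @ qs)" "i \<noteq> j" "g e = - s" "s \<in> {1, -1}"
    and "mix i j e A1 (ps @ R) B1 qs W V g \<in> TD n"
  shows "(mix i j e A1 (ps @ R) B1 qs W V g,
      mix i j e (A1 @ ps) R (B1 @ qs) [] W (\<lambda>a. map (trs ps qs) (V a)) g) \<in> vAC_rel n"
  using assms
proof (induction ps qs arbitrary: A1 B1 V rule: list_induct2)
  case Nil
  then show ?case using mix_AC vAC_refl by (simp add: comp_def)
next
  case (Cons p ps q qs)
  let ?V = "\<lambda>a. map (tr p q) (V a)"
  have st: "(mix i j e A1 (p # ps @ R) B1 (q # qs) W V g, mix i j e (A1 @ [p]) (ps @ R) (B1 @ [q]) qs W ?V g) \<in> vAC_rel n"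
    using Cons.prems by (intro mix_step[where s = s]) auto
  \<comment> \<open>The transposition of \<open>p\<close> and \<open>q\<close> fixes the later
    entries, so these remain parallel.\<close>
  have "list_all2 (par ?V g s) ps qs"
  proof (rule list.rel_mono_strong)
    show "list_all2 (par V g s) ps qs" using Cons.prems by simp
    fix x y assume "x \<in> set ps" "y \<in> set qs" "par V g s x y"
    moreover have "tr p q x = x" "tr p q y = y" using calculation Cons.prems by (auto simp: tr_def)
    ultimately show "par ?V g s x y" using nxt_map[of V x y "tr p q"] nxt_map[of V y x "tr p q"] by (auto simp: par_def)
  qed
  then have "(mix i j e (A1 @ [p]) (ps @ R) (B1 @ [q]) qs W ?V g,
      mix i j e ((A1 @ [p]) @ ps) R ((B1 @ [q]) @ qs) [] W (\<lambda>a. map (trs ps qs) (?V a)) g) \<in> vAC_rel n"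
    using Cons.prems AC_TD vAC_in[OF st] by (intro Cons.IH) auto
  with st show ?case using vAC_trans by (simp add: comp_def)
qed

section \<open>Extracting a generator\<close>

text \<open>
  The crossing \<open>c\<close> can be pulled out of the diagram as a first factor \<open>\<sigma>\<^sub>i\<^sub>j\<^sup>s\<close>: its under point comes
  first on strand \<open>j\<close>, and the overs \<open>ps\<close> in front of it on strand \<open>i\<close> are parallel to all overs of strand \<open>j\<close>.
\<close>

definition divs :: "(nat \<Rightarrow> nat list) \<Rightarrow> (nat \<Rightarrow> nat list) \<Rightarrow> (nat \<Rightarrow> int) \<Rightarrow> nat \<Rightarrow> nat \<Rightarrow> int \<Rightarrow>
    nat list \<Rightarrow> nat \<Rightarrow> nat list \<Rightarrow> nat list \<Rightarrow> bool" where
  "divs W V g i j s ps c w v \<longleftrightarrow> i \<noteq> j \<and> W i = ps @ c # w \<and> V j = c # v \<and> g c = s \<and>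
     list_all2 (par V g s) ps (W j)"

definition ext_overs :: "(nat \<Rightarrow> nat list) \<Rightarrow> nat \<Rightarrow> nat list \<Rightarrow> nat list \<Rightarrow> nat \<Rightarrow> nat list" where
  "ext_overs W i ps w = W(i := ps @ w)"

text \<open>The renaming by \<open>trs\<close> records the R3 moves that carry the inverse factor
  through the parallel pairs up to \<open>c\<close>, where it cancels with \<open>c\<close>.\<close>

definition ext_unders :: "(nat \<Rightarrow> nat list) \<Rightarrow> (nat \<Rightarrow> nat list) \<Rightarrow> nat \<Rightarrow> nat list \<Rightarrow> nat \<Rightarrow> nat \<Rightarrow> nat list" where
  "ext_unders W V j ps c = (\<lambda>a. map (trs ps (W j)) (filter (\<lambda>x. x \<noteq> c) (V a)))"

lemma mix_iso:
  assumes T: "ou W V g \<in> TD n" and ij: "i \<noteq> j" and e: "e \<notin> crossings (ou W V g)"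
  shows "diag_iso (diag_prod (sigma_diag ((i, j), s)) (ou W V g)) (mix i j e [] (W i) [] (W j) W V (g(e := s)))"
proof -
  let ?f = "\<lambda>k. if even k then e else k div 2"
  have c: "crossings (sigma_diag ((i, j), s)) = {0}"
    by (auto simp: crossings_def sigma_diag_def)
  have "map_endpt ?f (map_endpt odn p) = p" for p by (cases p) auto
  then have m: "map (map_endpt ?f \<circ> map_endpt odn) xs = xs" for xs by (auto intro!: map_idI)
  have "iso_by ?f (diag_prod (sigma_diag ((i, j), s)) (ou W V g)) (mix i j e [] (W i) [] (W j) W V (g(e := s)))"
    unfolding iso_by_def crossings_prod c
  proof (intro conjI allI ballI)
    show "inj_on ?f (evn ` {0} \<union> odn ` crossings (ou W V g))" using e by (auto simp: inj_on_def)
    fix a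
    show "strand (mix i j e [] (W i) [] (W j) W V (g(e := s))) a =
        map (map_endpt ?f) (strand (diag_prod (sigma_diag ((i, j), s)) (ou W V g)) a)"
      using ij unfolding strand_prod map_append map_map m by (auto simp: mix_def strand_ou sigma_diag_def)
  next
    fix d assume "d \<in> evn ` {0} \<union> odn ` crossings (ou W V g)"
    then consider "d = 0" | b where "b \<in> crossings (ou W V g)" "d = odn b" by auto
    then show "csign (mix i j e [] (W i) [] (W j) W V (g(e := s))) (?f d) =
        csign (diag_prod (sigma_diag ((i, j), s)) (ou W V g)) d"
    proof cases
      case 1 then show ?thesis by (simp add: mix_def diag_prod_def sigma_diag_def)
    next
      case 2 then show ?thesis using e by (auto simp: mix_def csign_prod)
    qed
  qed
  then show ?thesis by (auto simp: diag_iso_iff)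
qed

lemma divs_facts:
  assumes T: "ou W V g \<in> TD n" and d: "divs W V g i j s ps c w v"
  shows "i \<noteq> j" "length ps = length (W j)" "distinct (ps @ W j)" "c \<notin> set ps" "c \<notin> set (W j)"
    "c \<in> crossings (ou W V g)" "i \<in> {1..n}" "j \<in> {1..n}" "s \<in> {1, -1}" "c \<notin> set w" "c \<notin> set v"
    "set ps \<inter> set w = {}" "distinct w" "trs ps (W j) c = c"
proof -
  show ij: "i \<noteq> j" and l: "length ps = length (W j)" using d by (auto simp: divs_def dest: list_all2_lengthD)
  have Wi: "W i = ps @ c # w" and Vj: "V j = c # v" and gc: "g c = s" using d by (auto simp: divs_def)
  have dis: "distinct (W i)" "distinct (W j)" "set (W i) \<inter> set (W j) = {}" "distinct (V j)"
    using T ij by (auto simp: ou_TD)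
  show "distinct (ps @ W j)" and cp: "c \<notin> set ps" "c \<notin> set (W j)" and "c \<notin> set w" "set ps \<inter> set w = {}" "distinct w"
    using dis Wi by auto
  then show "trs ps (W j) c = c" using trs_other by simp
  show "c \<notin> set v" using dis Vj by simp
  show cc: "c \<in> crossings (ou W V g)" unfolding crossings_ou using Wi by (auto intro!: exI[of _ i])
  have "W i \<noteq> []" "V j \<noteq> []" using Wi Vj by auto
  then show "i \<in> {1..n}" "j \<in> {1..n}" using T unfolding ou_TD by metis+
  show "s \<in> {1, -1}" using TD_sign[OF T cc] gc by auto
qed

text \<open>The crossing \<open>e\<close> of the new factor has the sign opposite to
  \<open>c\<close>. Once it has passed \<open>ps\<close> on strand \<open>i\<close> and all overs of
  strand \<open>j\<close>, its two points stand right before those of \<open>c\<close>, and both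
  crossings cancel by R2.\<close>

lemma extract_vAC:
  assumes T: "ou W V g \<in> TD n" and d: "divs W V g i j s ps c w v"
  shows "(diag_prod (sigma_diag ((i, j), - s)) (ou W V g), ou (ext_overs W i ps w) (ext_unders W V j ps c) g) \<in> vAC_rel n"
proof -
  note f = divs_facts[OF T d]
  have Wi: "W i = ps @ c # w" and Vj: "V j = c # v" and gc: "g c = s" and par: "list_all2 (par V g s) ps (W j)"
    using d by (auto simp: divs_def)
  obtain e where e: "e \<notin> crossings (ou W V g)" using fresh2[OF _ T, of "{}"] by auto
  let ?g = "g(e := - s)"
  let ?P = "diag_prod (sigma_diag ((i, j), - s)) (ou W V g)"
  have P: "?P \<in> AC n" using f OU_AC[OF T OU_ou] by (intro prod_AC sigma_AC) (auto simp: vPB_gens_def)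
  let ?M = "mix i j e [] (ps @ (c # w)) [] (W j) W V ?g"
  have i1: "diag_iso ?P ?M" using mix_iso[OF T f(1) e, of "- s"] Wi by simp
  have M: "?M \<in> TD n" using iso_TD[OF AC_TD[OF P] i1] .
  have We: "e \<notin> set (W a)" for a using e by (auto simp: crossings_ou)
  then have eps: "e \<notin> set ps" "e \<notin> set (W j)" using We[of i] Wi by auto
  have par': "list_all2 (par V ?g s) ps (W j)"
    using par by (rule list.rel_mono_strong) (use eps in \<open>auto simp: par_def\<close>)
  let ?V = "\<lambda>a. map (trs ps (W j)) (V a)"
  let ?N = "mix i j e ps (c # w) (W j) [] W ?V ?g"
  have i2: "(?M, ?N) \<in> vAC_rel n"
    using mix_steps[OF f(2) par' f(3) f(1) _ f(9), where e = e and R = "c # w" and ?A1.0 = "[]" and ?B1.0 = "[]" and W = W] M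
    by simp
  have N: "?N \<in> AC n" using vAC_in[OF i2] by simp
  have ec: "e \<noteq> c" using e f(6) by auto
  have sNi: "strand ?N i = map Over ps @ [Over e, Over c] @ map Over w @ map Under (?V i)" by (simp add: mix_def)
  have sNj: "strand ?N j = map Over (W j) @ [Under e, Under c] @ map Under (map (trs ps (W j)) v)"
    using f(1) Vj f(14) by (simp add: mix_def)
  have "rdel ?N {e, c}"
  proof (rule R2_rdel)
    show "adjacent ?N (Over e) (Over c)" "adjacent ?N (Under e) (Under c)"
      unfolding adjacent_seg seg_def using sNi sNj by blast+
  qed (use gc ec in \<open>auto simp: mix_def\<close>)
  then have r: "red1 ?N (del_crossings {e, c} ?N)" by (rule red1I)
  have i3: "(?N, del_crossings {e, c} ?N) \<in> vAC_rel n" using vAC_step[OF N red1_AC[OF N r]] r by blast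
  have i4: "diag_iso (del_crossings {e, c} ?N) (ou (ext_overs W i ps w) (ext_unders W V j ps c) g)" (is "diag_iso ?L ?R")
  proof -
    have We: "e \<notin> set (W a)" "e \<notin> set (V a)" for a using We T unfolding ou_TD by blast+
    have Wc: "c \<notin> set (W a)" if "a \<noteq> i" for a using T that Wi unfolding ou_TD by (metis disjoint_iff in_set_conv_decomp)
    have fW: "filter (\<lambda>p. cname p \<notin> {e, c}) (map Over xs) = map Over xs" if "e \<notin> set xs" "c \<notin> set xs" for xs
      using that by (intro filter_True) auto
    have te: "trs ps (W j) x = e \<longleftrightarrow> x = e" "trs ps (W j) x = c \<longleftrightarrow> x = c" for x
      using trs_other[OF eps] f(14) inj_trs[OF f(2,3)] by (metis injD)+
    have fV: "filter (\<lambda>p. cname p \<notin> {e, c}) (map Under (?V a)) = map Under (ext_unders W V j ps c a)" for a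
    proof -
      have "filter (\<lambda>x. x \<noteq> e \<and> x \<noteq> c) (V a) = filter (\<lambda>x. x \<noteq> c) (V a)"
        using We(2)[of a] by (intro filter_cong) auto
      then show ?thesis by (simp add: filter_map comp_def te ext_unders_def)
    qed
    have ew: "e \<notin> set w" "c \<notin> set w" using We(1)[of i] Wi f by auto
    have st: "strand ?L a = strand ?R a" for a
    proof -
      consider "a = i" | "a = j" "a \<noteq> i" | "a \<noteq> i" "a \<noteq> j" by blast
      then show ?thesis
      proof cases
        case 1
        then show ?thesis
          unfolding strand_del 1 sNi filter_append fV fW[OF eps(1) f(4)] fW[OF ew] by (simp add: strand_ou ext_overs_def)
      next
        case 2
        have "strand ?N j = map Over (W j) @ [Under e] @ map Under (?V j)" using f(1) by (simp add: mix_def)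
        then show ?thesis
          unfolding strand_del 2(1) using 2 fV[of j] fW[OF eps(2) f(5)] by (simp add: strand_ou ext_overs_def)
      next
        case 3
        have "strand ?N a = map Over (W a) @ map Under (?V a)" using 3 by (simp add: mix_def)
        then show ?thesis
          unfolding strand_del using 3 fV[of a] fW[OF We(1) Wc[OF 3(1)]] by (simp add: strand_ou ext_overs_def)
      qed
    qed
    have "e \<notin> crossings ?L" by (simp add: crossings_del)
    moreover have "csign ?L = ?g" by (simp add: mix_def)
    ultimately have "iso_by id ?L ?R" unfolding iso_by_def by (auto simp: st endpt.map_id0)
    then show ?thesis by (auto simp: diag_iso_iff)
  qed
  show ?thesis
    using vAC_trans[OF vAC_trans[OF vAC_trans[OF vAC_iso[OF P i1] i2] i3] vAC_iso[OF red1_AC[OF N r] i4]] .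
qed

section \<open>Reducing both sides of a multiplication by a generator\<close>

text \<open>\<open>E\<close> represents \<open>\<sigma>\<^sub>i\<^sub>j\<^sup>s D\<close>, and \<open>D\<close> is obtained from \<open>E\<close> by pulling out the crossing \<open>c\<close>.\<close>

definition link :: "nat \<Rightarrow> nat \<Rightarrow> nat \<Rightarrow> int \<Rightarrow> vdiag \<Rightarrow> vdiag \<Rightarrow> bool" where
  "link n i j s D E \<longleftrightarrow> (\<exists>W V g ps c w v. E = ou W V g \<and> E \<in> TD n \<and> divs W V g i j s ps c w v \<and>
     D = ou (ext_overs W i ps w) (ext_unders W V j ps c) g)"

definition dl :: "nat set \<Rightarrow> (nat \<Rightarrow> nat list) \<Rightarrow> nat \<Rightarrow> nat list" where
  "dl C W a = filter (\<lambda>x. x \<notin> C) (W a)"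

lemma del_ou: "del_crossings C (ou W V g) = ou (dl C W) (dl C V) g"
  by (rule vdiag.equality) (auto simp: fun_eq_iff strand_del strand_ou dl_def filter_map comp_def ou_def)

lemma filter_neq: "q \<notin> set xs \<Longrightarrow> filter (\<lambda>x. x \<noteq> q) xs = xs"
  by (rule filter_True) auto

lemma nxt_dl:
  assumes "nxt V x y" "x \<notin> C" "y \<notin> C" shows "nxt (dl C V) x y"
proof -
  obtain a xs ys where "V a = xs @ [x, y] @ ys" using assms(1) unfolding nxt_def by blast
  then have "dl C V a = filter (\<lambda>x. x \<notin> C) xs @ [x, y] @ filter (\<lambda>x. x \<notin> C) ys" using assms by (simp add: dl_def)
  then show ?thesis unfolding nxt_def by blast
qed

lemma ext_unders_eq: "ext_unders W V j ps c = (\<lambda>a. map (trs ps (W j)) (dl {c} V a))"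
  by (simp add: ext_unders_def dl_def fun_eq_iff)

lemma link_AC:
  assumes "link n i j s D E"
  shows "D \<in> TD n" "E \<in> TD n" "OU D" "OU E" "D \<in> AC n" "E \<in> AC n"
    "(diag_prod (sigma_diag ((i, j), - s)) E, D) \<in> vAC_rel n" "crossing_number E = Suc (crossing_number D)"
    "i \<in> {1..n}" "j \<in> {1..n}" "i \<noteq> j" "s \<in> {1, -1}"
proof -
  obtain W V g ps c w v where E: "E = ou W V g" "E \<in> TD n" and d: "divs W V g i j s ps c w v"
    and D: "D = ou (ext_overs W i ps w) (ext_unders W V j ps c) g"
    using assms by (auto simp: link_def)
  note f = divs_facts[OF E(2)[unfolded E(1)] d]
  show "E \<in> TD n" by fact
  show "(diag_prod (sigma_diag ((i, j), - s)) E, D) \<in> vAC_rel n"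
    unfolding E(1) D by (rule extract_vAC[OF E(2)[unfolded E(1)] d])
  then show DA: "D \<in> AC n" using vAC_in by blast
  then show "D \<in> TD n" by (rule AC_TD)
  show "OU D" "OU E" unfolding D E by (rule OU_ou)+
  then show "E \<in> AC n" using OU_AC E by blast
  show "i \<in> {1..n}" "j \<in> {1..n}" "i \<noteq> j" "s \<in> {1, -1}" using f by auto
  have "crossings E = insert c (crossings D)" "c \<notin> crossings D"
  proof -
    have Wi: "W i = ps @ c # w" using d by (simp add: divs_def)
    have Wa: "c \<notin> set (W a)" if "a \<noteq> i" for a
      using E(2) that Wi unfolding E(1) ou_TD by (metis disjoint_iff in_set_conv_decomp)
    have "x \<in> set (W a) \<longleftrightarrow> x \<in> set (ext_overs W i ps w a) \<or> (a = i \<and> x = c)" for x a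
      using Wi by (auto simp: ext_overs_def)
    then show "crossings E = insert c (crossings D)" unfolding E(1) D crossings_ou by auto
    show "c \<notin> crossings D" unfolding D crossings_ou using Wa f by (auto simp: ext_overs_def split: if_splits)
  qed
  then show "crossing_number E = Suc (crossing_number D)"
    using finite_crossings[OF AC_TD[OF DA]] by (simp add: crossing_number_def)
qed

lemma trs_filter:
  assumes "list_all2 R ps qs" "distinct (ps @ qs)" "\<And>p q. (p, q) \<in> set (zip ps qs) \<Longrightarrow> p \<in> C \<longleftrightarrow> q \<in> C"
  shows "(trs ps qs x \<in> C \<longleftrightarrow> x \<in> C) \<and>
    (x \<notin> C \<longrightarrow> trs (filter (\<lambda>x. x \<notin> C) ps) (filter (\<lambda>x. x \<notin> C) qs) x = trs ps qs x) \<and>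
    list_all2 R (filter (\<lambda>x. x \<notin> C) ps) (filter (\<lambda>x. x \<notin> C) qs)"
  using assms
proof (induction ps qs arbitrary: x rule: list_all2_induct)
  case (Cons p ps q qs)
  have pq: "p \<in> C \<longleftrightarrow> q \<in> C" using Cons.prems by simp
  have t: "tr p q x \<in> C \<longleftrightarrow> x \<in> C" using pq by (auto simp: tr_def)
  have IH: "(trs ps qs y \<in> C \<longleftrightarrow> y \<in> C) \<and>
    (y \<notin> C \<longrightarrow> trs (filter (\<lambda>x. x \<notin> C) ps) (filter (\<lambda>x. x \<notin> C) qs) y = trs ps qs y) \<and>
    list_all2 R (filter (\<lambda>x. x \<notin> C) ps) (filter (\<lambda>x. x \<notin> C) qs)" for y
    using Cons.prems by (intro Cons.IH) auto
  have "tr p q x = x" if "p \<in> C" "x \<notin> C" using that pq by (auto simp: tr_def)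
  then show ?case using IH[of "tr p q x"] IH[of x] t pq Cons.hyps by auto
qed simp

text \<open>Deleting partners together keeps the remaining partners at corresponding positions, and
  surviving neighbours stay neighbours. So the extraction can be made after the deletion, with the
  same result.\<close>

lemma divs_dl:
  assumes T: "ou W V g \<in> TD n" and d: "divs W V g i j s ps c w v" and c: "c \<notin> C"
    and C: "\<And>p q. (p, q) \<in> set (zip ps (W j)) \<Longrightarrow> p \<in> C \<longleftrightarrow> q \<in> C"
  shows "link n i j s (del_crossings C (ou (ext_overs W i ps w) (ext_unders W V j ps c) g)) (del_crossings C (ou W V g))"
proof -
  note f = divs_facts[OF T d]
  let ?F = "filter (\<lambda>x. x \<notin> C)"
  have par: "list_all2 (par V g s) ps (W j)" using d by (simp add: divs_def)
  note tf = trs_filter[OF par f(3) C]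
  have "list_all2 (par V g s) (?F ps) (?F (W j))" using tf by blast
  then have "list_all2 (par (dl C V) g s) (?F ps) (?F (W j))"
    by (rule list.rel_mono_strong) (auto simp: par_def intro: nxt_dl)
  then have d': "divs (dl C W) (dl C V) g i j s (?F ps) c (?F w) (?F v)"
    using d c by (auto simp: divs_def dl_def)
  have "del_crossings C (ou W V g) \<in> TD n" by (rule del_TD[OF T])
  moreover have "ou (dl C (ext_overs W i ps w)) (dl C (ext_unders W V j ps c)) g =
      ou (ext_overs (dl C W) i (?F ps) (?F w)) (ext_unders (dl C W) (dl C V) j (?F ps) c) g"
  proof -
    have "dl C (ext_overs W i ps w) = ext_overs (dl C W) i (?F ps) (?F w)"
      by (auto simp: ext_overs_def dl_def fun_eq_iff)
    moreover have "dl C (ext_unders W V j ps c) a = ext_unders (dl C W) (dl C V) j (?F ps) c a" for a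
    proof -
      have "dl C (ext_unders W V j ps c) a = map (trs ps (W j)) (filter (\<lambda>x. x \<notin> C) (filter (\<lambda>x. x \<noteq> c) (V a)))"
        using tf by (simp add: dl_def ext_unders_def filter_map comp_def)
      also have "\<dots> = map (trs (?F ps) (?F (W j))) (filter (\<lambda>x. x \<noteq> c) (filter (\<lambda>x. x \<notin> C) (V a)))"
        using tf by (auto simp: conj_commute)
      finally show ?thesis by (simp add: ext_unders_def dl_def)
    qed
    ultimately show ?thesis by (metis ext)
  qed
  ultimately show ?thesis unfolding link_def del_ou using d' by metis
qed

definition ext_point :: "nat list \<Rightarrow> nat list \<Rightarrow> nat endpt \<Rightarrow> nat endpt" where
  "ext_point ps qs p = (case p of Over x \<Rightarrow> Over x | Under x \<Rightarrow> Under (trs ps qs x))"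

lemma strand_ext:
  assumes T: "ou W V g \<in> TD n" and d: "divs W V g i j s ps c w v"
  shows "strand (ou (ext_overs W i ps w) (ext_unders W V j ps c) g) a =
    map (ext_point ps (W j)) (filter (\<lambda>p. cname p \<noteq> c) (strand (ou W V g) a))"
proof -
  have Wi: "W i = ps @ c # w" using d by (simp add: divs_def)
  have Wa: "c \<notin> set (W a)" if "a \<noteq> i" for a
    using T that Wi unfolding ou_TD by (metis disjoint_iff in_set_conv_decomp)
  have "ext_overs W i ps w a = filter (\<lambda>x. x \<noteq> c) (W a)"
  proof (cases "a = i")
    case True
    have "filter (\<lambda>x. x \<noteq> c) ps = ps" "filter (\<lambda>x. x \<noteq> c) w = w"
      using divs_facts(4,10)[OF T d] by (auto intro!: filter_True)
    then show ?thesis using True Wi by (simp add: ext_overs_def)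
  next
    case False
    then show ?thesis using Wa[OF False] by (auto simp: ext_overs_def intro!: filter_True[symmetric])
  qed
  then show ?thesis by (simp add: strand_ou ext_unders_def ext_point_def filter_map comp_def)
qed

lemma seg_ext:
  assumes T: "ou W V g \<in> TD n" and d: "divs W V g i j s ps c w v" and sg: "seg (ou W V g) xs"
  shows "seg (ou (ext_overs W i ps w) (ext_unders W V j ps c) g)
    (map (ext_point ps (W j)) (filter (\<lambda>p. cname p \<noteq> c) xs))"
proof -
  let ?h = "\<lambda>xs. map (ext_point ps (W j)) (filter (\<lambda>p. cname p \<noteq> c) xs)"
  obtain a us vs where "strand (ou W V g) a = us @ xs @ vs" using sg by (auto simp: seg_def)
  then have "strand (ou (ext_overs W i ps w) (ext_unders W V j ps c) g) a = ?h us @ ?h xs @ ?h vs"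
    unfolding strand_ext[OF T d] by simp
  then show ?thesis unfolding seg_def by blast
qed

lemma nxt_ext:
  assumes T: "ou W V g \<in> TD n" and d: "divs W V g i j s ps c w v" and x: "nxt V x y" "x \<noteq> c" "y \<noteq> c"
  shows "nxt (ext_unders W V j ps c) (trs ps (W j) x) (trs ps (W j) y)"
  unfolding ext_unders_eq by (rule nxt_map, rule nxt_dl) (use x in auto)

text \<open>The extraction exchanges the neighbouring unders of each pair, which puts them into the
  order demanded for \<open>-s\<close>. This is the source of the reversal of links.\<close>

lemma par_ext_flip:
  assumes T: "ou W V g \<in> TD n" and d: "divs W V g i j s ps c w v" and m: "m < length ps"
  shows "par (ext_unders W V j ps c) g (- s) (ps ! m) (W j ! m)"
proof -
  note f = divs_facts[OF T d]
  have p: "par V g s (ps ! m) (W j ! m)" using d m by (auto simp: divs_def dest: list_all2_nthD)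
  have t: "trs ps (W j) (ps ! m) = W j ! m" "trs ps (W j) (W j ! m) = ps ! m" using trs_nth[OF f(2,3) m] by auto
  have ne: "ps ! m \<noteq> c" "W j ! m \<noteq> c" using f m by (metis nth_mem)+
  have "W j ! m \<in> crossings (ou W V g)" unfolding crossings_ou using f(2) m by (auto intro!: exI[of _ j])
  then have "g (W j ! m) = 1 \<or> g (W j ! m) = -1" using TD_sign[OF T] by simp
  then show ?thesis using p nxt_ext[OF T d, of "ps ! m" "W j ! m"] nxt_ext[OF T d, of "W j ! m" "ps ! m"] t ne f(9)
    by (auto simp: par_def split: if_splits)
qed

lemma two_R2:
  assumes dis: "distinct [x, x', y, y']"
    and s: "csign A x = - csign A x'" "csign A y = - csign A y'"
    and U: "seg A [Under x, Under y, Under y', Under x'] \<or> seg A [Under x', Under y', Under y, Under x]"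
    and O: "adjacent A (Over x) (Over x')" "adjacent A (Over y) (Over y')"
  shows "red1\<^sup>*\<^sup>* A (del_crossings {x, x', y, y'} A)"
proof -
  have 1: "adjacent A (Under y) (Under y')"
    using U seg_sub[of A "[Under x]" "[Under y, Under y']" "[Under x']"]
      seg_sub[of A "[Under x']" "[Under y', Under y]" "[Under x]"] by (auto simp: adjacent_seg)
  have r1: "red1 A (del_crossings {y, y'} A)" by (intro red1I R2_rdel 1 O s) (use dis in auto)
  have 2: "adjacent (del_crossings {y, y'} A) (Under x) (Under x')"
    using U
  proof
    assume "seg A [Under x, Under y, Under y', Under x']"
    then show ?thesis by (rule adjacent_seg_del[of _ _ _ "[]" _ _ "[]"]) (use dis in auto)
  next
    assume "seg A [Under x', Under y', Under y, Under x]"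
    then have "adjacent (del_crossings {y, y'} A) (Under x') (Under x)"
      by (rule adjacent_seg_del[of _ _ _ "[]" _ _ "[]"]) (use dis in auto)
    then show ?thesis by (simp add: adjacent_sym)
  qed
  have "adjacent (del_crossings {y, y'} A) (Over x) (Over x')" using O(1) dis by (intro adjacent_del) auto
  then have r2: "red1 (del_crossings {y, y'} A) (del_crossings {x, x'} (del_crossings {y, y'} A))"
    using 2 s dis by (intro red1I R2_rdel) auto
  show ?thesis using r1 r2 unfolding del_del by (simp add: insert_commute)
qed

lemma red1_steps_vAC: "red1\<^sup>*\<^sup>* D E \<Longrightarrow> D \<in> AC n \<Longrightarrow> (D, E) \<in> vAC_rel n"
proof (induction rule: rtranclp_induct)
  case (step E F)
  then have "(E, F) \<in> vAC_rel n" using vAC_in vAC_step red1_AC by blast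
  then show ?case using step vAC_trans by blast
qed (rule vAC_refl)

lemma crossing_number_del:
  assumes "D \<in> TD n" shows "crossing_number (del_crossings C D) \<le> crossing_number D"
    and "C \<subseteq> crossings D \<Longrightarrow> C \<noteq> {} \<Longrightarrow> crossing_number (del_crossings C D) < crossing_number D"
  using finite_crossings[OF assms] unfolding crossing_number_def crossings_del
  by (auto intro: card_mono psubset_card_mono)

lemma nxt_unique:
  assumes T: "ou W V g \<in> TD n"
  shows "nxt V x y \<Longrightarrow> nxt V x z \<Longrightarrow> y = z" "nxt V y x \<Longrightarrow> nxt V z x \<Longrightarrow> y = z"
  using seg_right_unique[OF T, of "Under x" "Under y" "Under z"] seg_left_unique[OF T, of "Under y" "Under x" "Under z"]
  by (auto simp: seg_ou_Under)

lemma seg4: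
  assumes T: "D \<in> TD n" and "seg D [a, b]" "seg D [b, c]" "seg D [c, d]" shows "seg D [a, b, c, d]"
  using seg_join_gen[OF T, of "[a]" b "[c, d]"] seg_join[OF T, of b c d] assms by auto

text \<open>An R2 move on two neighbours in the parallel segments \<open>ps\<close>, \<open>W j\<close> forces one on their parallels.\<close>

lemma link_reduce_parallel:
  assumes T: "ou W V g \<in> TD n" and d: "divs W V g i j s ps c w v" and m: "Suc m < length ps"
    and sgn: "g (ps ! m) = - g (ps ! Suc m)"
    and U: "nxt V (ps ! m) (ps ! Suc m) \<or> nxt V (ps ! Suc m) (ps ! m) \<or>
      nxt V (W j ! m) (W j ! Suc m) \<or> nxt V (W j ! Suc m) (W j ! m)"
  defines "X \<equiv> {ps ! m, ps ! Suc m, W j ! m, W j ! Suc m}"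
  shows "red1\<^sup>*\<^sup>* (ou W V g) (del_crossings X (ou W V g))"
    "red1\<^sup>*\<^sup>* (ou (ext_overs W i ps w) (ext_unders W V j ps c) g)
       (del_crossings X (ou (ext_overs W i ps w) (ext_unders W V j ps c) g))"
    "link n i j s (del_crossings X (ou (ext_overs W i ps w) (ext_unders W V j ps c) g)) (del_crossings X (ou W V g))"
proof -
  note f = divs_facts[OF T d]
  let ?E = "ou W V g" and ?D = "ou (ext_overs W i ps w) (ext_unders W V j ps c) g"
  define p p' q q' where "p = ps ! m" and "p' = ps ! Suc m" and "q = W j ! m" and "q' = W j ! Suc m"
  note defs = p_def p'_def q_def q'_def
  have "list_all2 (par V g s) ps (W j)" using d by (simp add: divs_def)
  then have par: "par V g s p q" "par V g s p' q'" using m unfolding defs by (auto intro: list_all2_nthD)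
  have mem: "p \<in> set ps" "p' \<in> set ps" "q \<in> set (W j)" "q' \<in> set (W j)" using m f(2) by (auto simp: defs)
  have dis: "distinct [p, p', q, q']"
  proof -
    have "p \<noteq> p'" "q \<noteq> q'" using f(2,3) m by (auto simp: defs nth_eq_iff_index_eq)
    then show ?thesis using mem f(3) by auto
  qed
  have sg: "g p = - g p'" "g q = - g q'" using sgn par by (auto simp: par_def defs)
  have gq: "g q = 1 \<or> g q = -1"
    using TD_sign[OF T, of q] mem(3) by (auto simp: crossings_ou)
  have s: "s = 1 \<or> s = -1" using f(9) by auto
  have U': "nxt V p p' \<or> nxt V p' p \<or> nxt V q q' \<or> nxt V q' q" using U by (simp add: defs)
  \<comment> \<open>Pairs of opposite signs are parallel in opposite orders: the unders contain
    \<open>q p\<close> and \<open>p' q'\<close>, or else \<open>p q\<close> and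
    \<open>q' p'\<close>. The adjacency in \<open>U\<close> joins these two blocks into one; each
    other way would give some point two predecessors or two successors.\<close>
  have chain: "nxt V q p \<and> nxt V p p' \<and> nxt V p' q' \<or> nxt V q' p' \<and> nxt V p' p \<and> nxt V p q \<or>
     nxt V p q \<and> nxt V q q' \<and> nxt V q' p' \<or> nxt V p' q' \<and> nxt V q' q \<and> nxt V q p"
  proof (cases "s * g q = 1")
    case True
    then have "s * g q' \<noteq> 1" using sg by auto
    then have "nxt V q p" "nxt V p' q'" using True par by (simp_all add: par_def)
    moreover have "\<not> nxt V p' p" "\<not> nxt V q q'"
      using nxt_unique(2)[OF T \<open>nxt V q p\<close>, of p'] nxt_unique(1)[OF T \<open>nxt V q p\<close>, of q'] dis by auto
    ultimately show ?thesis using U' by blast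
  next
    case False
    then have "s * g q' = 1" using sg gq s by auto
    then have "nxt V p q" "nxt V q' p'" using False par by (simp_all add: par_def)
    moreover have "\<not> nxt V p p'" "\<not> nxt V q' q"
      using nxt_unique(1)[OF T \<open>nxt V p q\<close>, of p'] nxt_unique(2)[OF T \<open>nxt V p q\<close>, of q'] dis by auto
    ultimately show ?thesis using U' by blast
  qed
  then have segs: "seg ?E [Under q, Under p, Under p', Under q'] \<or> seg ?E [Under q', Under p', Under p, Under q] \<or>
      seg ?E [Under p, Under q, Under q', Under p'] \<or> seg ?E [Under p', Under q', Under q, Under p]"
    using seg4[OF T] by (simp add: seg_ou_Under[symmetric, of V _ _ W g]) blast
  have Wi: "W i = ps @ c # w" using d by (simp add: divs_def)
  have Np: "nxt (\<lambda>_. ps) p p'"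
    using id_take_nth_drop[of m ps] Cons_nth_drop_Suc[of "Suc m" ps] m unfolding nxt_def
    by (metis Suc_lessD append_Cons append_Nil p'_def p_def)
  have Nq: "nxt W q q'"
    using id_take_nth_drop[of m "W j"] Cons_nth_drop_Suc[of "Suc m" "W j"] m f(2) unfolding nxt_def
    by (metis Suc_lessD append_Cons append_Nil q'_def q_def)
  have Np1: "nxt W p p'" "nxt (ext_overs W i ps w) p p'"
  proof -
    obtain xs ys where "ps = xs @ [p, p'] @ ys" using Np by (auto simp: nxt_def)
    then have "W i = xs @ [p, p'] @ (ys @ c # w)" "ext_overs W i ps w i = xs @ [p, p'] @ (ys @ w)"
      using Wi by (simp_all add: ext_overs_def)
    then show "nxt W p p'" "nxt (ext_overs W i ps w) p p'" unfolding nxt_def by blast+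
  qed
  have Nq1: "nxt (ext_overs W i ps w) q q'"
  proof -
    have "xs @ q # q' # ys = W j \<Longrightarrow> ext_overs W i ps w j = xs @ [q, q'] @ ys" for xs ys
      using f(1) by (simp add: ext_overs_def)
    moreover have "\<exists>xs ys. xs @ q # q' # ys = W j"
      using id_take_nth_drop[of m "W j"] Cons_nth_drop_Suc[of "Suc m" "W j"] m f(2)
      by (metis Suc_lessD q'_def q_def)
    ultimately show ?thesis unfolding nxt_def by blast
  qed
  have OE: "adjacent ?E (Over p) (Over p')" "adjacent ?E (Over q) (Over q')"
    using Np1(1) Nq by (auto simp: adjacent_seg seg_ou_Over)
  have OD: "adjacent ?D (Over p) (Over p')" "adjacent ?D (Over q) (Over q')"
    using Np1(2) Nq1 by (auto simp: adjacent_seg seg_ou_Over)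
  have ncs: "p \<noteq> c" "p' \<noteq> c" "q \<noteq> c" "q' \<noteq> c" using mem f(4,5) by auto
  have tq: "trs ps (W j) p = q" "trs ps (W j) q = p" "trs ps (W j) p' = q'" "trs ps (W j) q' = p'"
    using trs_nth[OF f(2,3), of m] trs_nth[OF f(2,3), of "Suc m"] m by (auto simp: defs)
  have segsD: "seg ?D [Under q, Under p, Under p', Under q'] \<or> seg ?D [Under q', Under p', Under p, Under q] \<or>
      seg ?D [Under p, Under q, Under q', Under p'] \<or> seg ?D [Under p', Under q', Under q, Under p]"
    using segs seg_ext[OF T d, of "[Under q, Under p, Under p', Under q']"] seg_ext[OF T d, of "[Under q', Under p', Under p, Under q]"]
      seg_ext[OF T d, of "[Under p, Under q, Under q', Under p']"] seg_ext[OF T d, of "[Under p', Under q', Under q, Under p]"]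
    by (auto simp: ext_point_def tq ncs)
  have X: "X = {p, p', q, q'}" "X = {q, q', p, p'}" by (auto simp: X_def defs)
  have R: "red1\<^sup>*\<^sup>* A (del_crossings X A)" if "csign A = g"
    "seg A [Under q, Under p, Under p', Under q'] \<or> seg A [Under q', Under p', Under p, Under q] \<or>
      seg A [Under p, Under q, Under q', Under p'] \<or> seg A [Under p', Under q', Under q, Under p]"
    "adjacent A (Over p) (Over p')" "adjacent A (Over q) (Over q')" for A
    using that(2)
  proof (elim disjE)
    assume "seg A [Under q, Under p, Under p', Under q']"
    then show ?thesis unfolding X(2) by (intro two_R2) (use that dis sg in auto)
  next
    assume "seg A [Under q', Under p', Under p, Under q]"
    then show ?thesis unfolding X(2) by (intro two_R2) (use that dis sg in auto)
  next
    assume "seg A [Under p, Under q, Under q', Under p']"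
    then show ?thesis unfolding X(1) by (intro two_R2) (use that dis sg in auto)
  next
    assume "seg A [Under p', Under q', Under q, Under p]"
    then show ?thesis unfolding X(1) by (intro two_R2) (use that dis sg in auto)
  qed
  show "red1\<^sup>*\<^sup>* ?E (del_crossings X ?E)" by (rule R[OF _ segs OE]) simp
  show "red1\<^sup>*\<^sup>* ?D (del_crossings X ?D)" by (rule R[OF _ segsD OD]) simp
  show "link n i j s (del_crossings X ?D) (del_crossings X ?E)"
  proof (rule divs_dl[OF T d])
    show "c \<notin> X" using ncs X by auto
    fix a b assume "(a, b) \<in> set (zip ps (W j))"
    then obtain k where k: "k < length ps" "a = ps ! k" "b = W j ! k" using f(2) by (auto simp: in_set_zip)
    have dp: "distinct ps" "distinct (W j)" "set ps \<inter> set (W j) = {}" using f(3) by auto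
    have "a \<in> set ps" "b \<in> set (W j)" using k f(2) by auto
    then have "a \<noteq> q" "a \<noteq> q'" "b \<noteq> p" "b \<noteq> p'" using mem dp(3) by auto
    moreover have "a = p \<longleftrightarrow> k = m" "a = p' \<longleftrightarrow> k = Suc m"
      using k(1) m dp(1) by (simp_all add: k(2) p_def p'_def nth_eq_iff_index_eq)
    moreover have "b = q \<longleftrightarrow> k = m" "b = q' \<longleftrightarrow> k = Suc m"
      using k(1) m dp(2) f(2) by (simp_all add: k(3) q_def q'_def nth_eq_iff_index_eq)
    ultimately have "a \<in> X \<longleftrightarrow> k = m \<or> k = Suc m" "b \<in> X \<longleftrightarrow> k = m \<or> k = Suc m" unfolding X(1) by auto
    then show "a \<in> X \<longleftrightarrow> b \<in> X" by blast
  qed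
qed

text \<open>The link changes its direction when the crossing \<open>c\<close> takes part in the R2 move.\<close>

lemma link_reduce:
  assumes L: "link n i j s D E" and red: "red1 E X"
  shows "\<exists>D' E'. (link n i j s D' E' \<or> link n i j (- s) E' D') \<and> (D, D') \<in> vAC_rel n \<and> (E, E') \<in> vAC_rel n \<and>
    crossing_number D' + crossing_number E' < crossing_number D + crossing_number E"
proof -
  obtain W V g ps c w v where E: "E = ou W V g" "E \<in> TD n" and d: "divs W V g i j s ps c w v"
    and D: "D = ou (ext_overs W i ps w) (ext_unders W V j ps c) g"
    using L by (auto simp: link_def)
  note T = E(2)[unfolded E(1)]
  note f = divs_facts[OF T d]
  note la = link_AC[OF L]
  have Wi: "W i = ps @ c # w" and Vj: "V j = c # v" and gc: "g c = s" using d by (auto simp: divs_def)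
  obtain C where C: "rdel E C" using red by (auto simp: red1_def)
  have CE: "C \<subseteq> crossings E" "C \<noteq> {}" using rdel_crossings[OF E(2) C] by auto
  have dW: "distinct (W a)" "distinct (V a)" for a using T by (auto simp: ou_TD)
  have uW: "a = b" if "x \<in> set (W a)" "x \<in> set (W b)" for x a b using T that unfolding ou_TD by blast
  have uV: "a = b" if "x \<in> set (V a)" "x \<in> set (V b)" for x a b using T that unfolding ou_TD by blast
  have finish: ?thesis if "link n i j s (del_crossings Y D) (del_crossings Y E)"
    "red1\<^sup>*\<^sup>* D (del_crossings Y D)" "red1\<^sup>*\<^sup>* E (del_crossings Y E)" "Y \<subseteq> crossings E" "Y \<noteq> {}" for Y
  proof -
    have "crossing_number (del_crossings Y D) + crossing_number (del_crossings Y E) < crossing_number D + crossing_number E"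
      using crossing_number_del(1)[OF la(1), of Y] crossing_number_del(2)[OF la(2) that(4,5)] by simp
    then show ?thesis using that red1_steps_vAC la(5,6) by blast
  qed
  \<comment> \<open>A removal away from \<open>c\<close>, \<open>ps\<close> and \<open>W j\<close>
    involves none of the exchanged unders and can be made on both sides of the link.\<close>
  have generic: ?thesis if gen: "C \<inter> ({c} \<union> set ps \<union> set (W j)) = {}"
  proof -
    have "link n i j s (del_crossings C D) (del_crossings C E)"
      unfolding D E(1) by (rule divs_dl[OF T d]) (use gen in \<open>auto dest: set_zip_leftD set_zip_rightD\<close>)
    moreover have "rdel D C"
    proof -
      have id: "ext_point ps (W j) p = p" if "cname p \<in> C" for p
        using that gen trs_other[of "cname p" ps "W j"] by (cases p) (auto simp: ext_point_def)
      have "adjacent D p q" if "adjacent E p q" "cname p \<in> C" "cname q \<in> C" for p q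
      proof -
        have "cname p \<noteq> c" "cname q \<noteq> c" using that gen by auto
        then show ?thesis using that(1) seg_ext[OF T d, of "[p, q]"] seg_ext[OF T d, of "[q, p]"] id[OF that(2)] id[OF that(3)]
          unfolding D E(1) adjacent_seg by auto
      qed
      then show ?thesis using C unfolding rdel_def D E(1) csign_ou by (metis cname.simps insertCI)
    qed
    then have "red1\<^sup>*\<^sup>* D (del_crossings C D)" using red1I by blast
    moreover have "red1\<^sup>*\<^sup>* E (del_crossings C E)" using red1I[OF C] by blast
    ultimately show ?thesis using finish CE by blast
  qed
  from C consider (R1) a where "C = {a}" "adjacent E (Over a) (Under a)"
    | (R2) a b where "C = {a, b}" "a \<noteq> b" "g a = - g b" "adjacent E (Over a) (Over b)" "adjacent E (Under a) (Under b)"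
    unfolding rdel_def E(1) csign_ou by blast
  then show ?thesis
  proof cases
    case R1
    \<comment> \<open>A kink of an OU diagram is the last over and the first under of its strand.
      The first under of \<open>j\<close> is \<open>c\<close>, whose over lies on another strand,
      and an entry of \<open>ps\<close> is never the last over; so this case is generic.\<close>
    have "seg (ou W V g) [Over a, Under a]" using R1(2) seg_ou_Under_Over unfolding E(1) adjacent_seg by blast
    from seg_ou_Over_Under[OF this] obtain b xs ys where b: "W b = xs @ [a]" "V b = a # ys" by blast
    have "a \<noteq> c" using uV[of c b j] uW[of c b i] b Vj Wi f(1) by auto
    moreover have "a \<notin> set ps"
    proof
      assume "a \<in> set ps"
      then have "b = i" using uW[of a b i] b Wi by simp
      then have "a = last (c # w)" using b Wi by (metis last_appendR last_snoc list.distinct(1))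
      then have "a \<in> set (c # w)" by (metis last_in_set list.distinct(1))
      then show False using \<open>a \<in> set ps\<close> dW(1)[of i] Wi by auto
    qed
    moreover have "a \<notin> set (W j)"
    proof
      assume "a \<in> set (W j)"
      then have "b = j" using uW[of a b j] b by simp
      then show False using b Vj \<open>a \<noteq> c\<close> by simp
    qed
    ultimately show ?thesis using generic R1(1) by auto
  next
    case R2
    have O: "nxt W a b \<or> nxt W b a" and U: "nxt V a b \<or> nxt V b a"
      using R2 unfolding E(1) adjacent_seg by (simp_all add: seg_ou_Over seg_ou_Under)
    consider "C \<inter> ({c} \<union> set ps \<union> set (W j)) = {}" | "c \<in> C" | "c \<notin> C" "C \<inter> (set ps \<union> set (W j)) \<noteq> {}" by blast
    then show ?thesis
    proof cases
      case 1 then show ?thesis by (rule generic)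
    next
      case 2
      then have "c = a \<or> c = b" using R2(1) by simp
      then have "\<exists>b'. C = {c, b'} \<and> b' \<noteq> c \<and> g c = - g b' \<and> (nxt W c b' \<or> nxt W b' c) \<and> (nxt V c b' \<or> nxt V b' c)"
      proof
        assume "c = a" then show ?thesis using R2 O U by (intro exI[of _ b]) auto
      next
        assume "c = b" then show ?thesis using R2 O U by (intro exI[of _ a]) auto
      qed
      then obtain b' where C': "C = {c, b'}" "b' \<noteq> c" "g c = - g b'" "nxt W c b' \<or> nxt W b' c" "nxt V c b' \<or> nxt V b' c"
        by blast
      have "\<not> nxt V b' c"
      proof
        assume "nxt V b' c"
        then obtain a xs ys where a: "V a = xs @ [b', c] @ ys" unfolding nxt_def by blast
        then have "a = j" using uV[of c a j] Vj by simp
        then show False using a Vj dW(2)[of j] by (cases xs) auto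
      qed
      then obtain a xs ys where "V a = xs @ [c, b'] @ ys" using C'(5) unfolding nxt_def by blast
      moreover from this have "a = j" using uV[of c a j] Vj by simp
      ultimately have v: "v = b' # ys" using Vj dW(2)[of j] by (cases xs) auto
      \<comment> \<open>The partner \<open>b'\<close> of \<open>c\<close> in the R2 pair stands
        right behind \<open>c\<close> among the overs of \<open>i\<close>, or right before it as the
        last entry of \<open>ps\<close>.\<close>
      from C'(4) have "(\<exists>w'. w = b' # w') \<or> (\<exists>ps'. ps = ps' @ [b'])"
      proof
        assume "nxt W c b'"
        then obtain a xs zs where "W a = xs @ [c, b'] @ zs" unfolding nxt_def by blast
        moreover from this have "a = i" using uW[of c a i] Wi by simp
        ultimately have "ps @ c # w = xs @ c # b' # zs" using Wi by simp
        then have "w = b' # zs" using append_Cons_eq_iff[of c ps w xs "b' # zs"] f(4,10) by simp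
        then show ?thesis by blast
      next
        assume "nxt W b' c"
        then obtain a xs zs where "W a = xs @ [b', c] @ zs" unfolding nxt_def by blast
        moreover from this have "a = i" using uW[of c a i] Wi by simp
        ultimately have "ps @ c # w = (xs @ [b']) @ c # zs" using Wi by simp
        then have "ps = xs @ [b']" using append_Cons_eq_iff[of c ps w "xs @ [b']" zs] f(4,10) by simp
        then show ?thesis by blast
      qed
      then show ?thesis
      proof (elim disjE exE)
        \<comment> \<open>After \<open>c\<close> has been pulled out, \<open>b'\<close> stands in
          its place and can be pulled out for the sign \<open>-s\<close>, the parallels having
          flipped. The second exchange of unders undoes the first one, so the result is
          \<open>E\<close> without the R2 pair.\<close>
        fix w' assume w: "w = b' # w'"
        let ?WD = "ext_overs W i ps w" and ?VD = "ext_unders W V j ps c"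
        have b': "b' \<notin> set ps" "b' \<notin> set (W j)" using f(12) w uW[of b' i j] Wi f(1) by auto
        then have tb: "trs ps (W j) b' = b'" by (rule trs_other)
        have tb': "trs ps (W j) x = b' \<longleftrightarrow> x = b'" for x using tb inj_trs[OF f(2,3)] by (metis injD)
        have "list_all2 (par ?VD g (- s)) ps (W j)"
          unfolding list_all2_conv_all_nth using f(2) par_ext_flip[OF T d] by simp
        then have d': "divs ?WD ?VD g i j (- s) ps b' w' (map (trs ps (W j)) (filter (\<lambda>x. x \<noteq> c) ys))"
          using f w v Vj C' gc tb by (simp add: divs_def ext_overs_def ext_unders_def)
        have "ou (ext_overs ?WD i ps w') (ext_unders ?WD ?VD j ps b') g = del_crossings C E"
        proof -
          have "ext_overs ?WD i ps w' = dl C W"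
          proof
            fix a
            show "ext_overs ?WD i ps w' a = dl C W a"
            proof (cases "a = i")
              case True
              have "filter (\<lambda>x. x \<notin> C) ps = ps" "filter (\<lambda>x. x \<notin> C) w' = w'"
                using f(4,10,13) b' w C'(1) by (auto intro!: filter_True)
              then show ?thesis using True Wi w C'(1) by (simp add: ext_overs_def dl_def)
            next
              case False
              then have "c \<notin> set (W a)" "b' \<notin> set (W a)" using uW[of _ a i] Wi w by auto
              then have "filter (\<lambda>x. x \<notin> C) (W a) = W a" using C'(1) by (auto intro!: filter_True)
              then show ?thesis using False by (simp add: ext_overs_def dl_def)
            qed
          qed
          moreover have "ext_unders ?WD ?VD j ps b' a = dl C V a" for a
          proof -
            have "?WD j = W j" using f(1) by (simp add: ext_overs_def)
            then have "ext_unders ?WD ?VD j ps b' a = map (trs ps (W j)) (map (trs ps (W j)) (filter (\<lambda>x. x \<noteq> b') (filter (\<lambda>x. x \<noteq> c) (V a))))"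
              by (simp add: ext_unders_def filter_map comp_def tb')
            also have "\<dots> = dl C V a" using trs_range(3)[OF f(2,3)] C'(1)
              by (auto simp: dl_def comp_def intro!: filter_cong)
            finally show ?thesis .
          qed
          ultimately show ?thesis unfolding E(1) del_ou by (metis ext)
        qed
        then have "link n i j (- s) (del_crossings C E) D" unfolding link_def D using d' la(1)[unfolded D] by metis
        moreover have "(E, del_crossings C E) \<in> vAC_rel n" using red1_steps_vAC[OF _ la(6)] red1I[OF C] by blast
        ultimately show ?thesis using crossing_number_del(2)[OF la(2) CE] vAC_refl[OF la(5)]
          by (intro exI[of _ D] exI[of _ "del_crossings C E"]) simp
      next
        \<comment> \<open>The parallel \<open>q\<close> of \<open>b'\<close> is the last over of
          strand \<open>j\<close>. The sign of \<open>b'\<close> forces the unders of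
          \<open>j\<close> to start with \<open>c, b', q\<close>, so \<open>q\<close> becomes a kink
          when the R2 pair is removed from \<open>E\<close>; in \<open>D\<close> it is a kink
          already. With \<open>q\<close> removed on both sides, \<open>b'\<close> can be pulled out
          for the sign \<open>-s\<close> with the shorter list \<open>ps'\<close>.\<close>
        fix ps' assume ps: "ps = ps' @ [b']"
        let ?WD = "ext_overs W i ps w" and ?VD = "ext_unders W V j ps c" and ?t = "trs ps (W j)"
        obtain qs' q where qs: "W j = qs' @ [q]" using f(2) ps by (cases "W j" rule: rev_cases) auto
        have l: "length ps' = length qs'" using f(2) ps qs by simp
        have dis: "distinct (ps' @ qs')" "b' \<noteq> q" "b' \<notin> set ps'" "b' \<notin> set qs'" "q \<notin> set ps'" "q \<notin> set qs'"
          using f(3) ps qs by auto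
        have par: "list_all2 (par V g s) ps (W j)" using d by (simp add: divs_def)
        then have "par V g s b' q" using list_all2_nthD[OF par, of "length ps'"] ps qs l by (simp add: nth_append)
        then have gq: "g b' = g q" and nq: "nxt V b' q" using C'(3) gc f(9) by (auto simp: par_def split: if_splits)
        then obtain a xs zs where a: "V a = xs @ [b', q] @ zs" unfolding nxt_def by blast
        then have "a = j" using uV[of b' a j] Vj v by simp
        then have "[c] @ b' # ys = xs @ b' # (q # zs)" using a Vj v by simp
        moreover have "b' \<notin> set [c]" "b' \<notin> set ys" using dW(2)[of j] Vj v by auto
        ultimately have ys: "ys = q # zs" using append_Cons_eq_iff[of b' "[c]" ys xs "q # zs"] by simp
        have tb: "?t b' = q" "?t q = b'"
          using trs_nth[OF f(2,3), of "length ps'"] ps qs l by (auto simp: nth_append)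
        have tiff: "?t x = q \<longleftrightarrow> x = b'" "?t x = b' \<longleftrightarrow> x = q" for x using tb inj_trs[OF f(2,3)] by (metis injD)+
        have tt: "trs ps' qs' (?t x) = x" if "x \<notin> {b', q}" for x
        proof -
          have "filter (\<lambda>x. x \<notin> {b', q}) ps = ps'" "filter (\<lambda>x. x \<notin> {b', q}) (W j) = qs'"
            using dis by (auto simp: ps qs intro!: filter_True)
          moreover have "(x, y) \<in> set (zip ps (W j)) \<Longrightarrow> x \<in> {b', q} \<longleftrightarrow> y \<in> {b', q}" for x y
            using dis l by (auto simp: ps qs dest: set_zip_leftD set_zip_rightD)
          ultimately have "trs ps' qs' x = ?t x" using trs_filter[OF par f(3), of "{b', q}" x] that by metis
          then show ?thesis using trs_range(3)[OF l dis(1)] by metis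
        qed
        let ?WD' = "dl {q} ?WD" and ?VD' = "dl {q} ?VD"
        have b'j: "b' \<notin> set (W a)" if "a \<noteq> i" for a using that uW[of b' a i] Wi ps by auto
        have qj: "q \<notin> set (W a)" if "a \<noteq> j" for a using that uW[of q a j] qs by auto
        have cj: "c \<notin> set (W a)" if "a \<noteq> i" for a using that uW[of c a i] Wi by auto
        have b'w: "b' \<notin> set w" using f(12) ps by auto
        have qw: "q \<notin> set w" using qj[OF f(1)] Wi by auto
        have WD'i: "?WD' i = ps' @ b' # w" using dis qw by (simp add: dl_def ext_overs_def ps filter_neq)
        have WD'j: "?WD' j = qs'" using dis f(1) by (simp add: dl_def ext_overs_def qs filter_neq)
        have VDj: "?VD j = q # b' # map ?t (filter (\<lambda>x. x \<noteq> c) zs)"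
          using Vj v ys tb C'(2) f(5) qs f(11) by (auto simp: ext_unders_def)
        have "list_all2 (par ?VD' g (- s)) ps' qs'"
          unfolding list_all2_conv_all_nth
        proof (intro conjI allI impI l)
          fix m assume m: "m < length ps'"
          then have "par ?VD g (- s) (ps' ! m) (qs' ! m)" using par_ext_flip[OF T d, of m] l by (simp add: ps qs nth_append)
          moreover have "ps' ! m \<noteq> q" "qs' ! m \<noteq> q" using m l dis by (metis nth_mem)+
          ultimately show "par ?VD' g (- s) (ps' ! m) (qs' ! m)" by (auto simp: par_def intro: nxt_dl)
        qed
        moreover have "?VD' j = b' # filter (\<lambda>x. x \<noteq> q) (map ?t (filter (\<lambda>x. x \<noteq> c) zs))"
          using VDj dis(2) by (simp add: dl_def)
        ultimately have d': "divs ?WD' ?VD' g i j (- s) ps' b' w (filter (\<lambda>x. x \<noteq> q) (map ?t (filter (\<lambda>x. x \<noteq> c) zs)))"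
          using f(1) WD'i WD'j C'(3) gc by (simp add: divs_def)
        let ?X = "{c, b', q}"
        have "ou (ext_overs ?WD' i ps' w) (ext_unders ?WD' ?VD' j ps' b') g = del_crossings ?X E"
        proof -
          have "ext_overs ?WD' i ps' w = dl ?X W"
          proof
            fix a
            have fX: "filter (\<lambda>x. x \<notin> ?X) xs = filter (\<lambda>x. x \<noteq> q) xs" if "c \<notin> set xs" "b' \<notin> set xs" for xs
              using that by (auto intro!: filter_cong)
            show "ext_overs ?WD' i ps' w a = dl ?X W a"
            proof (cases "a = i")
              case True
              have "filter (\<lambda>x. x \<notin> ?X) ps' = ps'" "filter (\<lambda>x. x \<notin> ?X) w = w"
                using fX[of ps'] fX[of w] f(4,10) dis b'w qw ps by (auto simp: filter_neq)
              then show ?thesis using True Wi ps by (simp add: ext_overs_def dl_def)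
            next
              case False
              then show ?thesis using fX[OF cj[OF False] b'j[OF False]] by (simp add: ext_overs_def dl_def)
            qed
          qed
          moreover have "ext_unders ?WD' ?VD' j ps' b' a = dl ?X V a" for a
          proof -
            have "ext_unders ?WD' ?VD' j ps' b' a =
                map (\<lambda>x. trs ps' qs' (?t x)) (filter (\<lambda>x. x \<noteq> q) (filter (\<lambda>x. x \<noteq> b') (filter (\<lambda>x. x \<noteq> c) (V a))))"
              unfolding ext_unders_def WD'j by (simp add: dl_def filter_map comp_def tiff)
            also have "\<dots> = map (\<lambda>x. x) (filter (\<lambda>x. x \<noteq> q) (filter (\<lambda>x. x \<noteq> b') (filter (\<lambda>x. x \<noteq> c) (V a))))"
              by (rule map_cong) (use tt in auto)
            also have "\<dots> = dl ?X V a" by (auto simp: dl_def intro!: filter_cong)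
            finally show ?thesis .
          qed
          ultimately show ?thesis unfolding E(1) del_ou by (metis ext)
        qed
        moreover have DD: "del_crossings {q} D = ou ?WD' ?VD' g" unfolding D del_ou ..
        moreover have "del_crossings {q} D \<in> TD n" using del_TD[OF la(1)] .
        ultimately have lk: "link n i j (- s) (del_crossings ?X E) (del_crossings {q} D)"
          unfolding link_def using d' by metis
        have sD: "strand D j = map Over qs' @ [Over q, Under q] @ map Under (b' # map ?t (filter (\<lambda>x. x \<noteq> c) zs))"
          unfolding D strand_ou VDj using f(1) qs by (simp add: ext_overs_def)
        then have "seg D [Over q, Under q]" unfolding seg_def by blast
        then have rD: "red1 D (del_crossings {q} D)" by (intro red1I) (auto simp: rdel_def adjacent_seg)
        have "strand E j = map Over qs' @ [Over q, Under c, Under b', Under q] @ map Under zs"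
          unfolding E(1) strand_ou Vj v ys qs by simp
        then have "seg E [Over q, Under c, Under b', Under q]" unfolding seg_def by blast
        then have "adjacent (del_crossings C E) (Over q) (Under q)"
          by (rule adjacent_seg_del[of _ _ _ "[]" _ _ "[]"]) (use C'(1) dis(2) f(5) qs in auto)
        then have "red1 (del_crossings C E) (del_crossings {q} (del_crossings C E))"
          by (intro red1I) (auto simp: rdel_def)
        then have "red1\<^sup>*\<^sup>* E (del_crossings ?X E)" using red1I[OF C] C'(1) unfolding del_del
          by (simp add: insert_commute)
        then have "(E, del_crossings ?X E) \<in> vAC_rel n" "(D, del_crossings {q} D) \<in> vAC_rel n"
          using red1_steps_vAC la(5,6) rD by blast+
        moreover have "crossing_number (del_crossings ?X E) + crossing_number (del_crossings {q} D) < crossing_number E + crossing_number D"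
        proof -
          have "crossing_number (del_crossings ?X E) \<le> crossing_number E" by (rule crossing_number_del(1)[OF la(2)])
          moreover have "crossing_number (del_crossings {q} D) < crossing_number D"
            using rdel_crossings[OF la(1)] \<open>seg D [Over q, Under q]\<close> seg_points
            by (intro crossing_number_del(2)[OF la(1)]) (force simp: crossings_points)+
          ultimately show ?thesis by simp
        qed
        ultimately show ?thesis using lk by (intro exI[of _ "del_crossings {q} D"] exI[of _ "del_crossings ?X E"]) simp
      qed
    next
      case 3
      have "\<exists>x y. C = {x, y} \<and> nxt W x y \<and> g x = - g y \<and> (nxt V x y \<or> nxt V y x)"
        using O
      proof
        assume "nxt W a b" then show ?thesis using U R2 by blast
      next
        assume "nxt W b a" then show ?thesis using U R2 by (intro exI[of _ b] exI[of _ a]) auto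
      qed
      then obtain x y where xy: "C = {x, y}" "nxt W x y" "g x = - g y" "nxt V x y \<or> nxt V y x"
        by blast
      then obtain e xs zs where e: "W e = xs @ [x, y] @ zs" unfolding nxt_def by blast
      let ?k = "length xs"
      have ek: "W e ! ?k = x" "W e ! Suc ?k = y" "Suc ?k < length (W e)" by (auto simp: e nth_append)
      have xye: "x \<in> set (W e)" "y \<in> set (W e)" by (auto simp: e)
      have "e = i \<or> e = j"
        using 3(2) xy(1) xye uW[of x e i] uW[of y e i] uW[of x e j] uW[of y e j] Wi by auto
      \<comment> \<open>The overs of the pair lie both in \<open>ps\<close> or both in
        \<open>W j\<close>: an entry of \<open>ps\<close> followed by one outside would be followed
        by \<open>c\<close>. So they sit at the positions \<open>?k\<close> and
        \<open>Suc ?k\<close> of that list, and their partners at the same positions of the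
        other.\<close>
      then have m: "Suc ?k < length ps \<and> (x = ps ! ?k \<and> y = ps ! Suc ?k \<or> x = W j ! ?k \<and> y = W j ! Suc ?k)"
      proof
        assume "e = j" then show ?thesis using ek f(2) by auto
      next
        assume ei: "e = i"
        have "x \<notin> set (W j)" "y \<notin> set (W j)" using uW[of x i j] uW[of y i j] xye ei f(1) by auto
        then have xyp: "x \<in> set ps \<or> y \<in> set ps" using 3(2) xy(1) by auto
        have nc: "x \<noteq> c" "y \<noteq> c" using 3(1) xy(1) by auto
        consider "Suc ?k < length ps" | "Suc ?k = length ps" | "length ps \<le> ?k" by linarith
        then show ?thesis
        proof cases
          case 1 then show ?thesis using ek ei Wi by (simp add: nth_append)
        next
          case 2 then have "y = c" using ek ei Wi by (simp add: nth_append)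
          then show ?thesis using nc by simp
        next
          case 3
          then have "x = (c # w) ! (?k - length ps)" "y = (c # w) ! (Suc ?k - length ps)" 
            "Suc ?k - length ps < length (c # w)"
            using ek ei Wi by (auto simp: nth_append)
          then have "x \<in> set (c # w)" "y \<in> set (c # w)" by (metis Suc_lessD nth_mem Suc_diff_le 3)+
          then show ?thesis using xyp f(4,12) by auto
        qed
      qed
      have par: "list_all2 (par V g s) ps (W j)" using d by (simp add: divs_def)
      have "g (ps ! ?k) = g (W j ! ?k)" "g (ps ! Suc ?k) = g (W j ! Suc ?k)"
        using list_all2_nthD[OF par, of ?k] list_all2_nthD[OF par, of "Suc ?k"] m by (auto simp: par_def)
      then have sg: "g (ps ! ?k) = - g (ps ! Suc ?k)" using m xy(3) by auto
      have U': "nxt V (ps ! ?k) (ps ! Suc ?k) \<or> nxt V (ps ! Suc ?k) (ps ! ?k) \<or>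
        nxt V (W j ! ?k) (W j ! Suc ?k) \<or> nxt V (W j ! Suc ?k) (W j ! ?k)" using m xy(4) by auto
      note lr = link_reduce_parallel[OF T d _ sg U', folded D E(1)]
      have "{ps ! ?k, ps ! Suc ?k, W j ! ?k, W j ! Suc ?k} \<subseteq> crossings E"
        unfolding E(1) crossings_ou using m f(2) Wi by (auto intro: exI[of _ i] exI[of _ j])
      then show ?thesis using finish lr m by blast
    qed
  qed
qed

section \<open>Existence of links by insertion of R2 pairs\<close>

lemma ou_fresh_iso:
  assumes "\<And>x. x \<in> crossings (ou W V g) \<Longrightarrow> g' x = g x"
  shows "diag_iso (ou W V g) (ou W V g')"
proof -
  have "map_endpt (\<lambda>x. x) = (id :: nat endpt \<Rightarrow> nat endpt)"
    by (rule ext) (simp add: endpt.map_ident)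
  then show ?thesis unfolding diag_iso_def
    by (intro exI[of _ "\<lambda>x. x"]) (use assms in \<open>auto simp: strand_ou inj_on_def\<close>)
qed

lemma ou_TDD:
  assumes "ou W V g \<in> TD n"
  shows "a \<notin> {1..n} \<Longrightarrow> W a = []" "a \<notin> {1..n} \<Longrightarrow> V a = []" "distinct (W a)" "distinct (V a)"
    "a \<noteq> b \<Longrightarrow> set (W a) \<inter> set (W b) = {}" "a \<noteq> b \<Longrightarrow> set (V a) \<inter> set (V b) = {}"
    "c \<in> set (W a) \<Longrightarrow> \<exists>b. c \<in> set (V b)" "c \<in> set (V a) \<Longrightarrow> \<exists>b. c \<in> set (W b)"
    "c \<in> set (W a) \<Longrightarrow> g c = 1 \<or> g c = -1"
  using assms unfolding ou_TD by (simp, simp, simp, simp, simp, simp, metis, metis, metis)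

text \<open>Behind \<open>ps\<close> strand \<open>i\<close> gets an R2 pair \<open>p, q\<close>
  over the place of \<open>Under x\<close>. The member \<open>p\<close> has the sign of
  \<open>x\<close> and comes next to \<open>Under x\<close>, on the side that \<open>par\<close>
  asks for; \<open>q\<close> has the opposite sign and stands on the far side of \<open>p\<close>.
  Only adjacencies at \<open>x\<close> are broken.\<close>

lemma insert_parallel_pair:
  assumes T: "ou W V g \<in> TD n" and x: "x \<in> set (W j)" and ij: "i \<noteq> j" "i \<in> {1..n}"
    and Wi: "W i = ps @ w" and s: "s \<in> {1, -1}"
  shows "\<exists>p q V' g'. (ou W V g, ou (W(i := ps @ [p, q] @ w)) V' g') \<in> vAC_rel n \<and> par V' g' s p x \<and>
    (\<forall>y z. y \<noteq> x \<longrightarrow> z \<noteq> x \<longrightarrow> nxt V y z \<longrightarrow> nxt V' y z) \<and> (\<forall>y\<in>crossings (ou W V g). g' y = g y)"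
proof -
  note td = ou_TDD[OF T]
  have fin: "finite (crossings (ou W V g))" by (rule finite_crossings[OF T])
  obtain p where p: "p \<notin> crossings (ou W V g)" using fin ex_new_if_finite infinite_UNIV_nat by blast
  obtain q where q: "q \<notin> insert p (crossings (ou W V g))" using fin ex_new_if_finite infinite_UNIV_nat by blast
  have pW: "p \<notin> set (W a)" "q \<notin> set (W a)" for a using p q unfolding crossings_ou by auto
  have pV: "p \<notin> set (V a)" "q \<notin> set (V a)" for a using pW td(8) by metis+
  have pq: "p \<noteq> q" using q by auto
  obtain b where "x \<in> set (V b)" using td(7)[OF x] by blast
  then obtain us vs where Vb: "V b = us @ x # vs" by (metis split_list)
  have xp: "x \<noteq> p" "x \<noteq> q" using x pW by metis+
  have gx: "g x = 1 \<or> g x = -1" by (rule td(9)[OF x])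
  define L where "L = (if s * g x = 1 then [x, p, q] else [q, p, x])"
  have L: "set L = {x, p, q}" "distinct L" using xp pq by (auto simp: L_def)
  define V' where "V' = V(b := us @ L @ vs)"
  define W' where "W' = W(i := ps @ [p, q] @ w)"
  define g' where "g' = g(p := g x, q := - g x)"
  have dV: "distinct (us @ x # vs)" using td(4)[of b] Vb by simp
  have xus: "x \<notin> set us" "x \<notin> set vs" using dV by auto
  have setV: "set (V' a) = set (V a) \<union> (if a = b then {p, q} else {})" for a
    using Vb L by (auto simp: V'_def)
  have setW: "set (W' a) = set (W a) \<union> (if a = i then {p, q} else {})" for a
    using Wi by (auto simp: W'_def)
  have bn: "b \<in> {1..n}" using td(2) Vb by (metis Nil_is_append_conv list.distinct(1))
  have T': "ou W' V' g' \<in> TD n"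
    unfolding ou_TD
  proof (intro conjI allI impI)
    fix a assume "a \<notin> {1..n}" then show "W' a = []" "V' a = []"
      using td(1,2)[of a] ij bn by (auto simp: W'_def V'_def)
  next
    fix a show "distinct (W' a)"
      using td(3)[of a] Wi pW[of i] pq by (cases "a = i") (auto simp: W'_def)
  next
    fix a show "distinct (V' a)"
      using td(4)[of a] dV L pV[of b] Vb by (cases "a = b") (auto simp: V'_def)
  next
    fix a a' :: nat assume "a \<noteq> a'"
    then show "set (W' a) \<inter> set (W' a') = {}" "set (V' a) \<inter> set (V' a') = {}"
      unfolding setW setV using td(5,6)[of a a'] pW pV by auto
  next
    fix c show "(\<exists>a. c \<in> set (W' a)) \<longleftrightarrow> (\<exists>a. c \<in> set (V' a))"
      unfolding setW setV using td(7,8) by (cases "c = p \<or> c = q") (auto split: if_splits, metis+)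
  next
    fix c a assume "c \<in> set (W' a)"
    then have "c = p \<or> c = q \<or> c \<in> set (W a)" unfolding setW by (auto split: if_splits)
    then show "g' c = 1 \<or> g' c = -1" using td(9)[of c a] gx by (auto simp: g'_def)
  qed
  have gg: "g' y = g y" if "y \<in> crossings (ou W V g)" for y using that p q by (auto simp: g'_def)
  have filt: "filter (\<lambda>x. x \<noteq> p \<and> x \<noteq> q) xs = xs" if "p \<notin> set xs" "q \<notin> set xs" for xs
    by (rule filter_True) (use that in auto)
  have "dl {p, q} W' = W"
  proof
    fix a show "dl {p, q} W' a = W a"
      using pW[of a] Wi by (auto simp: dl_def W'_def filt)
  qed
  moreover have "dl {p, q} V' = V"
  proof
    fix a show "dl {p, q} V' a = V a"
      using pV[of a] Vb xp by (auto simp: dl_def V'_def L_def filt)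
  qed
  ultimately have del: "del_crossings {p, q} (ou W' V' g') = ou W V g'" by (simp add: del_ou)
  have "nxt W' p q" unfolding nxt_def by (intro exI[of _ i] exI[of _ ps] exI[of _ w]) (simp add: W'_def)
  moreover have "nxt V' p q \<or> nxt V' q p"
  proof (cases "s * g x = 1")
    case True
    then have "V' b = (us @ [x]) @ [p, q] @ vs" by (simp add: V'_def L_def)
    then show ?thesis unfolding nxt_def by blast
  next
    case False
    then have "V' b = us @ [q, p] @ (x # vs)" by (simp add: V'_def L_def)
    then show ?thesis unfolding nxt_def by blast
  qed
  ultimately have "red1 (ou W' V' g') (ou W V g')"
    unfolding del[symmetric]
    by (intro red1I R2_rdel) (use pq in \<open>auto simp: adjacent_seg seg_ou_Over seg_ou_Under g'_def\<close>)
  moreover have A': "ou W' V' g' \<in> AC n" using OU_AC[OF T' OU_ou] .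
  ultimately have "(ou W' V' g', ou W V g') \<in> vAC_rel n" using red1_steps_vAC by blast
  moreover have "(ou W V g, ou W V g') \<in> vAC_rel n" using ou_fresh_iso gg OU_AC[OF T OU_ou] vAC_iso by blast
  ultimately have "(ou W V g, ou W' V' g') \<in> vAC_rel n" using vAC_sym vAC_trans by blast
  moreover have "par V' g' s p x"
  proof (cases "s * g x = 1")
    case True
    then have "V' b = us @ [x, p] @ (q # vs)" by (simp add: V'_def L_def)
    then have "nxt V' x p" unfolding nxt_def by blast
    then show ?thesis using True xp pq by (simp add: par_def g'_def)
  next
    case False
    then have "V' b = (us @ [q]) @ [p, x] @ vs" by (simp add: V'_def L_def)
    then have "nxt V' p x" unfolding nxt_def by blast
    then show ?thesis using False xp pq by (simp add: par_def g'_def)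
  qed
  moreover have "nxt V' y z" if "y \<noteq> x" "z \<noteq> x" and n: "nxt V y z" for y z
  proof -
    \<comment> \<open>\<open>V'\<close> arises from \<open>V\<close> by substituting
      \<open>L\<close> for \<open>x\<close>, so neighbours different from \<open>x\<close> stay
      neighbours.\<close>
    define h where "h = (\<lambda>y. if y = x then L else [y])"
    have id: "x \<notin> set xs \<Longrightarrow> concat (map h xs) = xs" for xs by (induction xs) (auto simp: h_def)
    have V'a: "V' a = concat (map h (V a))" for a
    proof (cases "a = b")
      case True then show ?thesis using Vb id xus by (simp add: V'_def h_def)
    next
      case False
      then have "x \<notin> set (V a)" using td(6)[of a b] Vb by auto
      then show ?thesis using id False by (simp add: V'_def)
    qed
    obtain a xs ys where "V a = xs @ [y, z] @ ys" using n unfolding nxt_def by blast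
    then have "V' a = concat (map h xs) @ [y, z] @ concat (map h ys)" unfolding V'a using that by (simp add: h_def)
    then show ?thesis unfolding nxt_def by blast
  qed
  ultimately show ?thesis using gg unfolding W'_def by blast
qed

text \<open>One pair is inserted for each over of \<open>j\<close>; the members \<open>p\<close>
  grow into the list \<open>ps\<close>, while the members \<open>q\<close> are left behind in
  \<open>w\<close>. The parallels are made for \<open>-s\<close>, since \<open>E1\<close> is
  obtained by exchanging their unders, which turns them into parallels for \<open>s\<close>, and by
  adding \<open>c\<close> behind \<open>ps\<close> and in front of the unders of
  \<open>j\<close>.\<close>

lemma link_exists:
  assumes D: "D \<in> TD n" "OU D" and ij: "i \<in> {1..n}" "j \<in> {1..n}" "i \<noteq> j" and s: "s \<in> {1, -1}"
  shows "\<exists>D1 E1. link n i j s D1 E1 \<and> (D, D1) \<in> vAC_rel n"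
proof -
  obtain W0 V0 where D0: "D = ou W0 V0 (csign D)" by (rule OU_obtain[OF D(2)])
  have "\<exists>W V g ps w. (D, ou W V g) \<in> vAC_rel n \<and> W j = W0 j \<and> W i = ps @ w \<and> length ps = m \<and>
      list_all2 (par V g (- s)) ps (take m (W0 j))" if "m \<le> length (W0 j)" for m
    using that
  proof (induction m)
    case 0
    have "(D, ou W0 V0 (csign D)) \<in> vAC_rel n" using D0 vAC_refl OU_AC D by metis
    then have "(D, ou W0 V0 (csign D)) \<in> vAC_rel n \<and> W0 j = W0 j \<and> W0 i = [] @ W0 i \<and> length ([] :: nat list) = 0 \<and>
      list_all2 (par V0 (csign D) (- s)) [] (take 0 (W0 j))" by simp
    then show ?case by blast
  next
    case (Suc m)
    then obtain W V g ps w where A: "(D, ou W V g) \<in> vAC_rel n" "W j = W0 j" "W i = ps @ w" "length ps = m"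
      "list_all2 (par V g (- s)) ps (take m (W0 j))" by auto
    have T: "ou W V g \<in> TD n" using A(1) vAC_in AC_TD by blast
    note td = ou_TDD[OF T]
    define x where "x = W0 j ! m"
    have xj: "x \<in> set (W j)" using Suc.prems A(2) by (simp add: x_def)
    have s': "- s \<in> {1, -1}" using s by auto
    obtain p q V' g' where B: "(ou W V g, ou (W(i := ps @ [p, q] @ w)) V' g') \<in> vAC_rel n" "par V' g' (- s) p x"
      "\<And>y z. y \<noteq> x \<Longrightarrow> z \<noteq> x \<Longrightarrow> nxt V y z \<Longrightarrow> nxt V' y z" "\<And>y. y \<in> crossings (ou W V g) \<Longrightarrow> g' y = g y"
      using insert_parallel_pair[OF T xj ij(3) ij(1) A(3) s'] by blast
    have "list_all2 (par V' g' (- s)) ps (take m (W0 j))"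
      unfolding list_all2_conv_all_nth
    proof (intro conjI allI impI)
      show "length ps = length (take m (W0 j))" using A(4) Suc.prems by simp
      fix k assume k: "k < length ps"
      have P: "par V g (- s) (ps ! k) (W0 j ! k)" using list_all2_nthD[OF A(5) k] A(4) k by simp
      have kl: "k < length (W0 j)" "k \<noteq> m" using k A(4) Suc.prems by auto
      have m1: "ps ! k \<in> set (W i)" using A(3) k by simp
      have m2: "W0 j ! k \<in> set (W j)" using A(2) kl by simp
      have "distinct (W0 j)" using td(3)[of j] A(2) by simp
      then have "W0 j ! k \<noteq> x" using kl Suc.prems by (simp add: x_def nth_eq_iff_index_eq)
      moreover have "ps ! k \<noteq> x" using m1 xj td(5)[OF ij(3)] by blast
      moreover have "g' (ps ! k) = g (ps ! k)" "g' (W0 j ! k) = g (W0 j ! k)"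
        using m1 m2 by (auto intro!: B(4) simp: crossings_ou)
      ultimately show "par V' g' (- s) (ps ! k) (take m (W0 j) ! k)"
        using P B(3) k A(4) by (auto simp: par_def split: if_splits)
    qed
    then have "list_all2 (par V' g' (- s)) (ps @ [p]) (take (Suc m) (W0 j))"
      using B(2) Suc.prems by (simp add: take_Suc_conv_app_nth list_all2_appendI x_def)
    moreover have "(D, ou (W(i := ps @ [p, q] @ w)) V' g') \<in> vAC_rel n" using A(1) B(1) vAC_trans by blast
    ultimately have "(D, ou (W(i := ps @ [p, q] @ w)) V' g') \<in> vAC_rel n \<and> (W(i := ps @ [p, q] @ w)) j = W0 j \<and>
        (W(i := ps @ [p, q] @ w)) i = (ps @ [p]) @ (q # w) \<and> length (ps @ [p]) = Suc m \<and>
        list_all2 (par V' g' (- s)) (ps @ [p]) (take (Suc m) (W0 j))"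
      using A ij(3) by simp
    then show ?case by blast
  qed
  from this[OF order_refl] obtain W V g ps w where A: "(D, ou W V g) \<in> vAC_rel n" "W j = W0 j" "W i = ps @ w"
    "length ps = length (W0 j)" "list_all2 (par V g (- s)) ps (W j)" by auto
  have T: "ou W V g \<in> TD n" using A(1) vAC_in AC_TD by blast
  note td = ou_TDD[OF T]
  have fin: "finite (crossings (ou W V g))" by (rule finite_crossings[OF T])
  obtain c where c: "c \<notin> crossings (ou W V g)" using fin ex_new_if_finite infinite_UNIV_nat by blast
  have cW: "c \<notin> set (W a)" for a using c unfolding crossings_ou by auto
  have cV: "c \<notin> set (V a)" for a using cW td(8) by metis
  have l: "length ps = length (W j)" using A by simp
  have dis: "distinct (ps @ W j)"
  proof -
    have "distinct (W i)" "distinct (W j)" "set (W i) \<inter> set (W j) = {}" using td(3,5) ij(3) by simp_all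
    then show ?thesis using A(3) by auto
  qed
  let ?t = "trs ps (W j)"
  have cps: "c \<notin> set ps" "c \<notin> set (W j)" using cW[of i] cW[of j] A(3) by auto
  have tc: "?t c = c" by (rule trs_other[OF cps])
  have tc': "?t x = c \<longleftrightarrow> x = c" for x using tc inj_trs[OF l dis] by (metis injD)
  have tt: "?t (?t x) = x" for x by (rule trs_range(3)[OF l dis])
  define WE where "WE = W(i := ps @ c # w)"
  define V1 where "V1 a = map ?t (V a)" for a
  define VE where "VE = V1(j := c # V1 j)"
  define gE where "gE = g(c := s)"
  have seq: "set (W a) = (if a = i then set (ps @ w) else set (W a))" for a using A(3) by simp
  have setW: "set (WE a) = set (W a) \<union> (if a = i then {c} else {})" for a
    using A(3) by (auto simp: WE_def)
  have setV: "set (VE a) = ?t ` set (V a) \<union> (if a = j then {c} else {})" for a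
    by (auto simp: VE_def V1_def)
  \<comment> \<open>The transpositions permute the crossings of the diagram, so overs and unders
    still match after the unders have been renamed.\<close>
  have tW: "(\<exists>a. ?t x \<in> set (W a)) \<longleftrightarrow> (\<exists>a. x \<in> set (W a))" for x
  proof -
    have *: "\<exists>a. ?t x \<in> set (W a)" if "x \<in> set (W a)" for x a
    proof (cases "x \<in> set ps \<or> x \<in> set (W j)")
      case True
      then have "?t x \<in> set (W j) \<or> ?t x \<in> set (W i)" using trs_range(1,2)[OF l dis, of x] A(3) by auto
      then show ?thesis by blast
    next
      case False then show ?thesis using that trs_other by metis
    qed
    show ?thesis using * tt by metis
  qed
  have im: "x \<in> ?t ` set (V a) \<longleftrightarrow> ?t x \<in> set (V a)" for x a
    using tt by (metis image_iff)
  have cV1: "c \<notin> set (V1 a)" for a using cV[of a] by (simp add: V1_def im tc del: image_iff)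
  have TE: "ou WE VE gE \<in> TD n"
    unfolding ou_TD
  proof (intro conjI allI impI)
    fix a assume "a \<notin> {1..n}" then show "WE a = []" "VE a = []"
      using td(1,2)[of a] ij by (auto simp: WE_def VE_def V1_def)
  next
    fix a show "distinct (WE a)"
      using td(3)[of a] cW[of i] A(3) by (cases "a = i") (auto simp: WE_def)
  next
    fix a
    have "distinct (V1 a)" unfolding V1_def distinct_map
      using td(4)[of a] inj_on_subset[OF inj_trs[OF l dis] subset_UNIV] by blast
    then show "distinct (VE a)" using cV1[of a] by (auto simp: VE_def)
  next
    fix a a' :: nat assume "a \<noteq> a'"
    then have "set (W a) \<inter> set (W a') = {}" "set (V a) \<inter> set (V a') = {}" using td(5,6) by simp_all
    moreover from this(2) have "?t ` set (V a) \<inter> ?t ` set (V a') = {}"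
      by (simp add: image_Int[OF inj_trs[OF l dis], symmetric])
    moreover have "c \<notin> ?t ` set (V a)" "c \<notin> ?t ` set (V a')" using cV1 unfolding V1_def set_map by blast+
    ultimately show "set (WE a) \<inter> set (WE a') = {}" "set (VE a) \<inter> set (VE a') = {}"
      unfolding setW setV using \<open>a \<noteq> a'\<close> cW by (simp_all add: Int_Un_distrib Int_Un_distrib2 del: image_iff)
  next
    fix x show "(\<exists>a. x \<in> set (WE a)) \<longleftrightarrow> (\<exists>a. x \<in> set (VE a))"
    proof (cases "x = c")
      case True then show ?thesis unfolding setW setV by auto
    next
      case False
      then have "(\<exists>a. x \<in> set (WE a)) \<longleftrightarrow> (\<exists>a. ?t x \<in> set (W a))" unfolding setW tW by auto
      also have "\<dots> \<longleftrightarrow> (\<exists>a. ?t x \<in> set (V a))" using td(7,8) by metis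
      also have "\<dots> \<longleftrightarrow> (\<exists>a. x \<in> set (VE a))" unfolding setV using False by (auto simp: im)
      finally show ?thesis .
    qed
  next
    fix x a assume "x \<in> set (WE a)"
    then have "x = c \<or> x \<in> set (W a)" unfolding setW by (auto split: if_splits)
    then show "gE x = 1 \<or> gE x = -1" using td(9)[of x a] s by (auto simp: gE_def)
  qed
  have "list_all2 (par VE gE s) ps (W j)"
    unfolding list_all2_conv_all_nth
  proof (intro conjI allI impI l)
    fix k assume k: "k < length ps"
    have P: "par V g (- s) (ps ! k) (W j ! k)" using list_all2_nthD[OF A(5) k] .
    have mm: "ps ! k \<in> set ps" "W j ! k \<in> set (W j)" using k l by auto
    then have ne: "ps ! k \<noteq> c" "W j ! k \<noteq> c" using cps by metis+
    have "g (W j ! k) = 1 \<or> g (W j ! k) = -1" by (rule td(9)[OF mm(2)])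
    moreover have t: "?t (ps ! k) = W j ! k" "?t (W j ! k) = ps ! k" using trs_nth[OF l dis k] by auto
    moreover have N: "nxt VE (?t y) (?t z)" if "nxt V y z" for y z
    proof -
      have "nxt V1 (?t y) (?t z)" using nxt_map[OF that, of ?t] by (simp add: V1_def[abs_def])
      then obtain a xs ys where a: "V1 a = xs @ [?t y, ?t z] @ ys" unfolding nxt_def by blast
      have "\<exists>xs. VE a = xs @ [?t y, ?t z] @ ys"
        using a by (cases "a = j") (auto simp: VE_def intro: exI[of _ "c # xs"])
      then show ?thesis unfolding nxt_def by blast
    qed
    ultimately show "par VE gE s (ps ! k) (W j ! k)"
      using P s ne N[of "ps ! k" "W j ! k"] N[of "W j ! k" "ps ! k"] by (auto simp: par_def gE_def split: if_splits)
  qed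
  then have d: "divs WE VE gE i j s ps c w (V1 j)"
    using ij(3) by (simp add: divs_def WE_def VE_def gE_def)
  have "ou (ext_overs WE i ps w) (ext_unders WE VE j ps c) gE = ou W V gE"
  proof -
    have "ext_overs WE i ps w = W" using A(3) by (auto simp: ext_overs_def WE_def)
    moreover have "ext_unders WE VE j ps c a = V a" for a
    proof -
      have "filter (\<lambda>x. x \<noteq> c) (VE a) = V1 a"
        using filter_neq[OF cV1[of a]] by (auto simp: VE_def)
      then show ?thesis using ij(3) tt by (simp add: ext_unders_def WE_def V1_def comp_def)
    qed
    ultimately show ?thesis by (metis ext)
  qed
  then have "link n i j s (ou W V gE) (ou WE VE gE)" unfolding link_def using TE d by metis
  moreover have "(ou W V g, ou W V gE) \<in> vAC_rel n"
    by (rule vAC_iso[OF OU_AC[OF T OU_ou] ou_fresh_iso]) (use c in \<open>auto simp: gE_def\<close>)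
  ultimately show ?thesis using A(1) vAC_trans by blast
qed

text \<open>\<open>link_reduce\<close> is repeated, lowering the total number of crossings and
  possibly turning the link around, until the side with one crossing more is irreducible.\<close>

lemma link_minimal:
  assumes "link n i j s D E"
  shows "\<exists>D' E'. (D, D') \<in> vAC_rel n \<and> (E, E') \<in> vAC_rel n \<and>
    (link n i j s D' E' \<and> \<not> (\<exists>X. red1 E' X) \<or> link n i j (- s) E' D' \<and> \<not> (\<exists>X. red1 D' X))"
  using assms
proof (induction "crossing_number D + crossing_number E" arbitrary: D E s rule: less_induct)
  case less
  have refl: "(D, D) \<in> vAC_rel n" "(E, E) \<in> vAC_rel n" using link_AC[OF less.prems] vAC_refl by blast+
  show ?case
  proof (cases "\<exists>X. red1 E X")
    case False
    then show ?thesis using less.prems refl by (intro exI[of _ D] exI[of _ E]) auto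
  next
    case True
    then obtain X where "red1 E X" ..
    from link_reduce[OF less.prems this] obtain D' E' where 1: "(D, D') \<in> vAC_rel n" "(E, E') \<in> vAC_rel n"
      "crossing_number D' + crossing_number E' < crossing_number D + crossing_number E"
      and 2: "link n i j s D' E' \<or> link n i j (- s) E' D'" by blast
    from 2 show ?thesis
    proof
      assume "link n i j s D' E'"
      from less.hyps[OF 1(3) this] show ?thesis using 1(1,2) vAC_trans by blast
    next
      assume l: "link n i j (- s) E' D'"
      have "crossing_number E' + crossing_number D' < crossing_number D + crossing_number E" using 1(3) by simp
      from less.hyps[OF this l] show ?thesis using 1(1,2) vAC_trans unfolding minus_minus by blast
    qed
  qed
qed

section \<open>Two extractions from the same diagram\<close>

lemma ou_list_inject:
  "map Over ws @ map Under vs = map Over ws' @ map Under vs' \<Longrightarrow> ws = ws' \<and> vs = vs'"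
proof (induction ws arbitrary: ws')
  case Nil
  have "ws' = []" using Nil by (cases ws'; cases vs) auto
  then show ?case using Nil by (simp add: inj_map_eq_map inj_def)
next
  case (Cons a ws)
  show ?case using Cons.prems Cons.IH by (cases ws'; cases vs') auto
qed

lemma divs_iso:
  assumes T: "ou W V g \<in> TD n" and d: "divs W V g i j s ps c w v" and iso: "diag_iso (ou W V g) (ou W' V' g')"
  shows "\<exists>ps' c' w' v'. divs W' V' g' i j s ps' c' w' v'"
proof -
  obtain f where f: "iso_by f (ou W V g) (ou W' V' g')" using iso by (auto simp: diag_iso_iff)
  have "map Over (W' a) @ map Under (V' a) = map Over (map f (W a)) @ map Under (map f (V a))" for a
    using f by (simp add: iso_by_def strand_ou comp_def)
  then have WV: "W' a = map f (W a)" "V' a = map f (V a)" for a using ou_list_inject by blast+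
  have g: "g' (f x) = g x" if "x \<in> set (W a)" for x a using f that unfolding iso_by_def crossings_ou by auto
  have N: "nxt V' (f x) (f y)" if "nxt V x y" for x y using nxt_map[OF that, of f] by (simp add: WV(2)[abs_def])
  have d1: "i \<noteq> j" "W i = ps @ c # w" "V j = c # v" "g c = s" "list_all2 (par V g s) ps (W j)"
    using d by (auto simp: divs_def)
  have "list_all2 (par V' g' s) (map f ps) (W' j)"
    unfolding WV(1) list_all2_map1 list_all2_map2
  proof (rule list.rel_mono_strong[OF d1(5)])
    fix z y assume z: "z \<in> set ps" "y \<in> set (W j)" "par V g s z y"
    have "g' (f z) = g z" "g' (f y) = g y" using g[of z i] g[of y j] z d1(2) by auto
    then show "par V' g' s (f z) (f y)" using z(3) N[of z y] N[of y z] by (simp add: par_def split: if_splits)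
  qed
  then have "divs W' V' g' i j s (map f ps) (f c) (map f w) (map f v)"
    using d1 WV g[of c i] by (simp add: divs_def)
  then show ?thesis by blast
qed

lemma par_flip: "g q = 1 \<or> g q = -1 \<Longrightarrow> s = 1 \<or> s = -1 \<Longrightarrow> par V g s p q \<Longrightarrow> par V g (- s) q p"
  by (auto simp: par_def split: if_splits)

text \<open>Three strands \<open>x\<close>, \<open>y\<close>, \<open>j\<close> are involved. By
  \<open>len\<close> the crossing \<open>c\<close>, at position \<open>?m\<close> of strand
  \<open>x\<close>, lies in the part in which the second extraction makes \<open>x\<close> and
  \<open>y\<close> parallel, so it has a parallel \<open>r\<close> at position \<open>?m\<close> of
  \<open>y\<close>. As \<open>c\<close> is the first under of \<open>j\<close>, \<open>r\<close> is
  the second, and this forces the sign \<open>t\<close>. Hence \<open>r\<close> can be pulled out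
  after \<open>c\<close>. If instead \<open>c'\<close> is pulled out first, then \<open>r\<close>
  comes to the front of \<open>j\<close>, and first \<open>r\<close> and then \<open>c\<close> can
  be pulled out.\<close>

lemma extraction_diamond:
  assumes T: "ou W V g \<in> TD n" and d1: "divs W V g x j s ps c w v" and d2: "divs W V g i k t ps' c' w' v'"
    and xy: "x = i \<and> y = k \<or> x = k \<and> y = i" and yj: "y \<noteq> j" and len: "length (W j) < length (W y)"
  shows "t = (if x = i then - s else s)" and
    "\<exists>G H K. link n y j s G (ou (ext_overs W x ps w) (ext_unders W V j ps c) g) \<and>
      link n y j s H (ou (ext_overs W i ps' w') (ext_unders W V k ps' c') g) \<and> link n x j s K H"
proof -
  note f1 = divs_facts[OF T d1] and f2 = divs_facts[OF T d2] and td = ou_TDD[OF T]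
  note la1 = AC_TD[OF conjunct2[OF vAC_in[OF extract_vAC[OF T d1]]]]
  note la2 = AC_TD[OF conjunct2[OF vAC_in[OF extract_vAC[OF T d2]]]]
  have W: "W x = ps @ c # w" "W i = ps' @ c' # w'" and Vj: "V j = c # v" and gc: "g c = s"
    using d1 d2 by (auto simp: divs_def)
  have P1: "list_all2 (par V g s) ps (W j)" and P2: "list_all2 (par V g t) ps' (W k)"
    using d1 d2 by (auto simp: divs_def)
  have ne: "x \<noteq> y" "x \<noteq> j" "y \<noteq> j" "i \<noteq> k" using xy yj f1(1) f2(1) by auto
  have s: "s = 1 \<or> s = -1" "t = 1 \<or> t = -1" using f1(9) f2(9) by auto
  let ?m = "length ps"
  have m: "?m < length ps'" "?m < length (W y)" "?m = length (W j)"
    using xy len f1(2) f2(2) W(1) by auto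
  define rs r z where "rs = take ?m (W y)" and "r = W y ! ?m" and "z = drop (Suc ?m) (W y)"
  have Wy: "W y = rs @ r # z" unfolding rs_def r_def z_def by (rule id_take_nth_drop[OF m(2)])
  have lrs: "length rs = ?m" using m(2) by (simp add: rs_def)
  let ?t1 = "trs ps (W j)" and ?t2 = "trs ps' (W k)" and ?t3 = "trs rs (W j)"
  have Wx: "W x ! h = (if h = ?m then c else ps ! h)" if "h \<le> ?m" for h
    using that W(1) by (auto simp: nth_append)
  have Wyn: "W y ! h = (if h = ?m then r else rs ! h)" if "h \<le> ?m" for h
    using that lrs by (subst Wy) (auto simp: nth_append)
  have Win: "W i ! h = ps' ! h" if "h \<le> ?m" for h using that W(2) m(1) by (simp add: nth_append)
  have Px: "x = i \<and> par V g t (W x ! h) (W y ! h) \<or> x = k \<and> par V g t (W y ! h) (W x ! h)" if "h \<le> ?m" for h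
    using list_all2_nthD[OF P2, of h] Win[OF that] that m(1) xy by auto
  have t2: "?t2 (W x ! h) = W y ! h" "?t2 (W y ! h) = W x ! h" if "h \<le> ?m" for h
    using trs_nth[OF f2(2,3), of h] Win[OF that] that m(1) xy by auto
  have "\<not> nxt V r c"
  proof
    assume "nxt V r c"
    then obtain a xs ys where a: "V a = xs @ [r, c] @ ys" unfolding nxt_def by blast
    then have "c \<in> set (V a) \<inter> set (V j)" using Vj by auto
    then have "a = j" using td(6)[of a j] by blast
    then show False using a Vj td(4)[of j] by (cases xs) auto
  qed
  moreover have Pc: "x = i \<and> par V g t c r \<or> x = k \<and> par V g t r c" using Px[of ?m] Wx[of ?m] Wyn[of ?m] by simp
  ultimately have ts: "t = (if x = i then - s else s)" and Nc: "nxt V c r"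
    using gc s ne xy by (auto simp: par_def split: if_splits)
  show "t = (if x = i then - s else s)" by (rule ts)
  have gr: "g r = s" using Pc gc by (auto simp: par_def)
  \<comment> \<open>Which of \<open>x\<close>, \<open>y\<close> is the upper strand of the second
    extraction differs between the two cases; by \<open>par_flip\<close> both give the same relation
    of \<open>x\<close> to \<open>y\<close>.\<close>
  have P3: "par V g (- s) (W x ! h) (W y ! h)" if h: "h \<le> ?m" for h
  proof -
    have "W x ! h \<in> set (W x)" using h W(1) by (intro nth_mem) simp
    then have "g (W x ! h) = 1 \<or> g (W x ! h) = -1" using td(9) by blast
    then show ?thesis using Px[OF h] ts s par_flip[of g "W x ! h" t V "W y ! h"] ne(4) by (cases "x = i") auto
  qed
  obtain u where v: "v = r # u"
  proof -
    obtain a xs ys where a: "V a = xs @ [c, r] @ ys" using Nc unfolding nxt_def by blast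
    then have "c \<in> set (V a) \<inter> set (V j)" using Vj by auto
    then have "a = j" using td(6)[of a j] by blast
    then have "v = r # ys" using a Vj td(4)[of j] by (cases xs) auto
    then show ?thesis by (rule that)
  qed
  have dj: "a \<noteq> b \<Longrightarrow> z \<in> set (W a) \<Longrightarrow> z \<notin> set (W b)" for a b z using td(5)[of a b] by blast
  have memx: "W x ! h \<in> set (W x)" "W y ! h \<in> set (W y)" if "h \<le> ?m" for h
  proof -
    have "h < length (W x)" "h < length (W y)" using that W(1) m(2) by simp_all
    then show "W x ! h \<in> set (W x)" "W y ! h \<in> set (W y)" using nth_mem by blast+
  qed
  have cx: "c \<in> set (W x)" and ry: "r \<in> set (W y)" and c'i: "c' \<in> set (W i)" using W Wy by auto
  have rsy: "set rs \<subseteq> set (W y)" using Wy by auto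
  have psx: "set ps \<subseteq> set (W x)" using W(1) by auto
  have rc: "r \<noteq> c" using dj[OF ne(1) cx] ry by metis
  have c'h: "W x ! h \<noteq> c'" "W y ! h \<noteq> c'" if h: "h \<le> ?m" for h
  proof -
    have 1: "W i ! h \<in> set ps'" using Win[OF h] h m(1) by simp
    have 2: "W k ! h \<in> set (W k)" using h m(1) f2(2) by simp
    show "W x ! h \<noteq> c'" "W y ! h \<noteq> c'" using 1 2 f2(4,5) xy by metis+
  qed
  have cc': "c \<noteq> c'" "r \<noteq> c'" using c'h[of ?m] Wx[of ?m] Wyn[of ?m] by auto
  have qh: "W j ! h \<notin> set (W x)" "W j ! h \<notin> set (W y)" if h: "h < ?m" for h
  proof -
    have "W j ! h \<in> set (W j)" using h m(3) by simp
    then show "W j ! h \<notin> set (W x)" "W j ! h \<notin> set (W y)" using dj ne by metis+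
  qed
  have t2q: "?t2 (W j ! h) = W j ! h" "W j ! h \<noteq> c'" if h: "h < ?m" for h
  proof -
    have "W j ! h \<notin> set (W i)" "W j ! h \<notin> set (W k)" using qh[OF h] xy by auto
    then show "?t2 (W j ! h) = W j ! h" "W j ! h \<noteq> c'" using W(2) c'i by (auto intro: trs_other)
  qed
  have sg: "g (W j ! h) = 1 \<or> g (W j ! h) = -1" "g (ps ! h) = g (W j ! h)" "g (rs ! h) = g (W j ! h)" if h: "h < ?m" for h
  proof -
    have "W j ! h \<in> set (W j)" using h m(3) by simp
    then show "g (W j ! h) = 1 \<or> g (W j ! h) = -1" by (rule td(9))
    show "g (ps ! h) = g (W j ! h)" using list_all2_nthD[OF P1 h] by (simp add: par_def)
    moreover have "g (ps ! h) = g (rs ! h)" using P3[of h] Wx[of h] Wyn[of h] h by (simp add: par_def)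
    ultimately show "g (rs ! h) = g (W j ! h)" by simp
  qed
  text \<open>Three parallel overs \<open>p\<close>, \<open>q\<close>, \<open>r\<close> on the strands \<open>x\<close>, \<open>j\<close>, \<open>y\<close> have their unders in the order \<open>q p r\<close> or \<open>r p q\<close>.\<close>
  have ord: "if s * g (W j ! h) = 1 then nxt V (W j ! h) (ps ! h) \<and> nxt V (ps ! h) (rs ! h)
      else nxt V (ps ! h) (W j ! h) \<and> nxt V (rs ! h) (ps ! h)" if h: "h < ?m" for h
    using list_all2_nthD[OF P1 h] P3[of h] Wx[of h] Wyn[of h] h sg[OF h] s
    by (auto simp: par_def split: if_splits)
  have nec: "ps ! h \<noteq> c" "W j ! h \<noteq> c" "rs ! h \<noteq> c" "ps ! h \<noteq> r" "W j ! h \<noteq> r" "rs ! h \<noteq> r" if h: "h < ?m" for h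
  proof -
    have mem: "ps ! h \<in> set ps" "W j ! h \<in> set (W j)" "rs ! h \<in> set rs" using h m(3) lrs by auto
    show "ps ! h \<noteq> c" "W j ! h \<noteq> c" using mem f1(4,5) by metis+
    show "rs ! h \<noteq> c" using mem(3) rsy dj[OF ne(1) cx] by blast
    show "ps ! h \<noteq> r" using mem(1) psx dj[OF ne(1)[symmetric] ry] by blast
    show "W j ! h \<noteq> r" using mem(2) dj[OF ne(3) ry] by blast
    show "rs ! h \<noteq> r" using mem(3) td(3)[of y] Wy by auto
  qed
  have dry: "distinct (rs @ W j)" using td(3)[of y] td(3)[of j] td(5)[OF ne(3)] Wy by auto
  have lrj: "length rs = length (W j)" using lrs m(3) by simp
  have t1: "?t1 (ps ! h) = W j ! h" "?t1 (W j ! h) = ps ! h" "?t1 (rs ! h) = rs ! h" if h: "h < ?m" for h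
  proof -
    show "?t1 (ps ! h) = W j ! h" "?t1 (W j ! h) = ps ! h" using trs_nth[OF f1(2,3) h] by auto
    have "rs ! h \<in> set (W y)" using h lrs rsy by auto
    then have "rs ! h \<notin> set ps" "rs ! h \<notin> set (W j)" using dj[OF ne(1)[symmetric]] dj[OF ne(3)] psx by blast+
    then show "?t1 (rs ! h) = rs ! h" by (rule trs_other)
  qed
  have t1c: "?t1 r = r"
    by (rule trs_other) (use ry dj[OF ne(1)[symmetric]] dj[OF ne(3)] psx in blast)+
  have t3: "?t3 (rs ! h) = W j ! h" "?t3 (W j ! h) = rs ! h" "?t3 (ps ! h) = ps ! h" if h: "h < ?m" for h
  proof -
    have h': "h < length rs" using h lrs by simp
    show "?t3 (rs ! h) = W j ! h" "?t3 (W j ! h) = rs ! h" using trs_nth[OF lrj dry h'] by auto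
    have "ps ! h \<in> set (W x)" using h psx by auto
    then have "ps ! h \<notin> set rs" "ps ! h \<notin> set (W j)" using dj[OF ne(1)] dj[OF ne(2)] rsy by blast+
    then show "?t3 (ps ! h) = ps ! h" by (rule trs_other)
  qed
  have t3c: "?t3 c = c"
    by (rule trs_other) (use cx dj[OF ne(1)] dj[OF ne(2)] rsy in blast)+
  have t2h: "?t2 (ps ! h) = rs ! h" "?t2 (rs ! h) = ps ! h" if "h < ?m" for h
    using t2[of h] Wx[of h] Wyn[of h] that by auto
  have t2c: "?t2 c = r" "?t2 r = c" using t2[of ?m] Wx[of ?m] Wyn[of ?m] by auto
  have c'h': "ps ! h \<noteq> c'" "rs ! h \<noteq> c'" if "h < ?m" for h
    using c'h[of h] Wx[of h] Wyn[of h] that by auto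

  define W1 V1 where "W1 = ext_overs W x ps w" and "V1 = ext_unders W V j ps c"
  define W2 V2 where "W2 = ext_overs W i ps' w'" and "V2 = ext_unders W V k ps' c'"
  have N1: "nxt V1 (?t1 a) (?t1 b)" if "nxt V a b" "a \<noteq> c" "b \<noteq> c" for a b
    using nxt_ext[OF T d1 that] by (simp add: V1_def)
  have N2: "nxt V2 (?t2 a) (?t2 b)" if "nxt V a b" "a \<noteq> c'" "b \<noteq> c'" for a b
    using nxt_ext[OF T d2 that] by (simp add: V2_def)
  have V1j: "V1 j = r # map ?t1 (filter (\<lambda>x. x \<noteq> c) u)"
    using Vj v rc t1c by (simp add: V1_def ext_unders_def)
  have V2j: "V2 j = r # c # map ?t2 (filter (\<lambda>x. x \<noteq> c') u)"
    using Vj v cc' t2c by (simp add: V2_def ext_unders_def)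
  have "list_all2 (par V1 g s) rs (W1 j)"
    unfolding list_all2_conv_all_nth
  proof (intro conjI allI impI)
    show "length rs = length (W1 j)" using lrj ne(2) by (simp add: W1_def ext_overs_def)
    fix h assume "h < length rs"
    then have h: "h < ?m" using lrs by simp
    then show "par V1 g s (rs ! h) (W1 j ! h)"
      using ord[OF h] N1[of "ps ! h" "rs ! h"] N1[of "rs ! h" "ps ! h"] nec[OF h] t1[OF h] sg[OF h] ne(2)
      by (auto simp: par_def W1_def ext_overs_def split: if_splits)
  qed
  then have "divs W1 V1 g y j s rs r z (map ?t1 (filter (\<lambda>x. x \<noteq> c) u))"
    using V1j Wy ne gr by (simp add: divs_def W1_def ext_overs_def)
  then have G: "\<exists>G. link n y j s G (ou W1 V1 g)" unfolding link_def using la1 unfolding W1_def V1_def by blast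
  have W2j: "W2 j = W j" using ne xy by (auto simp: W2_def ext_overs_def)
  \<comment> \<open>The second extraction removes only \<open>c'\<close> from the overs, and
    \<open>c'\<close> stands behind position \<open>?m\<close>; so these prefixes survive on every
    strand.\<close>
  have W2e: "\<exists>u. W2 a = take (Suc ?m) (W a) @ u" for a
  proof (cases "a = i")
    case True
    have "ps' = take (Suc ?m) ps' @ drop (Suc ?m) ps'" by simp
    then have "W2 a = take (Suc ?m) (W a) @ drop (Suc ?m) ps' @ w'"
      using True m(1) W(2) by (simp add: W2_def ext_overs_def)
    then show ?thesis by blast
  next
    case False
    then have "W2 a = take (Suc ?m) (W a) @ drop (Suc ?m) (W a)" by (simp add: W2_def ext_overs_def)
    then show ?thesis by blast
  qed
  have "take (Suc ?m) (W x) = ps @ [c]" "take (Suc ?m) (W y) = rs @ [r]"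
    using W(1) Wy lrs by simp_all
  then obtain w2 z2 where W2x: "W2 x = ps @ c # w2" and W2y: "W2 y = rs @ r # z2"
    using W2e[of x] W2e[of y] by auto
  have "list_all2 (par V2 g s) rs (W2 j)"
    unfolding list_all2_conv_all_nth
  proof (intro conjI allI impI)
    show "length rs = length (W2 j)" using lrj W2j by simp
    fix h assume "h < length rs"
    then have h: "h < ?m" using lrs by simp
    then show "par V2 g s (rs ! h) (W2 j ! h)"
      using ord[OF h] N2[of "ps ! h" "W j ! h"] N2[of "W j ! h" "ps ! h"] c'h'[OF h] t2h[OF h] t2q[OF h] sg[OF h] W2j
      by (auto simp: par_def split: if_splits)
  qed
  then have d3: "divs W2 V2 g y j s rs r z2 (c # map ?t2 (filter (\<lambda>x. x \<noteq> c') u))"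
    using V2j W2y ne gr by (simp add: divs_def)
  have T2: "ou W2 V2 g \<in> TD n" using la2 by (simp add: W2_def V2_def)
  define W3 V3 where "W3 = ext_overs W2 y rs z2" and "V3 = ext_unders W2 V2 j rs r"
  have H: "link n y j s (ou W3 V3 g) (ou W2 V2 g)" unfolding link_def W3_def V3_def using T2 d3 by blast
  have T3: "ou W3 V3 g \<in> TD n" by (rule link_AC(1)[OF H])
  have N3: "nxt V3 (?t3 a) (?t3 b)" if "nxt V2 a b" "a \<noteq> r" "b \<noteq> r" for a b
    using nxt_ext[OF T2 d3 that] W2j by (simp add: V3_def)
  have "list_all2 (par V3 g s) ps (W3 j)"
    unfolding list_all2_conv_all_nth
  proof (intro conjI allI impI)
    show "length ps = length (W3 j)" using m(3) W2j ne by (simp add: W3_def ext_overs_def)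
    fix h assume h: "h < ?m"
    have "W3 j = W j" using W2j ne by (simp add: W3_def ext_overs_def)
    then show "par V3 g s (ps ! h) (W3 j ! h)"
      using ord[OF h] N2[of "ps ! h" "rs ! h"] N2[of "rs ! h" "ps ! h"] c'h'[OF h] t2h[OF h]
        N3[of "ps ! h" "rs ! h"] N3[of "rs ! h" "ps ! h"] nec[OF h] t3[OF h] sg[OF h]
      by (auto simp: par_def split: if_splits)
  qed
  moreover have "V3 j = c # map ?t3 (filter (\<lambda>x. x \<noteq> r) (map ?t2 (filter (\<lambda>x. x \<noteq> c') u)))"
    using V2j rc t3c W2j by (simp add: V3_def ext_unders_def)
  ultimately have "divs W3 V3 g x j s ps c w2 (map ?t3 (filter (\<lambda>x. x \<noteq> r) (map ?t2 (filter (\<lambda>x. x \<noteq> c') u))))"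
    using W2x ne gc by (simp add: divs_def W3_def ext_overs_def)
  then have "\<exists>K. link n x j s K (ou W3 V3 g)" unfolding link_def using T3 by blast
  then show "\<exists>G H K. link n y j s G (ou (ext_overs W x ps w) (ext_unders W V j ps c) g) \<and>
      link n y j s H (ou (ext_overs W i ps' w') (ext_unders W V k ps' c') g) \<and> link n x j s K H"
    using G H unfolding W1_def V1_def W2_def V2_def by blast
qed

text \<open>An extraction moves only the unders of crossings whose overs lie on its own two strands.
  The second extraction depends on crossings with overs on \<open>k\<close> and \<open>l\<close>,
  hence it is not affected.\<close>

lemma extraction_commute:
  assumes T: "ou W V g \<in> TD n" and d1: "divs W V g i j s ps c w v" and d2: "divs W V g k l t ps' c' w' v'"
    and dis: "distinct [i, j, k, l]"
  shows "\<exists>G. link n k l t G (ou (ext_overs W i ps w) (ext_unders W V j ps c) g)"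
proof -
  note f1 = divs_facts[OF T d1] and f2 = divs_facts[OF T d2] and td = ou_TDD[OF T]
  note la1 = AC_TD[OF conjunct2[OF vAC_in[OF extract_vAC[OF T d1]]]]
  define W1 V1 where "W1 = ext_overs W i ps w" and "V1 = ext_unders W V j ps c"
  have D: "W i = ps @ c # w" "W k = ps' @ c' # w'" "V l = c' # v'" "g c' = t" "list_all2 (par V g t) ps' (W l)"
    using d1 d2 by (auto simp: divs_def)
  have out: "trs ps (W j) a = a" "a \<noteq> c" if "a \<in> set (W k) \<or> a \<in> set (W l)" for a
  proof -
    have "a \<notin> set (W i)" "a \<notin> set (W j)"
      using that dis td(5)[of i k] td(5)[of i l] td(5)[of j k] td(5)[of j l] by auto
    then show "trs ps (W j) a = a" "a \<noteq> c" using D(1) by (auto intro: trs_other)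
  qed
  have "list_all2 (par V1 g t) ps' (W1 l)"
    unfolding list_all2_conv_all_nth
  proof (intro conjI allI impI)
    show "length ps' = length (W1 l)" using f2(2) dis by (simp add: W1_def ext_overs_def)
    fix h assume h: "h < length ps'"
    have "ps' ! h \<in> set (W k)" "W l ! h \<in> set (W l)" using h f2(2) D(2) by auto
    then show "par V1 g t (ps' ! h) (W1 l ! h)"
      using list_all2_nthD[OF D(5) h] nxt_ext[OF T d1, of "ps' ! h" "W l ! h"] nxt_ext[OF T d1, of "W l ! h" "ps' ! h"]
        out[of "ps' ! h"] out[of "W l ! h"] dis by (auto simp: par_def V1_def W1_def ext_overs_def split: if_splits)
  qed
  moreover have "V1 l = c' # map (trs ps (W j)) (filter (\<lambda>x. x \<noteq> c) v')"
    using D(2,3) out[of c'] by (simp add: V1_def ext_unders_def)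
  ultimately have "divs W1 V1 g k l t ps' c' w' (map (trs ps (W j)) (filter (\<lambda>x. x \<noteq> c) v'))"
    using D dis by (simp add: divs_def W1_def ext_overs_def)
  then show ?thesis unfolding link_def using la1 unfolding W1_def V1_def by blast
qed

section \<open>Crossing numbers of braid words\<close>

definition rep :: "nat \<Rightarrow> ((nat \<times> nat) \<times> int) list \<Rightarrow> vdiag \<Rightarrow> bool" where
  "rep n w D \<longleftrightarrow> w \<in> words (vPB_gens n) \<and> D \<in> TD n \<and> OU D \<and> (word_diag w, D) \<in> vAC_rel n"

text \<open>The minimum over all OU representatives, so that each of them gives an upper bound; by
  \<open>xi_eq\<close> it is attained at the reduced ones.\<close>

definition xi :: "nat \<Rightarrow> ((nat \<times> nat) \<times> int) list \<Rightarrow> nat" where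
  "xi n w = (LEAST k. \<exists>D. rep n w D \<and> crossing_number D = k)"

abbreviation letters :: "nat \<Rightarrow> ((nat \<times> nat) \<times> int) set" where
  "letters n \<equiv> vPB_gens n \<times> {1, -1}"

lemma vAC_letter:
  "l \<in> letters n \<Longrightarrow> (D, E) \<in> vAC_rel n \<Longrightarrow> (diag_prod (sigma_diag l) D, diag_prod (sigma_diag l) E) \<in> vAC_rel n"
  by (rule vAC_prod[OF vAC_refl[OF sigma_AC]])

lemma letter_cancel:
  assumes l: "(g, s) \<in> letters n" and D: "D \<in> AC n"
  shows "(diag_prod (sigma_diag (g, s)) (diag_prod (sigma_diag (g, - s)) D), D) \<in> vAC_rel n"
proof -
  let ?a = "sigma_diag (g, s)" and ?b = "sigma_diag (g, - s)"
  have l': "(g, - s) \<in> letters n" using l by auto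
  have "diag_prod (diag_prod ?a ?b) D \<in> AC n" by (intro prod_AC sigma_AC l l' D)
  then have "(diag_prod (diag_prod ?a ?b) D, diag_prod ?a (diag_prod ?b D)) \<in> vAC_rel n"
    by (rule vAC_iso[OF _ prod_assoc])
  moreover have "(diag_prod (diag_prod ?a ?b) D, diag_prod diag_one D) \<in> vAC_rel n"
    by (rule vAC_prod[OF sigma_cancel vAC_refl[OF D]]) (use l in auto)
  moreover have "(diag_prod diag_one D, D) \<in> vAC_rel n" by (rule vAC_iso[OF prod_AC[OF one_AC D] one_prod])
  ultimately show ?thesis by (rule vAC_trans[OF vAC_sym vAC_trans])
qed

lemma link_letter:
  assumes "link n i j s D E" shows "((i, j), s) \<in> letters n" "((i, j), - s) \<in> letters n"
  using link_AC(9-12)[OF assms] by (auto simp: vPB_gens_def)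

lemma rep_link_down:
  assumes r: "rep n w D" and L: "link n i j s E D" shows "rep n (((i, j), - s) # w) E"
proof -
  note la = link_AC[OF L]
  have "(word_diag (((i, j), - s) # w), diag_prod (sigma_diag ((i, j), - s)) D) \<in> vAC_rel n"
    using r vAC_letter[OF link_letter(2)[OF L], of "word_diag w" D] by (simp add: rep_def)
  then have "(word_diag (((i, j), - s) # w), E) \<in> vAC_rel n" using la(7) vAC_trans by blast
  then show ?thesis using la r link_letter(2)[OF L] by (simp add: rep_def words_simps del: word_diag_simps)
qed

lemma rep_link_up:
  assumes r: "rep n w D" and L: "link n i j s D E" shows "rep n (((i, j), s) # w) E"
proof -
  note la = link_AC[OF L] and l = link_letter[OF L]
  have "(word_diag (((i, j), s) # w), diag_prod (sigma_diag ((i, j), s)) D) \<in> vAC_rel n"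
    using r vAC_letter[OF l(1), of "word_diag w" D] by (simp add: rep_def)
  moreover have "(diag_prod (sigma_diag ((i, j), s)) D, diag_prod (sigma_diag ((i, j), s)) (diag_prod (sigma_diag ((i, j), - s)) E)) \<in> vAC_rel n"
    using vAC_letter[OF l(1) vAC_sym[OF la(7)]] .
  moreover have "(diag_prod (sigma_diag ((i, j), s)) (diag_prod (sigma_diag ((i, j), - s)) E), E) \<in> vAC_rel n"
    by (rule letter_cancel[OF l(1) la(6)])
  ultimately have "(word_diag (((i, j), s) # w), E) \<in> vAC_rel n" using vAC_trans by blast
  then show ?thesis using la r l by (simp add: rep_def words_simps del: word_diag_simps)
qed

lemma rep_vAC: "rep n w D \<Longrightarrow> (D, E) \<in> vAC_rel n \<Longrightarrow> OU E \<Longrightarrow> rep n w E"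
  unfolding rep_def using vAC_trans vAC_in AC_TD by blast

lemma rep_Nil: "rep n [] diag_one"
  using one_TD one_AC vAC_refl by (auto simp: rep_def words_simps OU_def diag_one_def)

lemma link_rep_exists:
  assumes r: "rep n w D" and l: "((i, j), s) \<in> letters n"
  shows "\<exists>D1 E1. link n i j s D1 E1 \<and> rep n w D1 \<and> rep n (((i, j), s) # w) E1"
proof -
  have D: "D \<in> TD n" "OU D" using r by (auto simp: rep_def)
  have "i \<in> {1..n}" "j \<in> {1..n}" "i \<noteq> j" "s \<in> {1, -1}" using l by (auto simp: vPB_gens_def)
  from link_exists[OF D this] obtain D1 E1 where L: "link n i j s D1 E1" "(D, D1) \<in> vAC_rel n" by blast
  have "rep n w D1" using rep_vAC[OF r L(2) link_AC(3)[OF L(1)]] .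
  then show ?thesis using L(1) rep_link_up by blast
qed

lemma rep_exists: "w \<in> words (vPB_gens n) \<Longrightarrow> \<exists>D. rep n w D"
proof (induction w)
  case Nil then show ?case using rep_Nil by blast
next
  case (Cons l w)
  then obtain D where "rep n w D" by (auto simp: words_simps)
  moreover obtain i j s where "l = ((i, j), s)" by (metis surj_pair)
  ultimately show ?case using link_rep_exists Cons.prems by (fastforce simp: words_simps)
qed

lemma xi_le: "rep n w D \<Longrightarrow> xi n w \<le> crossing_number D"
  unfolding xi_def by (rule Least_le) blast

lemma rep_nf: "rep n w D \<Longrightarrow> \<not> (\<exists>X. red1 D X) \<Longrightarrow> nf D D"
  using OU_reduced_nf reduced_iff unfolding rep_def by blast

lemma rep_unique:
  assumes "rep n w D" "rep n w D'" "\<not> (\<exists>X. red1 D X)" "\<not> (\<exists>X. red1 D' X)" shows "diag_iso D D'"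
proof -
  have "(D, D') \<in> vAC_rel n" using assms(1,2) vAC_sym vAC_trans unfolding rep_def by blast
  then show ?thesis using vAC_nf rep_nf assms by blast
qed

lemma red1_steps_le: "red1\<^sup>*\<^sup>* D E \<Longrightarrow> D \<in> TD n \<Longrightarrow> E \<in> TD n \<and> crossing_number E \<le> crossing_number D"
proof (induction rule: rtranclp_induct)
  case (step E F)
  then show ?case using crossing_number_del(1)[of E n] red1_TD unfolding red1_def by (metis le_trans)
qed simp

lemma rep_reduce:
  assumes r: "rep n w D"
  shows "\<exists>E. rep n w E \<and> \<not> (\<exists>X. red1 E X) \<and> crossing_number E \<le> crossing_number D"
proof -
  have T: "D \<in> TD n" "OU D" using r by (auto simp: rep_def)
  have A: "D \<in> AC n" using OU_AC T by blast
  obtain E where E: "red1\<^sup>*\<^sup>* D E" "\<not> (\<exists>X. red1 E X)" using red.normal_form_exists[OF T(1)] by blast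
  have "OU F" if "red1\<^sup>*\<^sup>* D F" for F
    using that
  proof (induction rule: rtranclp_induct)
    case (step E F) then show ?case using OU_del unfolding red1_def by blast
  qed (rule T(2))
  then have "rep n w E" using rep_vAC[OF r red1_steps_vAC[OF E(1) A]] E by blast
  then show ?thesis using E red1_steps_le[OF E(1) T(1)] by blast
qed

lemma xi_eq:
  assumes r: "rep n w D" and i: "\<not> (\<exists>X. red1 D X)" shows "xi n w = crossing_number D"
proof -
  have "\<exists>k D. rep n w D \<and> crossing_number D = k" using r by blast
  then obtain D' where D': "rep n w D'" "crossing_number D' = xi n w"
    unfolding xi_def using LeastI_ex[of "\<lambda>k. \<exists>D. rep n w D \<and> crossing_number D = k"] by blast
  obtain E where E: "rep n w E" "\<not> (\<exists>X. red1 E X)" "crossing_number E \<le> crossing_number D'"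
    using rep_reduce[OF D'(1)] by blast
  have "crossing_number D = crossing_number E" using iso_crossing_number[OF rep_unique[OF r E(1) i E(2)]] .
  then show ?thesis using E(3) D'(2) xi_le[OF r] by simp
qed

lemma rep_cong: "vPB_eq n u v \<Longrightarrow> rep n u D \<longleftrightarrow> rep n v D"
  unfolding rep_def using word_diag_respects vAC_sym vAC_trans pres_eq_words[OF vPB_rels_words] by blast

lemma xi_cong: "vPB_eq n u v \<Longrightarrow> xi n u = xi n v"
  by (simp add: xi_def rep_cong)

lemma xi_Nil: "xi n [] = 0"
  using xi_le[OF rep_Nil] by (simp add: crossing_number_def crossings_def diag_one_def)

text \<open>A link between representatives of both words is reduced until its larger side is
  irreducible. That side realizes \<open>xi\<close> of its word, and the other side has one crossing
  less, so \<open>xi\<close> of the other word is strictly smaller. A descent therefore exhibits an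
  extraction from a reduced diagram of \<open>w\<close>.\<close>

lemma xi_letter:
  assumes w: "w \<in> words (vPB_gens n)" and l: "((i, j), s) \<in> letters n"
  shows "xi n w < xi n (((i, j), s) # w) \<or>
    (xi n (((i, j), s) # w) < xi n w \<and> (\<exists>D E. rep n w D \<and> \<not> (\<exists>X. red1 D X) \<and> link n i j (- s) E D))"
proof -
  obtain D0 where "rep n w D0" using rep_exists[OF w] by blast
  from link_rep_exists[OF this l] obtain D1 E1
    where L: "link n i j s D1 E1" "rep n w D1" "rep n (((i, j), s) # w) E1" by blast
  obtain D E where V: "(D1, D) \<in> vAC_rel n" "(E1, E) \<in> vAC_rel n" and
    C: "link n i j s D E \<and> \<not> (\<exists>X. red1 E X) \<or> link n i j (- s) E D \<and> \<not> (\<exists>X. red1 D X)"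
    using link_minimal[OF L(1)] by blast
  have "OU D \<and> OU E" using C link_AC(3,4) by blast
  then have r: "rep n w D" "rep n (((i, j), s) # w) E" using rep_vAC L V by blast+
  from C show ?thesis
  proof
    assume a: "link n i j s D E \<and> \<not> (\<exists>X. red1 E X)"
    then have "crossing_number E = Suc (crossing_number D)" "xi n (((i, j), s) # w) = crossing_number E"
      using link_AC(8) xi_eq[OF r(2)] by blast+
    then show ?thesis using xi_le[OF r(1)] by simp
  next
    assume a: "link n i j (- s) E D \<and> \<not> (\<exists>X. red1 D X)"
    then have "crossing_number D = Suc (crossing_number E)" "xi n w = crossing_number D"
      using link_AC(8) xi_eq[OF r(1)] by blast+
    then show ?thesis using xi_le[OF r(2)] a r(1) by auto
  qed
qed

section \<open>Inverse words and signed forms of the relators\<close>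

definition winv :: "((nat \<times> nat) \<times> int) list \<Rightarrow> ((nat \<times> nat) \<times> int) list" where
  "winv w = rev (map (\<lambda>(g, s). (g, - s)) w)"

lemmas [trans] = pres_eq.trans

lemma vPB_refl: "w \<in> words (vPB_gens n) \<Longrightarrow> vPB_eq n w w" by (rule pres_eq.refl)

lemma vPB_words: "vPB_eq n u v \<Longrightarrow> u \<in> words (vPB_gens n)" "vPB_eq n u v \<Longrightarrow> v \<in> words (vPB_gens n)"
  using pres_eq_words[OF vPB_rels_words] by blast+

lemma winv_words: "w \<in> words (vPB_gens n) \<Longrightarrow> winv w \<in> words (vPB_gens n)"
  by (induction w) (auto simp: winv_def words_simps)

lemma winv_winv: "winv (winv w) = w"
  by (simp add: winv_def rev_map comp_def case_prod_beta)

lemma vPB_delete: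
  assumes "vPB_eq n x []" "u \<in> words (vPB_gens n)" "v \<in> words (vPB_gens n)"
  shows "vPB_eq n (u @ x @ v) (u @ v)"
  using pres_eq.congr[OF assms] by simp

lemma winv_right: "w \<in> words (vPB_gens n) \<Longrightarrow> vPB_eq n (w @ winv w) []"
proof (induction w)
  case Nil then show ?case by (simp add: winv_def words_simps pres_eq.refl)
next
  case (Cons l w)
  obtain g s where l: "l = (g, s)" by fastforce
  have L: "g \<in> vPB_gens n" "s \<in> {1, -1}" using Cons.prems by (auto simp: l words_simps)
  have W: "[(g, s)] \<in> words (vPB_gens n)" "[(g, - s)] \<in> words (vPB_gens n)" using L by (auto simp: words_simps)
  have IH: "vPB_eq n (w @ winv w) []" using Cons by (simp add: words_simps)
  have "vPB_eq n ([(g, s)] @ (w @ winv w) @ [(g, - s)]) ([(g, s)] @ [(g, - s)])"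
    by (rule vPB_delete[OF IH W])
  also have "vPB_eq n ([(g, s)] @ [(g, - s)]) []" using pres_eq.cancel[OF L] by simp
  finally show ?case by (simp add: l winv_def)
qed

lemma winv_left: "w \<in> words (vPB_gens n) \<Longrightarrow> vPB_eq n (winv w @ w) []"
  using winv_right[OF winv_words, of w n] by (simp add: winv_winv)

lemma vPB_conj:
  assumes e: "vPB_eq n (a @ u) (v @ a)" shows "vPB_eq n (winv a @ v) (u @ winv a)"
proof -
  have w: "a \<in> words (vPB_gens n)" "u \<in> words (vPB_gens n)" "v \<in> words (vPB_gens n)" "winv a \<in> words (vPB_gens n)"
    using vPB_words[OF e] winv_words by (auto simp: words_simps)
  have wv: "winv a @ v \<in> words (vPB_gens n)" "u @ winv a \<in> words (vPB_gens n)" using w by (auto simp: words_simps)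
  have "vPB_eq n ((winv a @ v) @ (a @ winv a) @ []) ((winv a @ v) @ [])"
    by (rule vPB_delete[OF winv_right[OF w(1)] wv(1)]) (simp add: words_simps)
  then have "vPB_eq n (winv a @ v) (winv a @ (v @ a) @ winv a)" using pres_eq.sym by fastforce
  also have "vPB_eq n (winv a @ (v @ a) @ winv a) (winv a @ (a @ u) @ winv a)"
    by (rule pres_eq.congr[OF pres_eq.sym[OF e] w(4) w(4)])
  also have "winv a @ (a @ u) @ winv a = [] @ (winv a @ a) @ (u @ winv a)" by simp
  also have "vPB_eq n ([] @ (winv a @ a) @ (u @ winv a)) ([] @ (u @ winv a))"
    by (rule vPB_delete[OF winv_left[OF w(1)] _ wv(2)]) (simp add: words_simps)
  finally show ?thesis by simp
qed

lemma vPB_winv: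
  assumes e: "vPB_eq n u v" shows "vPB_eq n (winv u) (winv v)"
proof -
  note w = vPB_words[OF e] and w' = winv_words[OF vPB_words(1)[OF e]] winv_words[OF vPB_words(2)[OF e]]
  have nil: "[] \<in> words (vPB_gens n)" by (simp add: words_simps)
  have "vPB_eq n (winv u @ (v @ winv v) @ []) (winv u @ [])" by (rule vPB_delete[OF winv_right[OF w(2)] w'(1) nil])
  then have "vPB_eq n (winv u) (winv u @ v @ winv v)" using pres_eq.sym by fastforce
  also have "vPB_eq n (winv u @ v @ winv v) (winv u @ u @ winv v)"
    by (rule pres_eq.congr[OF pres_eq.sym[OF e] w'])
  also have "winv u @ u @ winv v = [] @ (winv u @ u) @ winv v" by simp
  also have "vPB_eq n ([] @ (winv u @ u) @ winv v) ([] @ winv v)" by (rule vPB_delete[OF winv_left[OF w(1)] nil w'(2)])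
  finally show ?thesis by simp
qed

text \<open>The forms in which the diamonds meet the relators: the braid relation with a common
  exponent, its variant with one outer letter carried to the other side by \<open>vPB_conj\<close>,
  and commutation for all exponents.\<close>

lemma vPB_relations:
  assumes s: "s \<in> {1, -1}"
  shows "{i, j, k} \<subseteq> {1..n} \<Longrightarrow> distinct [i, j, k] \<Longrightarrow>
      vPB_eq n [((i, k), s), ((i, j), s), ((k, j), s)] [((k, j), s), ((i, j), s), ((i, k), s)]"
    and "{i, j, k} \<subseteq> {1..n} \<Longrightarrow> distinct [i, j, k] \<Longrightarrow>
      vPB_eq n [((i, k), s), ((k, j), - s), ((i, j), - s)] [((i, j), - s), ((k, j), - s), ((i, k), s)]"
    and "t \<in> {1, -1} \<Longrightarrow> {i, j, k, l} \<subseteq> {1..n} \<Longrightarrow> distinct [i, j, k, l] \<Longrightarrow>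
      vPB_eq n [((i, j), s), ((k, l), t)] [((k, l), t), ((i, j), s)]"
proof -
  have B: "vPB_eq n [((i, k), s), ((i, j), s), ((k, j), s)] [((k, j), s), ((i, j), s), ((i, k), s)]"
    if s: "s \<in> {1, -1}" and h: "{i, j, k} \<subseteq> {1..n}" "distinct [i, j, k]" for s :: int
  proof -
    have "vPB_eq n [((i, k), 1), ((i, j), 1), ((k, j), 1)] [((k, j), 1), ((i, j), 1), ((i, k), 1)]"
      by (rule pres_eq.relator) (use h in \<open>auto simp: vPB_rels_def\<close>)
    from this vPB_winv[OF pres_eq.sym[OF this]] s show ?thesis by (auto simp: winv_def)
  qed
  show "vPB_eq n [((i, k), s), ((i, j), s), ((k, j), s)] [((k, j), s), ((i, j), s), ((i, k), s)]"
    if h: "{i, j, k} \<subseteq> {1..n}" "distinct [i, j, k]" using B[OF s h] .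
  show "vPB_eq n [((i, k), s), ((k, j), - s), ((i, j), - s)] [((i, j), - s), ((k, j), - s), ((i, k), s)]"
    if h: "{i, j, k} \<subseteq> {1..n}" "distinct [i, j, k]"
  proof -
    have "vPB_eq n ([((i, k), - s)] @ [((i, j), - s), ((k, j), - s)]) ([((k, j), - s), ((i, j), - s)] @ [((i, k), - s)])"
      using B[OF _ h, of "- s"] s by auto
    from vPB_conj[OF this] show ?thesis by (simp add: winv_def)
  qed
  show "vPB_eq n [((i, j), s), ((k, l), t)] [((k, l), t), ((i, j), s)]"
    if t: "t \<in> {1, -1}" and h: "{i, j, k, l} \<subseteq> {1..n}" "distinct [i, j, k, l]"
  proof -
    have flip: "vPB_eq n [(a, - s), b] [b, (a, - s)]" if "vPB_eq n [(a, s), b] [b, (a, s)]" for a b and s :: int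
      using vPB_conj[of n "[(a, s)]" "[b]" "[b]"] that by (simp add: winv_def)
    have 1: "vPB_eq n [((i, j), 1), ((k, l), 1)] [((k, l), 1), ((i, j), 1)]"
      by (rule pres_eq.relator) (use h in \<open>auto simp: vPB_rels_def\<close>)
    have 2: "vPB_eq n [((i, j), s), ((k, l), 1)] [((k, l), 1), ((i, j), s)]" using s 1 flip[OF 1] by auto
    show ?thesis using t pres_eq.sym[OF 2] pres_eq.sym[OF flip[OF pres_eq.sym[OF 2]]] 2 by auto
  qed
qed

text \<open>The ways in which two descents \<open>a w\<close> and \<open>b w\<close> are connected
  by words of \<open>xi\<close> below that of \<open>w\<close>: equality, the square of a
  commutation, and the hexagon of a braid relation \<open>a d b = b d a\<close>. The value at
  \<open>b d a w\<close> is controlled through the relation itself.\<close>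

definition connected_below :: "nat \<Rightarrow> ((nat \<times> nat) \<times> int) list \<Rightarrow> (nat \<times> nat) \<times> int \<Rightarrow> (nat \<times> nat) \<times> int \<Rightarrow> bool" where
  "connected_below n w a b \<longleftrightarrow> a = b \<or> (xi n (a # b # w) < xi n w \<and> vPB_eq n (a # b # w) (b # a # w)) \<or>
    (\<exists>d\<in>letters n. xi n (d # a # w) < xi n w \<and> xi n (d # b # w) < xi n w \<and> xi n (a # d # b # w) < xi n w \<and>
       vPB_eq n (a # d # b # w) (b # d # a # w))"

lemma connected_below_sym: "connected_below n w a b \<Longrightarrow> connected_below n w b a"
  unfolding connected_below_def using pres_eq.sym xi_cong by metis

lemma connected_below_triple:
  assumes r: "rep n w (ou W V g)" and red: "\<not> (\<exists>X. red1 (ou W V g) X)" and d1: "divs W V g x j s ps c w1 v"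
    and d2: "divs W V g i k t ps' c' w2 v'" and xy: "x = i \<and> y = k \<or> x = k \<and> y = i" and yj: "y \<noteq> j" and len: "length (W j) < length (W y)"
  shows "connected_below n w ((x, j), - s) ((i, k), - t)"
proof -
  have T: "ou W V g \<in> TD n" using r by (simp add: rep_def)
  note f1 = divs_facts[OF T d1] and f2 = divs_facts[OF T d2]
  note ed = extraction_diamond[OF T d1 d2 xy yj len]
  obtain G H K where L: "link n y j s G (ou (ext_overs W x ps w1) (ext_unders W V j ps c) g)"
    "link n y j s H (ou (ext_overs W i ps' w2) (ext_unders W V k ps' c') g)" "link n x j s K H" using ed(2) by blast
  have L1: "link n x j s (ou (ext_overs W x ps w1) (ext_unders W V j ps c) g) (ou W V g)"
    unfolding link_def using T d1 by blast
  have L2: "link n i k t (ou (ext_overs W i ps' w2) (ext_unders W V k ps' c') g) (ou W V g)"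
    unfolding link_def using T d2 by blast
  define a b d where "a = ((x, j), - s)" and "b = ((i, k), - t)" and "d = ((y, j), - s)"
  have r1: "rep n (a # w) (ou (ext_overs W x ps w1) (ext_unders W V j ps c) g)"
    unfolding a_def by (rule rep_link_down[OF r L1])
  have r2: "rep n (b # w) (ou (ext_overs W i ps' w2) (ext_unders W V k ps' c') g)"
    unfolding b_def by (rule rep_link_down[OF r L2])
  have r3: "rep n (d # a # w) G" unfolding d_def by (rule rep_link_down[OF r1 L(1)])
  have r4: "rep n (d # b # w) H" unfolding d_def by (rule rep_link_down[OF r2 L(2)])
  have r5: "rep n (a # d # b # w) K" unfolding a_def by (rule rep_link_down[OF r4 L(3)])
  have "xi n w = crossing_number (ou W V g)" by (rule xi_eq[OF r red])
  then have x: "xi n (d # a # w) < xi n w" "xi n (d # b # w) < xi n w" "xi n (a # d # b # w) < xi n w"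
    using link_AC(8)[OF L1] link_AC(8)[OF L2] link_AC(8)[OF L(1)] link_AC(8)[OF L(2)] link_AC(8)[OF L(3)]
      xi_le[OF r3] xi_le[OF r4] xi_le[OF r5] by simp_all
  have d: "d \<in> letters n" unfolding d_def by (rule link_letter(2)[OF L(1)])
  have ran: "{i, j, k} \<subseteq> {1..n}" "distinct [i, j, k]" using f1(1,7,8) f2(1,7,8) xy yj by auto
  have s: "s \<in> {1, -1}" "- s \<in> {1, -1}" using f1(9) by auto
  \<comment> \<open>For \<open>x = i\<close> the exponent of \<open>b\<close> is opposite to that of
    \<open>a\<close> and \<open>d\<close>; otherwise all three exponents agree.\<close>
  have "vPB_eq n [b, d, a] [a, d, b]"
  proof (cases "x = i")
    case True
    then have "y = k" "t = - s" using xy ed(1) f2(1) by auto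
    then show ?thesis using vPB_relations(2)[OF s(1) ran] True by (simp add: a_def b_def d_def)
  next
    case False
    then have "x = k" "y = i" "t = s" using xy ed(1) by auto
    then show ?thesis using vPB_relations(1)[OF s(2) ran] by (simp add: a_def b_def d_def)
  qed
  moreover have "w \<in> words (vPB_gens n)" using r by (simp add: rep_def)
  ultimately have "vPB_eq n (a # d # b # w) (b # d # a # w)"
    using pres_eq_append[OF pres_eq.sym[of _ _ "[b, d, a]" "[a, d, b]"] vPB_refl] by simp
  then have "connected_below n w a b" using x d unfolding connected_below_def by blast
  then show ?thesis by (simp add: a_def b_def)
qed

text \<open>Both descents are extractions from the same reduced diagram up to isomorphism. A
  crossing pulled out over strand \<open>j\<close> is the first under of \<open>j\<close>, so
  extractions with the same lower strand coincide. In general the upper strand of an extraction has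
  more overs than the lower one; this excludes \<open>i\<close> over \<open>j\<close> together with
  \<open>j\<close> over \<open>i\<close>, and provides the length condition of the diamond in the
  remaining overlaps.\<close>

lemma word_diamond:
  assumes w: "w \<in> words (vPB_gens n)" and l: "a \<in> letters n" "b \<in> letters n"
    and x: "xi n (a # w) < xi n w" "xi n (b # w) < xi n w"
  shows "connected_below n w a b"
proof -
  obtain i j s' where a: "a = ((i, j), s')" by (metis surj_pair)
  obtain k h t' where b: "b = ((k, h), t')" by (metis surj_pair)
  define s t where "s = - s'" and "t = - t'"
  obtain D E where D: "rep n w D" "\<not> (\<exists>X. red1 D X)" "link n i j s E D"
    using xi_letter[OF w l(1)[unfolded a]] x(1) unfolding a s_def by auto
  obtain D' E' where D': "rep n w D'" "\<not> (\<exists>X. red1 D' X)" "link n k h t E' D'"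
    using xi_letter[OF w l(2)[unfolded b]] x(2) unfolding b t_def by auto
  obtain W V g ps c w1 v where 1: "D = ou W V g" and d1: "divs W V g i j s ps c w1 v"
    using D(3) by (auto simp: link_def)
  obtain W' V' g' ps' c' w2 v' where 2: "D' = ou W' V' g'" "divs W' V' g' k h t ps' c' w2 v'"
    using D'(3) by (auto simp: link_def)
  have "diag_iso D' D" by (rule rep_unique[OF D'(1) D(1) D'(2) D(2)])
  moreover have "D' \<in> TD n" using D'(1) by (simp add: rep_def)
  ultimately obtain ps' c' w2 v' where d2: "divs W V g k h t ps' c' w2 v'"
    using divs_iso[of W' V' g' n] 1 2 by blast
  have T: "ou W V g \<in> TD n" using D(1) 1 by (simp add: rep_def)
  note f1 = divs_facts[OF T d1] and f2 = divs_facts[OF T d2] and td = ou_TDD[OF T]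
  note r = D(1,2)[unfolded 1]
  have c1: "W i = ps @ c # w1" "V j = c # v" "g c = s" and c2: "W k = ps' @ c' # w2" "V h = c' # v'" "g c' = t"
    using d1 d2 by (auto simp: divs_def)
  have len: "length (W j) < length (W i)" "length (W h) < length (W k)" using c1 c2 f1(2) f2(2) by simp_all
  have ab: "a = ((i, j), - s)" "b = ((k, h), - t)" by (simp_all add: a b s_def t_def)
  consider "j = h" | "j \<noteq> h" "i = k" | "i = h" "k = j" | "i = h" "k \<noteq> j" | "k = j" "i \<noteq> h"
    | "distinct [i, j, k, h]" using f1(1) f2(1) by auto
  then show ?thesis
  proof cases
    case 1
    then have "c = c'" using c1 c2 by simp
    then have "c \<in> set (W i) \<inter> set (W k)" using c1(1) c2(1) by auto
    then have "i = k" using td(5)[of i k] by blast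
    then show ?thesis using 1 \<open>c = c'\<close> c1 c2 ab by (simp add: connected_below_def)
  next
    case 2
    note out = 2
    consider "length (W j) < length (W h)" | "length (W h) < length (W j)" | "length (W j) = length (W h)" by linarith
    then show ?thesis
    proof cases
      case 1
      show ?thesis unfolding ab by (rule connected_below_triple[OF r d1 d2, of h]) (use 1 out in auto)
    next
      case 2
      show ?thesis unfolding ab
        by (rule connected_below_sym, rule connected_below_triple[OF r d2 d1, of j]) (use 2 out in auto)
    next
      case 3
      \<comment> \<open>With equally many overs on \<open>j\<close> and \<open>h\<close>, both
        crossings are the same entry of strand \<open>i\<close>; yet they are unders of different
        strands.\<close>
      then have "c = c'" using c1(1) c2(1) out f1(2) f2(2) by (simp add: append_eq_append_conv)
      then have "c \<in> set (V j) \<inter> set (V h)" using c1 c2 by auto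
      then show ?thesis using td(6)[OF out(1)] by blast
    qed
  next
    case 3 then show ?thesis using len by simp
  next
    case 4
    show ?thesis unfolding ab by (rule connected_below_triple[OF r d1 d2, of k]) (use 4 len in auto)
  next
    case 5
    show ?thesis unfolding ab
      by (rule connected_below_sym, rule connected_below_triple[OF r d2 d1, of i]) (use 5 len in auto)
  next
    case 6
    obtain G where G: "link n k h t G (ou (ext_overs W i ps w1) (ext_unders W V j ps c) g)"
      using extraction_commute[OF T d1 d2 6] by blast
    have L1: "link n i j s (ou (ext_overs W i ps w1) (ext_unders W V j ps c) g) (ou W V g)"
      unfolding link_def using T d1 by blast
    have rG: "rep n (b # a # w) G" unfolding ab by (rule rep_link_down[OF rep_link_down[OF r(1) L1] G])
    have "vPB_eq n [b, a] [a, b]"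
      unfolding ab by (rule vPB_relations(3)) (use 6 f1(7-9) f2(7-9) in auto)
    then have e: "vPB_eq n (b # a # w) (a # b # w)" using pres_eq_append[OF _ vPB_refl[OF w]] by fastforce
    have "xi n (b # a # w) < xi n w"
      using xi_le[OF rG] link_AC(8)[OF L1] link_AC(8)[OF G] xi_eq[OF r] by simp
    then have "connected_below n w b a" using e unfolding connected_below_def by blast
    then show ?thesis by (rule connected_below_sym)
  qed
qed

text \<open>One descent to the trivial element exists. That no descending letter leads astray from a
  good word is the content of \<open>good_down\<close>.\<close>

inductive good :: "nat \<Rightarrow> ((nat \<times> nat) \<times> int) list \<Rightarrow> bool" for n where
  trivial: "vPB_eq n w [] \<Longrightarrow> good n w"
| descend: "w \<in> words (vPB_gens n) \<Longrightarrow> l \<in> letters n \<Longrightarrow> xi n (l # w) < xi n w \<Longrightarrow> good n (l # w) \<Longrightarrow> good n w"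

lemma vPB_Cons: "l \<in> letters n \<Longrightarrow> vPB_eq n u v \<Longrightarrow> vPB_eq n (l # u) (l # v)"
  using pres_eq_append[OF vPB_refl[of "[l]" n], of u v] by (simp add: words_simps)

lemma good_cong: "good n w \<Longrightarrow> vPB_eq n w w' \<Longrightarrow> good n w'"
proof (induction arbitrary: w' rule: good.induct)
  case (trivial w) then show ?case using pres_eq.sym pres_eq.trans good.trivial by metis
next
  case (descend w l)
  have e: "vPB_eq n (l # w) (l # w')" by (rule vPB_Cons[OF descend.hyps(2) descend.prems])
  show ?case
    by (rule good.descend[OF vPB_words(2)[OF descend.prems] descend.hyps(2) _ descend.IH[OF e]])
      (use descend.hyps(3) xi_cong[OF e] xi_cong[OF descend.prems] in simp)
qed

lemma letter_inverse:
  assumes "a \<in> letters n" "u \<in> words (vPB_gens n)"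
  shows "\<exists>a'\<in>letters n. vPB_eq n (a' # a # u) u"
proof -
  obtain g s where a: "a = (g, s)" by fastforce
  have "vPB_eq n (winv [a] @ [a]) []" using winv_left[of "[a]" n] assms by (simp add: words_simps)
  from vPB_delete[OF this _ assms(2), of "[]"] have "vPB_eq n ((g, - s) # a # u) u"
    by (simp add: a winv_def words_simps)
  then show ?thesis using assms(1) a by (intro bexI[of _ "(g, - s)"]) auto
qed

lemma xi_Cons:
  assumes "u \<in> words (vPB_gens n)" "a \<in> letters n" shows "xi n u < xi n (a # u) \<or> xi n (a # u) < xi n u"
  using xi_letter[OF assms(1), of "fst (fst a)" "snd (fst a)" "snd a"] assms(2) by (auto simp: prod.collapse)

text \<open>Newman's argument, with the diamonds of \<open>word_diamond\<close> connecting \<open>a w\<close> and \<open>b w\<close> below \<open>w\<close>.\<close>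

lemma good_down:
  "w \<in> words (vPB_gens n) \<Longrightarrow> a \<in> letters n \<Longrightarrow> xi n (a # w) < xi n w \<Longrightarrow> good n w \<Longrightarrow> good n (a # w)"
proof (induction "xi n w" arbitrary: w a rule: less_induct)
  case less
  \<comment> \<open>Between two words below \<open>w\<close>, goodness passes along a letter in both
    directions: downwards by the induction hypothesis, upwards by definition.\<close>
  have edge: "good n u \<longleftrightarrow> good n (d # u)"
    if u: "u \<in> words (vPB_gens n)" "d \<in> letters n" "xi n u < xi n w" "xi n (d # u) < xi n w" for u d
    using xi_Cons[OF u(1,2)]
  proof
    assume lt: "xi n (d # u) < xi n u"
    show ?thesis using good.descend[OF u(1,2) lt] less.hyps[OF u(3,1,2) lt] by blast
  next
    assume lt: "xi n u < xi n (d # u)"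
    obtain d' where d': "d' \<in> letters n" "vPB_eq n (d' # d # u) u" using letter_inverse[OF u(2,1)] by blast
    have du: "d # u \<in> words (vPB_gens n)" using u by (simp add: words_simps)
    have lt': "xi n (d' # d # u) < xi n (d # u)" using lt xi_cong[OF d'(2)] by simp
    have "good n (d' # d # u) \<longleftrightarrow> good n u" using good_cong d'(2) pres_eq.sym by blast
    then show ?thesis using good.descend[OF du d'(1) lt'] less.hyps[OF u(4) du d'(1) lt'] by blast
  qed
  from less.prems(4) show ?case
  proof cases
    case trivial
    then show ?thesis using xi_cong[OF trivial] xi_Nil less.prems(3) by simp
  next
    case (descend b)
    note w = less.prems(1)
    have aw: "a # w \<in> words (vPB_gens n)" "b # w \<in> words (vPB_gens n)"
      using w less.prems(2) descend by (simp_all add: words_simps)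
    from word_diamond[OF w less.prems(2) descend(2) less.prems(3) descend(3)]
    consider "a = b" | "xi n (a # b # w) < xi n w" "vPB_eq n (a # b # w) (b # a # w)"
      | d where "d \<in> letters n" "xi n (d # a # w) < xi n w" "xi n (d # b # w) < xi n w" "xi n (a # d # b # w) < xi n w"
        "vPB_eq n (a # d # b # w) (b # d # a # w)" unfolding connected_below_def by blast
    then show ?thesis
    proof cases
      case 1 then show ?thesis using descend by simp
    next
      case 2
      have "good n (a # b # w)" using edge[OF aw(2) less.prems(2) descend(3) 2(1)] descend(4) by blast
      then have "good n (b # a # w)" using good_cong 2(2) by blast
      moreover have "xi n (b # a # w) < xi n w" using 2 xi_cong by metis
      ultimately show ?thesis using edge[OF aw(1) descend(2) less.prems(3)] by blast
    next
      case 3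
      have dw: "d # a # w \<in> words (vPB_gens n)" "d # b # w \<in> words (vPB_gens n)"
        using aw 3(1) by (simp_all add: words_simps)
      have "good n (d # b # w)" using edge[OF aw(2) 3(1) descend(3) 3(3)] descend(4) by blast
      then have "good n (a # d # b # w)" using edge[OF dw(2) less.prems(2) 3(3,4)] by blast
      then have "good n (b # d # a # w)" using good_cong 3(5) by blast
      moreover have "xi n (b # d # a # w) < xi n w" using 3(4,5) xi_cong by metis
      ultimately have "good n (d # a # w)" using edge[OF dw(1) descend(2) 3(2)] by blast
      then show ?thesis using edge[OF aw(1) 3(1) less.prems(3) 3(2)] by blast
    qed
  qed
qed

text \<open>A new letter either descends, which preserves \<open>good\<close>, or ascends, and then
  its inverse descends back to the class of \<open>w\<close>.\<close>

lemma good_all: "w \<in> words (vPB_gens n) \<Longrightarrow> good n w"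
proof (induction w)
  case Nil then show ?case by (intro good.trivial vPB_refl)
next
  case (Cons l w)
  have w: "w \<in> words (vPB_gens n)" "l \<in> letters n" using Cons.prems by (auto simp: words_simps)
  from xi_Cons[OF this] show ?case
  proof
    assume "xi n (l # w) < xi n w" then show ?thesis using good_down w Cons.IH by blast
  next
    assume lt: "xi n w < xi n (l # w)"
    obtain l' where l': "l' \<in> letters n" "vPB_eq n (l' # l # w) w" using letter_inverse[OF w(2,1)] by blast
    then have "good n (l' # l # w)" using good_cong[OF Cons.IH[OF w(1)] pres_eq.sym] by blast
    then show ?thesis using good.descend[OF Cons.prems l'(1)] lt xi_cong[OF l'(2)] by simp
  qed
qed

text \<open>The word \<open>winv v @ u\<close> is represented by the empty diagram, so its
  \<open>xi\<close> is 0 and leaves no descent; being good, it is trivial in the group.\<close>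

lemma word_diag_faithful:
  assumes w: "u \<in> words (vPB_gens n)" "v \<in> words (vPB_gens n)" and e: "(word_diag u, word_diag v) \<in> vAC_rel n"
  shows "vPB_eq n u v"
proof -
  have v': "winv v \<in> words (vPB_gens n)" by (rule winv_words[OF w(2)])
  have vu: "winv v @ u \<in> words (vPB_gens n)" using v' w by (simp add: words_simps)
  have A: "word_diag (winv v) \<in> AC n" "word_diag u \<in> AC n" "word_diag v \<in> AC n" using word_AC v' w by blast+
  have 1: "(diag_prod (word_diag (winv v)) (word_diag u), word_diag (winv v @ u)) \<in> vAC_rel n"
    by (rule vAC_iso[OF prod_AC[OF A(1,2)] word_append[OF v']])
  have 2: "(diag_prod (word_diag (winv v)) (word_diag v), word_diag (winv v @ v)) \<in> vAC_rel n"
    by (rule vAC_iso[OF prod_AC[OF A(1,3)] word_append[OF v']])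
  have 3: "(word_diag (winv v @ v), word_diag []) \<in> vAC_rel n" by (rule word_diag_respects[OF winv_left[OF w(2)]])
  have "(word_diag (winv v @ u), word_diag []) \<in> vAC_rel n"
    using vAC_trans[OF vAC_sym[OF 1] vAC_trans[OF vAC_prod[OF vAC_refl[OF A(1)] e] vAC_trans[OF 2 3]]] .
  then have "rep n (winv v @ u) diag_one" using rep_Nil[of n] vu by (simp add: rep_def)
  then have xi0: "xi n (winv v @ u) = 0"
    using xi_le by (fastforce simp: crossing_number_def crossings_def diag_one_def)
  have "vPB_eq n (winv v @ u) []"
    using good_all[OF vu]
  proof cases
    case (descend l) then show ?thesis using xi0 by simp
  qed
  from vPB_delete[OF this w(2), of "[]"] have "vPB_eq n (v @ winv v @ u) v" by (simp add: words_simps)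
  moreover from vPB_delete[OF winv_right[OF w(2)] _ w(1), of "[]"] have "vPB_eq n (v @ winv v @ u) u"
    by (simp add: words_simps)
  ultimately show ?thesis using pres_eq.sym pres_eq.trans by metis
qed

section \<open>The image of the braid group\<close>

lemma Gamma_bar_v_reduced:
  assumes "D \<in> TD n" "OU D" "\<not> (\<exists>X. red1 D X)" shows "Gamma_bar_v n (vAC_rel n `` {D}) = iso_rel n `` {D}"
proof (rule Gamma_bar_v_eq)
  show "D \<in> AC n" by (rule OU_AC[OF assms(1,2)])
  show "nf D D" using OU_reduced_nf reduced_iff assms by blast
qed

lemma Ch_class:
  assumes r: "rep n w D" and red: "\<not> (\<exists>X. red1 D X)" shows "Ch n (vPB_class n w) = iso_rel n `` {D}"
proof -
  have w: "w \<in> words (vPB_gens n)" "(word_diag w, D) \<in> vAC_rel n" "D \<in> TD n" "OU D" using r by (auto simp: rep_def)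
  have "iota_bar_v n (vPB_class n w) = vAC_rel n `` {D}"
    unfolding iota_class[OF w(1)] by (rule equiv_class_eq[OF vAC_rel_equiv w(2)])
  then show ?thesis using Gamma_bar_v_reduced[OF w(3,4) red] by (simp add: Ch_def)
qed

text \<open>The Gauss code O0 O1 U0 U1 of the virtual trefoil with two positive crossings, cut open
  to one strand. The other strands are empty, so it serves for every \<open>n\<close>.\<close>

definition virtual_trefoil :: vdiag where
  "virtual_trefoil = ou (\<lambda>a. if a = 1 then [0, 1] else []) (\<lambda>a. if a = 1 then [0, 1] else []) (\<lambda>_. 1)"

lemma virtual_trefoil_reduced:
  assumes "n \<ge> 1"
  shows "virtual_trefoil \<in> TD n" "OU virtual_trefoil" "\<not> (\<exists>X. red1 virtual_trefoil X)" "crossing_number virtual_trefoil = 2"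
proof -
  show T: "virtual_trefoil \<in> TD n" unfolding virtual_trefoil_def ou_TD using assms by auto
  show "OU virtual_trefoil" unfolding virtual_trefoil_def by (rule OU_ou)
  show "crossing_number virtual_trefoil = 2"
  proof -
    have "crossings virtual_trefoil = {0, 1}" unfolding virtual_trefoil_def crossings_ou by (auto split: if_splits)
    then show ?thesis by (simp add: crossing_number_def)
  qed
  show "\<not> (\<exists>X. red1 virtual_trefoil X)"
  proof
    assume "\<exists>X. red1 virtual_trefoil X"
    then obtain C where C: "rdel virtual_trefoil C" by (auto simp: red1_def)
    \<comment> \<open>The last over is 1 and the first under is 0, so there is no kink; an R2
      removal is excluded by the equal signs.\<close>
    have "\<not> adjacent virtual_trefoil (Over a) (Under a)" for a
    proof
      assume "adjacent virtual_trefoil (Over a) (Under a)"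
      then have "seg virtual_trefoil [Over a, Under a]"
        unfolding adjacent_seg virtual_trefoil_def using seg_ou_Under_Over by blast
      then obtain b xs ys where "(if b = (1::nat) then [0, 1] else []) = xs @ [a]" "(if b = (1::nat) then [0, 1] else []) = a # ys"
        using seg_ou_Over_Under unfolding virtual_trefoil_def by blast
      then have "a = 1" "a = 0" by (auto split: if_splits simp: Cons_eq_append_conv append_eq_Cons_conv)
      then show False by simp
    qed
    then show False using C unfolding rdel_def by (auto simp: virtual_trefoil_def)
  qed
qed

text \<open>A word with this image would have \<open>xi\<close> equal to 2 and hence a descent, so
  the diagram would admit an extraction from two distinct strands; but only strand 1 carries
  points.\<close>

lemma virtual_trefoil_not_braid:
  assumes n: "n \<ge> 1" and w: "w \<in> words (vPB_gens n)" shows "Ch n (vPB_class n w) \<noteq> iso_rel n `` {virtual_trefoil}"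
proof
  note tr = virtual_trefoil_reduced[OF n]
  assume eq: "Ch n (vPB_class n w) = iso_rel n `` {virtual_trefoil}"
  obtain D where D: "rep n w D" "\<not> (\<exists>X. red1 D X)" using rep_exists[OF w] rep_reduce by blast
  have "(D, virtual_trefoil) \<in> iso_rel n"
    using eq Ch_class[OF D] tr(1) iso_rel_equiv[of n] eq_equiv_class_iff D(1) rep_def by metis
  then have iso: "diag_iso D virtual_trefoil" by (simp add: iso_rel_iff)
  have "xi n w = 2" using xi_eq[OF D] iso_crossing_number[OF iso] tr(4) by simp
  from good_all[OF w] show False
  proof cases
    case trivial
    then show False using xi_cong[OF trivial] xi_Nil \<open>xi n w = 2\<close> by simp
  next
    case (descend l)
    obtain i j s where l: "l = ((i, j), s)" by (metis surj_pair)
    obtain D' E where D': "rep n w D'" "\<not> (\<exists>X. red1 D' X)" "link n i j (- s) E D'"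
      using xi_letter[OF w descend(2)[unfolded l]] descend(3) unfolding l by auto
    have iso': "diag_iso D' virtual_trefoil" using diag_iso_trans[OF rep_unique[OF D'(1) D(1) D'(2) D(2)] iso] .
    obtain W V g ps c w1 v where W: "D' = ou W V g" "D' \<in> TD n" "divs W V g i j (- s) ps c w1 v"
      using D'(3) by (auto simp: link_def)
    show False
      using divs_iso[OF W(2)[unfolded W(1)] W(3) iso'[unfolded W(1) virtual_trefoil_def]]
      by (auto simp: divs_def split: if_splits)
  qed
qed

theorem theorem4p1:
  fixes n :: nat
  assumes "n \<ge> 1"
  shows "Ch n \<in> carrier (vPB n) \<rightarrow> vROU n \<and>
         inj_on (Ch n) (carrier (vPB n)) \<and>
         Ch n ` carrier (vPB n) \<noteq> vROU n \<and>
         iota_bar_v n \<in> hom (vPB n) (vAC n) \<and>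
         inj_on (iota_bar_v n) (carrier (vPB n)) \<and>
         iota_bar_v n ` carrier (vPB n) \<noteq> carrier (vAC n)"
proof (intro conjI)
  note tr = virtual_trefoil_reduced[OF assms]
  have rep: "\<exists>D. rep n w D \<and> \<not> (\<exists>X. red1 D X)" if "w \<in> words (vPB_gens n)" for w
    using rep_exists[OF that] rep_reduce by blast
  show "Ch n \<in> carrier (vPB n) \<rightarrow> vROU n"
  proof
    fix A assume "A \<in> carrier (vPB n)"
    then obtain w where w: "w \<in> words (vPB_gens n)" "A = vPB_class n w" by (auto simp: carrier_vPB)
    obtain D where D: "rep n w D" "\<not> (\<exists>X. red1 D X)" using rep[OF w(1)] by blast
    then have "D \<in> {D \<in> TD n. OU D \<and> reduced n D}" using reduced_iff by (auto simp: rep_def)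
    then show "Ch n A \<in> vROU n" unfolding w(2) Ch_class[OF D] vROU_def by (rule quotientI)
  qed
  show inj: "inj_on (Ch n) (carrier (vPB n))"
  proof (rule inj_onI)
    fix A B assume "A \<in> carrier (vPB n)" "B \<in> carrier (vPB n)" and eq: "Ch n A = Ch n B"
    then obtain u v where u: "u \<in> words (vPB_gens n)" "A = vPB_class n u" and v: "v \<in> words (vPB_gens n)" "B = vPB_class n v"
      by (auto simp: carrier_vPB)
    obtain D where D: "rep n u D" "\<not> (\<exists>X. red1 D X)" using rep[OF u(1)] by blast
    obtain E where E: "rep n v E" "\<not> (\<exists>X. red1 E X)" using rep[OF v(1)] by blast
    have "iso_rel n `` {D} = iso_rel n `` {E}" using eq u(2) v(2) Ch_class[OF D] Ch_class[OF E] by simp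
    then have "(D, E) \<in> iso_rel n" using iso_rel_equiv[of n] eq_equiv_class_iff D(1) E(1) rep_def by metis
    then have "(D, E) \<in> vAC_rel n" using D(1) OU_AC vAC_iso by (auto simp: rep_def iso_rel_iff)
    then have "(word_diag u, word_diag v) \<in> vAC_rel n" using D(1) E(1) vAC_sym vAC_trans unfolding rep_def by blast
    then show "A = B" unfolding u(2) v(2) using vPB_class_eq word_diag_faithful[OF u(1) v(1)] by blast
  qed
  have "iso_rel n `` {virtual_trefoil} \<in> vROU n" unfolding vROU_def
    by (rule quotientI) (use tr reduced_iff in auto)
  moreover have ni: "iso_rel n `` {virtual_trefoil} \<notin> Ch n ` carrier (vPB n)"
    using virtual_trefoil_not_braid[OF assms] by (force simp: carrier_vPB)
  ultimately show "Ch n ` carrier (vPB n) \<noteq> vROU n" by blast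
  show "iota_bar_v n \<in> hom (vPB n) (vAC n)" by (rule iota_hom)
  \<comment> \<open>\<open>Ch\<close> factors through \<open>iota_bar_v\<close>, which therefore
    inherits injectivity.\<close>
  show "inj_on (iota_bar_v n) (carrier (vPB n))" using inj unfolding Ch_def by (rule inj_on_imageI2)
  have "virtual_trefoil \<in> AC n" by (rule OU_AC[OF tr(1,2)])
  then have "vAC_rel n `` {virtual_trefoil} \<in> carrier (vAC n)" unfolding vAC_def by (simp add: quotientI)
  \<comment> \<open>The diagram is its own normal form, so a preimage of its class under
    \<open>iota_bar_v\<close> would be a preimage under \<open>Ch\<close> as well.\<close>
  moreover have "vAC_rel n `` {virtual_trefoil} \<notin> iota_bar_v n ` carrier (vPB n)"
  proof
    assume "vAC_rel n `` {virtual_trefoil} \<in> iota_bar_v n ` carrier (vPB n)"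
    then obtain A where "A \<in> carrier (vPB n)" "iota_bar_v n A = vAC_rel n `` {virtual_trefoil}" by auto
    then show False using ni Gamma_bar_v_reduced[OF tr(1-3)] by (force simp: Ch_def image_iff)
  qed
  ultimately show "iota_bar_v n ` carrier (vPB n) \<noteq> carrier (vAC n)" by blast
qed

end
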